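(* Let $L,K\ge 1$, let $T_S=iR_S$ with $R_S$ a real antisymmetric $2L\times 2L$ matrix, let $\Theta=iW$ with $W$ a real $2L\times 2K$ matrix, and let $\omega$ be a quasi-free state on $\mathcal{H}_B=\Gamma(\mathbb{C}^K)$. Let $(\Lambda^t)_{t\ge0}$ be the fermionic quantum dynamical semigroup on $\mathcal{H}_S=\Gamma(\mathbb{C}^L)$ associated with $(T_S,\Theta,\omega)$ (defined in the context), and write $\rho(t)=\Lambda^t\rho(0)$. Then the following are equivalent: (1) There exists a unique stationary state $\rho_\infty$ of $(\Lambda^t)$; it is quasi-free, and $\rho(t)\to\rho_\infty$ as $t\to\infty$ for every initial state $\rho(0)$. (2) $\ker\Theta^*$ contains no eigenvector of $T_S$. (3) The linear span $V(T_S,\Theta)$ of $\bigcup_{k=0}^{2L}\mathrm{Ran}\big((T_S)^k\Theta\big)$ is the whole of $\mathbb{C}^{2L}$.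
   Context: For $n\ge1$, $\Gamma(\mathbb{C}^n)$ denotes the fermionic (antisymmetric) Fock space over $\mathbb{C}^n$ (dimension $2^n$), with annihilation operators $c_1,\dots,c_n$ attached to the standard basis ($\{c_i,c_j\}=0$, $\{c_i^*,c_j\}=\delta_{ij}I$), number operator $N=\sum_i c_i^*c_i$, and Majorana operators $\gamma_i=c_i+c_i^*$, $\gamma_{i+n}=-i(c_i-c_i^* )$ for $1\le i\le n$ (self-adjoint, $\{\gamma_i,\gamma_j\}=2\delta_{ij}$). A quadratic Hamiltonian is a self-adjoint operator of the form $\sum_{i,j}T_{ij}\gamma_i\gamma_j$; a Gaussian state is $e^{-\beta H}/\mathrm{Tr}(e^{-\beta H})$ with $H$ a quadratic Hamiltonian; a quasi-free state is a limit of Gaussian states. System and bath: $\mathcal{H}_S=\Gamma(\mathbb{C}^L)$ with Majorana operators $\gamma^S_1,\dots,\gamma^S_{2L}$ and number operator $N_S$; $\mathcal{H}_B=\Gamma(\mathbb{C}^K)$ with Majorana operators $\gamma^B_1,\dots,\gamma^B_{2K}$ and number operator $N_B$. The space $\mathcal{H}_S\otimes\mathcal{H}_B$ is identified with $\Gamma(\mathbb{C}^L\oplus\mathbb{C}^K)$ through one fixed choice of either $E_{SB}$ (sending $c^S_i\mapsto c^S_i\otimes I$, $c^B_j\mapsto(-1)^{N_S}\otimes c^B_j$) or $E_{BS}$ (sending $c^S_i\mapsto c^S_i\otimes(-1)^{N_B}$, $c^B_j\mapsto I\otimes c^B_j$); $\gamma^S_i,\gamma^B_j$ also denote the corresponding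 operators on $\mathcal{H}_S\otimes\mathcal{H}_B$. Put $H_S=\frac12\sum_{i,j}(T_S)_{ij}\gamma^S_i\gamma^S_j$ and $V=\sum_{i,j}\Theta_{ij}\gamma^S_i\gamma^B_j$ (self-adjoint). The semigroup is $\Lambda^t=e^{t\mathcal{L}}$ on $\mathcal{B}(\mathcal{H}_S)$ with $\mathcal{L}(\rho)=-i[H_S,\rho]+\Phi^*(\rho)-\frac12\{\Phi(I),\rho\}$, where $\Phi^*(\rho)=\mathrm{Tr}_{\mathcal{H}_B}\big(V(\rho\otimes\omega)V\big)$ and $\Phi$ is the dual (Hilbert–Schmidt adjoint) of $\Phi^*$. (This is the continuous-time limit $\tau\to0$ of repeated interactions of duration $\tau$ with fresh copies of the bath in state $\omega$, with interaction $\tau^{-1/2}V$.) A stationary state is a state $\sigma$ with $\Lambda^t\sigma=\sigma$ for all $t\ge0$. *)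

theory Defs
  imports Complex_Main "Jordan_Normal_Form.Schur_Decomposition"
begin

text \<open>Kronecker (tensor) product; basis index of e_a tensor e_b is a * dim B + b.\<close>
definition kron :: "complex mat \<Rightarrow> complex mat \<Rightarrow> complex mat" where
  "kron A B = mat (dim_row A * dim_row B) (dim_col A * dim_col B)
     (\<lambda>(i,j). A $$ (i div dim_row B, j div dim_col B) * B $$ (i mod dim_row B, j mod dim_col B))"

fun kpow :: "complex mat \<Rightarrow> nat \<Rightarrow> complex mat" where
  "kpow A 0 = 1\<^sub>m 1"
| "kpow A (Suc k) = kron A (kpow A k)"

definition msum :: "nat \<Rightarrow> nat \<Rightarrow> ('i \<Rightarrow> complex mat) \<Rightarrow> 'i set \<Rightarrow> complex mat" where
  "msum r c f I = mat r c (\<lambda>(i,j). \<Sum>k\<in>I. f k $$ (i,j))"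

definition mat_exp :: "complex mat \<Rightarrow> complex mat" where
  "mat_exp A = mat (dim_row A) (dim_col A)
     (\<lambda>(i,j). \<Sum>k. (A ^\<^sub>m k) $$ (i,j) / of_nat (fact k))"

definition mtrace :: "complex mat \<Rightarrow> complex" where
  "mtrace A = (\<Sum>i<dim_row A. A $$ (i,i))"

definition is_state :: "nat \<Rightarrow> complex mat \<Rightarrow> bool" where
  "is_state d \<rho> \<longleftrightarrow> \<rho> \<in> carrier_mat d d \<and> mtrace \<rho> = 1 \<and>
     (\<forall>v \<in> carrier_vec d. Im ((\<rho> *\<^sub>v v) \<bullet>c v) = 0 \<and> 0 \<le> Re ((\<rho> *\<^sub>v v) \<bullet>c v))"

definition mat_tendsto :: "('b \<Rightarrow> complex mat) \<Rightarrow> complex mat \<Rightarrow> 'b filter \<Rightarrow> bool" where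
  "mat_tendsto f A F \<longleftrightarrow> (\<forall>\<^sub>F x in F. f x \<in> carrier_mat (dim_row A) (dim_col A)) \<and>
     (\<forall>i < dim_row A. \<forall>j < dim_col A. ((\<lambda>x. f x $$ (i,j)) \<longlongrightarrow> A $$ (i,j)) F)"

definition Ran :: "complex mat \<Rightarrow> complex vec set" where
  "Ran M = {M *\<^sub>v x | x. x \<in> carrier_vec (dim_col M)}"

definition cspan :: "nat \<Rightarrow> complex vec set \<Rightarrow> complex vec set" where
  "cspan n S = LinearCombinations.module.span class_ring (module_vec TYPE(complex) n) S"

section \<open>Fermionic Fock space Gamma(C^n), dimension 2^n (Jordan-Wigner realization)\<close>

definition ann1 :: "complex mat" where
  "ann1 = mat 2 2 (\<lambda>(i,j). if i = 0 \<and> j = 1 then 1 else 0)"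

definition zpar1 :: "complex mat" where
  "zpar1 = mat 2 2 (\<lambda>(i,j). if i = j then (if i = 0 then 1 else -1) else 0)"

text \<open>Annihilation operator c_{i+1} (0-based index i < n) on Gamma(C^n).\<close>
definition fock_c :: "nat \<Rightarrow> nat \<Rightarrow> complex mat" where
  "fock_c n i = kron (kpow zpar1 i) (kron ann1 (1\<^sub>m (2 ^ (n - i - 1))))"

definition fock_N :: "nat \<Rightarrow> complex mat" where
  "fock_N n = msum (2^n) (2^n) (\<lambda>i. mat_adjoint (fock_c n i) * fock_c n i) {..<n}"

definition fock_parity :: "nat \<Rightarrow> complex mat" where
  "fock_parity n = mat_exp ((\<i> * of_real pi) \<cdot>\<^sub>m fock_N n)"

text \<open>Majorana operators, 0-based: gamma_{k+1} for k < 2n.\<close>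
definition majorana :: "nat \<Rightarrow> nat \<Rightarrow> complex mat" where
  "majorana n k = (if k < n then fock_c n k + mat_adjoint (fock_c n k)
                   else (- \<i>) \<cdot>\<^sub>m (fock_c n (k - n) - mat_adjoint (fock_c n (k - n))))"

definition quadratic_hamiltonian :: "nat \<Rightarrow> complex mat \<Rightarrow> bool" where
  "quadratic_hamiltonian n H \<longleftrightarrow> H = mat_adjoint H \<and>
     (\<exists>T \<in> carrier_mat (2*n) (2*n).
        H = msum (2^n) (2^n) (\<lambda>(i,j). T $$ (i,j) \<cdot>\<^sub>m (majorana n i * majorana n j))
                ({..<2*n} \<times> {..<2*n}))"

definition gaussian_state :: "nat \<Rightarrow> complex mat \<Rightarrow> bool" where
  "gaussian_state n \<rho> \<longleftrightarrow> (\<exists>(\<beta>::real) H. \<beta> > 0 \<and> quadratic_hamiltonian n H \<and>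
     \<rho> = (1 / mtrace (mat_exp ((- of_real \<beta>) \<cdot>\<^sub>m H))) \<cdot>\<^sub>m mat_exp ((- of_real \<beta>) \<cdot>\<^sub>m H))"

definition quasi_free :: "nat \<Rightarrow> complex mat \<Rightarrow> bool" where
  "quasi_free n \<rho> \<longleftrightarrow> \<rho> \<in> carrier_mat (2^n) (2^n) \<and>
     (\<exists>s. (\<forall>k. gaussian_state n (s k)) \<and> mat_tendsto s \<rho> sequentially)"

text \<open>esb = True: identification E_SB; esb = False: identification E_BS.\<close>
definition gammaS :: "bool \<Rightarrow> nat \<Rightarrow> nat \<Rightarrow> nat \<Rightarrow> complex mat" where
  "gammaS esb L K i = (if esb then kron (majorana L i) (1\<^sub>m (2^K))
                       else kron (majorana L i) (fock_parity K))"

definition gammaB :: "bool \<Rightarrow> nat \<Rightarrow> nat \<Rightarrow> nat \<Rightarrow> complex mat" where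
  "gammaB esb L K j = (if esb then kron (fock_parity L) (majorana K j)
                       else kron (1\<^sub>m (2^L)) (majorana K j))"

definition sys_H :: "nat \<Rightarrow> complex mat \<Rightarrow> complex mat" where
  "sys_H L T = (1/2) \<cdot>\<^sub>m msum (2^L) (2^L)
     (\<lambda>(i,j). T $$ (i,j) \<cdot>\<^sub>m (majorana L i * majorana L j)) ({..<2*L} \<times> {..<2*L})"

definition int_V :: "bool \<Rightarrow> nat \<Rightarrow> nat \<Rightarrow> complex mat \<Rightarrow> complex mat" where
  "int_V esb L K \<Theta> = msum (2^L * 2^K) (2^L * 2^K)
     (\<lambda>(i,j). \<Theta> $$ (i,j) \<cdot>\<^sub>m (gammaS esb L K i * gammaB esb L K j)) ({..<2*L} \<times> {..<2*K})"

definition ptrace_B :: "nat \<Rightarrow> nat \<Rightarrow> complex mat \<Rightarrow> complex mat" where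
  "ptrace_B dS dB X = mat dS dS (\<lambda>(i,j). \<Sum>k<dB. X $$ (i*dB + k, j*dB + k))"

definition PhiStar :: "bool \<Rightarrow> nat \<Rightarrow> nat \<Rightarrow> complex mat \<Rightarrow> complex mat \<Rightarrow> complex mat \<Rightarrow> complex mat" where
  "PhiStar esb L K \<Theta> \<omega> \<rho> =
     ptrace_B (2^L) (2^K) (int_V esb L K \<Theta> * kron \<rho> \<omega> * int_V esb L K \<Theta>)"

definition Phi :: "bool \<Rightarrow> nat \<Rightarrow> nat \<Rightarrow> complex mat \<Rightarrow> complex mat \<Rightarrow> complex mat \<Rightarrow> complex mat" where
  "Phi esb L K \<Theta> \<omega> X = (THE Y. Y \<in> carrier_mat (2^L) (2^L) \<and>
     (\<forall>\<rho> \<in> carrier_mat (2^L) (2^L).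
        mtrace (mat_adjoint Y * \<rho>) = mtrace (mat_adjoint X * PhiStar esb L K \<Theta> \<omega> \<rho>)))"

definition lindbladian :: "bool \<Rightarrow> nat \<Rightarrow> nat \<Rightarrow> complex mat \<Rightarrow> complex mat \<Rightarrow> complex mat \<Rightarrow> complex mat \<Rightarrow> complex mat" where
  "lindbladian esb L K T \<Theta> \<omega> \<rho> =
     (- \<i>) \<cdot>\<^sub>m (sys_H L T * \<rho> - \<rho> * sys_H L T) + PhiStar esb L K \<Theta> \<omega> \<rho>
     - (1/2) \<cdot>\<^sub>m (Phi esb L K \<Theta> \<omega> (1\<^sub>m (2^L)) * \<rho> + \<rho> * Phi esb L K \<Theta> \<omega> (1\<^sub>m (2^L)))"

definition vec_of :: "nat \<Rightarrow> complex mat \<Rightarrow> complex vec" where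
  "vec_of d \<rho> = vec (d*d) (\<lambda>a. \<rho> $$ (a div d, a mod d))"

definition unvec :: "nat \<Rightarrow> complex vec \<Rightarrow> complex mat" where
  "unvec d v = mat d d (\<lambda>(i,j). v $ (i*d + j))"

definition unit_mat_at :: "nat \<Rightarrow> nat \<Rightarrow> complex mat" where
  "unit_mat_at d b = mat d d (\<lambda>(i,j). if i = b div d \<and> j = b mod d then 1 else 0)"

definition superop_mat :: "nat \<Rightarrow> (complex mat \<Rightarrow> complex mat) \<Rightarrow> complex mat" where
  "superop_mat d F = mat (d*d) (d*d) (\<lambda>(a,b). F (unit_mat_at d b) $$ (a div d, a mod d))"

definition semigroup :: "bool \<Rightarrow> nat \<Rightarrow> nat \<Rightarrow> complex mat \<Rightarrow> complex mat \<Rightarrow> complex mat \<Rightarrow> real \<Rightarrow> complex mat \<Rightarrow> complex mat" where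
  "semigroup esb L K T \<Theta> \<omega> t \<rho> =
     unvec (2^L) (mat_exp (of_real t \<cdot>\<^sub>m superop_mat (2^L) (lindbladian esb L K T \<Theta> \<omega>))
                  *\<^sub>v vec_of (2^L) \<rho>)"

definition stationary :: "bool \<Rightarrow> nat \<Rightarrow> nat \<Rightarrow> complex mat \<Rightarrow> complex mat \<Rightarrow> complex mat \<Rightarrow> complex mat \<Rightarrow> bool" where
  "stationary esb L K T \<Theta> \<omega> \<sigma> \<longleftrightarrow> is_state (2^L) \<sigma> \<and>
     (\<forall>t \<ge> 0. semigroup esb L K T \<Theta> \<omega> t \<sigma> = \<sigma>)"

end

theory Submission
  imports Defs
begin

text \<open>On the operators of the system, creation and annihilation maps \<open>b\<^sub>i\<close>, \<open>a\<^sub>i\<close> arise from twisted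
  multiplication by Majorana operators from both sides, and the generator becomes
  \<open>\<Sum> N\<^sub>i\<^sub>j b\<^sub>i a\<^sub>j + 2 \<Sum> A\<^sub>i\<^sub>j b\<^sub>i b\<^sub>j\<close> with drift \<open>N = 2 (R - W W\<^sup>T)\<close> and a noise matrix \<open>A\<close> given by the
  two-point function of the bath. The first term acts on the tensor of \<open>q\<close>-point functions as
  \<open>N \<otimes> 1 \<otimes> \<dots> + 1 \<otimes> N \<otimes> \<dots> + \<dots>\<close> and the second one only feeds in functions of lower order. As
  \<open>N + N\<^sup>T = - 4 W W\<^sup>T\<close>, the absence of eigenvectors of \<open>R\<close> in the kernel of \<open>W\<^sup>T\<close> makes every
  eigenvalue on traceless operators have negative real part, which gives a unique stationary operator
  and convergence to it.

  The covariance \<open>Y\<close> of this operator solves a Lyapunov equation, which also forces its spectrum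
  into \<open>[- 1, 1]\<close>. The Gaussian state of covariance \<open>(1 - \<epsilon>) Y\<close> is stationary for the noise matrix
  \<open>(1 - \<epsilon>) A + \<epsilon> W W\<^sup>T\<close>. Letting \<open>\<epsilon>\<close> tend to 0 shows that the stationary operator is a quasi-free
  state, so its positivity never has to be checked directly. Conversely, an eigenvector of \<open>R\<close> in the
  kernel of \<open>W\<^sup>T\<close> yields a linear combination of Majorana expectations whose modulus is constant
  along the semigroup, which contradicts convergence to a common limit.\<close>

section \<open>Linear operators on sequences\<close>

text \<open>The parity twist makes left and right multiplication by Majorana operators anticommute,
  so operators on the system form a Fock space with 2L modes: the identity is the vacuum, the trace
  is the vacuum functional, and annihilators followed by the trace give correlation functions. The
  factor 1 - \<epsilon> is there because a stationary covariance may have eigenvalues 1 or -1, as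
  pure states do, where the exponent 2 artanh Y of a Gaussian state is infinite. The added noise is
  W W^T because it is symmetric: the source of the Lyapunov equation is the antisymmetric part of
  the noise, so mixing in W W^T scales the source by 1 - \<epsilon> as well. The drift comes from
  the symmetric part, which is W W^T already and stays the same. The approximants are
  O(\<epsilon>)-close to the stationary operator because their entries are bounded by 1 and the
  generator is invertible on traceless operators. The spectral bound on Y rests on positivity of the
  bath two-point function: an eigenvector with eigenvalue outside [-1, 1] would lie in the kernel of
  W^T together with its whole orbit under R.\<close>

text \<open>A ring type that contains all square matrices via \<open>opm\<close> below; matrices themselves carry their
  dimension as a value and form no ring.\<close>
typedef lop = "{f :: (nat \<Rightarrow> complex) \<Rightarrow> (nat \<Rightarrow> complex).
   (\<forall>x y. f (\<lambda>i. x i + y i) = (\<lambda>i. f x i + f y i)) \<and> (\<forall>c x. f (\<lambda>i. c * x i) = (\<lambda>i. c * f x i))}"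
  by (rule exI[of _ "\<lambda>x. x"]) simp

setup_lifting type_definition_lop

instantiation lop :: ring_1
begin
lift_definition zero_lop :: lop is "\<lambda>x i. 0" by simp
lift_definition one_lop :: lop is "\<lambda>x. x" by simp
lift_definition plus_lop :: "lop \<Rightarrow> lop \<Rightarrow> lop" is "\<lambda>f g x i. f x i + g x i"
  by (simp add: algebra_simps)
lift_definition minus_lop :: "lop \<Rightarrow> lop \<Rightarrow> lop" is "\<lambda>f g x i. f x i - g x i"
  by (simp add: algebra_simps)
lift_definition uminus_lop :: "lop \<Rightarrow> lop" is "\<lambda>f x i. - f x i"
  by (simp add: algebra_simps)
lift_definition times_lop :: "lop \<Rightarrow> lop \<Rightarrow> lop" is "\<lambda>f g x. f (g x)"
  by simp
instance
proof
  show "(0::lop) \<noteq> 1" by transfer (metis one_neq_zero)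
qed (transfer; simp add: algebra_simps fun_eq_iff)+
end

lift_definition sc :: "complex \<Rightarrow> lop \<Rightarrow> lop" is "\<lambda>c f x i. c * f x i"
  by (simp add: algebra_simps)

lemma sc_mult_left [simp]: "sc c x * y = sc c (x * y)" by transfer simp
lemma sc_mult_right [simp]: "x * sc c y = sc c (x * y)" by transfer simp
lemma sc_sc [simp]: "sc c (sc d x) = sc (c * d) x" by transfer (simp add: algebra_simps)
lemma sc_one [simp]: "sc 1 x = x" by transfer simp
lemma sc_zero [simp]: "sc 0 x = 0" by transfer simp
lemma sc_zero_right [simp]: "sc c 0 = 0" by transfer simp
lemma sc_minus_left: "sc (- c) x = - sc c x" by transfer simp
lemma sc_minus_right: "sc c (- x) = - sc c x" by transfer simp
lemma sc_add_left: "sc (c + d) x = sc c x + sc d x" by transfer (simp add: algebra_simps)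
lemma sc_add_right: "sc c (x + y) = sc c x + sc c y" by transfer (simp add: algebra_simps)
lemma sc_diff_left: "sc (c - d) x = sc c x - sc d x" by transfer (simp add: algebra_simps)
lemma sc_diff_right: "sc c (x - y) = sc c x - sc c y" by transfer (simp add: algebra_simps)
lemma sc_two: "sc 2 x = x + x" using sc_add_left[of 1 1 x] by simp
lemma sc_sum_right: "sc c (sum f S) = (\<Sum>i\<in>S. sc c (f i))"
  by (induct S rule: infinite_finite_induct) (auto simp: sc_add_right)
lemma sc_sum_left: "sc (sum f S) x = (\<Sum>i\<in>S. sc (f i) x)"
  by (induct S rule: infinite_finite_induct) (auto simp: sc_add_left)
lemma sc_eq_0_iff: "sc c x = 0 \<longleftrightarrow> c = 0 \<or> x = 0"
proof
  assume e: "sc c x = 0"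
  show "c = 0 \<or> x = 0"
  proof (rule disjCI)
    assume "x \<noteq> 0"
    show "c = 0"
    proof (rule ccontr)
      assume "c \<noteq> 0"
      then have "x = sc (inverse c) (sc c x)" by simp
      with e \<open>x \<noteq> 0\<close> show False by simp
    qed
  qed
qed auto

lemma lop_eq_neg_self: "x = 0" if "(x::lop) = - x"
proof -
  have "sc 2 x = 0" unfolding sc_two using that by (metis add.right_inverse)
  thus ?thesis by (simp add: sc_eq_0_iff)
qed

lemma sc_scaled_eqI: assumes "sc c x = sc c y" "c \<noteq> 0" shows "x = y"
proof -
  have "sc c (x - y) = 0" using assms by (simp add: sc_diff_right)
  thus ?thesis using assms(2) by (simp add: sc_eq_0_iff)
qed

lemmas sc_distribs = sc_add_left sc_add_right sc_diff_left sc_diff_right sc_minus_left sc_minus_right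

section \<open>Drift on tensors\<close>

text \<open>Recursion on the word length, instead of a sum over the set \<open>words n p\<close>,
  peels off the first tensor index exactly as \<open>leibniz\<close> does below.\<close>

primrec list_sum :: "nat \<Rightarrow> nat \<Rightarrow> (nat list \<Rightarrow> 'a::comm_monoid_add) \<Rightarrow> 'a" where
  "list_sum n 0 f = f []"
| "list_sum n (Suc p) f = (\<Sum>i<n. list_sum n p (\<lambda>is. f (i # is)))"

definition words :: "nat \<Rightarrow> nat \<Rightarrow> nat list set" where
  "words n p = {is. set is \<subseteq> {..<n} \<and> length is = p}"

lemma words_0 [simp]: "words n 0 = {[]}"
  and words_Suc: "i # is \<in> words n (Suc p) \<longleftrightarrow> i < n \<and> is \<in> words n p"
  by (auto simp: words_def)

lemma words_SucE: assumes "w \<in> words n (Suc p)"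
  obtains i "is" where "w = i # is" "i < n" "is \<in> words n p"
  using assms by (cases w) (auto simp: words_def)

lemma list_sum_cong: "(\<And>is. is \<in> words n p \<Longrightarrow> f is = g is) \<Longrightarrow> list_sum n p f = list_sum n p g"
proof (induct p arbitrary: f g)
  case (Suc p)
  show ?case unfolding list_sum.simps
    by (intro sum.cong refl Suc.hyps) (use Suc.prems in \<open>auto simp: words_Suc\<close>)
qed simp

lemma list_sum_add: "list_sum n p (\<lambda>is. f is + g is) = list_sum n p f + list_sum n p g"
  by (induct p arbitrary: f g) (auto simp: sum.distrib)

lemma list_sum_mult: "list_sum n p (\<lambda>is. c * f is) = (c :: 'a :: semiring_0) * list_sum n p f"
  by (induct p arbitrary: f) (auto simp: sum_distrib_left)

lemma list_sum_Re: "Re (list_sum n p f) = list_sum n p (\<lambda>is. Re (f is))"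
  by (induct p arbitrary: f) auto

lemma list_sum_nonneg: "(\<And>is. 0 \<le> f is) \<Longrightarrow> 0 \<le> (list_sum n p f :: real)"
  by (induct p arbitrary: f) (auto intro!: sum_nonneg)

lemma list_sum_swap: "list_sum n p (\<lambda>is. \<Sum>k\<in>S. f k is) = (\<Sum>k\<in>S. list_sum n p (f k))"
  by (induct p arbitrary: f) (auto intro: sum.swap)

lemma list_sum_eq_0D: "list_sum n p f = (0 :: real) \<Longrightarrow> (\<And>is. 0 \<le> f is) \<Longrightarrow> is \<in> words n p \<Longrightarrow> f is = 0"
proof (induct p arbitrary: f "is")
  case (Suc p)
  from Suc.prems(3) obtain i js where w: "is = i # js" "i < n" "js \<in> words n p" by (rule words_SucE)
  have "\<forall>i<n. list_sum n p (\<lambda>is. f (i # is)) = 0"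
    using Suc.prems(1) sum_nonneg_eq_0_iff[of "{..<n}" "\<lambda>i. list_sum n p (\<lambda>is. f (i # is))"]
    by (auto simp: list_sum_nonneg Suc.prems(2))
  thus ?case using w Suc.hyps[of "\<lambda>is. f (i # is)" js] Suc.prems(2) by auto
qed auto

text \<open>\<open>leibniz n N w t\<close> is the value at \<open>w\<close> of \<open>N \<otimes> 1 \<otimes> \<dots> + 1 \<otimes> N \<otimes> \<dots> + \<dots>\<close> applied to the tensor \<open>t\<close>.\<close>
primrec leibniz :: "nat \<Rightarrow> (nat \<Rightarrow> nat \<Rightarrow> complex) \<Rightarrow> nat list \<Rightarrow> (nat list \<Rightarrow> complex) \<Rightarrow> complex" where
  "leibniz n N [] t = 0"
| "leibniz n N (i # is) t = (\<Sum>j<n. N i j * t (j # is)) + leibniz n N is (\<lambda>js. t (i # js))"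

lemma leibniz_cong:
  "is \<in> words n p \<Longrightarrow> (\<And>js. js \<in> words n p \<Longrightarrow> t js = u js) \<Longrightarrow> leibniz n N is t = leibniz n N is u"
proof (induct "is" arbitrary: p t u)
  case (Cons i js)
  then obtain q where p: "p = Suc q" and i: "i < n" "js \<in> words n q" by (auto simp: words_def)
  have "leibniz n N js (\<lambda>js. t (i # js)) = leibniz n N js (\<lambda>js. u (i # js))"
    by (rule Cons.hyps[OF i(2)]) (use Cons.prems(2) p i in \<open>auto simp: words_Suc\<close>)
  thus ?case using Cons.prems(2) p i by (auto intro!: sum.cong simp: words_Suc)
qed simp

lemma leibniz_sum:
  "leibniz n N is (\<lambda>js. \<Sum>k\<in>S. c k * t k js) = (\<Sum>k\<in>S. c k * leibniz n N is (t k))"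
proof (induct "is" arbitrary: t)
  case (Cons i js)
  have "(\<Sum>j<n. N i j * (\<Sum>k\<in>S. c k * t k (j # js))) = (\<Sum>k\<in>S. c k * (\<Sum>j<n. N i j * t k (j # js)))"
    unfolding sum_distrib_left by (subst sum.swap) (simp add: mult_ac)
  thus ?case by (simp add: Cons.hyps sum.distrib algebra_simps)
qed simp

lemma leibniz_zero: "is \<in> words n p \<Longrightarrow> (\<And>js. js \<in> words n p \<Longrightarrow> t js = 0) \<Longrightarrow> leibniz n N is t = 0"
  using leibniz_cong[of "is" n p t "\<lambda>_. 0" N] leibniz_sum[of n N "is" "\<lambda>_. 0" "\<lambda>_ _. 0" "{}"] by simp

section \<open>Dissipativity of the drift and its spectrum on tensors\<close>

definition drift :: "nat \<Rightarrow> (nat \<Rightarrow> nat \<Rightarrow> real) \<Rightarrow> (nat \<Rightarrow> nat \<Rightarrow> real) \<Rightarrow> nat \<Rightarrow> nat \<Rightarrow> complex" where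
  "drift m R W i j = of_real (2 * (R i j - (\<Sum>k<m. W i k * W j k)))"

definition mv :: "nat \<Rightarrow> (nat \<Rightarrow> nat \<Rightarrow> real) \<Rightarrow> (nat \<Rightarrow> complex) \<Rightarrow> nat \<Rightarrow> complex" where
  "mv n R z i = (\<Sum>j<n. of_real (R i j) * z j)"

text \<open>The rank condition in dual form, for the bilinear pairing without complex conjugation.
  All powers \<open>r\<close> occur, so it applies as soon as \<open>z\<close> annihilates an
  R-invariant set containing the columns of \<open>W\<close>.\<close>

definition krylov :: "nat \<Rightarrow> nat \<Rightarrow> (nat \<Rightarrow> nat \<Rightarrow> real) \<Rightarrow> (nat \<Rightarrow> nat \<Rightarrow> real) \<Rightarrow> bool" where
  "krylov n m R W \<longleftrightarrow> (\<forall>z. (\<forall>r. \<forall>k<m. (\<Sum>i<n. (mv n R ^^ r) (\<lambda>i. of_real (W i k)) i * z i) = 0) \<longrightarrow> (\<forall>i<n. z i = 0))"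

text \<open>The antisymmetric part \<open>2 R\<close> contributes a purely imaginary number, the
  symmetric part \<open>- 2 W W^T\<close> minus twice the squared norm of
  \<open>W^T z\<close>.\<close>

lemma drift_energy:
  assumes R: "\<And>i j. i < n \<Longrightarrow> j < n \<Longrightarrow> R i j = - R j i"
  shows "Re (\<Sum>i<n. cnj (z i) * (\<Sum>j<n. drift m R W i j * z j))
     = - 2 * (\<Sum>k<m. (cmod (\<Sum>i<n. of_real (W i k) * z i))\<^sup>2)"
proof -
  let ?S = "\<Sum>i<n. \<Sum>j<n. cnj (z i) * of_real (R i j) * z j"
  have "cnj ?S = (\<Sum>i<n. \<Sum>j<n. z i * of_real (R i j) * cnj (z j))" by simp
  also have "\<dots> = (\<Sum>j<n. \<Sum>i<n. z i * of_real (R i j) * cnj (z j))" by (rule sum.swap)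
  also have "\<dots> = (\<Sum>j<n. \<Sum>i<n. - (cnj (z j) * of_real (R j i) * z i))"
    by (intro sum.cong refl, subst R) (auto simp: mult_ac)
  also have "\<dots> = - ?S" by (simp add: sum_negf)
  finally have "Re (cnj ?S) = Re (- ?S)" by simp
  hence S: "Re ?S = 0" by simp
  have q: "complex_of_real ((cmod (\<Sum>i<n. of_real (W i k) * z i))\<^sup>2)
     = (\<Sum>i<n. \<Sum>j<n. cnj (z i) * (of_real (W i k) * of_real (W j k)) * z j)" for k
  proof -
    have "complex_of_real ((cmod (\<Sum>i<n. of_real (W i k) * z i))\<^sup>2)
      = (\<Sum>i<n. \<Sum>j<n. (of_real (W i k) * z i) * (of_real (W j k) * cnj (z j)))"
      unfolding complex_norm_square cnj_sum sum_product by simp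
    also have "\<dots> = (\<Sum>j<n. \<Sum>i<n. (of_real (W i k) * z i) * (of_real (W j k) * cnj (z j)))"
      by (rule sum.swap)
    finally show ?thesis by (simp add: mult_ac)
  qed
  have "(\<Sum>i<n. cnj (z i) * (\<Sum>j<n. drift m R W i j * z j))
     = 2 * ?S - 2 * (\<Sum>i<n. \<Sum>j<n. \<Sum>k<m. cnj (z i) * (of_real (W i k) * of_real (W j k)) * z j)"
    by (simp add: drift_def sum_distrib_left sum_distrib_right sum_subtractf algebra_simps)
  also have "(\<Sum>i<n. \<Sum>j<n. \<Sum>k<m. cnj (z i) * (of_real (W i k) * of_real (W j k)) * z j)
     = (\<Sum>k<m. \<Sum>i<n. \<Sum>j<n. cnj (z i) * (of_real (W i k) * of_real (W j k)) * z j)"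
    by (subst sum.swap[of _ "{..<n}" "{..<m}"], subst sum.swap[of _ "{..<n}" "{..<m}"]) simp
  also have "\<dots> = of_real (\<Sum>k<m. (cmod (\<Sum>i<n. of_real (W i k) * z i))\<^sup>2)"
    unfolding of_real_sum q ..
  finally show ?thesis using S by simp
qed

text \<open>Each tensor slot contributes a nonpositive amount by \<open>drift_energy\<close>. The
  second bound retains the first slot; the first bound accompanies it in the induction to control
  the remaining slots.\<close>

lemma leibniz_energy_le:
  assumes R: "\<And>i j. i < n \<Longrightarrow> j < n \<Longrightarrow> R i j = - R j i"
  shows "Re (list_sum n p (\<lambda>is. cnj (t is) * leibniz n (drift m R W) is t)) \<le> 0"
    and "p = Suc q \<Longrightarrow> Re (list_sum n p (\<lambda>is. cnj (t is) * leibniz n (drift m R W) is t))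
      \<le> - 2 * list_sum n q (\<lambda>is. \<Sum>k<m. (cmod (\<Sum>i<n. of_real (W i k) * t (i # is)))\<^sup>2)"
proof (induct p arbitrary: t q)
  case (Suc p)
  let ?N = "drift m R W"
  have eq: "list_sum n (Suc p) (\<lambda>is. cnj (t is) * leibniz n ?N is t)
    = list_sum n p (\<lambda>is. \<Sum>i<n. cnj (t (i # is)) * (\<Sum>j<n. ?N i j * t (j # is)))
     + (\<Sum>i<n. list_sum n p (\<lambda>is. cnj (t (i # is)) * leibniz n ?N is (\<lambda>js. t (i # js))))" for t
    by (simp add: distrib_left list_sum_add sum.distrib list_sum_swap)
  have le: "Re (\<Sum>i<n. list_sum n p (\<lambda>is. cnj (t (i # is)) * leibniz n ?N is (\<lambda>js. t (i # js)))) \<le> 0" for t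
    unfolding Re_sum by (intro sum_nonpos Suc.hyps(1))
  have eq2: "Re (list_sum n p (\<lambda>is. \<Sum>i<n. cnj (t (i # is)) * (\<Sum>j<n. ?N i j * t (j # is))))
     = - 2 * list_sum n p (\<lambda>is. \<Sum>k<m. (cmod (\<Sum>i<n. of_real (W i k) * t (i # is)))\<^sup>2)" for t
    unfolding list_sum_Re list_sum_mult[symmetric]
    by (rule list_sum_cong) (rule drift_energy[OF R])
  have nn: "0 \<le> list_sum n p (\<lambda>is. \<Sum>k<m. (cmod (\<Sum>i<n. of_real (W i k) * t (i # is)))\<^sup>2)" for t
    by (intro list_sum_nonneg sum_nonneg) auto
  note eqR = arg_cong[OF eq, of Re, unfolded plus_complex.sel]
  { case 1 show ?case using eqR[of t] eq2[of t] le[of t] nn[of t] by linarith }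
  { case 2
    hence "q = p" by simp
    thus ?case using eqR[of t] eq2[of t] le[of t] by (simp only:) }
qed auto

text \<open>Contracting from the left transposes \<open>R\<close>; antisymmetry turns this into the
  action of \<open>R\<close> on \<open>w\<close>, up to a combination of the columns of
  \<open>W\<close>.\<close>

lemma mv_drift:
  assumes R: "\<And>i j. i < n \<Longrightarrow> j < n \<Longrightarrow> R i j = - R j i" and j: "j < n"
  shows "(\<Sum>i<n. w i * drift m R W i j)
    = - 2 * mv n R w j - 2 * (\<Sum>k<m. (\<Sum>i<n. w i * of_real (W i k)) * of_real (W j k))"
proof -
  have "(\<Sum>i<n. w i * drift m R W i j)
     = (\<Sum>i<n. - 2 * (of_real (R j i) * w i) - 2 * (\<Sum>k<m. w i * of_real (W i k) * of_real (W j k)))"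
    unfolding drift_def
    by (intro sum.cong refl, subst R) (auto simp: j algebra_simps sum_distrib_left)
  also have "\<dots> = - 2 * mv n R w j - 2 * (\<Sum>i<n. \<Sum>k<m. w i * of_real (W i k) * of_real (W j k))"
    by (simp add: mv_def sum_subtractf sum_distrib_left sum_negf)
  finally show ?thesis by (subst (asm) sum.swap) (simp add: sum_distrib_right)
qed

text \<open>If the real part of the eigenvalue is nonnegative, the energy bound leaves no room for
  dissipation, so \<open>W^T\<close> kills the first slot of \<open>t\<close>. The vectors that kill
  the first slot form an R-invariant set containing the columns of \<open>W\<close>, and
  controllability leaves only \<open>t = 0\<close>.\<close>

lemma leibniz_eigen_zero:
  assumes R: "\<And>i j. i < n \<Longrightarrow> j < n \<Longrightarrow> R i j = - R j i"
    and K: "krylov n m R W"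
    and ev: "\<And>is. is \<in> words n (Suc q) \<Longrightarrow> leibniz n (drift m R W) is t = \<mu> * t is"
    and mu: "0 \<le> Re \<mu>" and w: "w \<in> words n (Suc q)"
  shows "t w = 0"
proof -
  let ?N = "drift m R W"
  have "list_sum n (Suc q) (\<lambda>is. cnj (t is) * leibniz n ?N is t)
     = \<mu> * list_sum n (Suc q) (\<lambda>is. of_real ((cmod (t is))\<^sup>2))"
    unfolding list_sum_mult[symmetric]
    by (rule list_sum_cong) (simp only: ev complex_norm_square mult_ac)
  also have "list_sum n (Suc q) (\<lambda>is. complex_of_real ((cmod (t is))\<^sup>2)) = of_real (list_sum n (Suc q) (\<lambda>is. (cmod (t is))\<^sup>2))"
  proof -
    have "list_sum n p (\<lambda>is. complex_of_real (f is)) = of_real (list_sum n p f)" for p f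
      by (induct p arbitrary: f) auto
    thus ?thesis .
  qed
  finally have "Re (list_sum n (Suc q) (\<lambda>is. cnj (t is) * leibniz n ?N is t))
     = Re \<mu> * list_sum n (Suc q) (\<lambda>is. (cmod (t is))\<^sup>2)" by simp
  moreover have "0 \<le> Re \<mu> * list_sum n (Suc q) (\<lambda>is. (cmod (t is))\<^sup>2)"
    by (intro mult_nonneg_nonneg mu list_sum_nonneg) auto
  ultimately have z: "list_sum n q (\<lambda>is. \<Sum>k<m. (cmod (\<Sum>i<n. of_real (W i k) * t (i # is)))\<^sup>2) \<le> 0"
    using leibniz_energy_le(2)[where n=n and R=R and q=q and t=t and m=m and W=W and p="Suc q", OF R refl] by linarith
  have nn: "0 \<le> (\<Sum>k<m. (cmod (\<Sum>i<n. of_real (W i k) * t (i # is)))\<^sup>2)" for "is"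
    by (intro sum_nonneg) auto
  have W0: "(\<Sum>i<n. of_real (W i k) * t (i # is)) = 0" if "is \<in> words n q" "k < m" for "is" k
  proof -
    have "(\<Sum>k<m. (cmod (\<Sum>i<n. of_real (W i k) * t (i # is)))\<^sup>2) = 0"
      by (rule list_sum_eq_0D[OF _ nn that(1)]) (use z list_sum_nonneg[OF nn] in \<open>auto intro: antisym\<close>)
    thus ?thesis using that(2) by (subst (asm) sum_nonneg_eq_0_iff) auto
  qed
  define V where "V = {w. \<forall>is\<in>words n q. (\<Sum>i<n. w i * t (i # is)) = 0}"
  \<comment> \<open>Contracting the eigenvalue equation with \<open>w\<close> in the first slot
    removes the right side and all terms acting on other slots. What remains is \<open>w^T N\<close>
    contracted with \<open>t\<close>, and by \<open>W0\<close> its part along the columns of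
    \<open>W\<close> drops out.\<close>
  have inv: "mv n R w \<in> V" if w: "w \<in> V" for w
    unfolding V_def
  proof (intro CollectI ballI)
    fix "is" assume "is": "is \<in> words n q"
    define C where "C k = (\<Sum>i<n. w i * complex_of_real (W i k))" for k
    have "(\<Sum>i<n. w i * leibniz n ?N (i # is) t) = \<mu> * (\<Sum>i<n. w i * t (i # is))"
      unfolding sum_distrib_left by (intro sum.cong refl) (simp only: ev words_Suc "is" lessThan_iff simp_thms mult_ac)
    also have "\<dots> = 0" using w "is" by (simp add: V_def)
    finally have "0 = (\<Sum>i<n. w i * (\<Sum>j<n. ?N i j * t (j # is))) + (\<Sum>i<n. w i * leibniz n ?N is (\<lambda>js. t (i # js)))"
      by (simp add: distrib_left sum.distrib)
    also have "(\<Sum>i<n. w i * leibniz n ?N is (\<lambda>js. t (i # js))) = leibniz n ?N is (\<lambda>js. \<Sum>i<n. w i * t (i # js))"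
      by (simp add: leibniz_sum)
    also have "\<dots> = 0" by (rule leibniz_zero[OF "is"]) (use w in \<open>auto simp: V_def\<close>)
    also have "(\<Sum>i<n. w i * (\<Sum>j<n. ?N i j * t (j # is))) = (\<Sum>j<n. (\<Sum>i<n. w i * ?N i j) * t (j # is))"
      unfolding sum_distrib_left sum_distrib_right by (subst sum.swap) (simp add: mult_ac)
    also have "\<dots> = (\<Sum>j<n. (- 2 * mv n R w j - 2 * (\<Sum>k<m. C k * of_real (W j k))) * t (j # is))"
      unfolding C_def by (intro sum.cong refl) (simp add: mv_drift[OF R])
    also have "\<dots> = - 2 * (\<Sum>j<n. mv n R w j * t (j # is)) - 2 * (\<Sum>j<n. \<Sum>k<m. C k * (of_real (W j k) * t (j # is)))"
      by (simp add: algebra_simps sum_subtractf sum_distrib_left sum_negf)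
    also have "(\<Sum>j<n. \<Sum>k<m. C k * (of_real (W j k) * t (j # is)))
       = (\<Sum>k<m. C k * (\<Sum>j<n. of_real (W j k) * t (j # is)))"
      by (subst sum.swap) (simp add: sum_distrib_left)
    also have "\<dots> = 0" using W0[OF "is"] by simp
    finally show "(\<Sum>i<n. mv n R w i * t (i # is)) = 0" by simp
  qed
  have "(mv n R ^^ r) (\<lambda>i. of_real (W i k)) \<in> V" if "k < m" for r k
  proof (induct r)
    case 0 show ?case using W0 that by (simp add: V_def)
  qed (simp add: inv)
  moreover obtain i "is" where "w = i # is" "i < n" "is \<in> words n q" using w by (rule words_SucE)
  ultimately show ?thesis
    using K[unfolded krylov_def, rule_format, of "\<lambda>i. t (i # is)" i] by (auto simp: V_def)
qed

section \<open>Creation and annihilation maps\<close>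

text \<open>\<open>n\<close> counts Majorana operators, twice the number of modes. Multiplication by
  \<open>P\<close> from both sides is the parity automorphism. The assumption
  \<open>irreducible\<close> makes the twisted commutant scalar; as this commutant is the common
  kernel of the annihilators defined below, it expresses uniqueness of the vacuum.\<close>

locale majorana_algebra =
  fixes n :: nat and \<M> :: "lop set" and g :: "nat \<Rightarrow> lop" and P :: lop and tr :: "lop \<Rightarrow> complex"
  assumes one_M: "1 \<in> \<M>" and add_M: "\<And>x y. x \<in> \<M> \<Longrightarrow> y \<in> \<M> \<Longrightarrow> x + y \<in> \<M>"
    and mult_M: "\<And>x y. x \<in> \<M> \<Longrightarrow> y \<in> \<M> \<Longrightarrow> x * y \<in> \<M>" and sc_M: "\<And>c x. x \<in> \<M> \<Longrightarrow> sc c x \<in> \<M>"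
    and g_M: "\<And>i. i < n \<Longrightarrow> g i \<in> \<M>" and P_M: "P \<in> \<M>"
    and PP: "P * P = 1"
    and Pg: "\<And>i. i < n \<Longrightarrow> P * g i = - (g i * P)"
    and CAR: "\<And>i j. i < n \<Longrightarrow> j < n \<Longrightarrow> g i * g j + g j * g i = (if i = j then 2 else 0)"
    and tr_add: "\<And>x y. tr (x + y) = tr x + tr y" and tr_sc: "\<And>c x. tr (sc c x) = c * tr x"
    and tr_mult_comm: "\<And>x y. x \<in> \<M> \<Longrightarrow> y \<in> \<M> \<Longrightarrow> tr (x * y) = tr (y * x)"
    and tr_one: "tr 1 \<noteq> 0"
    and irreducible: "\<And>x. x \<in> \<M> \<Longrightarrow> (\<And>i. i < n \<Longrightarrow> g i * x = P * x * P * g i) \<Longrightarrow> \<exists>c. x = sc c 1"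
begin

definition tw :: "lop \<Rightarrow> lop" where "tw x = P * x * P"

text \<open>Identifying operators with a Fock space over their span, \<open>b i\<close> and \<open>a i\<close> are the creation and
  annihilation operators (third quantization).\<close>
definition a :: "nat \<Rightarrow> lop \<Rightarrow> lop" where "a i x = sc (1/2) (g i * x - tw x * g i)"
definition b :: "nat \<Rightarrow> lop \<Rightarrow> lop" where "b i x = sc (1/2) (g i * x + tw x * g i)"

lemma tw_tw [simp]: "tw (tw x) = x"
  unfolding tw_def by (metis PP mult.assoc mult.left_neutral mult.right_neutral)

lemma gP: "i < n \<Longrightarrow> g i * P = - (P * g i)" using Pg[of i] by simp

lemma tw_g_left: "i < n \<Longrightarrow> tw (g i * x) = - (g i * tw x)"
  by (simp add: tw_def mult.assoc[symmetric] Pg)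

lemma tw_g_right: "i < n \<Longrightarrow> tw (x * g i) = - (tw x * g i)"
  by (simp add: tw_def mult.assoc gP)

lemma tw_add: "tw (x + y) = tw x + tw y" by (simp add: tw_def algebra_simps)
lemma tw_diff: "tw (x - y) = tw x - tw y" by (simp add: tw_def algebra_simps)
lemma tw_sc: "tw (sc c x) = sc c (tw x)" by (simp add: tw_def)
lemma tw_uminus: "tw (- x) = - tw x" by (simp add: tw_def)

lemmas tw_simps = tw_g_left tw_g_right tw_add tw_diff tw_sc tw_uminus

lemma zero_M: "0 \<in> \<M>" using sc_M[OF one_M, of 0] by simp
lemma uminus_M: "x \<in> \<M> \<Longrightarrow> - x \<in> \<M>" using sc_M[of x "-1"] by (simp add: sc_minus_left)
lemma diff_M: "x \<in> \<M> \<Longrightarrow> y \<in> \<M> \<Longrightarrow> x - y \<in> \<M>" using add_M[OF _ uminus_M, of x y] by simp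
lemma tw_M: "x \<in> \<M> \<Longrightarrow> tw x \<in> \<M>" by (simp add: tw_def mult_M P_M)
lemma a_M: "i < n \<Longrightarrow> x \<in> \<M> \<Longrightarrow> a i x \<in> \<M>" by (simp add: a_def sc_M diff_M mult_M g_M tw_M)
lemma b_M: "i < n \<Longrightarrow> x \<in> \<M> \<Longrightarrow> b i x \<in> \<M>" by (simp add: b_def sc_M add_M mult_M g_M tw_M)
lemma sum_M: "(\<And>i. i \<in> S \<Longrightarrow> f i \<in> \<M>) \<Longrightarrow> sum f S \<in> \<M>"
  by (induct S rule: infinite_finite_induct) (auto simp: zero_M add_M)

lemma a_add: "a i (x + y) = a i x + a i y" by (simp add: a_def tw_add algebra_simps sc_distribs)
lemma b_add: "b i (x + y) = b i x + b i y" by (simp add: b_def tw_add algebra_simps sc_distribs)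
lemma a_sc: "a i (sc c x) = sc c (a i x)" by (simp add: a_def tw_sc sc_distribs mult.commute)
lemma b_sc: "b i (sc c x) = sc c (b i x)" by (simp add: b_def tw_sc sc_distribs mult.commute)
lemma a_zero [simp]: "a i 0 = 0" using a_sc[of i 0 0] by simp
lemma b_zero [simp]: "b i 0 = 0" using b_sc[of i 0 0] by simp
lemma a_uminus: "a i (- x) = - a i x" using a_sc[of i "-1" x] by (simp add: sc_minus_left)
lemma b_uminus: "b i (- x) = - b i x" using b_sc[of i "-1" x] by (simp add: sc_minus_left)
lemma a_diff: "a i (x - y) = a i x - a i y" using a_add[of i x "- y"] by (simp add: a_uminus)
lemma a_sum: "a i (sum f S) = (\<Sum>k\<in>S. a i (f k))"
  by (induct S rule: infinite_finite_induct) (auto simp: a_add)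
lemma b_sum: "b i (sum f S) = (\<Sum>k\<in>S. b i (f k))"
  by (induct S rule: infinite_finite_induct) (auto simp: b_add)

section \<open>Anticommutation relations of the creation and annihilation maps\<close>

lemma CAR_left: "i < n \<Longrightarrow> j < n \<Longrightarrow> g i * (g j * x) = (if i = j then 2 * x else 0) - g j * (g i * x)"
proof -
  assume "i < n" "j < n"
  then have "(g i * g j + g j * g i) * x = (if i = j then 2 else 0) * x" by (simp add: CAR)
  thus ?thesis by (simp add: algebra_simps split: if_splits)
qed

lemma CAR_right: "i < n \<Longrightarrow> j < n \<Longrightarrow> x * g i * g j = (if i = j then 2 * x else 0) - x * g j * g i"
proof -
  assume "i < n" "j < n"
  then have "x * (g i * g j + g j * g i) = x * (if i = j then 2 else 0)" by (simp add: CAR)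
  thus ?thesis by (simp add: algebra_simps mult_2 mult_2_right split: if_splits)
qed

lemma g_sq: "i < n \<Longrightarrow> g i * g i = 1"
proof -
  assume "i < n"
  then have "sc 2 (g i * g i) = sc 2 1" using CAR[of i i] by (simp add: sc_two)
  thus ?thesis by (rule sc_scaled_eqI) simp
qed

lemma sc_four: "sc 4 x = x + x + x + x"
  using sc_add_left[of 2 2 x] by (simp add: sc_two add.assoc)

text \<open>A common normal form for the four products of two maps. They differ only in the signs of
  the last three terms, so the identities below compare coefficients and reorder with
  \<open>CAR_left\<close> and \<open>CAR_right\<close>.\<close>

lemma ba_expand: assumes "i < n" "j < n"
  shows "b i (a j x) = sc (1/4) (g i * (g j * x) - g i * (tw x * g j) - g j * (tw x * g i) + x * g j * g i)"
  using assms by (simp add: a_def b_def tw_simps algebra_simps sc_distribs)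

lemma ab_expand: assumes "i < n" "j < n"
  shows "a i (b j x) = sc (1/4) (g i * (g j * x) + g i * (tw x * g j) + g j * (tw x * g i) + x * g j * g i)"
  using assms by (simp add: a_def b_def tw_simps algebra_simps sc_distribs)

lemma aa_expand: assumes "i < n" "j < n"
  shows "a i (a j x) = sc (1/4) (g i * (g j * x) - g i * (tw x * g j) + g j * (tw x * g i) - x * g j * g i)"
  using assms by (simp add: a_def b_def tw_simps algebra_simps sc_distribs)

lemma bb_expand: assumes "i < n" "j < n"
  shows "b i (b j x) = sc (1/4) (g i * (g j * x) + g i * (tw x * g j) - g j * (tw x * g i) - x * g j * g i)"
  using assms by (simp add: a_def b_def tw_simps algebra_simps sc_distribs)

lemma aa: assumes "i < n" "j < n" shows "a i (a j x) = - a j (a i x)"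
  unfolding aa_expand[OF assms] aa_expand[OF assms(2,1)]
  by (subst CAR_left[OF assms], subst CAR_right[OF assms(2,1)]) (simp add: sc_minus_right[symmetric] algebra_simps mult_2)

lemma bb: assumes "i < n" "j < n" shows "b i (b j x) = - b j (b i x)"
  unfolding bb_expand[OF assms] bb_expand[OF assms(2,1)]
  by (subst CAR_left[OF assms], subst CAR_right[OF assms(2,1)]) (simp add: sc_minus_right[symmetric] algebra_simps mult_2)

lemma ab: assumes "i < n" "j < n" shows "a i (b j x) = (if i = j then x else 0) - b j (a i x)"
proof -
  have "sc 4 (a i (b j x) + b j (a i x)) = (g i * (g j * x) + g j * (g i * x)) + (x * g j * g i + x * g i * g j)"
    unfolding ab_expand[OF assms] ba_expand[OF assms(2,1)] by (simp add: algebra_simps sc_distribs)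
  also have "\<dots> = sc 4 (if i = j then x else 0)"
    by (subst CAR_left[OF assms], subst CAR_right[OF assms(2,1)]) (simp add: mult_2 add.assoc sc_four)
  finally have "a i (b j x) + b j (a i x) = (if i = j then x else 0)" by (rule sc_scaled_eqI) simp
  thus ?thesis by (simp add: algebra_simps)
qed

lemma a_a_self: "i < n \<Longrightarrow> a i (a i x) = 0"
  using aa[of i i x] by (intro lop_eq_neg_self)

text \<open>A creator after an annihilator preserves the degree: the Hamiltonian part of the
  generator mixes only correlation functions of equal order.\<close>

lemma commutator_form: assumes "i < n" "j < n"
  shows "g i * g j * x - x * g i * g j = sc 2 (b i (a j x)) - sc 2 (b j (a i x))"
proof -
  have "sc 2 (sc 2 (b i (a j x)) - sc 2 (b j (a i x)))
     = (g i * (g j * x) - g j * (g i * x)) + (x * g j * g i - x * g i * g j)"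
    unfolding ba_expand[OF assms] ba_expand[OF assms(2,1)] by (simp add: algebra_simps sc_distribs)
  also have "\<dots> = sc 2 (g i * (g j * x) - x * g i * g j)"
    using CAR_left[OF assms(2,1), of x] CAR_right[OF assms(2,1), of x]
    by (simp add: sc_two algebra_simps)
  finally have "g i * (g j * x) - x * g i * g j = sc 2 (b i (a j x)) - sc 2 (b j (a i x))"
    by (rule sc_scaled_eqI[of 2, THEN sym]) simp_all
  thus ?thesis by (simp add: mult.assoc)
qed

text \<open>The twist in the jump term lets it combine with the anticommutator into
  degree-preserving terms and one term that raises the degree by two. Every term has a creator on
  the left, which is trace preservation in this language.\<close>

lemma dissipator_form: assumes "i < n" "j < n"
  shows "g i * tw x * g j - sc (1/2) (g j * g i * x + x * g j * g i)
    = sc 2 (b i (b j x)) - b j (a i x) - b i (a j x)"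
proof -
  have "sc 4 (sc 2 (b i (b j x)) - b j (a i x) - b i (a j x))
     = sc 4 (g i * (tw x * g j)) - sc 2 (g j * (g i * x) + x * g j * g i)
       + ((g i * (g j * x) + g j * (g i * x)) - (x * g j * g i + x * g i * g j))"
    unfolding ba_expand[OF assms] ba_expand[OF assms(2,1)] bb_expand[OF assms]
    by (simp add: algebra_simps sc_distribs sc_four sc_two)
  also have "(g i * (g j * x) + g j * (g i * x)) - (x * g j * g i + x * g i * g j) = 0"
    by (subst CAR_left[OF assms], subst CAR_right[OF assms(2,1)]) simp
  also have "sc 4 (g i * (tw x * g j)) - sc 2 (g j * (g i * x) + x * g j * g i) + 0
    = sc 4 (g i * (tw x * g j) - sc (1/2) (g j * (g i * x) + x * g j * g i))"
    by (simp add: sc_diff_right)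
  finally have "g i * (tw x * g j) - sc (1/2) (g j * (g i * x) + x * g j * g i)
    = sc 2 (b i (b j x)) - b j (a i x) - b i (a j x)"
    by (rule sc_scaled_eqI[of 4, THEN sym]) simp
  thus ?thesis by (simp add: mult.assoc)
qed

text \<open>The trace is the vacuum functional.\<close>
lemma tr_b: assumes "i < n" "x \<in> \<M>" shows "tr (b i x) = 0"
proof -
  have "tr (tw x * g i) = tr (P * (x * P * g i))" by (simp add: tw_def mult.assoc)
  also have "\<dots> = tr (x * P * g i * P)" by (rule tr_mult_comm) (auto intro: assms mult_M P_M g_M)
  also have "x * P * g i * P = - (x * (P * P) * g i)" by (simp add: mult.assoc gP[OF assms(1)])
  also have "\<dots> = sc (- 1) (x * g i)" by (simp add: PP sc_minus_left)
  also have "tr (sc (- 1) (x * g i)) = - tr (g i * x)"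
    unfolding tr_sc using tr_mult_comm[of x "g i"] assms g_M by simp
  finally show ?thesis by (simp add: b_def tr_sc tr_add)
qed

section \<open>Correlation functions from annihilators and the trace\<close>

lemma tr_zero [simp]: "tr 0 = 0" using tr_sc[of 0 0] by simp
lemma tr_uminus: "tr (- x) = - tr x" using tr_sc[of "-1" x] by (simp add: sc_minus_left)
lemma tr_diff: "tr (x - y) = tr x - tr y" using tr_add[of x "- y"] by (simp add: tr_uminus)
lemma tr_sum: "tr (sum f S) = (\<Sum>k\<in>S. tr (f k))"
  by (induct S rule: infinite_finite_induct) (auto simp: tr_add)

text \<open>\<open>fold\<close> applies the head of the list first, so removing the head from the
  word replaces \<open>x\<close> by \<open>a i x\<close>. This is the recursion of
  \<open>leibniz\<close>.\<close>

abbreviation as :: "nat list \<Rightarrow> lop \<Rightarrow> lop" where "as \<equiv> fold a"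

lemma as_add: "as is (x + y) = as is x + as is y"
  by (induct "is" arbitrary: x y) (auto simp: a_add)
lemma as_sc: "as is (sc c x) = sc c (as is x)"
  by (induct "is" arbitrary: x) (auto simp: a_sc)
lemma as_zero [simp]: "as is 0 = 0" by (induct "is") auto
lemma as_uminus: "as is (- x) = - as is x" using as_sc[of "is" "-1" x] by (simp add: sc_minus_left)
lemma as_diff: "as is (x - y) = as is x - as is y" using as_add[of "is" x "- y"] by (simp add: as_uminus)
lemma as_sum: "as is (sum f S) = (\<Sum>k\<in>S. as is (f k))"
  by (induct S rule: infinite_finite_induct) (auto simp: as_add)
lemma as_M: "set is \<subseteq> {..<n} \<Longrightarrow> x \<in> \<M> \<Longrightarrow> as is x \<in> \<M>"
  by (induct "is" arbitrary: x) (auto simp: a_M)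

text \<open>Anticommutation moves the extra annihilator next to its copy in the word, and its square
  is zero.\<close>

lemma as_a_eq_0: "i < n \<Longrightarrow> set is \<subseteq> {..<n} \<Longrightarrow> i \<in> set is \<Longrightarrow> as is (a i x) = 0"
proof (induct "is" arbitrary: x)
  case (Cons k ks)
  show ?case
  proof (cases "k = i")
    case True thus ?thesis using Cons.prems by (simp add: a_a_self)
  next
    case False
    thus ?thesis using Cons.prems Cons.hyps[of "a k x"] by (simp add: aa[of k i] as_uminus)
  qed
qed simp

lemma distinct_if_as: "set is \<subseteq> {..<n} \<Longrightarrow> as is x \<noteq> 0 \<Longrightarrow> distinct is"
  by (induct "is" arbitrary: x) (use as_a_eq_0 in auto)

lemma length_if_as: assumes "set is \<subseteq> {..<n}" "as is x \<noteq> 0" shows "length is \<le> n"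
  using distinct_if_as[OF assms] card_mono[OF _ assms(1)] by (simp add: distinct_card)

text \<open>Correlation functions determine the operator. Annihilators are applied as long as the
  result stays nonzero, which is at most \<open>n\<close> times because letters cannot repeat. A
  longest such word yields an element killed by all annihilators, hence a nonzero multiple of 1,
  whose trace does not vanish.\<close>

lemma correlation_nonzero:
  assumes x: "x \<in> \<M>" "x \<noteq> 0"
  obtains "is" where "set is \<subseteq> {..<n}" "tr (as is x) \<noteq> 0"
proof -
  define Q where "Q l \<longleftrightarrow> (\<exists>is. set is \<subseteq> {..<n} \<and> as is x \<noteq> 0 \<and> length is = l)" for l
  have "Q 0" unfolding Q_def using x(2) by (intro exI[of _ "[]"]) simp
  moreover have "\<forall>l. Q l \<longrightarrow> l \<le> n" unfolding Q_def using length_if_as by auto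
  ultimately obtain l where l: "Q l" "\<forall>l'. Q l' \<longrightarrow> l' \<le> l" using Nat.ex_has_greatest_nat[of Q 0 n] by auto
  from l(1) obtain "is" where "is": "set is \<subseteq> {..<n}" "as is x \<noteq> 0" "length is = l" unfolding Q_def by blast
  have "a i (as is x) = 0" if "i < n" for i
  proof (rule ccontr)
    assume "a i (as is x) \<noteq> 0"
    hence "Q (Suc l)" unfolding Q_def using "is" that by (intro exI[of _ "is @ [i]"]) auto
    with l(2) show False by auto
  qed
  hence "g i * as is x = P * as is x * P * g i" if "i < n" for i
    using that by (auto simp: a_def sc_eq_0_iff tw_def)
  from irreducible[OF as_M[OF "is"(1) x(1)] this] obtain c where c: "as is x = sc c 1" by auto
  with "is"(2) have "c \<noteq> 0" by auto
  hence "tr (as is x) \<noteq> 0" by (simp add: c tr_sc tr_one)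
  with "is"(1) show ?thesis by (rule that)
qed

section \<open>The generator in normal order and its action on correlation functions\<close>

definition gen :: "(nat \<Rightarrow> nat \<Rightarrow> complex) \<Rightarrow> (nat \<Rightarrow> nat \<Rightarrow> complex) \<Rightarrow> lop \<Rightarrow> lop" where
  "gen N A x = (\<Sum>i<n. \<Sum>j<n. sc (N i j) (b i (a j x))) + (\<Sum>i<n. \<Sum>j<n. sc (2 * A i j) (b i (b j x)))"

text \<open>Moving \<open>a k\<close> through \<open>b i (a j x)\<close> leaves one contraction, in
  which \<open>a k\<close> is replaced by row \<open>k\<close> of \<open>N\<close> applied to the
  annihilators. The term without contraction ends with a creator under the trace and
  vanishes.\<close>

lemma tr_as_N:
  assumes "set is \<subseteq> {..<n}" "x \<in> \<M>"
  shows "tr (as is (\<Sum>i<n. \<Sum>j<n. sc (N i j) (b i (a j x)))) = leibniz n N is (\<lambda>js. tr (as js x))"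
  using assms
proof (induct "is" arbitrary: x)
  case Nil
  thus ?case by (simp add: tr_sum tr_sc tr_b a_M)
next
  case (Cons k ks)
  hence k: "k < n" by simp
  have "a k (\<Sum>i<n. \<Sum>j<n. sc (N i j) (b i (a j x)))
     = (\<Sum>i<n. \<Sum>j<n. sc (N i j) ((if k = i then a j x else 0) + b i (a j (a k x))))"
    unfolding a_sum a_sc
  proof (intro sum.cong refl)
    fix i j assume "i \<in> {..<n}" "j \<in> {..<n}"
    hence ij: "i < n" "j < n" by auto
    show "sc (N i j) (a k (b i (a j x))) = sc (N i j) ((if k = i then a j x else 0) + b i (a j (a k x)))"
      unfolding ab[OF k ij(1)] aa[OF k ij(2)] b_uminus by simp
  qed
  also have "\<dots> = (\<Sum>i<n. if k = i then (\<Sum>j<n. sc (N i j) (a j x)) else 0)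
      + (\<Sum>i<n. \<Sum>j<n. sc (N i j) (b i (a j (a k x))))"
    unfolding sc_add_right sum.distrib by (intro arg_cong2[of _ _ _ _ "(+)"] sum.cong refl) auto
  also have "(\<Sum>i<n. if k = i then (\<Sum>j<n. sc (N i j) (a j x)) else 0) = (\<Sum>j<n. sc (N k j) (a j x))"
    using k by (simp add: sum.delta')
  finally have "tr (as (k # ks) (\<Sum>i<n. \<Sum>j<n. sc (N i j) (b i (a j x))))
    = (\<Sum>j<n. N k j * tr (as ks (a j x))) + tr (as ks (\<Sum>i<n. \<Sum>j<n. sc (N i j) (b i (a j (a k x)))))"
    by (simp add: as_add as_sum as_sc tr_add tr_sum tr_sc)
  also have "tr (as ks (\<Sum>i<n. \<Sum>j<n. sc (N i j) (b i (a j (a k x))))) = leibniz n N ks (\<lambda>js. tr (as js (a k x)))"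
    using Cons a_M[OF k] by simp
  finally show ?case by simp
qed

text \<open>The creator either reaches the trace, which kills it, or is contracted and leaves a word
  shorter by one. Thus a creator raises the lowest order of nonvanishing correlation functions by at
  least one.\<close>

lemma tr_as_b_eq_0:
  assumes "set is \<subseteq> {..<n}" "k < n" "x \<in> \<M>"
    and "\<And>js. set js \<subseteq> {..<n} \<Longrightarrow> length js < length is \<Longrightarrow> tr (as js x) = 0"
  shows "tr (as is (b k x)) = 0"
  using assms
proof (induct "is" arbitrary: x)
  case Nil thus ?case by (simp add: tr_b)
next
  case (Cons i "is")
  have "as (i # is) (b k x) = (if i = k then as is x else 0) - as is (b k (a i x))"
    using Cons.prems by (simp add: ab as_diff)
  moreover have "tr (as is x) = 0" using Cons.prems by simp
  moreover have "tr (as is (b k (a i x))) = 0"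
  proof (rule Cons.hyps)
    fix js assume "set js \<subseteq> {..<n}" "length js < length is"
    thus "tr (as js (a i x)) = 0" using Cons.prems(4)[of "i # js"] Cons.prems(1) by simp
  qed (use Cons.prems a_M in auto)
  ultimately show ?case by (simp add: tr_diff)
qed

lemma gen_M: "x \<in> \<M> \<Longrightarrow> gen N A x \<in> \<M>"
  unfolding gen_def by (intro add_M sum_M sc_M b_M a_M) auto

lemma tr_gen: assumes "x \<in> \<M>" shows "tr (gen N A x) = 0"
  using assms by (simp add: gen_def tr_add tr_sum tr_sc tr_b a_M b_M)

text \<open>The part of \<open>gen\<close> containing \<open>b b\<close> raises the degree by two, so it is invisible to the
  nonvanishing correlation functions of lowest order.\<close>
lemma gen_eigenvalue:
  assumes R: "\<And>i j. i < n \<Longrightarrow> j < n \<Longrightarrow> R i j = - R j i" and K: "krylov n m R W"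
    and x: "x \<in> \<M>" "x \<noteq> 0" "tr x = 0" and ev: "gen (drift m R W) A x = sc \<mu> x"
  shows "Re \<mu> < 0"
proof (rule ccontr)
  assume "\<not> Re \<mu> < 0" hence mu: "0 \<le> Re \<mu>" by simp
  let ?N = "drift m R W"
  define Q where "Q l \<longleftrightarrow> (\<exists>is. set is \<subseteq> {..<n} \<and> tr (as is x) \<noteq> 0 \<and> length is = l)" for l
  from correlation_nonzero[OF x(1,2)] have "\<exists>l. Q l" unfolding Q_def by metis
  then obtain p where p: "Q p" "\<And>l. l < p \<Longrightarrow> \<not> Q l" using exists_least_iff[of Q] by auto
  have "p \<noteq> 0" using p(1) x(3) unfolding Q_def by auto
  then obtain q where q: "p = Suc q" by (cases p) auto
  have low: "tr (as js x) = 0" if "set js \<subseteq> {..<n}" "length js < p" for js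
    using p(2)[OF that(2)] that(1) unfolding Q_def by auto
  have "leibniz n ?N is (\<lambda>js. tr (as js x)) = \<mu> * tr (as is x)" if w: "is \<in> words n (Suc q)" for "is"
  proof -
    from w have "is": "set is \<subseteq> {..<n}" "length is = p" by (auto simp: words_def q)
    have z: "tr (as is (b i (b j x))) = 0" if "i < n" "j < n" for i j
    proof (rule tr_as_b_eq_0[OF "is"(1) that(1) b_M[OF that(2) x(1)]])
      fix js assume js: "set js \<subseteq> {..<n}" "length js < length is"
      show "tr (as js (b j x)) = 0" by (rule tr_as_b_eq_0[OF js(1) that(2) x(1)], rule low) (use js "is" in auto)
    qed
    have "\<mu> * tr (as is x) = tr (as is (gen ?N A x))" by (simp add: ev as_sc tr_sc)
    also have "\<dots> = leibniz n ?N is (\<lambda>js. tr (as js x))"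
      unfolding gen_def as_add tr_add tr_as_N[OF "is"(1) x(1)] by (simp add: as_sum as_sc tr_sum tr_sc z)
    finally show ?thesis ..
  qed
  from leibniz_eigen_zero[OF R K this mu] have "tr (as is x) = 0" if "is \<in> words n (Suc q)" for "is"
    using that by blast
  with p(1) show False unfolding Q_def q words_def by blast
qed

lemma tr_a_gen:
  assumes "i < n" "x \<in> \<M>"
  shows "tr (a i (gen N A x)) = (\<Sum>j<n. N i j * tr (a j x))"
proof -
  have "tr (a i (b k (b l x))) = 0" if "k < n" "l < n" for k l
    using tr_as_b_eq_0[of "[i]" k "b l x"] assms that by (simp add: b_M tr_b)
  thus ?thesis using tr_as_N[of "[i]" x N] assms
    by (simp add: gen_def a_add tr_add a_sum a_sc tr_sum tr_sc)
qed

text \<open>The pair of creators contributes its two Wick contractions with opposite signs, so the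
  antisymmetric part of \<open>A\<close> is the source term for the second moments.\<close>

lemma tr_aa_gen:
  assumes ij: "i < n" "j < n" and x: "x \<in> \<M>"
  shows "tr (a j (a i (gen N A x)))
    = (\<Sum>k<n. N i k * tr (a j (a k x))) + (\<Sum>k<n. N j k * tr (a k (a i x))) + 2 * (A i j - A j i) * tr x"
proof -
  have d: "tr (a i' (b l y)) = (if i' = l then tr y else 0)" if "i' < n" "l < n" "y \<in> \<M>" for i' l y
    unfolding ab[OF that(1,2)] tr_diff using that by (simp add: tr_b a_M)
  have "tr (a j (a i (b k (b l x)))) = (if i = k then (if j = l then tr x else 0) else 0)
      - (if j = k then (if i = l then tr x else 0) else 0)" if "k < n" "l < n" for k l
    unfolding ab[OF ij(1) that(1)] a_diff tr_diff using ij that x by (simp add: d a_M b_M)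
  hence "(\<Sum>k<n. \<Sum>l<n. 2 * A k l * tr (a j (a i (b k (b l x)))))
    = (\<Sum>k<n. \<Sum>l<n. (if i = k then (if j = l then 2 * A k l * tr x else 0) else 0)
        - (if j = k then (if i = l then 2 * A k l * tr x else 0) else 0))"
    by (intro sum.cong refl) auto
  also have "\<dots> = 2 * A i j * tr x - 2 * A j i * tr x"
  proof -
    have s: "(\<Sum>k<n. \<Sum>l<n. if i = k then (if j = l then f k l else 0) else 0) = f i j"
      if "i < n" "j < n" for i j and f :: "nat \<Rightarrow> nat \<Rightarrow> complex"
    proof -
      have "(\<Sum>k<n. \<Sum>l<n. if i = k then (if j = l then f k l else 0) else 0)
        = (\<Sum>k<n. if i = k then (\<Sum>l<n. if j = l then f k l else 0) else 0)"
        by (intro sum.cong refl) auto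
      thus ?thesis using that by (simp add: sum.delta')
    qed
    show ?thesis unfolding sum_subtractf using s[OF ij] s[OF ij(2,1)] by simp
  qed
  finally show ?thesis using tr_as_N[of "[i, j]" x N] ij x
    by (simp add: gen_def a_add tr_add a_sum a_sc tr_sum tr_sc algebra_simps)
qed

text \<open>The hypothesis \<open>\<rho>\<close> is the Gaussian property: on \<open>x\<close>, annihilators act as linear combinations of creators.\<close>
lemma gen_gaussian_eq_0:
  assumes \<rho>: "\<And>j. j < n \<Longrightarrow> a j x = - (\<Sum>l<n. sc (Y l j) (b l x))"
    and Y: "\<And>i j. i < n \<Longrightarrow> j < n \<Longrightarrow> Y j i = - Y i j"
    and lyap: "\<And>i j. i < n \<Longrightarrow> j < n \<Longrightarrow> (\<Sum>k<n. N i k * Y k j) + (\<Sum>k<n. Y i k * N j k) = - 2 * (A i j - A j i)"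
  shows "gen N A x = 0"
proof -
  define S where "S i l = (\<Sum>j<n. N i j * Y j l) + 2 * A i l" for i l
  have "(\<Sum>i<n. \<Sum>j<n. sc (N i j) (b i (a j x))) = (\<Sum>i<n. \<Sum>j<n. \<Sum>l<n. sc (N i j * Y j l) (b i (b l x)))"
  proof (intro sum.cong refl)
    fix i j assume "i \<in> {..<n}" "j \<in> {..<n}"
    hence j: "j < n" by simp
    have "a j x = (\<Sum>l<n. sc (Y j l) (b l x))"
      unfolding \<rho>[OF j] sum_negf[symmetric] by (intro sum.cong refl, subst Y) (auto simp: j sc_minus_left)
    thus "sc (N i j) (b i (a j x)) = (\<Sum>l<n. sc (N i j * Y j l) (b i (b l x)))"
      by (simp add: b_sum b_sc sc_sum_right)
  qed
  also have "\<dots> = (\<Sum>i<n. \<Sum>l<n. \<Sum>j<n. sc (N i j * Y j l) (b i (b l x)))"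
    by (intro sum.cong refl sum.swap)
  finally have g: "gen N A x = (\<Sum>i<n. \<Sum>l<n. sc (S i l) (b i (b l x)))"
    by (simp add: gen_def S_def sc_add_left sc_sum_left sum.distrib)
  \<comment> \<open>The Lyapunov equation says exactly that \<open>S\<close> is symmetric.
    Contracted with the antisymmetric products of creators it gives zero.\<close>
  have sym: "S i l = S l i" if "i < n" "l < n" for i l
  proof -
    have "(\<Sum>k<n. Y i k * N l k) = - (\<Sum>k<n. N l k * Y k i)"
      unfolding sum_negf[symmetric] by (intro sum.cong refl, subst Y) (auto simp: that)
    thus ?thesis using lyap[OF that] by (simp add: S_def algebra_simps)
  qed
  have "gen N A x = (\<Sum>l<n. \<Sum>i<n. sc (S i l) (b i (b l x)))" unfolding g by (rule sum.swap)
  also have "\<dots> = (\<Sum>l<n. \<Sum>i<n. - sc (S l i) (b l (b i x)))"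
    by (intro sum.cong refl, subst bb) (auto simp: sym sc_minus_right)
  also have "\<dots> = - gen N A x" unfolding g by (simp add: sum_negf)
  finally show ?thesis by (rule lop_eq_neg_self)
qed

text \<open>The commutator sees the antisymmetric part of \<open>R\<close>. The symmetric part of
  \<open>A\<close> enters the drift through the two \<open>b a\<close> terms of
  \<open>dissipator_form\<close>, while the \<open>b b\<close> term keeps its antisymmetric part
  because creators anticommute.\<close>

lemma gen_eq:
  assumes A: "\<And>i j. i < n \<Longrightarrow> j < n \<Longrightarrow> A i j + A j i = of_real (2 * (\<Sum>k<m. W i k * W j k))"
    and R': "\<And>i j. i < n \<Longrightarrow> j < n \<Longrightarrow> R' i j = (R i j - R j i) / 2"
  shows "(\<Sum>i<n. \<Sum>j<n. sc (of_real (R i j) / 2) (g i * g j * x - x * g i * g j))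
     + (\<Sum>i<n. \<Sum>j<n. sc (A i j) (g i * tw x * g j - sc (1/2) (g j * g i * x + x * g j * g i)))
     = gen (drift m R' W) A x"
proof -
  have sw: "(\<Sum>i<n. \<Sum>j<n. sc (f i j) (b j (a i x))) = (\<Sum>i<n. \<Sum>j<n. sc (f j i) (b i (a j x)))" for f
    by (rule sum.swap)
  have "(\<Sum>i<n. \<Sum>j<n. sc (of_real (R i j) / 2) (g i * g j * x - x * g i * g j))
     = (\<Sum>i<n. \<Sum>j<n. sc (of_real (R i j)) (b i (a j x)) - sc (of_real (R i j)) (b j (a i x)))"
    by (intro sum.cong refl) (simp add: commutator_form sc_diff_right)
  also have "\<dots> = (\<Sum>i<n. \<Sum>j<n. sc (of_real (R i j - R j i)) (b i (a j x)))"
    by (simp add: sum_subtractf sw sc_diff_left)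
  finally have 1: "(\<Sum>i<n. \<Sum>j<n. sc (of_real (R i j) / 2) (g i * g j * x - x * g i * g j))
     = (\<Sum>i<n. \<Sum>j<n. sc (of_real (R i j - R j i)) (b i (a j x)))" .
  have "(\<Sum>i<n. \<Sum>j<n. sc (A i j) (g i * tw x * g j - sc (1/2) (g j * g i * x + x * g j * g i)))
     = (\<Sum>i<n. \<Sum>j<n. sc (2 * A i j) (b i (b j x)) - sc (A i j) (b j (a i x)) - sc (A i j) (b i (a j x)))"
    by (intro sum.cong refl) (simp add: dissipator_form sc_diff_right mult.commute)
  also have "\<dots> = (\<Sum>i<n. \<Sum>j<n. sc (2 * A i j) (b i (b j x))) - (\<Sum>i<n. \<Sum>j<n. sc (A i j + A j i) (b i (a j x)))"
    by (simp add: sum_subtractf sw sc_add_left sum.distrib)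
  also have "(\<Sum>i<n. \<Sum>j<n. sc (A i j + A j i) (b i (a j x)))
     = (\<Sum>i<n. \<Sum>j<n. sc (of_real (2 * (\<Sum>k<m. W i k * W j k))) (b i (a j x)))"
    by (intro sum.cong refl) (use A in auto)
  finally have 2: "(\<Sum>i<n. \<Sum>j<n. sc (A i j) (g i * tw x * g j - sc (1/2) (g j * g i * x + x * g j * g i)))
    = (\<Sum>i<n. \<Sum>j<n. sc (2 * A i j) (b i (b j x)))
      - (\<Sum>i<n. \<Sum>j<n. sc (of_real (2 * (\<Sum>k<m. W i k * W j k))) (b i (a j x)))" .
  have "(\<Sum>i<n. \<Sum>j<n. sc (drift m R' W i j) (b i (a j x)))
     = (\<Sum>i<n. \<Sum>j<n. sc (of_real (R i j - R j i)) (b i (a j x)))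
      - (\<Sum>i<n. \<Sum>j<n. sc (of_real (2 * (\<Sum>k<m. W i k * W j k))) (b i (a j x)))"
    unfolding sum_subtractf[symmetric] sc_diff_left[symmetric] drift_def of_real_diff[symmetric]
    by (intro sum.cong refl arg_cong2[of _ _ _ _ sc], subst R') (auto simp: right_diff_distrib)
  thus ?thesis unfolding 1 2 gen_def by simp
qed

end

section \<open>Matrix exponential\<close>

lemma index_mult_sum:
  "A \<in> carrier_mat n m \<Longrightarrow> B \<in> carrier_mat m p \<Longrightarrow> i < n \<Longrightarrow> j < p \<Longrightarrow>
    (A * B) $$ (i,j) = (\<Sum>k<m. A $$ (i,k) * B $$ (k,j))"
  by (simp add: scalar_prod_def atLeast0LessThan)

lemma index_mult_vec_sum:
  "A \<in> carrier_mat n m \<Longrightarrow> v \<in> carrier_vec m \<Longrightarrow> i < n \<Longrightarrow> (A *\<^sub>v v) $ i = (\<Sum>k<m. A $$ (i,k) * v $ k)"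
  by (simp add: scalar_prod_def atLeast0LessThan)

lemma dim_mat_adjoint [simp]: "dim_row (mat_adjoint A) = dim_col A" "dim_col (mat_adjoint A) = dim_row A"
  unfolding mat_adjoint_def mat_of_rows_def by auto

lemma mat_adjoint_carrier [simp]: "mat_adjoint A \<in> carrier_mat n m \<longleftrightarrow> A \<in> carrier_mat m n"
  unfolding carrier_mat_def by auto

lemma index_mat_adjoint [simp]:
  "i < dim_col A \<Longrightarrow> j < dim_row A \<Longrightarrow> mat_adjoint A $$ (i,j) = cnj (A $$ (j,i) :: complex)"
  unfolding mat_adjoint_def mat_of_rows_def by (simp add: cols_def)

lemma mat_adjoint_mult:
  fixes A :: "complex mat"
  shows "A \<in> carrier_mat n m \<Longrightarrow> B \<in> carrier_mat m p \<Longrightarrow> mat_adjoint (A * B) = mat_adjoint B * mat_adjoint A"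
  by (rule eq_matI) (auto simp: scalar_prod_def mult.commute intro!: sum.cong)

lemma mat_adjoint_add:
  fixes A :: "complex mat"
  shows "A \<in> carrier_mat n m \<Longrightarrow> B \<in> carrier_mat n m \<Longrightarrow> mat_adjoint (A + B) = mat_adjoint A + mat_adjoint B"
  by (rule eq_matI) auto

lemma mat_adjoint_smult: "mat_adjoint (c \<cdot>\<^sub>m A) = cnj c \<cdot>\<^sub>m mat_adjoint A"
  by (rule eq_matI) auto

lemma mat_adjoint_adjoint [simp]: "mat_adjoint (mat_adjoint A) = (A :: complex mat)"
  by (rule eq_matI) auto

lemma mat_adjoint_one [simp]: "mat_adjoint (1\<^sub>m n) = (1\<^sub>m n :: complex mat)"
  by (rule eq_matI) auto

lemma pow_mat_smult: "A \<in> carrier_mat n n \<Longrightarrow> (z \<cdot>\<^sub>m A) ^\<^sub>m k = (z ^ k :: complex) \<cdot>\<^sub>m (A ^\<^sub>m k)"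
proof (induct k)
  case (Suc k)
  hence "(z \<cdot>\<^sub>m A) ^\<^sub>m Suc k = (z ^ k \<cdot>\<^sub>m A ^\<^sub>m k) * (z \<cdot>\<^sub>m A)" by simp
  also have "\<dots> = z ^ Suc k \<cdot>\<^sub>m (A ^\<^sub>m k * A)"
    by (rule eq_matI) (use Suc in \<open>auto simp: scalar_prod_def sum_distrib_left mult_ac\<close>)
  finally show ?case by simp
qed (auto intro: eq_matI)

lemma pow_mat_adjoint:
  fixes A :: "complex mat"
  assumes A: "A \<in> carrier_mat n n" shows "mat_adjoint (A ^\<^sub>m k) = mat_adjoint A ^\<^sub>m k"
proof (induct k)
  case (Suc k)
  have comm: "B * B ^\<^sub>m k = B ^\<^sub>m k * B" if "B \<in> carrier_mat n n" for B :: "complex mat"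
  proof (induct k)
    case (Suc k)
    have "B * B ^\<^sub>m Suc k = B * B ^\<^sub>m k * B" using that by (simp add: assoc_mult_mat[of _ n n _ n _ n])
    thus ?case using Suc by simp
  qed (use that in simp)
  have "mat_adjoint (A ^\<^sub>m Suc k) = mat_adjoint A * mat_adjoint A ^\<^sub>m k"
    using A Suc by (simp add: mat_adjoint_mult[of _ n n _ n])
  thus ?case using comm[of "mat_adjoint A"] A by simp
qed (use A in simp)

lemma cmod_pow_mat_le:
  assumes A: "A \<in> carrier_mat n n" and "i < n" "j < n"
  shows "cmod ((A ^\<^sub>m k) $$ (i,j)) \<le> (\<Sum>i<n. \<Sum>j<n. cmod (A $$ (i,j))) ^ k"
  using assms(2,3)
proof (induct k arbitrary: j)
  case 0 thus ?case using A by simp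
next
  case (Suc k)
  let ?c = "\<Sum>i<n. \<Sum>j<n. cmod (A $$ (i,j))"
  have "cmod ((A ^\<^sub>m Suc k) $$ (i,j)) = cmod (\<Sum>l<n. (A ^\<^sub>m k) $$ (i,l) * A $$ (l,j))"
    using A Suc.prems by (simp add: index_mult_sum[of _ n n _ n] del: index_mult_mat)
  also have "\<dots> \<le> (\<Sum>l<n. ?c ^ k * cmod (A $$ (l,j)))"
    by (intro sum_norm_le) (use Suc in \<open>auto simp: norm_mult intro!: mult_right_mono\<close>)
  also have "\<dots> = ?c ^ k * (\<Sum>l<n. cmod (A $$ (l,j)))" by (simp add: sum_distrib_left)
  also have "\<dots> \<le> ?c ^ k * ?c"
  proof (intro mult_left_mono sum_mono)
    fix l assume "l \<in> {..<n}"
    show "cmod (A $$ (l,j)) \<le> (\<Sum>j<n. cmod (A $$ (l,j)))"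
      by (rule member_le_sum) (use Suc in auto)
  qed (auto intro!: sum_nonneg zero_le_power)
  finally show ?case by (simp add: mult.commute)
qed

text \<open>The variable \<open>z\<close> is kept in the series so that termwise differentiation
  applies later. The sum of all absolute values of entries is submultiplicative and gives the
  majorant.\<close>

lemma summable_mat_exp:
  fixes A :: "complex mat"
  assumes A: "A \<in> carrier_mat n n" and "i < n" "j < n"
  shows "summable (\<lambda>k. (A ^\<^sub>m k) $$ (i,j) / fact k * z ^ k)"
proof (rule summable_comparison_test)
  let ?c = "(\<Sum>i<n. \<Sum>j<n. cmod (A $$ (i,j)))"
  show "summable (\<lambda>k. (?c * cmod z) ^ k /\<^sub>R fact k)" by (rule summable_exp_generic)
  have "norm ((A ^\<^sub>m k) $$ (i,j) / fact k * z ^ k) \<le> (?c * cmod z) ^ k /\<^sub>R fact k" for k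
    using mult_right_mono[OF cmod_pow_mat_le[OF assms, of k], of "cmod z ^ k / fact k"]
    by (simp add: norm_mult norm_divide norm_power power_mult_distrib divide_simps)
  thus "\<exists>N. \<forall>k\<ge>N. norm ((A ^\<^sub>m k) $$ (i,j) / fact k * z ^ k) \<le> (?c * cmod z) ^ k /\<^sub>R fact k" by blast
qed

lemma dim_mat_exp [simp]: "dim_row (mat_exp A) = dim_row A" "dim_col (mat_exp A) = dim_col A"
  unfolding mat_exp_def by (rule dim_row_mat, rule dim_col_mat)

lemma mat_exp_carrier [simp]: "mat_exp A \<in> carrier_mat n m \<longleftrightarrow> A \<in> carrier_mat n m"
  unfolding carrier_mat_def by simp

lemma index_mat_exp_smult:
  assumes A: "A \<in> carrier_mat n n" and "i < n" "j < n"
  shows "mat_exp (z \<cdot>\<^sub>m A) $$ (i,j) = (\<Sum>k. (A ^\<^sub>m k) $$ (i,j) / fact k * z ^ k)"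
proof -
  have "dim_row (A ^\<^sub>m k) = n" "dim_col (A ^\<^sub>m k) = n" for k using A by auto
  moreover have "dim_row A = n" "dim_col A = n" using A by auto
  ultimately show ?thesis using assms(2,3)
    unfolding mat_exp_def pow_mat_smult[OF A] by (simp add: field_simps)
qed

lemma index_mat_exp:
  assumes A: "A \<in> carrier_mat n n" and "i < n" "j < n"
  shows "mat_exp A $$ (i,j) = (\<Sum>k. (A ^\<^sub>m k) $$ (i,j) / fact k)"
    and "summable (\<lambda>k. (A ^\<^sub>m k) $$ (i,j) / fact k)"
  using summable_mat_exp[OF assms, of 1] assms by (auto simp: mat_exp_def)

lemma smult_one_mat [simp]: "(1::complex) \<cdot>\<^sub>m A = A" by (rule eq_matI) auto

text \<open>\<open>B\<close> may be rectangular: a row or a column in its place yields left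
  eigenvectors and kernel vectors of exponentials, a square one the ladder relations of Gaussian
  states.\<close>

lemma mat_exp_intertwine:
  assumes A: "A \<in> carrier_mat n n" and C: "C \<in> carrier_mat m m" and B: "B \<in> carrier_mat n m"
    and AB: "A * B = B * C"
  shows "mat_exp A * B = B * mat_exp C"
proof (rule eq_matI)
  have pow: "A ^\<^sub>m k * B = B * C ^\<^sub>m k" for k
  proof (induct k)
    case 0 show ?case using A B C by simp
  next
    case (Suc k)
    have "A ^\<^sub>m Suc k * B = A ^\<^sub>m k * (A * B)"
      using assoc_mult_mat[OF pow_carrier_mat[OF A] A B] by simp
    also have "\<dots> = A ^\<^sub>m k * B * C" unfolding AB using assoc_mult_mat[OF pow_carrier_mat[OF A] B C] by simp
    also have "\<dots> = B * C ^\<^sub>m Suc k" unfolding Suc using assoc_mult_mat[OF B pow_carrier_mat[OF C] C] by simp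
    finally show ?case .
  qed
  fix i j assume "i < dim_row (B * mat_exp C)" "j < dim_col (B * mat_exp C)"
  hence i: "i < n" and j: "j < m" using B C by (auto simp: mat_exp_def)
  have eA: "mat_exp A \<in> carrier_mat n n" and eC: "mat_exp C \<in> carrier_mat m m" using A C by auto
  have "(mat_exp A * B) $$ (i,j) = (\<Sum>l<n. (\<Sum>k. (A ^\<^sub>m k) $$ (i,l) / fact k) * B $$ (l,j))"
    unfolding index_mult_sum[OF eA B i j]
    by (intro sum.cong refl arg_cong2[of _ _ _ _ "(*)"] index_mat_exp(1)[OF A i]) simp
  also have "\<dots> = (\<Sum>l<n. (\<Sum>k. (A ^\<^sub>m k) $$ (i,l) / fact k * B $$ (l,j)))"
    by (intro sum.cong refl suminf_mult2 index_mat_exp(2)[OF A i]) simp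
  also have "\<dots> = (\<Sum>k. \<Sum>l<n. (A ^\<^sub>m k) $$ (i,l) / fact k * B $$ (l,j))"
    by (rule suminf_sum[symmetric]) (intro summable_mult2 index_mat_exp(2)[OF A i], simp)
  also have "\<dots> = (\<Sum>k. (A ^\<^sub>m k * B) $$ (i,j) / fact k)"
    unfolding index_mult_sum[OF pow_carrier_mat[OF A] B i j] by (simp add: sum_divide_distrib)
  also have "\<dots> = (\<Sum>k. \<Sum>l<m. B $$ (i,l) * ((C ^\<^sub>m k) $$ (l,j) / fact k))"
    unfolding pow index_mult_sum[OF B pow_carrier_mat[OF C] i j] by (simp add: sum_divide_distrib)
  also have "\<dots> = (\<Sum>l<m. (\<Sum>k. B $$ (i,l) * ((C ^\<^sub>m k) $$ (l,j) / fact k)))"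
    by (rule suminf_sum) (rule summable_mult, rule index_mat_exp(2)[OF C _ j], simp)
  also have "\<dots> = (\<Sum>l<m. B $$ (i,l) * (\<Sum>k. (C ^\<^sub>m k) $$ (l,j) / fact k))"
    by (intro sum.cong refl suminf_mult index_mat_exp(2)[OF C _ j]) simp
  also have "\<dots> = (B * mat_exp C) $$ (i,j)"
    unfolding index_mult_sum[OF B eC i j]
    by (intro sum.cong refl arg_cong2[of _ _ _ _ "(*)"] index_mat_exp(1)[OF C _ j, symmetric]) simp
  finally show "(mat_exp A * B) $$ (i,j) = (B * mat_exp C) $$ (i,j)" .
qed (use A B C in \<open>auto simp: mat_exp_def\<close>)

lemma mat_exp_adjoint:
  assumes A: "A \<in> carrier_mat n n" shows "mat_adjoint (mat_exp A) = mat_exp (mat_adjoint A)"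
proof (rule eq_matI)
  fix i j assume "i < dim_row (mat_exp (mat_adjoint A))" "j < dim_col (mat_exp (mat_adjoint A))"
  hence ij: "i < n" "j < n" using A by (auto simp: mat_exp_def)
  have A': "mat_adjoint A \<in> carrier_mat n n" using A by simp
  have d: "dim_row (A ^\<^sub>m k) = n" "dim_col (A ^\<^sub>m k) = n" for k using A by auto
  have "mat_exp A \<in> carrier_mat n n" using A by simp
  hence "mat_adjoint (mat_exp A) $$ (i,j) = cnj (mat_exp A $$ (j,i))" using ij by auto
  also have "\<dots> = (\<Sum>k. cnj ((A ^\<^sub>m k) $$ (j,i) / fact k))"
    unfolding index_mat_exp(1)[OF A ij(2,1)]
    by (rule bounded_linear.suminf[OF bounded_linear_cnj index_mat_exp(2)[OF A ij(2,1)]])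
  also have "\<dots> = mat_exp (mat_adjoint A) $$ (i,j)"
    unfolding index_mat_exp(1)[OF A' ij] pow_mat_adjoint[OF A, symmetric] using ij d by simp
  finally show "mat_adjoint (mat_exp A) $$ (i,j) = mat_exp (mat_adjoint A) $$ (i,j)" .
qed (auto simp: mat_exp_def)

lemma mat_exp_zero: "mat_exp (0 \<cdot>\<^sub>m A) = 1\<^sub>m n" if "A \<in> carrier_mat n n"
proof (rule eq_matI)
  fix i j assume "i < dim_row (1\<^sub>m n :: complex mat)" "j < dim_col (1\<^sub>m n :: complex mat)"
  hence ij: "i < n" "j < n" by auto
  have "mat_exp (0 \<cdot>\<^sub>m A) $$ (i,j) = (A ^\<^sub>m 0) $$ (i,j) / fact 0"
    unfolding index_mat_exp_smult[OF that ij] by (rule powser_zero)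
  thus "mat_exp (0 \<cdot>\<^sub>m A) $$ (i,j) = 1\<^sub>m n $$ (i,j)" using that by simp
qed (use that in \<open>auto simp: mat_exp_def\<close>)

section \<open>Differential and functional equations of the exponential\<close>

lemma complex_deriv_zero_const:
  assumes "\<And>z. (f has_field_derivative 0) (at z)"
  shows "f z = (f 0 :: complex)"
proof -
  have "((\<lambda>w. f (w * z)) has_field_derivative 0) (at w)" for w
  proof -
    have "((\<lambda>w. w * z) has_field_derivative z) (at w)" by (auto intro!: derivative_eq_intros)
    from DERIV_chain2[OF assms this] show ?thesis by simp
  qed
  hence v: "((\<lambda>t. f (of_real t * z)) has_vector_derivative 0) (at t)" for t :: real
    by (rule has_vector_derivative_real_field)
  have "((\<lambda>t. Re (f (of_real t * z))) has_real_derivative 0) (at t)"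
    and "((\<lambda>t. Im (f (of_real t * z))) has_real_derivative 0) (at t)" for t :: real
    using bounded_linear.has_vector_derivative[OF bounded_linear_Re v[of t]]
      bounded_linear.has_vector_derivative[OF bounded_linear_Im v[of t]]
    by (simp_all add: has_real_derivative_iff_has_vector_derivative)
  from DERIV_isconst_all[of "\<lambda>t. Re (f (of_real t * z))" 1 0] DERIV_isconst_all[of "\<lambda>t. Im (f (of_real t * z))" 1 0] this
  show ?thesis by (simp add: complex_eq_iff)
qed

lemma mat_exp_has_derivative:
  assumes A: "A \<in> carrier_mat n n" and i: "i < n" and j: "j < n"
  shows "((\<lambda>z. mat_exp (z \<cdot>\<^sub>m A) $$ (i,j)) has_field_derivative (mat_exp (z \<cdot>\<^sub>m A) * A) $$ (i,j)) (at z)"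
proof -
  let ?c = "\<lambda>k. (A ^\<^sub>m k) $$ (i,j) / fact k"
  have eA: "mat_exp (z \<cdot>\<^sub>m A) \<in> carrier_mat n n" using A by simp
  have "diffs ?c k * z ^ k = (\<Sum>l<n. ((A ^\<^sub>m k) $$ (i,l) / fact k * z ^ k) * A $$ (l,j))" for k
  proof -
    have "diffs ?c k = (A ^\<^sub>m Suc k) $$ (i,j) / fact k"
      unfolding diffs_def by (simp add: divide_simps del: of_nat_Suc)
    also have "(A ^\<^sub>m Suc k) $$ (i,j) = (\<Sum>l<n. (A ^\<^sub>m k) $$ (i,l) * A $$ (l,j))"
      using index_mult_sum[OF pow_carrier_mat[OF A] A i j] by simp
    finally show ?thesis by (simp add: sum_divide_distrib sum_distrib_left sum_distrib_right mult_ac)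
  qed
  hence "(\<Sum>k. diffs ?c k * z ^ k) = (\<Sum>k. \<Sum>l<n. ((A ^\<^sub>m k) $$ (i,l) / fact k * z ^ k) * A $$ (l,j))" by simp
  also have "\<dots> = (\<Sum>l<n. (\<Sum>k. (A ^\<^sub>m k) $$ (i,l) / fact k * z ^ k * A $$ (l,j)))"
    by (rule suminf_sum) (intro summable_mult2 summable_mat_exp[OF A i], simp)
  also have "\<dots> = (\<Sum>l<n. (\<Sum>k. (A ^\<^sub>m k) $$ (i,l) / fact k * z ^ k) * A $$ (l,j))"
    by (intro sum.cong refl suminf_mult2[symmetric] summable_mat_exp[OF A i]) simp
  also have "\<dots> = (mat_exp (z \<cdot>\<^sub>m A) * A) $$ (i,j)"
    unfolding index_mult_sum[OF eA A i j]
    by (intro sum.cong refl arg_cong2[of _ _ _ _ "(*)"] index_mat_exp_smult[OF A i, symmetric]) simp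
  finally show ?thesis
    using termdiffs_strong_converges_everywhere[of ?c z, OF summable_mat_exp[OF A i j]]
    by (simp add: index_mat_exp_smult[OF A i j])
qed

text \<open>Multiplying a solution by \<open>exp (- z A)\<close> makes it constant.\<close>

lemma mat_exp_unique:
  assumes A: "A \<in> carrier_mat n n" and Y: "\<And>z. Y z \<in> carrier_mat m n"
    and dY: "\<And>z i j. i < m \<Longrightarrow> j < n \<Longrightarrow> ((\<lambda>z. Y z $$ (i,j)) has_field_derivative (Y z * A) $$ (i,j)) (at z)"
  shows "Y z = Y 0 * mat_exp (z \<cdot>\<^sub>m A)"
proof -
  \<comment> \<open>Stated for an arbitrary solution because it serves twice: for the exponential
    itself, which makes \<open>exp (- z A)\<close> its inverse, and for \<open>Y\<close>.\<close>
  have const: "Z w * mat_exp (w \<cdot>\<^sub>m (- 1 \<cdot>\<^sub>m A)) = Z 0"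
    if Z: "\<And>z. Z z \<in> carrier_mat m n"
      and dZ: "\<And>z i j. i < m \<Longrightarrow> j < n \<Longrightarrow> ((\<lambda>z. Z z $$ (i,j)) has_field_derivative (Z z * A) $$ (i,j)) (at z)"
    for Z w m
  proof -
    let ?E = "\<lambda>z. mat_exp (z \<cdot>\<^sub>m (- 1 \<cdot>\<^sub>m A))"
    have E: "?E z \<in> carrier_mat n n" for z using A by simp
    have dE: "dim_row (?E z) = n" "dim_col (?E z) = n" for z using E[of z] by auto
    have mA: "- 1 \<cdot>\<^sub>m A \<in> carrier_mat n n" using A by simp
    have comm: "?E z * (- 1 \<cdot>\<^sub>m A) = - 1 \<cdot>\<^sub>m (A * ?E z)" for z
    proof -
      have "z \<cdot>\<^sub>m (- 1 \<cdot>\<^sub>m A) * A = A * (z \<cdot>\<^sub>m (- 1 \<cdot>\<^sub>m A))"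
        by (rule eq_matI) (use A in \<open>auto simp: scalar_prod_def mult_ac\<close>)
      from mat_exp_intertwine[OF _ _ A this] A have "?E z * A = A * ?E z" by simp
      thus ?thesis using A by (metis mult_smult_distrib E)
    qed
    have "(Z w * ?E w) $$ (i,j) = (Z 0 * ?E 0) $$ (i,j)" if ij: "i < m" "j < n" for i j
    proof -
      have "((\<lambda>z. (Z z * ?E z) $$ (i,j)) has_field_derivative 0) (at z)" for z
      proof -
        have "((\<lambda>z. \<Sum>l<n. Z z $$ (i,l) * ?E z $$ (l,j)) has_field_derivative
            (\<Sum>l<n. Z z $$ (i,l) * (?E z * (- 1 \<cdot>\<^sub>m A)) $$ (l,j) + (Z z * A) $$ (i,l) * ?E z $$ (l,j))) (at z)"
          by (intro DERIV_sum DERIV_mult' dZ mat_exp_has_derivative[OF mA]) (use ij in auto)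
        also have "(\<Sum>l<n. Z z $$ (i,l) * (?E z * (- 1 \<cdot>\<^sub>m A)) $$ (l,j) + (Z z * A) $$ (i,l) * ?E z $$ (l,j))
          = - (Z z * (A * ?E z)) $$ (i,j) + (Z z * A * ?E z) $$ (i,j)"
          unfolding comm index_mult_sum[OF Z mult_carrier_mat[OF A E] ij]
            index_mult_sum[OF mult_carrier_mat[OF Z A] E ij] sum.distrib sum_negf[symmetric]
          using A dE ij by (intro arg_cong2[of _ _ _ _ "(+)"] sum.cong refl) auto
        also have "\<dots> = 0" using assoc_mult_mat[OF Z A E] by simp
        finally show ?thesis unfolding index_mult_sum[OF Z E ij] .
      qed
      from complex_deriv_zero_const[of "\<lambda>z. (Z z * ?E z) $$ (i,j)", OF this]
      show ?thesis .
    qed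
    hence "Z w * ?E w = Z 0 * ?E 0" by (intro eq_matI) (use Z[of w] Z[of 0] E[of w] E[of 0] in \<open>auto simp del: index_mult_mat(1)\<close>)
    thus ?thesis unfolding mat_exp_zero[OF mA] using right_mult_one_mat[OF Z] by simp
  qed
  let ?F = "mat_exp (z \<cdot>\<^sub>m A)" and ?E = "mat_exp (z \<cdot>\<^sub>m (- 1 \<cdot>\<^sub>m A))"
  have F: "?F \<in> carrier_mat n n" and E: "?E \<in> carrier_mat n n" using A by auto
  have "?F * ?E = 1\<^sub>m n"
    using const[of "\<lambda>z. mat_exp (z \<cdot>\<^sub>m A)" n z] mat_exp_has_derivative[OF A] A mat_exp_zero[OF A] by simp
  hence EF: "?E * ?F = 1\<^sub>m n" by (rule mat_mult_left_right_inverse[OF F E])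
  have c: "Y z * ?E = Y 0" by (rule const[OF Y dY])
  have "Y z = Y z * (?E * ?F)" unfolding EF by (rule right_mult_one_mat[OF Y, symmetric])
  also have "\<dots> = Y 0 * ?F" unfolding assoc_mult_mat[OF Y E F, symmetric] c ..
  finally show ?thesis .
qed

lemma mat_exp_add:
  assumes A: "A \<in> carrier_mat n n"
  shows "mat_exp ((w + z) \<cdot>\<^sub>m A) = mat_exp (w \<cdot>\<^sub>m A) * mat_exp (z \<cdot>\<^sub>m A)"
proof -
  have "((\<lambda>z. mat_exp ((w + z) \<cdot>\<^sub>m A) $$ (i,j)) has_field_derivative (mat_exp ((w + z) \<cdot>\<^sub>m A) * A) $$ (i,j)) (at z)"
    if "i < n" "j < n" for i j z
  proof -
    have "((\<lambda>z. w + z) has_field_derivative 1) (at z)" by (auto intro!: derivative_eq_intros)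
    from DERIV_chain2[OF mat_exp_has_derivative[OF A that] this] show ?thesis by simp
  qed
  from mat_exp_unique[OF A _ this, of n z] A show ?thesis by simp
qed

text \<open>Both sides are time-one values of the same linear differential equation. This
  exponentiates a ladder relation \<open>X B = B (f + X)\<close> to a scalar factor
  \<open>exp f\<close>.\<close>

lemma mat_exp_scalar_add:
  assumes A: "A \<in> carrier_mat n n"
  shows "mat_exp (\<mu> \<cdot>\<^sub>m 1\<^sub>m n + A) = exp \<mu> \<cdot>\<^sub>m mat_exp A"
proof -
  let ?B = "\<mu> \<cdot>\<^sub>m 1\<^sub>m n + A" and ?Y = "\<lambda>z. exp (\<mu> * z) \<cdot>\<^sub>m mat_exp (z \<cdot>\<^sub>m A)"
  have B: "?B \<in> carrier_mat n n" using A by simp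
  have Y: "?Y z \<in> carrier_mat n n" for z using A by simp
  have "((\<lambda>z. ?Y z $$ (i,j)) has_field_derivative (?Y z * ?B) $$ (i,j)) (at z)" if ij: "i < n" "j < n" for i j z
  proof -
    have E: "mat_exp (z \<cdot>\<^sub>m A) \<in> carrier_mat n n" for z using A by simp
    have d: "dim_row (mat_exp (z \<cdot>\<^sub>m A)) = n" "dim_col (mat_exp (z \<cdot>\<^sub>m A)) = n" for z using E[of z] by auto
    have "((\<lambda>z. exp (\<mu> * z) * mat_exp (z \<cdot>\<^sub>m A) $$ (i,j)) has_field_derivative
       exp (\<mu> * z) * (mat_exp (z \<cdot>\<^sub>m A) * A) $$ (i,j) + \<mu> * exp (\<mu> * z) * mat_exp (z \<cdot>\<^sub>m A) $$ (i,j)) (at z)"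
      by (rule DERIV_mult'[OF _ mat_exp_has_derivative[OF A ij]]) (auto intro!: derivative_eq_intros)
    also have "exp (\<mu> * z) * (mat_exp (z \<cdot>\<^sub>m A) * A) $$ (i,j) + \<mu> * exp (\<mu> * z) * mat_exp (z \<cdot>\<^sub>m A) $$ (i,j)
       = (?Y z * ?B) $$ (i,j)"
    proof -
      have "?Y z * ?B = exp (\<mu> * z) \<cdot>\<^sub>m (mat_exp (z \<cdot>\<^sub>m A) * ?B)"
        using mult_smult_assoc_mat[OF E B] by simp
      also have "mat_exp (z \<cdot>\<^sub>m A) * ?B = \<mu> \<cdot>\<^sub>m mat_exp (z \<cdot>\<^sub>m A) + mat_exp (z \<cdot>\<^sub>m A) * A"
      proof -
        have "mat_exp (z \<cdot>\<^sub>m A) * (\<mu> \<cdot>\<^sub>m 1\<^sub>m n) = \<mu> \<cdot>\<^sub>m mat_exp (z \<cdot>\<^sub>m A)"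
          using mult_smult_distrib[OF E one_carrier_mat] right_mult_one_mat[OF E] by simp
        thus ?thesis using mult_add_distrib_mat[OF E _ A, of "\<mu> \<cdot>\<^sub>m 1\<^sub>m n"] by simp
      qed
      finally show ?thesis using ij d A by (simp add: algebra_simps)
    qed
    finally show ?thesis using ij d by simp
  qed
  from mat_exp_unique[OF B Y this, of 1] show ?thesis
    using A mat_exp_zero[OF A] by simp
qed

lemma mat_exp_inverse:
  assumes A: "A \<in> carrier_mat n n" shows "mat_exp A * mat_exp (- 1 \<cdot>\<^sub>m A) = 1\<^sub>m n"
  using mat_exp_add[OF A, of 1 "-1"] mat_exp_zero[OF A] by simp

lemma mat_exp_1x1: "mat_exp (mat 1 1 (\<lambda>_. \<mu>)) = mat 1 1 (\<lambda>_. exp \<mu>)"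
proof -
  have z: "mat 1 1 (\<lambda>_. \<mu>) = \<mu> \<cdot>\<^sub>m 1\<^sub>m 1 + 0 \<cdot>\<^sub>m 1\<^sub>m 1" by (rule eq_matI) auto
  have "mat_exp (mat 1 1 (\<lambda>_. \<mu>)) = exp \<mu> \<cdot>\<^sub>m mat_exp (0 \<cdot>\<^sub>m 1\<^sub>m 1)"
    unfolding z by (rule mat_exp_scalar_add) simp
  thus ?thesis by (auto simp: mat_exp_zero[of _ 1])
qed

lemma mat_exp_left_eigen:
  assumes A: "A \<in> carrier_mat n n" and u: "\<And>j. j < n \<Longrightarrow> (\<Sum>i<n. u i * A $$ (i,j)) = \<mu> * u j" and j: "j < n"
  shows "(\<Sum>i<n. u i * mat_exp A $$ (i,j)) = exp \<mu> * u j"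
proof -
  let ?U = "mat 1 n (\<lambda>(_, i). u i)" and ?L = "mat 1 1 (\<lambda>_. \<mu>)"
  have U: "?U \<in> carrier_mat 1 n" by simp
  have L: "?L \<in> carrier_mat 1 1" and eL: "mat 1 1 (\<lambda>_. exp \<mu>) \<in> carrier_mat 1 1" by auto
  have eA: "mat_exp A \<in> carrier_mat n n" using A by simp
  have "?L * ?U = ?U * A"
  proof (rule eq_matI)
    fix i k assume "i < dim_row (?U * A)" "k < dim_col (?U * A)"
    hence "i = 0" "k < n" using A by auto
    thus "(?L * ?U) $$ (i,k) = (?U * A) $$ (i,k)"
      using index_mult_sum[OF L U, of i k] index_mult_sum[OF U A, of i k] u[of k] by simp
  qed (use A in auto)
  from mat_exp_intertwine[OF L A U this, unfolded mat_exp_1x1] have "(mat 1 1 (\<lambda>_. exp \<mu>) * ?U) $$ (0,j) = (?U * mat_exp A) $$ (0,j)"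
    by (rule arg_cong)
  thus ?thesis using index_mult_sum[OF eL U, of 0 j] index_mult_sum[OF U eA, of 0 j] j by simp
qed

lemma mat_exp_kernel:
  assumes A: "A \<in> carrier_mat n n" and v: "v \<in> carrier_vec n" "A *\<^sub>v v = 0\<^sub>v n"
  shows "mat_exp A *\<^sub>v v = v"
proof -
  let ?V = "mat n 1 (\<lambda>(i,_). v $ i)" and ?L = "mat 1 1 (\<lambda>_. 0)"
  have V: "?V \<in> carrier_mat n 1" by simp
  have L: "?L \<in> carrier_mat 1 1" and eL: "mat 1 1 (\<lambda>_. exp 0) \<in> carrier_mat 1 1" by auto
  have eA: "mat_exp A \<in> carrier_mat n n" using A by simp
  have "A * ?V = ?V * ?L"
  proof (rule eq_matI)
    fix i k assume "i < dim_row (?V * ?L)" "k < dim_col (?V * ?L)"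
    hence ik: "i < n" "k < 1" using A by auto
    have "(A *\<^sub>v v) $ i = 0" using v(2) ik by simp
    thus "(A * ?V) $$ (i,k) = (?V * ?L) $$ (i,k)"
      unfolding index_mult_sum[OF A V ik] index_mult_sum[OF V L ik]
        index_mult_vec_sum[OF A v(1) ik(1)] using ik by simp
  qed (use A in auto)
  note eq = mat_exp_intertwine[OF A L V this, unfolded mat_exp_1x1]
  show ?thesis
  proof (rule eq_vecI)
    fix i assume "i < dim_vec v"
    hence i: "i < n" using v by simp
    show "(mat_exp A *\<^sub>v v) $ i = v $ i"
      using arg_cong[OF eq, of "\<lambda>M. M $$ (i,0)"] index_mult_sum[OF eA V i, of 0] index_mult_sum[OF V eL i, of 0]
        index_mult_vec_sum[OF eA v(1) i] i by simp
  qed (use A v in \<open>auto simp: mat_exp_def\<close>)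
qed

text \<open>A Gronwall estimate for the squared modulus: its derivative is at most
  \<open>- \<delta> |y|^2 + |g|^2 / \<delta>\<close> with \<open>\<delta> = - Re \<mu>\<close>, and
  the last term tends to zero.\<close>

lemma linear_ode_decay:
  fixes y g :: "real \<Rightarrow> complex"
  assumes dy: "\<And>t. (y has_vector_derivative \<mu> * y t + g t) (at t)"
    and g: "(g \<longlongrightarrow> 0) at_top" and mu: "Re \<mu> < 0"
  shows "(y \<longlongrightarrow> 0) at_top"
proof -
  define \<delta> where "\<delta> = - Re \<mu>"
  have d: "\<delta> > 0" using mu by (simp add: \<delta>_def)
  define \<phi> where "\<phi> t = (Re (y t))\<^sup>2 + (Im (y t))\<^sup>2" for t
  define \<phi>' where "\<phi>' t = 2 * Re (cnj (y t) * (\<mu> * y t + g t))" for t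
  have dphi: "(\<phi> has_real_derivative \<phi>' t) (at t)" for t
  proof -
    have "((\<lambda>t. Re (y t)) has_real_derivative Re (\<mu> * y t + g t)) (at t)"
      and "((\<lambda>t. Im (y t)) has_real_derivative Im (\<mu> * y t + g t)) (at t)"
      unfolding has_real_derivative_iff_has_vector_derivative
      by (rule bounded_linear.has_vector_derivative[OF bounded_linear_Re dy]
        bounded_linear.has_vector_derivative[OF bounded_linear_Im dy])+
    from DERIV_cong[OF DERIV_add[OF DERIV_power[OF this(1), of 2] DERIV_power[OF this(2), of 2]], of "\<phi>' t"]
    show ?thesis unfolding \<phi>_def \<phi>'_def by (simp add: algebra_simps)
  qed
  have bound: "\<phi>' t \<le> - \<delta> * \<phi> t + (cmod (g t))\<^sup>2 / \<delta>" for t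
  proof -
    have phi: "\<phi> t = (cmod (y t))\<^sup>2" by (simp add: \<phi>_def cmod_power2)
    have 1: "Re (cnj (y t) * (\<mu> * y t)) = Re \<mu> * (cmod (y t))\<^sup>2"
      unfolding cmod_power2 by (simp add: algebra_simps power2_eq_square)
    have 2: "2 * Re (cnj (y t) * g t) \<le> 2 * (cmod (y t) * cmod (g t))"
      using complex_Re_le_cmod[of "cnj (y t) * g t"] by (simp add: norm_mult)
    \<comment> \<open>Young's inequality with weight \<open>\<delta>\<close> spends half of the
      available decay rate \<open>2 \<delta>\<close> on the cross term.\<close>
    have "0 \<le> (\<delta> * cmod (y t) - cmod (g t))\<^sup>2 / \<delta>" using d by simp
    also have "\<dots> = \<delta> * (cmod (y t))\<^sup>2 - 2 * (cmod (y t) * cmod (g t)) + (cmod (g t))\<^sup>2 / \<delta>"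
      using d by (simp add: power2_diff power2_eq_square divide_simps algebra_simps)
    finally have 3: "2 * (cmod (y t) * cmod (g t)) \<le> \<delta> * (cmod (y t))\<^sup>2 + (cmod (g t))\<^sup>2 / \<delta>" by simp
    have "\<phi>' t = 2 * (Re \<mu> * (cmod (y t))\<^sup>2) + 2 * Re (cnj (y t) * g t)"
      unfolding \<phi>'_def 1[symmetric] by (simp add: algebra_simps)
    also have "\<dots> \<le> 2 * (Re \<mu> * (cmod (y t))\<^sup>2) + (\<delta> * (cmod (y t))\<^sup>2 + (cmod (g t))\<^sup>2 / \<delta>)" using 2 3 by linarith
    finally show ?thesis by (simp add: phi \<delta>_def algebra_simps)
  qed
  have "(\<phi> \<longlongrightarrow> 0) at_top"
  proof (rule tendstoI)
    fix e :: real assume e: "0 < e"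
    have "((\<lambda>t. (cmod (g t))\<^sup>2 / \<delta>) \<longlongrightarrow> (cmod 0)\<^sup>2 / \<delta>) at_top" by (intro tendsto_intros g) (use d in auto)
    hence "\<forall>\<^sub>F t in at_top. (cmod (g t))\<^sup>2 / \<delta> < \<delta> * (e/2)" using d e by (intro order_tendstoD(2)) auto
    then obtain T where T: "\<And>t. t \<ge> T \<Longrightarrow> (cmod (g t))\<^sup>2 / \<delta> < \<delta> * (e/2)"
      unfolding eventually_at_top_linorder by auto
    \<comment> \<open>Beyond \<open>T\<close> the excess of \<open>\<phi>\<close> over
      \<open>e/2\<close>, times the integrating factor, cannot increase, so \<open>\<phi>\<close>
      eventually stays below \<open>e\<close>.\<close>
    define \<psi> where "\<psi> t = (\<phi> t - e/2) * exp (\<delta> * t)" for t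
    have psi: "\<psi> t \<le> \<psi> T" if "t \<ge> T" for t
    proof (rule DERIV_nonpos_imp_nonincreasing[OF that])
      fix x assume x: "T \<le> x" "x \<le> t"
      have "(\<psi> has_real_derivative (\<phi>' x + \<delta> * (\<phi> x - e/2)) * exp (\<delta> * x)) (at x)"
        unfolding \<psi>_def by (rule derivative_eq_intros dphi refl | simp add: algebra_simps)+
      moreover have "\<phi>' x + \<delta> * (\<phi> x - e/2) \<le> 0"
        using bound[of x] T[OF x(1)] by (simp add: algebra_simps)
      ultimately show "\<exists>y. (\<psi> has_real_derivative y) (at x) \<and> y \<le> 0"
        by (meson exp_ge_zero mult_nonpos_nonneg)
    qed
    have "((\<lambda>t. \<psi> T * exp (- (\<delta> * t))) \<longlongrightarrow> \<psi> T * 0) at_top"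
    proof (intro tendsto_mult tendsto_const filterlim_compose[OF exp_at_bot])
      show "filterlim (\<lambda>t. - (\<delta> * t)) at_bot at_top"
        unfolding filterlim_uminus_at_bot using d by (simp add: filterlim_tendsto_pos_mult_at_top[OF tendsto_const _ filterlim_ident])
    qed
    hence "\<forall>\<^sub>F t in at_top. \<psi> T * exp (- (\<delta> * t)) < e/2" using e by (intro order_tendstoD(2)) auto
    moreover have "\<forall>\<^sub>F t in at_top. t \<ge> T" by (rule eventually_ge_at_top)
    ultimately show "\<forall>\<^sub>F t in at_top. dist (\<phi> t) 0 < e"
    proof eventually_elim
      case (elim t)
      have "\<phi> t = e/2 + \<psi> t * exp (- (\<delta> * t))" by (simp add: \<psi>_def exp_minus field_simps)
      also have "\<dots> \<le> e/2 + \<psi> T * exp (- (\<delta> * t))" using psi[OF elim(2)] by (simp add: mult_right_mono)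
      finally have "\<phi> t < e" using elim(1) by simp
      moreover have "\<phi> t \<ge> 0" by (simp add: \<phi>_def)
      ultimately show ?case by simp
    qed
  qed
  hence "((\<lambda>t. sqrt (\<phi> t)) \<longlongrightarrow> sqrt 0) at_top" by (rule tendsto_real_sqrt)
  hence "((\<lambda>t. cmod (y t)) \<longlongrightarrow> 0) at_top" by (simp add: \<phi>_def cmod_def)
  thus ?thesis by (rule tendsto_norm_zero_cancel)
qed

text \<open>Back substitution: the components are treated from the last to the first, those already
  known to decay acting as the forcing term \<open>g\<close>.\<close>

lemma upper_triangular_ode_decay:
  fixes y :: "nat \<Rightarrow> real \<Rightarrow> complex"
  assumes up: "\<And>i j. j < i \<Longrightarrow> i < n \<Longrightarrow> B i j = 0" and neg: "\<And>i. i < n \<Longrightarrow> Re (B i i) < 0"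
    and dy: "\<And>i t. i < n \<Longrightarrow> (y i has_vector_derivative (\<Sum>j<n. B i j * y j t)) (at t)"
    and i: "i < n"
  shows "(y i \<longlongrightarrow> 0) at_top"
  using i
proof (induct "n - i" arbitrary: i rule: less_induct)
  case less
  define g where "g t = (\<Sum>j\<in>{i<..<n}. B i j * y j t)" for t
  have "(\<Sum>j<n. B i j * y j t) = B i i * y i t + g t" for t
  proof -
    have "(\<Sum>j<n. B i j * y j t) = (\<Sum>j\<in>insert i {i<..<n}. B i j * y j t)"
      by (rule sum.mono_neutral_right) (use less.prems up in auto)
    thus ?thesis by (simp add: g_def)
  qed
  with dy[OF less.prems] have "(y i has_vector_derivative B i i * y i t + g t) (at t)" for t by simp
  moreover have "(g \<longlongrightarrow> (\<Sum>j\<in>{i<..<n}. B i j * 0)) at_top"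
    unfolding g_def by (intro tendsto_sum tendsto_mult tendsto_const less.hyps) auto
  hence "(g \<longlongrightarrow> 0) at_top" by simp
  ultimately show ?case using neg[OF less.prems] by (rule linear_ode_decay)
qed

lemma triangularize:
  assumes A: "(A :: complex mat) \<in> carrier_mat n n"
  obtains B P Q where "similar_mat_wit A B P Q" "upper_triangular B" "B \<in> carrier_mat n n"
    "\<And>i. i < n \<Longrightarrow> eigenvalue A (B $$ (i,i))"
proof -
  from char_poly_factorized[OF A] obtain es where es: "char_poly A = (\<Prod>a\<leftarrow>es. [:- a, 1:])" by auto
  obtain B P Q where B: "schur_decomposition A es = (B,P,Q)" by (cases "schur_decomposition A es") auto
  from schur_decomposition[OF A es B]
  have w: "similar_mat_wit A B P Q" and u: "upper_triangular B" and d: "diag_mat B = es" by auto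
  from similar_mat_witD2[OF A w] have Bc: "B \<in> carrier_mat n n" by auto
  have "eigenvalue A (B $$ (i,i))" if "i < n" for i
  proof -
    have "B $$ (i,i) \<in> set es" unfolding d[symmetric] diag_mat_def using that Bc by auto
    thus ?thesis unfolding eigenvalue_root_char_poly[OF A] es by (simp add: poly_prod_list prod_list_zero_iff)
  qed
  with w u Bc show ?thesis by (rule that)
qed

text \<open>In the Schur basis every column of the exponential solves a triangular system with the
  eigenvalues of \<open>A\<close> on the diagonal.\<close>

lemma hurwitz_mat_exp_tendsto_0:
  assumes A: "A \<in> carrier_mat n n" and ev: "\<And>\<mu>. eigenvalue A \<mu> \<Longrightarrow> Re \<mu> < 0" and i: "i < n" and j: "j < n"
  shows "((\<lambda>t. mat_exp (of_real t \<cdot>\<^sub>m A) $$ (i,j)) \<longlongrightarrow> 0) at_top"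
proof -
  from triangularize[OF A] obtain B P Q where w: "similar_mat_wit A B P Q" and u: "upper_triangular B"
    and B: "B \<in> carrier_mat n n" and e: "\<And>i. i < n \<Longrightarrow> eigenvalue A (B $$ (i,i))" by blast
  from similar_mat_witD2[OF A w] have P: "P \<in> carrier_mat n n" and Q: "Q \<in> carrier_mat n n"
    and PQ: "P * Q = 1\<^sub>m n" "Q * P = 1\<^sub>m n" and APQ: "A = P * B * Q" by auto
  let ?E = "\<lambda>t. mat_exp (of_real t \<cdot>\<^sub>m A)"
  have E: "?E t \<in> carrier_mat n n" for t using A by simp
  have QA: "Q * A = B * Q"
  proof -
    have "Q * A = Q * (P * (B * Q))" unfolding APQ using assoc_mult_mat[OF P B Q] by simp
    also have "\<dots> = (Q * P) * (B * Q)" using assoc_mult_mat[OF Q P mult_carrier_mat[OF B Q]] by simp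
    finally show ?thesis unfolding PQ using B Q by simp
  qed
  have comm: "?E t * A = A * ?E t" for t
  proof -
    have tA: "of_real t \<cdot>\<^sub>m A \<in> carrier_mat n n" using A by simp
    show ?thesis
      by (rule mat_exp_intertwine[OF tA tA A]) (simp add: mult_smult_distrib[OF A A] mult_smult_assoc_mat[OF A A])
  qed
  let ?y = "\<lambda>k t. (Q * ?E t) $$ (k,j)"
  have y0: "(?y k \<longlongrightarrow> 0) at_top" if "k < n" for k
  proof (rule upper_triangular_ode_decay[OF _ _ _ that, of "\<lambda>i j. B $$ (i,j)" ?y])
    fix k t assume k: "k < n"
    have "Q * (?E t * A) = B * (Q * ?E t)"
      unfolding comm assoc_mult_mat[OF Q A E, symmetric] QA using assoc_mult_mat[OF B Q E] by simp
    hence "(\<Sum>l<n. B $$ (k,l) * ?y l t) = (Q * (?E t * A)) $$ (k,j)"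
      using index_mult_sum[OF B mult_carrier_mat[OF Q E] k j] by simp
    also have "\<dots> = (\<Sum>l<n. Q $$ (k,l) * (?E t * A) $$ (l,j))"
      by (rule index_mult_sum[OF Q mult_carrier_mat[OF E A] k j])
    finally have eq: "(\<Sum>l<n. B $$ (k,l) * ?y l t) = (\<Sum>l<n. Q $$ (k,l) * (?E t * A) $$ (l,j))" .
    have "((\<lambda>t. \<Sum>l<n. Q $$ (k,l) * ?E t $$ (l,j)) has_vector_derivative (\<Sum>l<n. Q $$ (k,l) * (?E t * A) $$ (l,j))) (at t)"
    proof (rule has_vector_derivative_sum)
      fix l assume "l \<in> {..<n}"
      hence l: "l < n" by simp
      show "((\<lambda>t. Q $$ (k,l) * ?E t $$ (l,j)) has_vector_derivative Q $$ (k,l) * (?E t * A) $$ (l,j)) (at t)"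
        by (rule has_vector_derivative_mult_right)
          (rule has_vector_derivative_real_field[OF mat_exp_has_derivative[OF A l j]])
    qed
    moreover have "?y k t = (\<Sum>l<n. Q $$ (k,l) * ?E t $$ (l,j))" for t by (rule index_mult_sum[OF Q E k j])
    ultimately show "(?y k has_vector_derivative (\<Sum>l<n. B $$ (k,l) * ?y l t)) (at t)" unfolding eq by simp
  qed (use u B ev e in auto)
  have "?E t $$ (i,j) = (\<Sum>k<n. P $$ (i,k) * ?y k t)" for t
  proof -
    have "?E t = P * (Q * ?E t)" unfolding assoc_mult_mat[OF P Q E, symmetric] PQ by (rule left_mult_one_mat[OF E, symmetric])
    thus ?thesis using index_mult_sum[OF P mult_carrier_mat[OF Q E] i j, of t] by metis
  qed
  moreover have "((\<lambda>t. \<Sum>k<n. P $$ (i,k) * ?y k t) \<longlongrightarrow> (\<Sum>k<n. P $$ (i,k) * 0)) at_top"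
    by (intro tendsto_sum tendsto_mult tendsto_const y0) auto
  ultimately show ?thesis by simp
qed

section \<open>Tensor products and Majorana operators\<close>

lemma div_mod_less: "i < n * (p::nat) \<Longrightarrow> i div p < n" "i < n * (p::nat) \<Longrightarrow> i mod p < p"
  by (auto simp: less_mult_imp_div_less intro!: mod_less_divisor intro: gr0I)

lemma index_pair_less: "a < m \<Longrightarrow> b < q \<Longrightarrow> a * q + b < m * (q::nat)"
proof -
  assume "a < m" "b < q"
  then have "a * q + b < Suc a * q" by simp
  also have "\<dots> \<le> m * q" by (rule mult_le_mono1) (use \<open>a < m\<close> in simp)
  finally show ?thesis .
qed

lemma sum_div_mod: "(\<Sum>k<m * q. f (k div q) (k mod q)) = (\<Sum>a<m. \<Sum>b<(q::nat). f a b)"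
proof -
  have "(\<Sum>a<m. \<Sum>b<q. f a b) = (\<Sum>(a,b)\<in>{..<m} \<times> {..<q}. f a b)" by (rule sum.cartesian_product)
  also have "\<dots> = (\<Sum>k<m * q. f (k div q) (k mod q))"
    by (rule sum.reindex_bij_witness[of _ "\<lambda>k. (k div q, k mod q)" "\<lambda>(a,b). a * q + b"])
      (auto simp: div_mod_less index_pair_less)
  finally show ?thesis ..
qed

lemma kron_carrier [simp]:
  "A \<in> carrier_mat n m \<Longrightarrow> B \<in> carrier_mat p q \<Longrightarrow> kron A B \<in> carrier_mat (n * p) (m * q)"
  unfolding kron_def by auto

lemma dim_kron [simp]: "dim_row (kron A B) = dim_row A * dim_row B" "dim_col (kron A B) = dim_col A * dim_col B"
  unfolding kron_def by auto

lemma index_kron [simp]: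
  "i < dim_row A * dim_row B \<Longrightarrow> j < dim_col A * dim_col B \<Longrightarrow>
    kron A B $$ (i,j) = A $$ (i div dim_row B, j div dim_col B) * B $$ (i mod dim_row B, j mod dim_col B)"
  unfolding kron_def by simp

lemma kron_mult:
  assumes A: "A \<in> carrier_mat n m" and C: "C \<in> carrier_mat m r" and B: "B \<in> carrier_mat p q" and D: "D \<in> carrier_mat q s"
  shows "kron A B * kron C D = kron (A * C) (B * D)"
proof (rule eq_matI)
  fix i j assume "i < dim_row (kron (A * C) (B * D))" "j < dim_col (kron (A * C) (B * D))"
  hence ij: "i < n * p" "j < r * s" using assms by auto
  note dm = div_mod_less[OF ij(1)] div_mod_less[OF ij(2)]
  have "(kron A B * kron C D) $$ (i,j) = (\<Sum>k<m * q. (A $$ (i div p, k div q) * B $$ (i mod p, k mod q)) * (C $$ (k div q, j div s) * D $$ (k mod q, j mod s)))"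
    unfolding index_mult_sum[OF kron_carrier[OF A B] kron_carrier[OF C D] ij]
    using assms ij by (intro sum.cong refl) auto
  also have "\<dots> = (\<Sum>a<m. \<Sum>b<q. (A $$ (i div p, a) * B $$ (i mod p, b)) * (C $$ (a, j div s) * D $$ (b, j mod s)))"
    by (rule sum_div_mod)
  also have "\<dots> = (A * C) $$ (i div p, j div s) * (B * D) $$ (i mod p, j mod s)"
    unfolding index_mult_sum[OF A C dm(1,3)] index_mult_sum[OF B D dm(2,4)] sum_product by (simp add: mult_ac)
  also have "\<dots> = kron (A * C) (B * D) $$ (i,j)" using assms ij by simp
  finally show "(kron A B * kron C D) $$ (i,j) = kron (A * C) (B * D) $$ (i,j)" .
qed (use assms in auto)

lemma kron_adjoint: "mat_adjoint (kron A B) = kron (mat_adjoint A) (mat_adjoint B)"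
  by (rule eq_matI) (auto simp: div_mod_less)

lemma kron_add_left:
  "A \<in> carrier_mat n m \<Longrightarrow> C \<in> carrier_mat n m \<Longrightarrow> kron (A + C) B = kron A B + kron C B"
  by (rule eq_matI) (auto simp: div_mod_less distrib_right)

lemma kron_add_right:
  "B \<in> carrier_mat n m \<Longrightarrow> C \<in> carrier_mat n m \<Longrightarrow> kron A (B + C) = kron A B + kron A C"
  by (rule eq_matI) (auto simp: div_mod_less distrib_left)

lemma kron_smult_left: "kron (c \<cdot>\<^sub>m A) B = c \<cdot>\<^sub>m kron A B"
  by (rule eq_matI) (auto simp: div_mod_less)

lemma kron_smult_right: "kron A (c \<cdot>\<^sub>m B) = c \<cdot>\<^sub>m kron A B"
  by (rule eq_matI) (auto simp: div_mod_less)

lemma kron_one: "kron (1\<^sub>m n) (1\<^sub>m m) = 1\<^sub>m (n * m)"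
proof (rule eq_matI)
  fix i j assume "i < dim_row (1\<^sub>m (n * m) :: complex mat)" "j < dim_col (1\<^sub>m (n * m) :: complex mat)"
  hence ij: "i < n * m" "j < n * m" by auto
  have "i = j \<longleftrightarrow> i div m = j div m \<and> i mod m = j mod m" by (metis div_mult_mod_eq)
  thus "kron (1\<^sub>m n) (1\<^sub>m m) $$ (i,j) = 1\<^sub>m (n * m) $$ (i,j)" using ij by (auto simp: div_mod_less)
qed auto

lemma kron_one_left [simp]: "kron (1\<^sub>m (Suc 0)) A = A"
  by (rule eq_matI) auto

lemma kron_assoc: "kron (kron A B) C = kron A (kron B C)"
proof (rule eq_matI)
  fix i j assume "i < dim_row (kron A (kron B C))" "j < dim_col (kron A (kron B C))"
  hence ij: "i < (dim_row A * dim_row B) * dim_row C" "j < (dim_col A * dim_col B) * dim_col C" by (auto simp: mult.assoc)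
  have d: "i div (b * c) = i div c div b" for i b c :: nat by (metis div_mult2_eq mult.commute)
  have m: "i mod (b * c) mod c = i mod c" for i b c :: nat by (simp add: mod_mod_cancel)
  have dm: "i mod (b * c) div c = i div c mod b" for i b c :: nat
    by (metis (no_types, lifting) add.commute add.right_neutral div_mult2_eq div_mult_self1_is_m mod_mult2_eq mult.commute mult_0_right
      mod_div_trivial div_mult_self2 gr_zeroI div_by_0 mod_by_0 mult_0)
  have ij': "i < dim_row A * (dim_row B * dim_row C)" "j < dim_col A * (dim_col B * dim_col C)" using ij by (auto simp: mult.assoc)
  show "kron (kron A B) C $$ (i,j) = kron A (kron B C) $$ (i,j)"
    using ij ij' by (simp add: div_mod_less d m dm mult.assoc)
qed (auto simp: mult.assoc)

lemma mtrace_mult_comm: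
  assumes A: "A \<in> carrier_mat n m" and B: "B \<in> carrier_mat m n" shows "mtrace (A * B) = mtrace (B * A)"
proof -
  have "mtrace (A * B) = (\<Sum>i<n. \<Sum>k<m. A $$ (i,k) * B $$ (k,i))"
    unfolding mtrace_def using A B by (intro sum.cong) (auto simp: index_mult_sum[OF A B] simp del: index_mult_mat(1))
  also have "\<dots> = (\<Sum>k<m. \<Sum>i<n. B $$ (k,i) * A $$ (i,k))" by (subst sum.swap) (simp add: mult.commute)
  also have "\<dots> = mtrace (B * A)"
    unfolding mtrace_def using A B by (intro sum.cong) (auto simp: index_mult_sum[OF B A] simp del: index_mult_mat(1))
  finally show ?thesis .
qed

lemma ptrace_kron:
  assumes A: "A \<in> carrier_mat n n" and B: "B \<in> carrier_mat m m"
  shows "ptrace_B n m (kron A B) = mtrace B \<cdot>\<^sub>m A"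
proof (rule eq_matI)
  fix i j assume "i < dim_row (mtrace B \<cdot>\<^sub>m A)" "j < dim_col (mtrace B \<cdot>\<^sub>m A)"
  hence ij: "i < n" "j < n" using A by auto
  have l: "i * m + k < n * m" if "i < n" "k < m" for i k
    using that by (rule index_pair_less)
  have "kron A B $$ (i * m + k, j * m + k) = A $$ (i,j) * B $$ (k,k)" if "k < m" for k
    using l[OF ij(1) that] l[OF ij(2) that] that A B by simp
  thus "ptrace_B n m (kron A B) $$ (i,j) = (mtrace B \<cdot>\<^sub>m A) $$ (i,j)"
    using ij A B by (simp add: ptrace_B_def mtrace_def sum_distrib_left mult.commute)
qed (use A in \<open>auto simp: ptrace_B_def\<close>)

text \<open>\<open>pauli True\<close> and \<open>pauli False\<close> are the Pauli matrices sigma_x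
  and sigma_y; \<open>zpar1\<close> is sigma_z.\<close>

definition pauli :: "bool \<Rightarrow> complex mat" where
  "pauli s = (if s then ann1 + mat_adjoint ann1 else (- \<i>) \<cdot>\<^sub>m (ann1 - mat_adjoint ann1))"

text \<open>The Majorana operators indexed by type \<open>s\<close> and mode \<open>i\<close>. In
  \<open>majorana n k\<close> the second half starts at \<open>k = n\<close>, which moves when a
  mode is split off; with the pair of indices \<open>quadrature_0\<close> and
  \<open>quadrature_Suc\<close> allow induction over modes.\<close>

definition quadrature :: "bool \<Rightarrow> nat \<Rightarrow> nat \<Rightarrow> complex mat" where
  "quadrature s n i = (if s then fock_c n i + mat_adjoint (fock_c n i)
     else (- \<i>) \<cdot>\<^sub>m (fock_c n i - mat_adjoint (fock_c n i)))"

lemma majorana_quadrature: "majorana n k = quadrature (k < n) n (if k < n then k else k - n)"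
  by (simp add: majorana_def quadrature_def)

lemma ann1_carrier [simp]: "ann1 \<in> carrier_mat 2 2" by (simp add: ann1_def)
lemma zpar1_carrier [simp]: "zpar1 \<in> carrier_mat 2 2" by (simp add: zpar1_def)
lemma pauli_carrier [simp]: "pauli s \<in> carrier_mat 2 2" unfolding pauli_def by (auto simp: minus_carrier_mat)

lemma kpow_carrier [simp]: "A \<in> carrier_mat d d \<Longrightarrow> kpow A k \<in> carrier_mat (d ^ k) (d ^ k)"
  by (induct k) auto

lemma fock_c_carrier [simp]: "i < n \<Longrightarrow> fock_c n i \<in> carrier_mat (2 ^ n) (2 ^ n)"
proof -
  assume i: "i < n"
  have "fock_c n i \<in> carrier_mat (2 ^ i * (2 * 2 ^ (n - i - 1))) (2 ^ i * (2 * 2 ^ (n - i - 1)))"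
    unfolding fock_c_def by (intro kron_carrier kpow_carrier) auto
  moreover have "2 ^ i * (2 * 2 ^ (n - i - 1)) = (2 ^ n :: nat)"
  proof -
    have "(2::nat) ^ n = 2 ^ (i + Suc (n - i - 1))" using i by simp
    thus ?thesis by (simp only: power_add power_Suc)
  qed
  ultimately show ?thesis by simp
qed

lemma quadrature_carrier [simp]: "i < n \<Longrightarrow> quadrature s n i \<in> carrier_mat (2 ^ n) (2 ^ n)"
  by (auto simp: quadrature_def minus_carrier_mat)

lemma dims [simp]:
  "dim_row ann1 = 2" "dim_col ann1 = 2" "dim_row zpar1 = 2" "dim_col zpar1 = 2"
  "dim_row (pauli s) = 2" "dim_col (pauli s) = 2"
  "dim_row (kpow zpar1 n) = 2 ^ n" "dim_col (kpow zpar1 n) = 2 ^ n"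
  by (rule carrier_matD[OF ann1_carrier] carrier_matD[OF zpar1_carrier] carrier_matD[OF pauli_carrier]
    carrier_matD[OF kpow_carrier[OF zpar1_carrier]])+

lemma dim_quadrature [simp]:
  "i < n \<Longrightarrow> dim_row (quadrature s n i) = 2 ^ n" "i < n \<Longrightarrow> dim_col (quadrature s n i) = 2 ^ n"
  by (rule carrier_matD[OF quadrature_carrier], assumption)+

lemma majorana_carrier [simp]: "k < 2 * n \<Longrightarrow> majorana n k \<in> carrier_mat (2 ^ n) (2 ^ n)"
  by (auto simp: majorana_quadrature)

lemma zpar1_adjoint [simp]: "mat_adjoint zpar1 = zpar1"
  by (rule eq_matI) (auto simp: zpar1_def)

lemma fock_c_0: "fock_c (Suc n) 0 = kron ann1 (1\<^sub>m (2 ^ n))" by (simp add: fock_c_def)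
lemma fock_c_Suc: "fock_c (Suc n) (Suc i) = kron zpar1 (fock_c n i)" by (simp add: fock_c_def kron_assoc)

lemma kron_diff_left:
  "A \<in> carrier_mat n m \<Longrightarrow> C \<in> carrier_mat n m \<Longrightarrow> kron (A - C) B = kron A B - kron C B"
  by (rule eq_matI) (auto simp: div_mod_less left_diff_distrib)

lemma kron_diff_right:
  "B \<in> carrier_mat n m \<Longrightarrow> C \<in> carrier_mat n m \<Longrightarrow> kron A (B - C) = kron A B - kron A C"
  by (rule eq_matI) (auto simp: div_mod_less right_diff_distrib)

lemma quadrature_0: "quadrature s (Suc n) 0 = kron (pauli s) (1\<^sub>m (2 ^ n))"
  by (simp add: quadrature_def pauli_def fock_c_0 kron_adjoint kron_add_left[of _ 2 2] kron_diff_left[of _ 2 2] kron_smult_left)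

lemma quadrature_Suc: "i < n \<Longrightarrow> quadrature s (Suc n) (Suc i) = kron zpar1 (quadrature s n i)"
  by (simp add: quadrature_def fock_c_Suc kron_adjoint kron_add_right[of _ "2^n" "2^n"] kron_diff_right[of _ "2^n" "2^n"] kron_smult_right)

lemma less_2E: "i < (2::nat) \<Longrightarrow> (i = 0 \<Longrightarrow> P) \<Longrightarrow> (i = 1 \<Longrightarrow> P) \<Longrightarrow> P" by (cases i) auto

lemma mat2_eqI:
  assumes "dim_row A = 2" "dim_col A = 2" "dim_row B = 2" "dim_col B = 2" "A $$ (0,0) = B $$ (0,0)" "A $$ (0,1) = B $$ (0,1)"
    "A $$ (1,0) = B $$ (1,0)" "A $$ (1,1) = B $$ (1,1)"
  shows "A = B"
  using assms by (intro eq_matI) (auto elim!: less_2E)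

lemma index_mult_2:
  "A \<in> carrier_mat 2 2 \<Longrightarrow> B \<in> carrier_mat 2 2 \<Longrightarrow> i < 2 \<Longrightarrow> j < 2 \<Longrightarrow>
    (A * B) $$ (i,j) = A $$ (i,0) * B $$ (0,j) + A $$ (i,1) * B $$ (1,j)"
  by (simp add: index_mult_sum[of _ 2 2 _ 2] numeral_2_eq_2 del: index_mult_mat(1))

lemma pauli_index:
  "pauli s $$ (0,0) = 0" "pauli s $$ (1,1) = 0" "pauli s $$ (0,1) = (if s then 1 else - \<i>)"
  "pauli s $$ (1,0) = (if s then 1 else \<i>)" "pauli s $$ (0,Suc 0) = (if s then 1 else - \<i>)"
  "pauli s $$ (Suc 0,0) = (if s then 1 else \<i>)" "pauli s $$ (Suc 0,Suc 0) = 0"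
  by (auto simp: pauli_def ann1_def)

lemma zpar1_index:
  "zpar1 $$ (0,0) = 1" "zpar1 $$ (1,1) = - 1" "zpar1 $$ (0,1) = 0" "zpar1 $$ (1,0) = 0"
  "zpar1 $$ (Suc 0,Suc 0) = - 1" "zpar1 $$ (0,Suc 0) = 0" "zpar1 $$ (Suc 0,0) = 0"
  by (auto simp: zpar1_def)

lemma pauli_adjoint [simp]: "mat_adjoint (pauli s) = pauli s"
  by (rule mat2_eqI) (auto simp: pauli_index)

lemma pauli_anticommute: "pauli s * pauli t + pauli t * pauli s = (if s = t then 2 else 0) \<cdot>\<^sub>m 1\<^sub>m 2"
  by (rule mat2_eqI) (auto simp: index_mult_2 pauli_index simp del: index_mult_mat(1))

lemma pauli_zpar1: "pauli s * zpar1 = - 1 \<cdot>\<^sub>m (zpar1 * pauli s)"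
  by (rule mat2_eqI) (auto simp: index_mult_2 pauli_index zpar1_index simp del: index_mult_mat(1))

lemma zpar1_sq: "zpar1 * zpar1 = 1\<^sub>m 2"
  by (rule mat2_eqI) (auto simp: index_mult_2 zpar1_index simp del: index_mult_mat(1))

lemma uminus_add_self_mat: "M \<in> carrier_mat d d \<Longrightarrow> - 1 \<cdot>\<^sub>m M + M = 0 \<cdot>\<^sub>m (1\<^sub>m d :: complex mat)"
  by (rule eq_matI) auto

lemma quadrature_anticommute:
  assumes "i < n" "j < n"
  shows "quadrature s n i * quadrature t n j + quadrature t n j * quadrature s n i
    = (if s = t \<and> i = j then 2 else 0) \<cdot>\<^sub>m 1\<^sub>m (2 ^ n)"
  using assms
proof (induct n arbitrary: i j s t)
  case (Suc n)
  let ?d = "2 ^ n :: nat"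
  \<comment> \<open>The Jordan-Wigner string: the first mode meets the sigma_z that later modes
    carry there, and the two anticommute.\<close>
  have mixed: "quadrature s (Suc n) 0 * quadrature t (Suc n) (Suc k) + quadrature t (Suc n) (Suc k) * quadrature s (Suc n) 0
     = 0 \<cdot>\<^sub>m 1\<^sub>m (2 ^ Suc n)" if k: "k < n" for s t k
  proof -
    have q: "quadrature t n k \<in> carrier_mat ?d ?d" using k by simp
    have "quadrature s (Suc n) 0 * quadrature t (Suc n) (Suc k) = - 1 \<cdot>\<^sub>m kron (zpar1 * pauli s) (quadrature t n k)"
      unfolding quadrature_0 quadrature_Suc[OF k] kron_mult[OF pauli_carrier zpar1_carrier one_carrier_mat q] pauli_zpar1 kron_smult_left
      using q by simp
    moreover have "quadrature t (Suc n) (Suc k) * quadrature s (Suc n) 0 = kron (zpar1 * pauli s) (quadrature t n k)"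
      unfolding quadrature_0 quadrature_Suc[OF k] kron_mult[OF zpar1_carrier pauli_carrier q one_carrier_mat] using q by simp
    moreover have "kron (zpar1 * pauli s) (quadrature t n k) \<in> carrier_mat (2 ^ Suc n) (2 ^ Suc n)"
      using kron_carrier[OF mult_carrier_mat[OF zpar1_carrier pauli_carrier] q] by simp
    ultimately show ?thesis using uminus_add_self_mat by simp
  qed
  show ?case
  proof (cases i)
    case i: 0
    show ?thesis
    proof (cases j)
      case j: 0
      have "quadrature s (Suc n) 0 * quadrature t (Suc n) 0 + quadrature t (Suc n) 0 * quadrature s (Suc n) 0
        = kron (pauli s * pauli t + pauli t * pauli s) (1\<^sub>m ?d)"
        unfolding quadrature_0 kron_mult[OF pauli_carrier pauli_carrier one_carrier_mat one_carrier_mat]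
        by (simp add: kron_add_left[OF mult_carrier_mat[OF pauli_carrier pauli_carrier] mult_carrier_mat[OF pauli_carrier pauli_carrier]])
      thus ?thesis unfolding i j pauli_anticommute kron_smult_left kron_one by simp
    next
      case j: (Suc k)
      thus ?thesis using mixed[of k s t] Suc.prems i by simp
    qed
  next
    case i: (Suc k)
    show ?thesis
    proof (cases j)
      case j: 0
      have "quadrature s (Suc n) (Suc k) * quadrature t (Suc n) 0 + quadrature t (Suc n) 0 * quadrature s (Suc n) (Suc k)
         = quadrature t (Suc n) 0 * quadrature s (Suc n) (Suc k) + quadrature s (Suc n) (Suc k) * quadrature t (Suc n) 0"
        by (rule comm_add_mat[of _ "2 ^ Suc n" "2 ^ Suc n"])
          (use Suc.prems i in \<open>auto intro!: mult_carrier_mat[of _ "2 ^ Suc n" "2 ^ Suc n" _ "2 ^ Suc n"] quadrature_carrier simp del: power_Suc\<close>)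
      thus ?thesis using mixed[of k t s] Suc.prems i j by simp
    next
      case j: (Suc l)
      from Suc.prems i j have kl: "k < n" "l < n" by auto
      note q = quadrature_carrier[OF kl(1), of s] quadrature_carrier[OF kl(2), of t]
      have "quadrature s (Suc n) i * quadrature t (Suc n) j + quadrature t (Suc n) j * quadrature s (Suc n) i
        = kron (1\<^sub>m 2) (quadrature s n k * quadrature t n l + quadrature t n l * quadrature s n k)"
        unfolding i j quadrature_Suc[OF kl(1)] quadrature_Suc[OF kl(2)]
          kron_mult[OF zpar1_carrier zpar1_carrier q] kron_mult[OF zpar1_carrier zpar1_carrier q(2,1)] zpar1_sq
        using q by (simp add: kron_add_right[of _ ?d ?d])
      thus ?thesis unfolding Suc.hyps[OF kl] kron_smult_right kron_one using i j by simp
    qed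
  qed
qed simp

lemma quadrature_adjoint: "i < n \<Longrightarrow> mat_adjoint (quadrature s n i) = quadrature s n i"
proof (induct n arbitrary: i)
  case (Suc n)
  thus ?case by (cases i) (auto simp: quadrature_0 quadrature_Suc kron_adjoint)
qed simp

lemma quadrature_parity:
  "i < n \<Longrightarrow> kpow zpar1 n * quadrature s n i = - 1 \<cdot>\<^sub>m (quadrature s n i * kpow zpar1 n)"
proof (induct n arbitrary: i)
  case (Suc n)
  have z: "kpow zpar1 n \<in> carrier_mat (2 ^ n) (2 ^ n)" by simp
  show ?case
  proof (cases i)
    case 0
    have "- 1 \<cdot>\<^sub>m (pauli s * zpar1) = zpar1 * pauli s" unfolding pauli_zpar1 by (rule eq_matI) auto
    thus ?thesis unfolding 0 quadrature_0 kpow.simps kron_mult[OF zpar1_carrier pauli_carrier z one_carrier_mat]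
        kron_mult[OF pauli_carrier zpar1_carrier one_carrier_mat z] kron_smult_left[symmetric]
        left_mult_one_mat[OF z] right_mult_one_mat[OF z] using \<open>- 1 \<cdot>\<^sub>m (pauli s * zpar1) = zpar1 * pauli s\<close> by simp
  next
    case (Suc k)
    with Suc.prems have k: "k < n" by simp
    note q = quadrature_carrier[OF k, of s]
    show ?thesis unfolding Suc quadrature_Suc[OF k] kpow.simps kron_mult[OF zpar1_carrier zpar1_carrier z q]
      kron_mult[OF zpar1_carrier zpar1_carrier q z] Suc.hyps[OF k] kron_smult_right ..
  qed
qed simp

lemma kpow_zpar1_sq: "kpow zpar1 n * kpow zpar1 n = 1\<^sub>m (2 ^ n)"
proof (induct n)
  case (Suc n)
  have z: "kpow zpar1 n \<in> carrier_mat (2 ^ n) (2 ^ n)" by simp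
  show ?case unfolding kpow.simps kron_mult[OF zpar1_carrier zpar1_carrier z z] zpar1_sq Suc kron_one by simp
qed simp

lemma kpow_zpar1_adjoint: "mat_adjoint (kpow zpar1 n) = kpow zpar1 n"
  by (induct n) (simp_all add: kron_adjoint)

section \<open>Particle number and parity\<close>

lemma mat_exp_diagonal:
  assumes A: "A \<in> carrier_mat n n" and diag: "\<And>i j. i < n \<Longrightarrow> j < n \<Longrightarrow> A $$ (i,j) = (if i = j then f i else 0)"
    and ij: "i < n" "j < n"
  shows "mat_exp A $$ (i,j) = (if i = j then exp (f i) else 0)"
proof -
  have "(\<Sum>k<n. (if k = i then 1 else 0) * A $$ (k,l)) = f i * (if l = i then 1 else 0)" if "l < n" for l
    using that ij by (simp add: diag if_distrib[of "\<lambda>x. x * _"] cong: if_cong)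
  from mat_exp_left_eigen[OF A this ij(2)] show ?thesis
    using ij by (simp add: if_distrib[of "\<lambda>x. x * _"] cong: if_cong)
qed

text \<open>The binary digit sum of \<open>i\<close>, that is, the particle number of the basis
  vector with index \<open>i\<close>.\<close>

primrec occupation :: "nat \<Rightarrow> nat \<Rightarrow> nat" where
  "occupation 0 i = 0"
| "occupation (Suc n) i = i div 2 ^ n + occupation n (i mod 2 ^ n)"

lemma kpow_zpar1_index:
  "i < 2 ^ n \<Longrightarrow> j < 2 ^ n \<Longrightarrow> kpow zpar1 n $$ (i,j) = (if i = j then (- 1) ^ occupation n i else 0)"
proof (induct n arbitrary: i j)
  case (Suc n)
  have z: "kpow zpar1 n \<in> carrier_mat (2 ^ n) (2 ^ n)" by simp
  have ij: "i < 2 * 2 ^ n" "j < 2 * 2 ^ n" using Suc.prems by auto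
  note dm = div_mod_less[OF ij(1)] div_mod_less[OF ij(2)]
  have eq: "i = j \<longleftrightarrow> i div 2 ^ n = j div 2 ^ n \<and> i mod 2 ^ n = j mod 2 ^ n" by (metis div_mult_mod_eq)
  have "kpow zpar1 (Suc n) $$ (i,j) = zpar1 $$ (i div 2 ^ n, j div 2 ^ n) * kpow zpar1 n $$ (i mod 2 ^ n, j mod 2 ^ n)"
    using ij by simp
  also have "zpar1 $$ (i div 2 ^ n, j div 2 ^ n) = (if i div 2 ^ n = j div 2 ^ n then (- 1) ^ (i div 2 ^ n) else 0)"
    using dm(1,3) by (auto simp: zpar1_def elim!: less_2E)
  finally show ?case unfolding Suc.hyps[OF dm(2,4)] by (auto simp: eq power_add)
qed simp

lemma fock_N_carrier [simp]: "fock_N n \<in> carrier_mat (2 ^ n) (2 ^ n)" by (simp add: fock_N_def msum_def)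

lemma fock_N_index:
  "i < 2 ^ n \<Longrightarrow> j < 2 ^ n \<Longrightarrow> fock_N n $$ (i,j) = (if i = j then of_nat (occupation n i) else 0)"
proof (induct n arbitrary: i j)
  case 0 thus ?case by (simp add: fock_N_def msum_def)
next
  case (Suc n)
  let ?d = "2 ^ n :: nat"
  have ij: "i < 2 * ?d" "j < 2 * ?d" using Suc.prems by auto
  note dm = div_mod_less[OF ij(1)] div_mod_less[OF ij(2)]
  have eq: "i = j \<longleftrightarrow> i div 2 ^ n = j div 2 ^ n \<and> i mod 2 ^ n = j mod 2 ^ n" by (metis div_mult_mod_eq)
  have d: "dim_row (fock_c n k) = ?d" "dim_col (fock_c n k) = ?d" if "k < n" for k using fock_c_carrier[OF that] by auto
  have "fock_N (Suc n) $$ (i,j) = (mat_adjoint (fock_c (Suc n) 0) * fock_c (Suc n) 0) $$ (i,j)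
     + (\<Sum>k<n. (mat_adjoint (fock_c (Suc n) (Suc k)) * fock_c (Suc n) (Suc k)) $$ (i,j))"
    using Suc.prems by (simp add: fock_N_def msum_def sum.lessThan_Suc_shift del: sum.lessThan_Suc index_mult_mat(1))
  also have "mat_adjoint (fock_c (Suc n) 0) * fock_c (Suc n) 0 = kron (mat_adjoint ann1 * ann1) (1\<^sub>m ?d)"
    unfolding fock_c_0 kron_adjoint
    by (subst kron_mult[of _ 2 2 _ 2 _ ?d ?d _ ?d]) auto
  also have "kron (mat_adjoint ann1 * ann1) (1\<^sub>m ?d) $$ (i,j) = (if i = j then of_nat (i div ?d) else 0)"
  proof -
    have "(mat_adjoint ann1 * ann1) $$ (a,b) = (if a = b then of_nat a else 0)" if "a < 2" "b < 2" for a b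
      using that by (auto simp: index_mult_2 ann1_def elim!: less_2E simp del: index_mult_mat(1))
    moreover have "dim_row ann1 = 2" "dim_col ann1 = 2" by (simp_all add: ann1_def)
    ultimately show ?thesis using ij dm by (auto simp: eq simp del: index_mult_mat(1))
  qed
  also have "(\<Sum>k<n. (mat_adjoint (fock_c (Suc n) (Suc k)) * fock_c (Suc n) (Suc k)) $$ (i,j))
     = (\<Sum>k<n. (if i div ?d = j div ?d then (mat_adjoint (fock_c n k) * fock_c n k) $$ (i mod ?d, j mod ?d) else 0))"
  proof (intro sum.cong refl)
    fix k assume "k \<in> {..<n}"
    hence k: "k < n" by simp
    have "mat_adjoint (fock_c (Suc n) (Suc k)) * fock_c (Suc n) (Suc k) = kron (1\<^sub>m 2) (mat_adjoint (fock_c n k) * fock_c n k)"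
      unfolding fock_c_Suc kron_adjoint zpar1_adjoint zpar1_sq[symmetric]
      by (rule kron_mult[of _ 2 2 _ 2 _ ?d ?d _ ?d]) (use k in auto)
    thus "(mat_adjoint (fock_c (Suc n) (Suc k)) * fock_c (Suc n) (Suc k)) $$ (i,j)
      = (if i div ?d = j div ?d then (mat_adjoint (fock_c n k) * fock_c n k) $$ (i mod ?d, j mod ?d) else 0)"
      using ij dm d[OF k] by (simp del: index_mult_mat(1))
  qed
  also have "\<dots> = (if i div ?d = j div ?d then fock_N n $$ (i mod ?d, j mod ?d) else 0)"
    using dm by (simp add: fock_N_def msum_def)
  finally show ?case unfolding Suc.hyps[OF dm(2,4)] by (auto simp: eq)
qed

text \<open>The number operator is diagonal with the occupations as entries, so
  \<open>exp (i pi N)\<close> has the signs \<open>(-1)^occupation\<close> on its diagonal. As a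
  tensor power of sigma_z the parity is open to induction over modes.\<close>

lemma fock_parity_eq: "fock_parity n = kpow zpar1 n"
proof (rule eq_matI)
  have z: "kpow zpar1 n \<in> carrier_mat (2 ^ n) (2 ^ n)" by simp
  fix i j assume "i < dim_row (kpow zpar1 n)" "j < dim_col (kpow zpar1 n)"
  hence ij: "i < 2 ^ n" "j < 2 ^ n" using z by auto
  have d: "dim_row (fock_N n) = 2 ^ n" "dim_col (fock_N n) = 2 ^ n" by (simp_all add: fock_N_def msum_def)
  have "fock_parity n $$ (i,j) = (if i = j then exp (\<i> * pi * of_nat (occupation n i)) else 0)"
    unfolding fock_parity_def by (rule mat_exp_diagonal[OF _ _ ij]) (auto simp: fock_N_index d)
  also have "exp (\<i> * pi * of_nat (occupation n i)) = (- 1) ^ occupation n i"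
    using exp_of_nat_mult[of "occupation n i" "\<i> * pi"] by (simp add: mult_ac)
  finally show "fock_parity n $$ (i,j) = kpow zpar1 n $$ (i,j)" using kpow_zpar1_index[OF ij] by simp
qed (simp_all add: fock_parity_def fock_N_def msum_def)

text \<open>Induction over modes: commuting with sigma_x and sigma_y on the first mode forces
  \<open>X\<close> to be the identity there tensored with one block, and that block commutes with
  the quadratures of the remaining modes.\<close>

lemma quadrature_commutant:
  assumes "X \<in> carrier_mat (2 ^ n) (2 ^ n)" "\<And>s i. i < n \<Longrightarrow> quadrature s n i * X = X * quadrature s n i"
  shows "\<exists>c. X = c \<cdot>\<^sub>m 1\<^sub>m (2 ^ n)"
  using assms
proof (induct n arbitrary: X)
  case 0
  thus ?case by (intro exI[of _ "X $$ (0,0)"] eq_matI) auto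
next
  case (Suc n)
  let ?d = "2 ^ n :: nat"
  have X: "X \<in> carrier_mat (2 * ?d) (2 * ?d)" using Suc.prems(1) by simp
  define B where "B a b = mat ?d ?d (\<lambda>(p,q). X $$ (a * ?d + p, b * ?d + q))" for a b
  have Bc: "B a b \<in> carrier_mat ?d ?d" for a b by (simp add: B_def)
  have l: "a * ?d + p < 2 * ?d" if "a < 2" "p < ?d" for a p using that by (rule index_pair_less)
  have blockL: "(kron A M * X) $$ (a * ?d + p, b * ?d + q) = A $$ (a,0) * (M * B 0 b) $$ (p,q) + A $$ (a,1) * (M * B 1 b) $$ (p,q)"
    and blockR: "(X * kron A M) $$ (a * ?d + p, b * ?d + q) = A $$ (0,b) * (B a 0 * M) $$ (p,q) + A $$ (1,b) * (B a 1 * M) $$ (p,q)"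
    if "A \<in> carrier_mat 2 2" "M \<in> carrier_mat ?d ?d" "a < 2" "b < 2" "p < ?d" "q < ?d" for A M a b p q
  proof -
    note k = kron_carrier[OF that(1,2)]
    note la = l[OF that(3,5)] and lb = l[OF that(4,6)]
    have "(kron A M * X) $$ (a * ?d + p, b * ?d + q)
      = (\<Sum>k<2 * ?d. (A $$ (a, k div ?d) * M $$ (p, k mod ?d)) * X $$ ((k div ?d) * ?d + k mod ?d, b * ?d + q))"
      unfolding index_mult_sum[OF k X la lb] div_mult_mod_eq using la that by (intro sum.cong refl) auto
    also have "\<dots> = (\<Sum>c<2. \<Sum>r<?d. A $$ (a, c) * M $$ (p, r) * X $$ (c * ?d + r, b * ?d + q))"
      by (rule sum_div_mod)
    also have "\<dots> = (\<Sum>c<2. A $$ (a, c) * (M * B c b) $$ (p,q))"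
      unfolding index_mult_sum[OF that(2) Bc that(5,6)] sum_distrib_left
      using that by (intro sum.cong refl) (auto simp: B_def)
    finally show "(kron A M * X) $$ (a * ?d + p, b * ?d + q) = A $$ (a,0) * (M * B 0 b) $$ (p,q) + A $$ (a,1) * (M * B 1 b) $$ (p,q)"
      by (simp add: numeral_2_eq_2)
    have "(X * kron A M) $$ (a * ?d + p, b * ?d + q)
      = (\<Sum>k<2 * ?d. X $$ (a * ?d + p, (k div ?d) * ?d + k mod ?d) * (A $$ (k div ?d, b) * M $$ (k mod ?d, q)))"
      unfolding index_mult_sum[OF X k la lb] div_mult_mod_eq using lb that by (intro sum.cong refl) auto
    also have "\<dots> = (\<Sum>c<2. \<Sum>r<?d. X $$ (a * ?d + p, c * ?d + r) * (A $$ (c,b) * M $$ (r,q)))"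
      by (rule sum_div_mod)
    also have "\<dots> = (\<Sum>c<2. A $$ (c, b) * (B a c * M) $$ (p,q))"
      unfolding index_mult_sum[OF Bc that(2) that(5,6)] sum_distrib_left
      using that by (intro sum.cong refl) (auto simp: B_def mult_ac)
    finally show "(X * kron A M) $$ (a * ?d + p, b * ?d + q) = A $$ (0,b) * (B a 0 * M) $$ (p,q) + A $$ (1,b) * (B a 1 * M) $$ (p,q)"
      by (simp add: numeral_2_eq_2)
  qed
  have one: "1\<^sub>m ?d * B a b = B a b" "B a b * 1\<^sub>m ?d = B a b" for a b
    using left_mult_one_mat[OF Bc] right_mult_one_mat[OF Bc] by auto
  have p: "pauli s $$ (a,0) * B 0 b $$ (p,q) + pauli s $$ (a,1) * B 1 b $$ (p,q)
      = pauli s $$ (0,b) * B a 0 $$ (p,q) + pauli s $$ (1,b) * B a 1 $$ (p,q)"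
    if "a < 2" "b < 2" "p < ?d" "q < ?d" for s a b p q
    using arg_cong[OF Suc.prems(2)[of 0 s], of "\<lambda>M. M $$ (a * ?d + p, b * ?d + q)"]
    unfolding quadrature_0 blockL[OF pauli_carrier one_carrier_mat that] blockR[OF pauli_carrier one_carrier_mat that] one by simp
  \<comment> \<open>Commuting with sigma_x equates the two diagonal blocks and the two off-diagonal
    ones; commuting with sigma_y makes the latter opposite to each other.\<close>
  have diag: "B 1 1 $$ (p,q) = B 0 0 $$ (p,q)" "B 0 1 $$ (p,q) = 0" "B 1 0 $$ (p,q) = 0" if "p < ?d" "q < ?d" for p q
  proof -
    show "B 1 1 $$ (p,q) = B 0 0 $$ (p,q)" using p[of 0 1 p q True] that by (simp add: pauli_index)
    have "B 1 0 $$ (p,q) = B 0 1 $$ (p,q)" "B 1 0 $$ (p,q) = - B 0 1 $$ (p,q)"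
      using p[of 0 0 p q True] p[of 0 0 p q False] that by (simp_all add: pauli_index)
    thus "B 0 1 $$ (p,q) = 0" "B 1 0 $$ (p,q) = 0" by auto
  qed
  have "quadrature s n i * B 0 0 = B 0 0 * quadrature s n i" if i: "i < n" for s i
  proof (rule eq_matI)
    note q = quadrature_carrier[OF i, of s]
    fix r c assume "r < dim_row (B 0 0 * quadrature s n i)" "c < dim_col (B 0 0 * quadrature s n i)"
    hence rc: "r < ?d" "c < ?d" using i by (simp_all add: B_def)
    have z2: "(0::nat) < 2" by simp
    show "(quadrature s n i * B 0 0) $$ (r,c) = (B 0 0 * quadrature s n i) $$ (r,c)"
      using arg_cong[OF Suc.prems(2)[of "Suc i" s], of "\<lambda>M. M $$ (0 * ?d + r, 0 * ?d + c)"] i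
      unfolding quadrature_Suc[OF i] blockL[OF zpar1_carrier q z2 z2 rc] blockR[OF zpar1_carrier q z2 z2 rc]
      by (simp add: zpar1_index del: index_mult_mat(1))
  qed (use i in \<open>simp_all add: B_def\<close>)
  from Suc.hyps[OF Bc this] obtain c where c: "B 0 0 = c \<cdot>\<^sub>m 1\<^sub>m ?d" by auto
  have "X = c \<cdot>\<^sub>m 1\<^sub>m (2 * ?d)"
  proof (rule eq_matI)
    fix i j assume "i < dim_row (c \<cdot>\<^sub>m 1\<^sub>m (2 * ?d))" "j < dim_col (c \<cdot>\<^sub>m 1\<^sub>m (2 * ?d))"
    hence ij: "i < 2 * ?d" "j < 2 * ?d" by auto
    note dm = div_mod_less[OF ij(1)] div_mod_less[OF ij(2)]
    have eq: "i = j \<longleftrightarrow> i div 2 ^ n = j div 2 ^ n \<and> i mod 2 ^ n = j mod 2 ^ n" by (metis div_mult_mod_eq)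
    have "X $$ (i,j) = B (i div ?d) (j div ?d) $$ (i mod ?d, j mod ?d)" using dm by (simp only: B_def index_mat split div_mult_mod_eq)
    also have "\<dots> = (if i div ?d = j div ?d then B 0 0 $$ (i mod ?d, j mod ?d) else 0)"
      using dm(1,3) diag[OF dm(2,4)] by (auto elim!: less_2E)
    finally show "X $$ (i,j) = (c \<cdot>\<^sub>m 1\<^sub>m (2 * ?d)) $$ (i,j)" using ij dm by (auto simp: c eq)
  qed (use X in auto)
  thus ?case by auto
qed

section \<open>Matrices as operators\<close>

text \<open>\<open>opm d\<close> is the unital embedding \<open>M \<mapsto> 1 \<otimes> M\<close> of the \<open>d \<times> d\<close> matrices.\<close>
lift_definition opm :: "nat \<Rightarrow> complex mat \<Rightarrow> lop" is
  "\<lambda>d M f i. \<Sum>j<d. M $$ (i mod d, j) * f (i div d * d + j)"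
  by (simp only: sum.distrib distrib_left sum_distrib_left simp_thms,
      intro allI ext sum.cong refl, rule mult.left_commute)

text \<open>The trace over the first block of length \<open>d\<close>, where \<open>opm d M\<close>
  acts as \<open>M\<close>.\<close>

lift_definition ltr :: "nat \<Rightarrow> lop \<Rightarrow> complex" is "\<lambda>d x. \<Sum>i<d. x (\<lambda>k. if k = i then 1 else 0) i" .

lemma Rep_opm: "Rep_lop (opm d M) f i = (\<Sum>j<d. M $$ (i mod d, j) * f (i div d * d + j))"
  by transfer (rule refl)

lemma lop_eqI: "(\<And>f i. Rep_lop x f i = Rep_lop y f i) \<Longrightarrow> x = y"
  by transfer (simp add: fun_eq_iff)

lemma opm_add: "0 < d \<Longrightarrow> A \<in> carrier_mat d d \<Longrightarrow> B \<in> carrier_mat d d \<Longrightarrow> opm d (A + B) = opm d A + opm d B"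
  by (rule lop_eqI) (simp add: Rep_opm plus_lop.rep_eq distrib_right sum.distrib)

lemma opm_diff: "0 < d \<Longrightarrow> A \<in> carrier_mat d d \<Longrightarrow> B \<in> carrier_mat d d \<Longrightarrow> opm d (A - B) = opm d A - opm d B"
  by (rule lop_eqI) (simp add: Rep_opm minus_lop.rep_eq left_diff_distrib sum_subtractf)

lemma opm_smult: "0 < d \<Longrightarrow> A \<in> carrier_mat d d \<Longrightarrow> opm d (c \<cdot>\<^sub>m A) = sc c (opm d A)"
  by (rule lop_eqI) (simp add: Rep_opm sc.rep_eq mult.assoc sum_distrib_left)

lemma opm_one: "0 < d \<Longrightarrow> opm d (1\<^sub>m d) = 1"
proof (transfer, intro ext)
  fix d :: nat and f :: "nat \<Rightarrow> complex" and i :: nat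
  assume d: "0 < d"
  have "(\<Sum>j<d. 1\<^sub>m d $$ (i mod d, j) * f (i div d * d + j)) = (\<Sum>j<d. if j = i mod d then f (i div d * d + j) else 0)"
    by (intro sum.cong refl) (use d in auto)
  thus "(\<Sum>j<d. 1\<^sub>m d $$ (i mod d, j) * f (i div d * d + j)) = f i" using d by simp
qed

lemma opm_mult: "0 < d \<Longrightarrow> A \<in> carrier_mat d d \<Longrightarrow> B \<in> carrier_mat d d \<Longrightarrow> opm d (A * B) = opm d A * opm d B"
proof (transfer, intro ext)
  fix d :: nat and f :: "nat \<Rightarrow> complex" and i :: nat and A B :: "complex mat"
  assume d: "0 < d" and A: "A \<in> carrier_mat d d" and B: "B \<in> carrier_mat d d"
  have "(\<Sum>j<d. (A * B) $$ (i mod d, j) * f (i div d * d + j))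
     = (\<Sum>j<d. \<Sum>k<d. A $$ (i mod d, k) * (B $$ (k, j) * f (i div d * d + j)))"
    using d by (intro sum.cong refl) (simp add: index_mult_sum[OF A B] sum_distrib_right mult.assoc del: index_mult_mat(1))
  also have "\<dots> = (\<Sum>k<d. \<Sum>j<d. A $$ (i mod d, k) * (B $$ (k, j) * f (i div d * d + j)))" by (rule sum.swap)
  also have "\<dots> = (\<Sum>k<d. A $$ (i mod d, k) * (\<Sum>j<d. B $$ ((i div d * d + k) mod d, j) * f ((i div d * d + k) div d * d + j)))"
    using d by (intro sum.cong refl) (simp add: sum_distrib_left)
  finally show "(\<Sum>j<d. (A * B) $$ (i mod d, j) * f (i div d * d + j))
     = (\<Sum>k<d. A $$ (i mod d, k) * (\<Sum>j<d. B $$ ((i div d * d + k) mod d, j) * f ((i div d * d + k) div d * d + j)))" .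
qed

lemma opm_inj:
  assumes A: "A \<in> carrier_mat d d" and B: "B \<in> carrier_mat d d" and eq: "opm d A = opm d B" shows "A = B"
proof (rule eq_matI)
  fix i j assume "i < dim_row B" "j < dim_col B"
  hence ij: "i < d" "j < d" using B by auto
  have entry: "Rep_lop (opm d M) (\<lambda>k. if k = j then 1 else 0) i = M $$ (i,j)" for M
    unfolding Rep_opm using ij by (simp add: if_distrib[of "\<lambda>x. _ * x"] cong: if_cong)
  show "A $$ (i,j) = B $$ (i,j)" using entry[of A] entry[of B] eq by simp
qed (use A B in auto)

lemma ltr_opm: "ltr d (opm d M) = mtrace M" if "M \<in> carrier_mat d d"
proof -
  have "ltr d (opm d M) = (\<Sum>i<d. \<Sum>j<d. M $$ (i mod d, j) * (if i div d * d + j = i then 1 else 0))"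
    unfolding ltr.rep_eq Rep_opm ..
  also have "\<dots> = (\<Sum>i<d. M $$ (i,i))"
    by (intro sum.cong refl) (simp add: if_distrib[of "\<lambda>x. _ * x"] cong: if_cong)
  finally show ?thesis using that by (simp add: mtrace_def)
qed

lemma ltr_add: "ltr d (x + y) = ltr d x + ltr d y" by transfer (simp add: sum.distrib)
lemma ltr_sc: "ltr d (sc c x) = c * ltr d x" by transfer (simp add: sum_distrib_left)

section \<open>Finite sums of matrices\<close>

lemma msum_carrier [simp]: "msum n m f I \<in> carrier_mat n m" by (simp add: msum_def)
lemma dim_msum [simp]: "dim_row (msum n m f I) = n" "dim_col (msum n m f I) = m" by (simp_all add: msum_def)
lemma index_msum [simp]: "i < n \<Longrightarrow> j < m \<Longrightarrow> msum n m f I $$ (i,j) = (\<Sum>k\<in>I. f k $$ (i,j))" by (simp add: msum_def)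

lemma msum_cong: "(\<And>k. k \<in> I \<Longrightarrow> f k = g k) \<Longrightarrow> msum n m f I = msum n m g I"
  by (rule eq_matI) auto

lemma msum_mult_right:
  assumes "\<And>k. k \<in> I \<Longrightarrow> f k \<in> carrier_mat n m" and B: "B \<in> carrier_mat m p"
  shows "msum n m f I * B = msum n p (\<lambda>k. f k * B) I"
proof (rule eq_matI)
  fix i j assume "i < dim_row (msum n p (\<lambda>k. f k * B) I)" "j < dim_col (msum n p (\<lambda>k. f k * B) I)"
  hence ij: "i < n" "j < p" by auto
  have "(msum n m f I * B) $$ (i,j) = (\<Sum>k\<in>I. \<Sum>l<m. f k $$ (i,l) * B $$ (l,j))"
    unfolding index_mult_sum[OF msum_carrier B ij] using ij by (simp add: sum_distrib_right sum.swap[of _ I])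
  also have "\<dots> = msum n p (\<lambda>k. f k * B) I $$ (i,j)"
    using ij assms by (auto simp: index_mult_sum[of _ n m _ p] simp del: index_mult_mat(1) intro!: sum.cong)
  finally show "(msum n m f I * B) $$ (i,j) = msum n p (\<lambda>k. f k * B) I $$ (i,j)" .
qed (use B in auto)

lemma mult_msum:
  assumes "\<And>k. k \<in> I \<Longrightarrow> f k \<in> carrier_mat m p" and B: "B \<in> carrier_mat n m"
  shows "B * msum m p f I = msum n p (\<lambda>k. B * f k) I"
proof (rule eq_matI)
  fix i j assume "i < dim_row (msum n p (\<lambda>k. B * f k) I)" "j < dim_col (msum n p (\<lambda>k. B * f k) I)"
  hence ij: "i < n" "j < p" by auto
  have "(B * msum m p f I) $$ (i,j) = (\<Sum>k\<in>I. \<Sum>l<m. B $$ (i,l) * f k $$ (l,j))"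
    unfolding index_mult_sum[OF B msum_carrier ij] using ij by (simp add: sum_distrib_left sum.swap[of _ I])
  also have "\<dots> = msum n p (\<lambda>k. B * f k) I $$ (i,j)"
    using ij assms by (auto simp: index_mult_sum[of _ n m _ p] simp del: index_mult_mat(1) intro!: sum.cong)
  finally show "(B * msum m p f I) $$ (i,j) = msum n p (\<lambda>k. B * f k) I $$ (i,j)" .
qed (use B in auto)

lemma ptrace_msum: "ptrace_B n m (msum (n * m) (n * m) f I) = msum n n (\<lambda>k. ptrace_B n m (f k)) I"
  by (rule eq_matI) (auto simp: ptrace_B_def index_pair_less sum.swap[of _ I])

lemma mat_adjoint_msum:
  assumes "\<And>k. k \<in> I \<Longrightarrow> f k \<in> carrier_mat n m"
  shows "mat_adjoint (msum n m f I) = msum m n (\<lambda>k. mat_adjoint (f k)) I"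
proof (rule eq_matI)
  have d: "dim_row (f k) = n" "dim_col (f k) = m" if "k \<in> I" for k using assms[OF that] by auto
  fix i j assume "i < dim_row (msum m n (\<lambda>k. mat_adjoint (f k)) I)" "j < dim_col (msum m n (\<lambda>k. mat_adjoint (f k)) I)"
  thus "mat_adjoint (msum n m f I) $$ (i,j) = msum m n (\<lambda>k. mat_adjoint (f k)) I $$ (i,j)"
    by (auto simp: d intro!: sum.cong)
qed auto

lemma opm_msum:
  assumes d: "0 < d" and f: "\<And>k. k \<in> I \<Longrightarrow> f k \<in> carrier_mat d d" and I: "finite I"
  shows "opm d (msum d d f I) = (\<Sum>k\<in>I. opm d (f k))"
  using I f
proof (induct I rule: finite_induct)
  case empty
  have "msum d d f {} = 0 \<cdot>\<^sub>m 1\<^sub>m d" by (rule eq_matI) auto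
  thus ?case by (simp add: opm_smult[OF d])
next
  case (insert k I)
  have "msum d d f (insert k I) = f k + msum d d f I"
    by (rule eq_matI) (use insert in auto)
  thus ?case using insert by (simp add: opm_add[OF d])
qed

text \<open>\<open>majo True\<close> are the Majorana operators; \<open>majo False\<close> is the second family with the same
  quadratic expressions that turns the \<open>E\<^sub>B\<^sub>S\<close> generator into the \<open>E\<^sub>S\<^sub>B\<close> one.\<close>
definition majo :: "bool \<Rightarrow> nat \<Rightarrow> nat \<Rightarrow> complex mat" where
  "majo esb n i = (if esb then majorana n i else \<i> \<cdot>\<^sub>m (fock_parity n * majorana n i))"

lemma fock_parity_carrier [simp]: "fock_parity n \<in> carrier_mat (2 ^ n) (2 ^ n)" by (simp add: fock_parity_eq)
lemma dim_fock_parity [simp]: "dim_row (fock_parity n) = 2 ^ n" "dim_col (fock_parity n) = 2 ^ n" by (simp_all add: fock_parity_eq)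
lemma fock_parity_sq: "fock_parity n * fock_parity n = 1\<^sub>m (2 ^ n)" by (simp add: fock_parity_eq kpow_zpar1_sq)
lemma fock_parity_adjoint: "mat_adjoint (fock_parity n) = fock_parity n" by (simp add: fock_parity_eq kpow_zpar1_adjoint)

lemma majorana_anticommute: "i < 2 * n \<Longrightarrow> j < 2 * n \<Longrightarrow>
  majorana n i * majorana n j + majorana n j * majorana n i = (if i = j then 2 else 0) \<cdot>\<^sub>m 1\<^sub>m (2 ^ n)"
  unfolding majorana_quadrature by (subst quadrature_anticommute) auto

lemma majorana_adjoint: "i < 2 * n \<Longrightarrow> mat_adjoint (majorana n i) = majorana n i"
  unfolding majorana_quadrature by (rule quadrature_adjoint) auto

lemma majorana_parity: "i < 2 * n \<Longrightarrow> fock_parity n * majorana n i = - 1 \<cdot>\<^sub>m (majorana n i * fock_parity n)"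
  unfolding majorana_quadrature fock_parity_eq by (rule quadrature_parity) auto

lemma dim_majorana [simp]: "i < 2 * n \<Longrightarrow> dim_row (majorana n i) = 2 ^ n" "i < 2 * n \<Longrightarrow> dim_col (majorana n i) = 2 ^ n"
  by (rule carrier_matD[OF majorana_carrier], assumption)+

lemma majo_carrier [simp]: "i < 2 * n \<Longrightarrow> majo esb n i \<in> carrier_mat (2 ^ n) (2 ^ n)"
  using mult_carrier_mat[OF fock_parity_carrier majorana_carrier] by (auto simp: majo_def)

lemma dim_majo [simp]: "i < 2 * n \<Longrightarrow> dim_row (majo esb n i) = 2 ^ n" "i < 2 * n \<Longrightarrow> dim_col (majo esb n i) = 2 ^ n"
  by (rule carrier_matD[OF majo_carrier], assumption)+

lemma majorana_commutant:
  assumes X: "X \<in> carrier_mat (2 ^ n) (2 ^ n)" and c: "\<And>i. i < 2 * n \<Longrightarrow> majorana n i * X = X * majorana n i"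
  shows "\<exists>c. X = c \<cdot>\<^sub>m 1\<^sub>m (2 ^ n)"
proof (rule quadrature_commutant[OF X])
  fix s i assume "i < n"
  thus "quadrature s n i * X = X * quadrature s n i"
    using c[of i] c[of "i + n"] by (cases s) (simp_all add: majorana_quadrature)
qed

context
  fixes n :: nat
begin

abbreviation (input) "\<gamma> \<equiv> \<lambda>i. opm (2 ^ n) (majorana n i)"
abbreviation (input) "\<pi> \<equiv> opm (2 ^ n) (fock_parity n)"
abbreviation (input) "\<M> \<equiv> opm (2 ^ n) ` carrier_mat (2 ^ n) (2 ^ n)"

lemma opm_majorana_CAR: "i < 2 * n \<Longrightarrow> j < 2 * n \<Longrightarrow> \<gamma> i * \<gamma> j + \<gamma> j * \<gamma> i = (if i = j then 2 else 0)"
proof -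
  assume ij: "i < 2 * n" "j < 2 * n"
  have "\<gamma> i * \<gamma> j + \<gamma> j * \<gamma> i = opm (2 ^ n) (majorana n i * majorana n j + majorana n j * majorana n i)"
    using ij by (simp add: opm_add opm_mult mult_carrier_mat[of _ "2^n" "2^n" _ "2^n"])
  thus ?thesis unfolding majorana_anticommute[OF ij] by (simp add: opm_smult opm_one sc_two)
qed

lemma opm_parity_sq: "\<pi> * \<pi> = 1"
  by (simp add: opm_mult[symmetric] fock_parity_sq opm_one)

lemma opm_majorana_parity: "i < 2 * n \<Longrightarrow> \<pi> * \<gamma> i = - (\<gamma> i * \<pi>)"
proof -
  assume i: "i < 2 * n"
  have "\<pi> * \<gamma> i = opm (2 ^ n) (- 1 \<cdot>\<^sub>m (majorana n i * fock_parity n))"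
    using i by (simp add: opm_mult[symmetric] majorana_parity)
  thus ?thesis using i by (simp add: opm_smult opm_mult mult_carrier_mat[of _ "2^n" "2^n" _ "2^n"] sc_minus_left)
qed

lemma opm_majo: "i < 2 * n \<Longrightarrow> opm (2 ^ n) (majo esb n i) = (if esb then \<gamma> i else sc \<i> (\<pi> * \<gamma> i))"
  by (simp add: majo_def opm_smult opm_mult mult_carrier_mat[of _ "2^n" "2^n" _ "2^n"])

lemma opm_parity_parity: "\<pi> * (\<pi> * x) = x" by (simp add: mult.assoc[symmetric] opm_parity_sq)

text \<open>The parity squares to one and anticommutes with Majorana operators; the resulting sign
  is cancelled by the two factors \<open>\<i>\<close>.\<close>

lemma majo_mult: "i < 2 * n \<Longrightarrow> j < 2 * n \<Longrightarrow> opm (2 ^ n) (majo esb n i) * opm (2 ^ n) (majo esb n j) = \<gamma> i * \<gamma> j"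
proof (cases esb)
  case False
  assume ij: "i < 2 * n" "j < 2 * n"
  have "\<pi> * \<gamma> i * (\<pi> * \<gamma> j) = - (\<gamma> i * \<pi>) * (\<pi> * \<gamma> j)" by (simp only: opm_majorana_parity[OF ij(1)])
  also have "\<dots> = - (\<gamma> i * \<gamma> j)" by (simp add: mult.assoc opm_parity_parity)
  finally show ?thesis using False ij by (simp add: opm_majo sc_minus_left)
qed (simp add: opm_majo)

lemma opm_commutant:
  assumes x: "x \<in> \<M>" and c: "\<And>i. i < 2 * n \<Longrightarrow> \<gamma> i * x = x * \<gamma> i"
  shows "\<exists>c. x = sc c 1"
proof -
  from x obtain X where X: "X \<in> carrier_mat (2 ^ n) (2 ^ n)" "x = opm (2 ^ n) X" by auto
  have "majorana n i * X = X * majorana n i" if i: "i < 2 * n" for i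
  proof (rule opm_inj[of _ "2 ^ n"])
    show "opm (2 ^ n) (majorana n i * X) = opm (2 ^ n) (X * majorana n i)"
      using c[OF i] i X by (simp add: opm_mult)
  qed (use i X in \<open>auto intro: mult_carrier_mat\<close>)
  from majorana_commutant[OF X(1) this] obtain c where "X = c \<cdot>\<^sub>m 1\<^sub>m (2 ^ n)" by auto
  thus ?thesis unfolding X(2) by (auto simp: opm_smult opm_one)
qed

text \<open>The element is split into its even part, which commutes with all Majorana operators and
  is scalar, and its odd part. The odd part times the parity is again in the commutant, so the odd
  part is a multiple of the parity. This multiple is even, hence zero.\<close>

lemma opm_twisted_commutant:
  assumes x: "x \<in> \<M>" and c: "\<And>i. i < 2 * n \<Longrightarrow> \<gamma> i * x = \<pi> * x * \<pi> * \<gamma> i" and n: "0 < n"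
    and M: "\<And>x y. x \<in> \<M> \<Longrightarrow> y \<in> \<M> \<Longrightarrow> x * y \<in> \<M>" "\<And>x y. x \<in> \<M> \<Longrightarrow> y \<in> \<M> \<Longrightarrow> x + y \<in> \<M>"
      "\<And>x y. x \<in> \<M> \<Longrightarrow> y \<in> \<M> \<Longrightarrow> x - y \<in> \<M>"
  shows "\<exists>c. x = sc c 1"
proof -
  let ?y = "\<pi> * x * \<pi>"
  have p: "\<pi> \<in> \<M>" by simp
  have yM: "?y \<in> \<M>" by (intro M x p)
  have yy: "\<pi> * ?y * \<pi> = x" by (simp add: mult.assoc opm_parity_sq opm_parity_parity)
  have c2: "\<gamma> i * ?y = x * \<gamma> i" if i: "i < 2 * n" for i
  proof -
    have "\<gamma> i * ?y = - (\<pi> * (\<gamma> i * x) * \<pi>)"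
      using opm_majorana_parity[OF i] by (simp add: mult.assoc[symmetric])
    also have "\<dots> = - (x * (\<pi> * \<gamma> i) * \<pi>)" unfolding c[OF i] by (simp add: mult.assoc opm_parity_parity)
    also have "\<dots> = x * \<gamma> i" unfolding opm_majorana_parity[OF i] by (simp add: mult.assoc opm_parity_sq)
    finally show ?thesis .
  qed
  have "\<gamma> i * (x + ?y) = (x + ?y) * \<gamma> i" if "i < 2 * n" for i
    using c[OF that] c2[OF that] by (simp add: distrib_left distrib_right add.commute)
  from opm_commutant[OF M(2)[OF x yM] this] obtain \<alpha> where \<alpha>: "x + ?y = sc \<alpha> 1" by auto
  have "\<gamma> i * ((x - ?y) * \<pi>) = ((x - ?y) * \<pi>) * \<gamma> i" if i: "i < 2 * n" for i
  proof -
    have "\<gamma> i * (x - ?y) = - ((x - ?y) * \<gamma> i)" using c[OF i] c2[OF i] by (simp add: left_diff_distrib right_diff_distrib)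
    hence "\<gamma> i * ((x - ?y) * \<pi>) = - ((x - ?y) * \<gamma> i) * \<pi>" by (simp add: mult.assoc[symmetric])
    also have "\<dots> = (x - ?y) * (\<pi> * \<gamma> i)" unfolding opm_majorana_parity[OF i] by (simp add: mult.assoc)
    finally show ?thesis by (simp add: mult.assoc)
  qed
  from opm_commutant[OF M(1)[OF M(3)[OF x yM] p] this] obtain \<beta> where \<beta>: "(x - ?y) * \<pi> = sc \<beta> 1" by auto
  have "x - ?y = (x - ?y) * \<pi> * \<pi>" by (simp add: mult.assoc opm_parity_sq)
  also have "\<dots> = sc \<beta> \<pi>" unfolding \<beta> by simp
  finally have d: "x - ?y = sc \<beta> \<pi>" .
  have "?y - x = \<pi> * (x - ?y) * \<pi>" using yy by (simp add: right_diff_distrib left_diff_distrib)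
  also have "\<dots> = sc \<beta> \<pi>" unfolding d by (simp add: opm_parity_sq)
  finally have "x - ?y = - (x - ?y)" unfolding d by (metis d minus_diff_eq)
  hence "x - ?y = 0" by (rule lop_eq_neg_self)
  hence "x + x = sc \<alpha> 1" using \<alpha> by simp
  hence "x = sc (\<alpha> / 2) 1" by (intro sc_scaled_eqI[of 2 x "sc (\<alpha> / 2) 1"]) (auto simp: sc_two[symmetric])
  thus ?thesis by blast
qed

end

lemma majorana_algebra_majo:
  assumes n: "0 < n"
  shows "majorana_algebra (2 * n) (opm (2 ^ n) ` carrier_mat (2 ^ n) (2 ^ n)) (\<lambda>i. opm (2 ^ n) (majo esb n i))
    (opm (2 ^ n) (fock_parity n)) (ltr (2 ^ n))"
proof -
  let ?d = "2 ^ n :: nat"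
  let ?M = "opm ?d ` carrier_mat ?d ?d" and ?g = "\<lambda>i. opm ?d (majorana n i)" and ?p = "opm ?d (fock_parity n)"
  have add: "x + y \<in> ?M" if "x \<in> ?M" "y \<in> ?M" for x y
    using that by (auto simp: opm_add[symmetric] intro!: imageI add_carrier_mat)
  have diff: "x - y \<in> ?M" if "x \<in> ?M" "y \<in> ?M" for x y
    using that by (auto simp: opm_diff[symmetric] intro!: imageI minus_carrier_mat)
  have mult: "x * y \<in> ?M" if "x \<in> ?M" "y \<in> ?M" for x y
    using that by (auto simp: opm_mult[symmetric] intro!: imageI mult_carrier_mat)
  \<comment> \<open>For \<open>g = \<i> \<pi> \<gamma>\<close> the parities cancel, and twisted
    commutation with \<open>g\<close> is ordinary commutation with \<open>\<gamma>\<close>. Hence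
    the two families need different commutant lemmas below.\<close>
  have comm: "opm ?d (majo esb n i) * x = ?p * x * ?p * opm ?d (majo esb n i) \<longleftrightarrow>
    (if esb then ?g i * x = ?p * x * ?p * ?g i else ?g i * x = x * ?g i)" if i: "i < 2 * n" for i x
  proof (cases esb)
    case False
    have "?p * x * ?p * (?p * ?g i) = ?p * (x * ?g i)" by (simp add: mult.assoc opm_parity_parity)
    moreover have "?p * (?g i * x) = ?p * (x * ?g i) \<longleftrightarrow> ?g i * x = x * ?g i"
      by (metis opm_parity_parity)
    moreover have "sc \<i> y = sc \<i> z \<longleftrightarrow> y = z" for y z using sc_scaled_eqI[of \<i>] by auto
    ultimately show ?thesis using False i by (simp add: opm_majo mult.assoc)
  qed (simp add: opm_majo i)
  show ?thesis
  proof
    show "1 \<in> ?M" using opm_one[of ?d] by (metis imageI one_carrier_mat zero_less_numeral zero_less_power)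
    show "sc c x \<in> ?M" if "x \<in> ?M" for c x
      using that by (auto simp: opm_smult[symmetric] intro!: imageI smult_carrier_mat)
    show "?p * ?p = 1" by (rule opm_parity_sq)
    show "?p * opm ?d (majo esb n i) = - (opm ?d (majo esb n i) * ?p)" if i: "i < 2 * n" for i
    proof -
      have "?p * (?g i * ?p) = - (?g i * ?p) * ?p"
        by (simp only: mult.assoc[symmetric] opm_majorana_parity[OF i] mult_minus_left)
      also have "\<dots> = - ?g i" by (simp add: mult.assoc opm_parity_sq)
      finally show ?thesis using opm_majorana_parity[OF i] i
        by (cases esb) (simp_all add: opm_majo opm_parity_parity opm_parity_sq mult.assoc sc_minus_right[symmetric])
    qed
    show "opm ?d (majo esb n i) * opm ?d (majo esb n j) + opm ?d (majo esb n j) * opm ?d (majo esb n i)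
      = (if i = j then 2 else 0)" if "i < 2 * n" "j < 2 * n" for i j
      using that by (simp add: majo_mult opm_majorana_CAR)
    show "ltr ?d (x * y) = ltr ?d (y * x)" if "x \<in> ?M" "y \<in> ?M" for x y
    proof -
      from that obtain X Y where XY: "X \<in> carrier_mat ?d ?d" "Y \<in> carrier_mat ?d ?d" "x = opm ?d X" "y = opm ?d Y" by auto
      have "ltr ?d (x * y) = mtrace (X * Y)" using XY by (simp add: opm_mult[symmetric] ltr_opm mult_carrier_mat[of _ ?d ?d _ ?d])
      also have "\<dots> = mtrace (Y * X)" by (rule mtrace_mult_comm[OF XY(1,2)])
      also have "\<dots> = ltr ?d (y * x)" using XY by (simp add: opm_mult[symmetric] ltr_opm mult_carrier_mat[of _ ?d ?d _ ?d])
      finally show ?thesis .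
    qed
    have "ltr ?d 1 = mtrace (1\<^sub>m ?d)" using ltr_opm[OF one_carrier_mat, of ?d] opm_one[of ?d] by simp
    thus "ltr ?d 1 \<noteq> 0" by (simp add: mtrace_def)
    show "\<exists>c. x = sc c 1" if x: "x \<in> ?M"
      and c: "\<And>i. i < 2 * n \<Longrightarrow> opm ?d (majo esb n i) * x = ?p * x * ?p * opm ?d (majo esb n i)" for x
    proof (cases esb)
      case True
      show ?thesis by (rule opm_twisted_commutant[OF x _ n mult add diff]) (use c comm True in auto)
    next
      case False
      show ?thesis by (rule opm_commutant[OF x]) (use c comm False in auto)
    qed
  qed (auto intro: add mult simp: ltr_add ltr_sc)
qed

section \<open>The generator in terms of creation and annihilation\<close>

lemma smult_smult_times: "c \<cdot>\<^sub>m (e \<cdot>\<^sub>m A) = (c * e :: complex) \<cdot>\<^sub>m A"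
  by (rule eq_matI) auto

lemma two_pow_pos: "0 < (2 ^ n :: nat)" by simp

text \<open>Positivity is put in trace form so that it can be tested on linear combinations
  \<open>M\<close> of Majorana operators.\<close>

definition bath_state :: "nat \<Rightarrow> complex mat \<Rightarrow> bool" where
  "bath_state d \<omega> \<longleftrightarrow> \<omega> \<in> carrier_mat d d \<and> mtrace \<omega> = 1 \<and> mat_adjoint \<omega> = \<omega> \<and>
    (\<forall>M \<in> carrier_mat d d. 0 \<le> Re (mtrace (\<omega> * (M * mat_adjoint M))))"

text \<open>The indices appear in reversed order because the partial trace produces
  \<open>Tr (v j * \<omega> * v l)\<close>, which cyclicity turns into
  \<open>Tr (\<omega> * v l * v j)\<close>. With \<open>C\<close> for this matrix,
  \<open>noise\<close> below is \<open>W C W^T\<close>.\<close>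

definition bath_corr :: "nat \<Rightarrow> complex mat \<Rightarrow> nat \<Rightarrow> nat \<Rightarrow> complex" where
  "bath_corr K \<omega> j l = mtrace (\<omega> * (majorana K l * majorana K j))"

definition noise :: "nat \<Rightarrow> real mat \<Rightarrow> complex mat \<Rightarrow> nat \<Rightarrow> nat \<Rightarrow> complex" where
  "noise K W \<omega> i k = (\<Sum>j<2*K. \<Sum>l<2*K. of_real (W $$ (i,j)) * of_real (W $$ (k,l)) * bath_corr K \<omega> j l)"

lemma mtrace_add: "A \<in> carrier_mat n n \<Longrightarrow> B \<in> carrier_mat n n \<Longrightarrow> mtrace (A + B) = mtrace A + mtrace B"
  by (simp add: mtrace_def sum.distrib)

lemma mtrace_smult: "mtrace (c \<cdot>\<^sub>m A) = c * mtrace A" if "A \<in> carrier_mat n n"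
  using that by (simp add: mtrace_def sum_distrib_left)

lemma mtrace_adjoint: "A \<in> carrier_mat n n \<Longrightarrow> mtrace (mat_adjoint A) = cnj (mtrace A)"
  by (simp add: mtrace_def)

lemma mtrace_msum: "mtrace (msum n n f I) = (\<Sum>k\<in>I. mtrace (f k))" if "\<And>k. k \<in> I \<Longrightarrow> f k \<in> carrier_mat n n"
proof -
  have "mtrace (msum n n f I) = (\<Sum>k\<in>I. \<Sum>i<n. f k $$ (i,i))"
    by (simp add: mtrace_def sum.swap[of _ I])
  also have "\<dots> = (\<Sum>k\<in>I. mtrace (f k))"
    by (intro sum.cong refl) (use that in \<open>auto simp: mtrace_def\<close>)
  finally show ?thesis .
qed

lemma mtrace_one: "mtrace (1\<^sub>m n) = of_nat n" by (simp add: mtrace_def)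

lemma mult_sq_carrier: "A \<in> carrier_mat n n \<Longrightarrow> B \<in> carrier_mat n n \<Longrightarrow> A * B \<in> carrier_mat n n"
  by (rule mult_carrier_mat)

lemma bath_corr_sum:
  assumes w: "bath_state (2 ^ K) \<omega>" and jl: "j < 2 * K" "l < 2 * K"
  shows "bath_corr K \<omega> j l + bath_corr K \<omega> l j = (if j = l then 2 else 0)"
proof -
  note c = mult_sq_carrier[OF majorana_carrier[OF jl(1)] majorana_carrier[OF jl(2)]]
    mult_sq_carrier[OF majorana_carrier[OF jl(2)] majorana_carrier[OF jl(1)]]
  have \<omega>: "\<omega> \<in> carrier_mat (2 ^ K) (2 ^ K)" "mtrace \<omega> = 1" using w by (auto simp: bath_state_def)
  have "bath_corr K \<omega> j l + bath_corr K \<omega> l j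
    = mtrace (\<omega> * (majorana K l * majorana K j + majorana K j * majorana K l))"
    unfolding bath_corr_def mult_add_distrib_mat[OF \<omega>(1) c(2,1)]
    by (rule mtrace_add[symmetric, OF mult_sq_carrier[OF \<omega>(1) c(2)] mult_sq_carrier[OF \<omega>(1) c(1)]])
  also have "\<dots> = (if j = l then 2 else 0)"
    unfolding majorana_anticommute[OF jl(2,1)] mult_smult_distrib[OF \<omega>(1) one_carrier_mat] right_mult_one_mat[OF \<omega>(1)]
      mtrace_smult[OF \<omega>(1)] \<omega>(2) by auto
  finally show ?thesis .
qed

lemma bath_corr_cnj:
  assumes w: "bath_state (2 ^ K) \<omega>" and jl: "j < 2 * K" "l < 2 * K"
  shows "cnj (bath_corr K \<omega> j l) = bath_corr K \<omega> l j"
proof -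
  have \<omega>: "\<omega> \<in> carrier_mat (2 ^ K) (2 ^ K)" "mat_adjoint \<omega> = \<omega>" using w by (auto simp: bath_state_def)
  note m = majorana_carrier[OF jl(1)] majorana_carrier[OF jl(2)]
  have "cnj (bath_corr K \<omega> j l) = mtrace (mat_adjoint (\<omega> * (majorana K l * majorana K j)))"
    unfolding bath_corr_def by (rule mtrace_adjoint[symmetric, OF mult_sq_carrier[OF \<omega>(1) mult_sq_carrier[OF m(2,1)]]])
  also have "mat_adjoint (\<omega> * (majorana K l * majorana K j)) = (majorana K j * majorana K l) * \<omega>"
    unfolding mat_adjoint_mult[OF \<omega>(1) mult_sq_carrier[OF m(2,1)]] mat_adjoint_mult[OF m(2,1)] majorana_adjoint[OF jl(1)]
      majorana_adjoint[OF jl(2)] \<omega>(2) ..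
  also have "mtrace \<dots> = bath_corr K \<omega> l j"
    unfolding bath_corr_def by (rule mtrace_mult_comm[OF mult_sq_carrier[OF m] \<omega>(1)])
  finally show ?thesis .
qed

lemma bath_corr_nonneg:
  assumes w: "bath_state (2 ^ K) \<omega>"
  shows "0 \<le> Re (\<Sum>j<2*K. \<Sum>l<2*K. cnj (z j) * bath_corr K \<omega> j l * z l)"
proof -
  have \<omega>: "\<omega> \<in> carrier_mat (2 ^ K) (2 ^ K)" using w by (auto simp: bath_state_def)
  let ?D = "2 ^ K :: nat"
  define M where "M = msum ?D ?D (\<lambda>l. z l \<cdot>\<^sub>m majorana K l) {..<2*K}"
  have M: "M \<in> carrier_mat ?D ?D" by (simp add: M_def)
  have Ma: "mat_adjoint M = msum ?D ?D (\<lambda>j. cnj (z j) \<cdot>\<^sub>m majorana K j) {..<2*K}"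
    unfolding M_def
    by (subst mat_adjoint_msum) (auto simp: mat_adjoint_smult majorana_adjoint intro!: msum_cong)
  have "\<omega> * (M * mat_adjoint M) = msum ?D ?D (\<lambda>l. msum ?D ?D (\<lambda>j. \<omega> * ((z l \<cdot>\<^sub>m majorana K l) * (cnj (z j) \<cdot>\<^sub>m majorana K j))) {..<2*K}) {..<2*K}"
  proof -
    have "M * mat_adjoint M = msum ?D ?D (\<lambda>l. (z l \<cdot>\<^sub>m majorana K l) * mat_adjoint M) {..<2*K}"
      unfolding M_def by (rule msum_mult_right) (auto simp: M_def[symmetric] M)
    also have "\<dots> = msum ?D ?D (\<lambda>l. msum ?D ?D (\<lambda>j. (z l \<cdot>\<^sub>m majorana K l) * (cnj (z j) \<cdot>\<^sub>m majorana K j)) {..<2*K}) {..<2*K}"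
      unfolding Ma by (intro msum_cong mult_msum) auto
    finally have "\<omega> * (M * mat_adjoint M) = msum ?D ?D (\<lambda>l. \<omega> * msum ?D ?D (\<lambda>j. (z l \<cdot>\<^sub>m majorana K l) * (cnj (z j) \<cdot>\<^sub>m majorana K j)) {..<2*K}) {..<2*K}"
      by (simp only:) (rule mult_msum[OF _ \<omega>], simp)
    thus ?thesis by (simp only:) (intro msum_cong mult_msum[OF _ \<omega>] mult_sq_carrier, auto)
  qed
  hence "mtrace (\<omega> * (M * mat_adjoint M)) = (\<Sum>l<2*K. \<Sum>j<2*K. mtrace (\<omega> * ((z l \<cdot>\<^sub>m majorana K l) * (cnj (z j) \<cdot>\<^sub>m majorana K j))))"
    by (simp only:, subst mtrace_msum, simp, intro sum.cong refl mtrace_msum mult_sq_carrier \<omega>) auto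
  also have "\<dots> = (\<Sum>l<2*K. \<Sum>j<2*K. cnj (z j) * bath_corr K \<omega> j l * z l)"
  proof (intro sum.cong refl)
    fix l j assume "l \<in> {..<2*K}" "j \<in> {..<2*K}"
    hence m: "majorana K l \<in> carrier_mat ?D ?D" "majorana K j \<in> carrier_mat ?D ?D" by auto
    have "\<omega> * ((z l \<cdot>\<^sub>m majorana K l) * (cnj (z j) \<cdot>\<^sub>m majorana K j))
      = z l \<cdot>\<^sub>m (cnj (z j) \<cdot>\<^sub>m (\<omega> * (majorana K l * majorana K j)))"
      using m \<omega> by (simp add: mult_smult_assoc_mat[of _ ?D ?D _ ?D] mult_smult_distrib[of _ ?D ?D _ ?D] mult_sq_carrier smult_carrier_mat
          smult_smult_times mult.commute)
    thus "mtrace (\<omega> * ((z l \<cdot>\<^sub>m majorana K l) * (cnj (z j) \<cdot>\<^sub>m majorana K j))) = cnj (z j) * bath_corr K \<omega> j l * z l"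
      using m \<omega> by (simp add: mtrace_smult[of _ ?D] mult_sq_carrier bath_corr_def)
  qed
  also have "\<dots> = (\<Sum>j<2*K. \<Sum>l<2*K. cnj (z j) * bath_corr K \<omega> j l * z l)" by (rule sum.swap)
  finally show ?thesis using w M unfolding bath_state_def by (metis (no_types, lifting))
qed

text \<open>The anticommutation relations fix the symmetric part of the two-point function of any
  state. This is why the drift does not depend on \<open>\<omega>\<close>.\<close>

lemma noise_sum:
  assumes w: "bath_state (2 ^ K) \<omega>"
  shows "noise K W \<omega> i k + noise K W \<omega> k i = of_real (2 * (\<Sum>j<2*K. W $$ (i,j) * W $$ (k,j)))"
proof -
  have "noise K W \<omega> k i = (\<Sum>j<2*K. \<Sum>l<2*K. of_real (W $$ (k,l)) * of_real (W $$ (i,j)) * bath_corr K \<omega> l j)"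
    unfolding noise_def by (rule sum.swap)
  hence "noise K W \<omega> i k + noise K W \<omega> k i
    = (\<Sum>j<2*K. \<Sum>l<2*K. of_real (W $$ (i,j)) * of_real (W $$ (k,l)) * (bath_corr K \<omega> j l + bath_corr K \<omega> l j))"
    unfolding noise_def by (simp only: sum.distrib[symmetric]) (simp only: distrib_left mult.commute mult.left_commute)
  also have "\<dots> = (\<Sum>j<2*K. \<Sum>l<2*K. if j = l then 2 * of_real (W $$ (i,j)) * of_real (W $$ (k,l)) else 0)"
    by (intro sum.cong refl) (auto simp: bath_corr_sum[OF w])
  finally show ?thesis by (simp add: sum_distrib_left mult.assoc)
qed

lemma noise_cnj:
  assumes w: "bath_state (2 ^ K) \<omega>" shows "cnj (noise K W \<omega> i k) = noise K W \<omega> k i"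
proof -
  have "cnj (noise K W \<omega> i k) = (\<Sum>j<2*K. \<Sum>l<2*K. of_real (W $$ (k,l)) * of_real (W $$ (i,j)) * bath_corr K \<omega> l j)"
    unfolding noise_def cnj_sum by (intro sum.cong refl) (simp add: bath_corr_cnj[OF w])
  also have "\<dots> = noise K W \<omega> k i" unfolding noise_def by (rule sum.swap)
  finally show ?thesis .
qed

lemma noise_quadratic_form:
  "(\<Sum>i<n. \<Sum>k<n. cnj (v i) * noise K W \<omega> i k * v k)
    = (\<Sum>j<2*K. \<Sum>l<2*K. cnj (\<Sum>i<n. of_real (W $$ (i,j)) * v i) * bath_corr K \<omega> j l * (\<Sum>k<n. of_real (W $$ (k,l)) * v k))"
proof -
  have "(\<Sum>i<n. \<Sum>k<n. cnj (v i) * noise K W \<omega> i k * v k)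
    = (\<Sum>i<n. \<Sum>k<n. \<Sum>j<2*K. \<Sum>l<2*K. (of_real (W $$ (i,j)) * cnj (v i)) * bath_corr K \<omega> j l * (of_real (W $$ (k,l)) * v k))"
    unfolding noise_def sum_distrib_left sum_distrib_right by (simp only: mult_ac)
  also have "\<dots> = (\<Sum>j<2*K. \<Sum>l<2*K. \<Sum>i<n. \<Sum>k<n. (of_real (W $$ (i,j)) * cnj (v i)) * bath_corr K \<omega> j l * (of_real (W $$ (k,l)) * v k))"
    by (simp only: sum.swap[of _ "{..<2*K}" "{..<n}"])
  also have "\<dots> = (\<Sum>j<2*K. \<Sum>l<2*K. cnj (\<Sum>i<n. of_real (W $$ (i,j)) * v i) * bath_corr K \<omega> j l * (\<Sum>k<n. of_real (W $$ (k,l)) * v k))"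
  proof (intro sum.cong refl)
    have e: "(\<Sum>i<n. \<Sum>k<n. p i * G * q k) = sum p {..<n} * G * sum q {..<n}" for p q and G :: complex
      by (simp only: sum_distrib_right[symmetric] sum_distrib_left[symmetric])
    fix j l
    show "(\<Sum>i<n. \<Sum>k<n. (of_real (W $$ (i,j)) * cnj (v i)) * bath_corr K \<omega> j l * (of_real (W $$ (k,l)) * v k))
      = cnj (\<Sum>i<n. of_real (W $$ (i,j)) * v i) * bath_corr K \<omega> j l * (\<Sum>k<n. of_real (W $$ (k,l)) * v k)"
      unfolding e by simp
  qed
  finally show ?thesis .
qed

lemma majo_adjoint: "i < 2 * n \<Longrightarrow> mat_adjoint (majo esb n i) = majo esb n i"
proof (cases esb)
  case False
  assume i: "i < 2 * n"
  note m = majorana_carrier[OF i]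
  have "mat_adjoint (majo False n i) = - \<i> \<cdot>\<^sub>m (majorana n i * fock_parity n)"
    by (simp add: majo_def mat_adjoint_smult mat_adjoint_mult[OF fock_parity_carrier m] majorana_adjoint[OF i] fock_parity_adjoint)
  also have "\<dots> = \<i> \<cdot>\<^sub>m (- 1 \<cdot>\<^sub>m (majorana n i * fock_parity n))" by (rule eq_matI) auto
  finally show ?thesis using False by (simp add: majo_def majorana_parity[OF i])
qed (simp add: majo_def majorana_adjoint)

text \<open>Tested on matrix units. It supplies the uniqueness behind the definite description in
  \<open>Phi\<close>.\<close>

lemma mtrace_adjoint_mult_unique:
  assumes Y: "Y \<in> carrier_mat d d" and Z: "Z \<in> carrier_mat d d"
    and eq: "\<And>\<rho>. \<rho> \<in> carrier_mat d d \<Longrightarrow> mtrace (mat_adjoint Y * \<rho>) = mtrace (mat_adjoint Z * \<rho>)"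
  shows "Y = Z"
proof (rule eq_matI)
  fix i j assume "i < dim_row Z" "j < dim_col Z"
  hence ij: "i < d" "j < d" using Z by auto
  let ?E = "mat d d (\<lambda>(a,b). if a = i \<and> b = j then 1 else 0) :: complex mat"
  have "mtrace (mat_adjoint M * ?E) = cnj (M $$ (i,j))" if M: "M \<in> carrier_mat d d" for M
  proof -
    have E: "?E \<in> carrier_mat d d" and Ma: "mat_adjoint M \<in> carrier_mat d d" using M by auto
    have "(mat_adjoint M * ?E) $$ (b,b) = (if b = j then cnj (M $$ (i,j)) else 0)" if b: "b < d" for b
    proof -
      have "(mat_adjoint M * ?E) $$ (b,b) = (\<Sum>k<d. if k = i then (if b = j then cnj (M $$ (k,b)) else 0) else 0)"
        unfolding index_mult_sum[OF Ma E b b] using M b by (intro sum.cong refl) auto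
      thus ?thesis using ij by simp
    qed
    hence "mtrace (mat_adjoint M * ?E) = (\<Sum>b<d. if b = j then cnj (M $$ (i,j)) else 0)"
      unfolding mtrace_def using M by (intro sum.cong) (auto simp del: index_mult_mat(1))
    thus ?thesis using ij by simp
  qed
  from this[OF Y] this[OF Z] eq[of ?E] show "Y $$ (i,j) = Z $$ (i,j)" by simp
qed (use Y Z in auto)

section \<open>The model and its generator\<close>

locale fermion_model =
  fixes L K :: nat and esb :: bool and R W :: "real mat"
  assumes L: "0 < L" and K: "0 < K"
    and Rc: "R \<in> carrier_mat (2*L) (2*L)" and Ra: "\<And>i j. i < 2*L \<Longrightarrow> j < 2*L \<Longrightarrow> R $$ (i,j) = - R $$ (j,i)"
    and Wc: "W \<in> carrier_mat (2*L) (2*K)"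
begin

sublocale majorana_algebra "2 * L" "opm (2 ^ L) ` carrier_mat (2 ^ L) (2 ^ L)" "\<lambda>i. opm (2 ^ L) (majo esb L i)"
    "opm (2 ^ L) (fock_parity L)" "ltr (2 ^ L)"
  by (rule majorana_algebra_majo[OF L])

definition T :: "complex mat" where "T = map_mat (\<lambda>x. \<i> * complex_of_real x) R"
definition \<Theta> :: "complex mat" where "\<Theta> = map_mat (\<lambda>x. \<i> * complex_of_real x) W"
abbreviation "R\<^sub>f \<equiv> \<lambda>i j. R $$ (i,j)"
abbreviation "W\<^sub>f \<equiv> \<lambda>i j. W $$ (i,j)"
abbreviation "N \<equiv> drift (2 * K) R\<^sub>f W\<^sub>f"
abbreviation "d \<equiv> (2 ^ L :: nat)"
abbreviation "g \<equiv> \<lambda>i. opm (2 ^ L) (majo esb L i)"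
abbreviation "emb \<equiv> opm (2 ^ L)"

lemma int_V_kron:
  "int_V esb L K \<Theta> = msum (d * 2 ^ K) (d * 2 ^ K) (\<lambda>p. \<Theta> $$ p \<cdot>\<^sub>m
     kron (if esb then majorana L (fst p) * fock_parity L else majorana L (fst p))
       (if esb then majorana K (snd p) else fock_parity K * majorana K (snd p)))
     ({..<2*L} \<times> {..<2*K})"
  unfolding int_V_def
proof (rule msum_cong)
  fix p assume "p \<in> {..<2*L} \<times> {..<2*K}"
  then obtain i j where p: "p = (i,j)" and ij: "i < 2 * L" "j < 2 * K" by auto
  note m = majorana_carrier[OF ij(1)] majorana_carrier[OF ij(2)]
  show "(case p of (i,j) \<Rightarrow> \<Theta> $$ (i,j) \<cdot>\<^sub>m (gammaS esb L K i * gammaB esb L K j)) = \<Theta> $$ p \<cdot>\<^sub>m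
     kron (if esb then majorana L (fst p) * fock_parity L else majorana L (fst p))
       (if esb then majorana K (snd p) else fock_parity K * majorana K (snd p))"
    by (simp add: p gammaS_def gammaB_def kron_mult[OF m(1) fock_parity_carrier one_carrier_mat m(2)]
       kron_mult[OF m(1) one_carrier_mat fock_parity_carrier m(2)] left_mult_one_mat[OF m(2)] right_mult_one_mat[OF m(1)])
qed

lemma opm_msum_msum:
  assumes "\<And>p q. p \<in> I \<Longrightarrow> q \<in> I \<Longrightarrow> F p q \<in> carrier_mat d d" "finite I"
  shows "emb (msum d d (\<lambda>p. msum d d (F p) I) I) = (\<Sum>p\<in>I. \<Sum>q\<in>I. emb (F p q))"
proof -
  have "emb (msum d d (\<lambda>p. msum d d (F p) I) I) = (\<Sum>p\<in>I. emb (msum d d (F p) I))"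
    by (rule opm_msum) (use assms in simp_all)
  also have "\<dots> = (\<Sum>p\<in>I. \<Sum>q\<in>I. emb (F p q))"
    by (intro sum.cong refl opm_msum) (use assms in simp_all)
  finally show ?thesis .
qed

text \<open>Both copies of \<open>V\<close> are expanded into tensor products; the partial trace
  turns each bath factor into a two-point function. The parities that the identification attaches to
  one side produce the twist of the system operator.\<close>

lemma opm_PhiStar:
  assumes \<rho>: "\<rho> \<in> carrier_mat d d" and \<omega>: "\<omega> \<in> carrier_mat (2 ^ K) (2 ^ K)"
  shows "emb (PhiStar esb L K \<Theta> \<omega> \<rho>) = (\<Sum>i<2*L. \<Sum>k<2*L. sc (noise K W \<omega> i k) (g i * tw (emb \<rho>) * g k))"
    and "PhiStar esb L K \<Theta> \<omega> \<rho> \<in> carrier_mat d d"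
proof -
  show "PhiStar esb L K \<Theta> \<omega> \<rho> \<in> carrier_mat d d" by (simp add: PhiStar_def ptrace_B_def)
  let ?D = "2 ^ K :: nat"
  let ?I = "{..<2*L} \<times> {..<2*K}"
  \<comment> \<open>The system and bath factors of a term of \<open>V\<close>: the parity multiplies
    the system factor if \<open>esb\<close> holds and the bath factor otherwise.\<close>
  define u where "u i = (if esb then majorana L i * fock_parity L else majorana L i)" for i
  define v where "v j = (if esb then majorana K j else fock_parity K * majorana K j)" for j
  define t where "t p = \<Theta> $$ p \<cdot>\<^sub>m kron (u (fst p)) (v (snd p))" for p
  define F where "F p q = (\<Theta> $$ p * \<Theta> $$ q * mtrace (v (snd p) * \<omega> * v (snd q))) \<cdot>\<^sub>m (u (fst p) * \<rho> * u (fst q))" for p q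
  define h where "h i j k l = sc (of_real (W $$ (i,j)) * of_real (W $$ (k,l)) * bath_corr K \<omega> j l) (g i * tw (emb \<rho>) * g k)" for i j k l
  let ?X = "kron \<rho> \<omega>"
  have u: "u i \<in> carrier_mat d d" if "i < 2 * L" for i
    unfolding u_def using majorana_carrier[OF that] mult_sq_carrier[OF majorana_carrier[OF that] fock_parity_carrier] by simp
  have v: "v j \<in> carrier_mat ?D ?D" if "j < 2 * K" for j
    unfolding v_def using majorana_carrier[OF that] mult_sq_carrier[OF fock_parity_carrier majorana_carrier[OF that]] by simp
  have X: "?X \<in> carrier_mat (d * ?D) (d * ?D)" using \<rho> \<omega> by (rule kron_carrier)
  have t: "t p \<in> carrier_mat (d * ?D) (d * ?D)" if "p \<in> ?I" for p
    unfolding t_def by (intro smult_carrier_mat kron_carrier u v) (use that in auto)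
  note tX = mult_sq_carrier[OF t X]
  have F: "F p q \<in> carrier_mat d d" if "p \<in> ?I" "q \<in> ?I" for p q
    unfolding F_def by (intro smult_carrier_mat mult_sq_carrier[OF mult_sq_carrier[OF u \<rho>] u]) (use that in auto)
  have V: "int_V esb L K \<Theta> = msum (d * ?D) (d * ?D) t ?I" unfolding int_V_kron t_def u_def v_def ..
  have "int_V esb L K \<Theta> * ?X * int_V esb L K \<Theta>
     = msum (d * ?D) (d * ?D) (\<lambda>p. t p * ?X) ?I * msum (d * ?D) (d * ?D) t ?I"
    unfolding V by (subst msum_mult_right[OF t X]) auto
  also have "\<dots> = msum (d * ?D) (d * ?D) (\<lambda>p. t p * ?X * msum (d * ?D) (d * ?D) t ?I) ?I"
    by (rule msum_mult_right[OF tX]) auto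
  also have "\<dots> = msum (d * ?D) (d * ?D) (\<lambda>p. msum (d * ?D) (d * ?D) (\<lambda>q. t p * ?X * t q) ?I) ?I"
    by (rule msum_cong, rule mult_msum[OF t tX])
  finally have "PhiStar esb L K \<Theta> \<omega> \<rho> = msum d d (\<lambda>p. msum d d (\<lambda>q. ptrace_B d ?D (t p * ?X * t q)) ?I) ?I"
    unfolding PhiStar_def by (simp only: ptrace_msum)
  also have "\<dots> = msum d d (\<lambda>p. msum d d (F p) ?I) ?I"
  proof (rule msum_cong, rule msum_cong)
    fix p q assume pq: "p \<in> ?I" "q \<in> ?I"
    hence c: "fst p < 2*L" "snd p < 2*K" "fst q < 2*L" "snd q < 2*K" by auto
    note uv = u[OF c(1)] v[OF c(2)] u[OF c(3)] v[OF c(4)]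
    note k1 = kron_carrier[OF uv(1,2)] and k2 = kron_carrier[OF uv(3,4)]
    have "t p * ?X * t q = (\<Theta> $$ p * \<Theta> $$ q) \<cdot>\<^sub>m (kron (u (fst p)) (v (snd p)) * ?X * kron (u (fst q)) (v (snd q)))"
      unfolding t_def mult_smult_assoc_mat[OF k1 X] mult_smult_distrib[OF smult_carrier_mat[OF mult_sq_carrier[OF k1 X]] k2]
        mult_smult_assoc_mat[OF mult_sq_carrier[OF k1 X] k2] smult_smult_times by (simp add: mult.commute)
    also have "kron (u (fst p)) (v (snd p)) * ?X * kron (u (fst q)) (v (snd q)) = kron (u (fst p) * \<rho> * u (fst q)) (v (snd p) * \<omega> * v (snd q))"
      unfolding kron_mult[OF uv(1) \<rho> uv(2) \<omega>]
        kron_mult[OF mult_sq_carrier[OF uv(1) \<rho>] uv(3) mult_sq_carrier[OF uv(2) \<omega>] uv(4)] ..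
    finally have "t p * ?X * t q = kron ((\<Theta> $$ p * \<Theta> $$ q) \<cdot>\<^sub>m (u (fst p) * \<rho> * u (fst q))) (v (snd p) * \<omega> * v (snd q))"
      unfolding kron_smult_left .
    moreover have "ptrace_B d ?D (kron ((\<Theta> $$ p * \<Theta> $$ q) \<cdot>\<^sub>m (u (fst p) * \<rho> * u (fst q))) (v (snd p) * \<omega> * v (snd q)))
       = mtrace (v (snd p) * \<omega> * v (snd q)) \<cdot>\<^sub>m ((\<Theta> $$ p * \<Theta> $$ q) \<cdot>\<^sub>m (u (fst p) * \<rho> * u (fst q)))"
      by (rule ptrace_kron[OF smult_carrier_mat[OF mult_sq_carrier[OF mult_sq_carrier[OF uv(1) \<rho>] uv(3)]]
        mult_sq_carrier[OF mult_sq_carrier[OF uv(2) \<omega>] uv(4)]])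
    ultimately show "ptrace_B d ?D (t p * ?X * t q) = F p q"
      by (simp only: F_def smult_smult_times mult.commute)
  qed
  finally have eq: "PhiStar esb L K \<Theta> \<omega> \<rho> = msum d d (\<lambda>p. msum d d (F p) ?I) ?I" .
  have "emb (PhiStar esb L K \<Theta> \<omega> \<rho>) = (\<Sum>p\<in>?I. \<Sum>q\<in>?I. emb (F p q))"
    unfolding eq by (rule opm_msum_msum, rule F) auto
  also have "\<dots> = (\<Sum>p\<in>?I. \<Sum>q\<in>?I. h (fst p) (snd p) (fst q) (snd q))"
  proof (rule sum.cong[OF refl], rule sum.cong[OF refl])
    fix p q assume pq: "p \<in> ?I" "q \<in> ?I"
    then obtain i j k l where p: "p = (i,j)" and q: "q = (k,l)" and c: "i < 2*L" "j < 2*K" "k < 2*L" "l < 2*K" by auto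
    note uv = u[OF c(1)] v[OF c(2)] u[OF c(3)] v[OF c(4)]
    let ?p = "emb (fock_parity L)" and ?\<gamma> = "\<lambda>i. emb (majorana L i)" and ?x = "emb \<rho>"
    \<comment> \<open>The two factors \<open>\<i>\<close> of \<Theta> give one sign. Moving a parity
      past a Majorana operator gives another, in \<open>uxu\<close> if \<open>esb\<close> holds and
      in \<open>vv\<close> otherwise, so the noise enters with a plus in both cases.\<close>
    have th: "\<Theta> $$ p * \<Theta> $$ q = - (of_real (W $$ (i,j)) * of_real (W $$ (k,l)))"
      using c Wc by (simp add: \<Theta>_def p q complex_eq_iff)
    note m = majorana_carrier[OF c(4)] majorana_carrier[OF c(2)]
    have vv: "v l * v j = (if esb then 1 else - 1) \<cdot>\<^sub>m (majorana K l * majorana K j)"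
    proof (cases esb)
      case False
      note pm = mult_sq_carrier[OF fock_parity_carrier m(1)] mult_sq_carrier[OF fock_parity_carrier m(2)]
      have "opm ?D (fock_parity K * majorana K l * (fock_parity K * majorana K j)) = opm ?D (- 1 \<cdot>\<^sub>m (majorana K l * majorana K j))"
      proof -
        let ?q = "opm ?D (fock_parity K)" and ?\<delta> = "\<lambda>i. opm ?D (majorana K i)"
        have "- (?q * ?\<delta> l * (?q * ?\<delta> j)) = ?\<delta> l * ?\<delta> j"
          using majo_mult[OF c(4,2), of False] c by (simp add: opm_majo sc_minus_left)
        hence "?q * ?\<delta> l * (?q * ?\<delta> j) = sc (- 1) (?\<delta> l * ?\<delta> j)" by (metis minus_minus sc_minus_left sc_one)
        thus ?thesis
          unfolding opm_mult[OF two_pow_pos pm] opm_smult[OF two_pow_pos mult_sq_carrier[OF m]] opm_mult[OF two_pow_pos m]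
            opm_mult[OF two_pow_pos fock_parity_carrier m(1)] opm_mult[OF two_pow_pos fock_parity_carrier m(2)] .
      qed
      hence "fock_parity K * majorana K l * (fock_parity K * majorana K j) = - 1 \<cdot>\<^sub>m (majorana K l * majorana K j)"
        by (rule opm_inj[rotated 2]) (intro mult_sq_carrier[OF pm] smult_carrier_mat[OF mult_sq_carrier[OF m]])+
      thus ?thesis using False by (simp add: v_def)
    qed (simp add: v_def)
    have tr: "mtrace (v j * \<omega> * v l) = (if esb then 1 else - 1) * bath_corr K \<omega> j l"
    proof -
      have "mtrace (v j * \<omega> * v l) = mtrace (v l * (v j * \<omega>))"
        by (rule mtrace_mult_comm[OF mult_sq_carrier[OF uv(2) \<omega>] uv(4)])
      also have "\<dots> = mtrace (v l * v j * \<omega>)" unfolding assoc_mult_mat[OF uv(4,2) \<omega>] ..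
      also have "\<dots> = mtrace (\<omega> * (v l * v j))" by (rule mtrace_mult_comm[OF mult_sq_carrier[OF uv(4,2)] \<omega>])
      also have "\<dots> = (if esb then 1 else - 1) * bath_corr K \<omega> j l"
        unfolding vv mult_smult_distrib[OF \<omega> mult_sq_carrier[OF m]] mtrace_smult[OF mult_sq_carrier[OF \<omega> mult_sq_carrier[OF m]]] bath_corr_def ..
      finally show ?thesis .
    qed
    \<comment> \<open>If \<open>esb\<close> holds, the parities inside \<open>u\<close> surround the
      operator and create the twist. Otherwise the parities contained in \<open>g\<close> undo the
      twist on the right side.\<close>
    have uxu: "emb (u i * \<rho> * u k) = sc (if esb then - 1 else 1) (g i * tw ?x * g k)"
    proof -
      note mL = majorana_carrier[OF c(1)] majorana_carrier[OF c(3)]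
      have e: "emb (u i * \<rho> * u k) = emb (u i) * ?x * emb (u k)"
        unfolding opm_mult[OF two_pow_pos mult_sq_carrier[OF uv(1) \<rho>] uv(3)] opm_mult[OF two_pow_pos uv(1) \<rho>] ..
      show ?thesis
      proof (cases esb)
        case True
        have "?\<gamma> i * ?p * ?x * (?\<gamma> k * ?p) = - (?\<gamma> i * ?p * ?x * (?p * ?\<gamma> k))"
          using opm_majorana_parity[OF c(3)] by simp
        thus ?thesis using True c e
          by (simp add: u_def opm_majo opm_mult[OF _ mL(1) fock_parity_carrier] opm_mult[OF _ mL(2) fock_parity_carrier] tw_def mult.assoc sc_minus_left)
      next
        case False
        have "?p * ?\<gamma> i * (?p * ?x * ?p) * (?p * ?\<gamma> k) = - (?\<gamma> i * ?p * (?p * ?x * ?p) * (?p * ?\<gamma> k))"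
          using opm_majorana_parity[OF c(1)] by simp
        also have "\<dots> = - (?\<gamma> i * ?x * ?\<gamma> k)" by (simp add: mult.assoc opm_parity_parity)
        finally show ?thesis using False c e by (simp add: u_def opm_majo tw_def mult.assoc sc_minus_left)
      qed
    qed
    have "emb (F p q) = sc (\<Theta> $$ p * \<Theta> $$ q * mtrace (v j * \<omega> * v l)) (emb (u i * \<rho> * u k))"
      unfolding F_def by (simp only: p q fst_conv snd_conv, rule opm_smult[OF _ mult_sq_carrier[OF mult_sq_carrier[OF uv(1) \<rho>] uv(3)]]) simp
    thus "emb (F p q) = h (fst p) (snd p) (fst q) (snd q)"
      unfolding tr uxu th[unfolded p q] sc_sc h_def p q fst_conv snd_conv by (cases esb) simp_all
  qed
  also have "\<dots> = (\<Sum>i<2*L. \<Sum>j<2*K. \<Sum>k<2*L. \<Sum>l<2*K. h i j k l)"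
  proof -
    have S: "(\<Sum>p\<in>?I. f (fst p) (snd p)) = (\<Sum>i<2*L. \<Sum>j<2*K. f i j)" for f :: "nat \<Rightarrow> nat \<Rightarrow> lop"
      unfolding sum.cartesian_product split_def ..
    show ?thesis unfolding S[of "\<lambda>i j. \<Sum>q\<in>?I. h i j (fst q) (snd q)"] by (intro sum.cong refl S)
  qed
  also have "\<dots> = (\<Sum>i<2*L. \<Sum>k<2*L. \<Sum>j<2*K. \<Sum>l<2*K. h i j k l)"
    by (intro sum.cong refl sum.swap)
  finally show "emb (PhiStar esb L K \<Theta> \<omega> \<rho>) = (\<Sum>i<2*L. \<Sum>k<2*L. sc (noise K W \<omega> i k) (g i * tw (emb \<rho>) * g k))"
    by (simp add: noise_def sc_sum_left h_def)
qed

lemma opm_quadratic: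
  "emb (msum d d (\<lambda>(i,j). C $$ (i,j) \<cdot>\<^sub>m (majorana L i * majorana L j)) ({..<2*L} \<times> {..<2*L}))
    = (\<Sum>i<2*L. \<Sum>j<2*L. sc (C $$ (i,j)) (g i * g j))"
proof -
  let ?J = "{..<2*L} \<times> {..<2*L}"
  let ?f = "\<lambda>(i,j). C $$ (i,j) \<cdot>\<^sub>m (majorana L i * majorana L j)"
  have f: "?f p \<in> carrier_mat d d" if "p \<in> ?J" for p
    using that mult_sq_carrier[OF majorana_carrier majorana_carrier] by auto
  have "emb (msum d d ?f ?J) = (\<Sum>p\<in>?J. emb (?f p))" by (rule opm_msum[OF two_pow_pos f]) simp_all
  also have "\<dots> = (\<Sum>(i,j)\<in>?J. sc (C $$ (i,j)) (g i * g j))"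
  proof (rule sum.cong[OF refl])
    fix p assume "p \<in> ?J"
    then obtain i j where p: "p = (i,j)" and ij: "i < 2*L" "j < 2*L" by auto
    note m = majorana_carrier[OF ij(1)] majorana_carrier[OF ij(2)]
    show "emb (?f p) = (case p of (i,j) \<Rightarrow> sc (C $$ (i,j)) (g i * g j))"
      unfolding p split opm_smult[OF two_pow_pos mult_sq_carrier[OF m]] opm_mult[OF two_pow_pos m] majo_mult[OF ij] ..
  qed
  finally show ?thesis by (simp add: sum.cartesian_product)
qed

lemma sys_H_eq: "emb (sys_H L T) = sc (1/2) (\<Sum>i<2*L. \<Sum>j<2*L. sc (\<i> * of_real (R $$ (i,j))) (g i * g j))"
  and sys_H_carrier: "sys_H L T \<in> carrier_mat d d"
proof -
  show "sys_H L T \<in> carrier_mat d d" unfolding sys_H_def by (intro smult_carrier_mat msum_carrier)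
  have "emb (sys_H L T) = sc (1/2) (\<Sum>i<2*L. \<Sum>j<2*L. sc (T $$ (i,j)) (g i * g j))"
    unfolding sys_H_def opm_smult[OF two_pow_pos msum_carrier] opm_quadratic ..
  also have "(\<Sum>i<2*L. \<Sum>j<2*L. sc (T $$ (i,j)) (g i * g j)) = (\<Sum>i<2*L. \<Sum>j<2*L. sc (\<i> * of_real (R $$ (i,j))) (g i * g j))"
    by (intro sum.cong refl) (use Rc in \<open>simp add: T_def\<close>)
  finally show "emb (sys_H L T) = sc (1/2) (\<Sum>i<2*L. \<Sum>j<2*L. sc (\<i> * of_real (R $$ (i,j))) (g i * g j))" .
qed

text \<open>The candidate \<open>Z\<close> is guessed from the jump term with its factors moved
  around the trace; cyclicity verifies the defining duality.\<close>

lemma Phi_one: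
  assumes w: "bath_state (2 ^ K) \<omega>"
  shows "emb (Phi esb L K \<Theta> \<omega> (1\<^sub>m d)) = (\<Sum>i<2*L. \<Sum>k<2*L. sc (noise K W \<omega> i k) (g k * g i))"
    and "Phi esb L K \<Theta> \<omega> (1\<^sub>m d) \<in> carrier_mat d d"
proof -
  have \<omega>: "\<omega> \<in> carrier_mat (2 ^ K) (2 ^ K)" using w by (simp add: bath_state_def)
  let ?A = "noise K W \<omega>"
  let ?z = "\<lambda>i k. ?A i k \<cdot>\<^sub>m (majo esb L k * majo esb L i)"
  define Z where "Z = msum d d (\<lambda>i. msum d d (?z i) {..<2*L}) {..<2*L}"
  have zc: "?z i k \<in> carrier_mat d d" if "i \<in> {..<2*L}" "k \<in> {..<2*L}" for i k
    using that mult_sq_carrier[OF majo_carrier majo_carrier, of k L i esb esb] by auto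
  have Zc: "Z \<in> carrier_mat d d" by (simp add: Z_def)
  have Za: "mat_adjoint Z = Z"
  proof -
    have "mat_adjoint Z = msum d d (\<lambda>i. msum d d (\<lambda>k. mat_adjoint (?z i k)) {..<2*L}) {..<2*L}"
      unfolding Z_def by (subst mat_adjoint_msum, simp, intro msum_cong mat_adjoint_msum zc)
    also have "\<dots> = msum d d (\<lambda>i. msum d d (\<lambda>k. ?z k i) {..<2*L}) {..<2*L}"
    proof (intro msum_cong)
      fix i k assume "i \<in> {..<2*L}" "k \<in> {..<2*L}"
      hence ik: "i < 2*L" "k < 2*L" by auto
      show "mat_adjoint (?z i k) = ?z k i"
        unfolding mat_adjoint_smult mat_adjoint_mult[OF majo_carrier[OF ik(2)] majo_carrier[OF ik(1)]] majo_adjoint[OF ik(1)] majo_adjoint[OF ik(2)]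
          noise_cnj[OF w] ..
    qed
    also have "\<dots> = Z" unfolding Z_def by (rule eq_matI, simp only: index_msum dim_msum, rule sum.swap) simp_all
    finally show ?thesis .
  qed
  have "emb Z = (\<Sum>i<2*L. \<Sum>k<2*L. emb (?z i k))"
    unfolding Z_def by (rule opm_msum_msum, rule zc) auto
  also have "\<dots> = (\<Sum>i<2*L. \<Sum>k<2*L. sc (?A i k) (g k * g i))"
  proof (intro sum.cong refl)
    fix i k assume "i \<in> {..<2*L}" "k \<in> {..<2*L}"
    hence m: "majo esb L k \<in> carrier_mat d d" "majo esb L i \<in> carrier_mat d d" by auto
    show "emb (?z i k) = sc (?A i k) (g k * g i)"
      unfolding opm_smult[OF two_pow_pos mult_sq_carrier[OF m]] opm_mult[OF two_pow_pos m] ..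
  qed
  finally have Ze: "emb Z = (\<Sum>i<2*L. \<Sum>k<2*L. sc (?A i k) (g k * g i))" .
  have key: "mtrace (mat_adjoint Z * \<rho>) = mtrace (mat_adjoint (1\<^sub>m d) * PhiStar esb L K \<Theta> \<omega> \<rho>)" if \<rho>: "\<rho> \<in> carrier_mat d d" for \<rho>
  proof -
    have x: "emb \<rho> \<in> emb ` carrier_mat d d" using \<rho> by simp
    have P: "PhiStar esb L K \<Theta> \<omega> \<rho> \<in> carrier_mat d d" by (rule opm_PhiStar(2)[OF \<rho> \<omega>])
    have "mtrace (mat_adjoint (1\<^sub>m d) * PhiStar esb L K \<Theta> \<omega> \<rho>) = ltr d (emb (PhiStar esb L K \<Theta> \<omega> \<rho>))"
      using P by (simp add: ltr_opm)
    also have "\<dots> = (\<Sum>i<2*L. \<Sum>k<2*L. ?A i k * ltr d (g i * tw (emb \<rho>) * g k))"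
      unfolding opm_PhiStar(1)[OF \<rho> \<omega>] by (simp add: tr_sum ltr_sc)
    also have "\<dots> = (\<Sum>i<2*L. \<Sum>k<2*L. ?A i k * ltr d (g k * g i * emb \<rho>))"
    proof (intro sum.cong refl arg_cong2[of _ _ _ _ "(*)"])
      fix i k assume "i \<in> {..<2*L}" "k \<in> {..<2*L}"
      hence ik: "i < 2*L" "k < 2*L" by auto
      have "ltr d (g i * tw (emb \<rho>) * g k) = ltr d (g k * (g i * tw (emb \<rho>)))"
        by (rule tr_mult_comm) (intro mult_M tw_M g_M ik x)+
      also have "\<dots> = ltr d ((g k * g i * emb (fock_parity L)) * (emb \<rho> * emb (fock_parity L)))"
        by (simp add: tw_def mult.assoc)
      also have "\<dots> = ltr d ((emb \<rho> * emb (fock_parity L)) * (g k * g i * emb (fock_parity L)))"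
        by (rule tr_mult_comm) (intro mult_M g_M P_M ik x)+
      also have "(emb \<rho> * emb (fock_parity L)) * (g k * g i * emb (fock_parity L)) = emb \<rho> * tw (g k * g i)"
        by (simp add: tw_def mult.assoc)
      \<comment> \<open>A product of two Majorana operators is even, so the twist disappears under
        the trace.\<close>
      also have "tw (g k * g i) = g k * g i"
      proof -
        have "tw 1 = 1" by (simp add: tw_def PP)
        thus ?thesis using tw_g_left[OF ik(2), of "g i"] tw_g_left[OF ik(1), of 1] by simp
      qed
      also have "ltr d (emb \<rho> * (g k * g i)) = ltr d (g k * g i * emb \<rho>)"
        by (rule tr_mult_comm) (intro mult_M g_M ik x)+
      finally show "ltr d (g i * tw (emb \<rho>) * g k) = ltr d (g k * g i * emb \<rho>)" .
    qed
    also have "\<dots> = ltr d (emb Z * emb \<rho>)"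
      unfolding Ze by (simp add: sum_distrib_right tr_sum ltr_sc)
    also have "\<dots> = mtrace (Z * \<rho>)"
      using ltr_opm[OF mult_sq_carrier[OF Zc \<rho>]] opm_mult[OF _ Zc \<rho>] by simp
    finally show ?thesis unfolding Za ..
  qed
  have "Phi esb L K \<Theta> \<omega> (1\<^sub>m d) = Z"
    unfolding Phi_def
  proof (rule the_equality)
    show "Z \<in> carrier_mat d d \<and> (\<forall>\<rho>\<in>carrier_mat d d. mtrace (mat_adjoint Z * \<rho>) = mtrace (mat_adjoint (1\<^sub>m d) * PhiStar esb L K \<Theta> \<omega> \<rho>))"
      using Zc key by blast
    fix Y assume "Y \<in> carrier_mat d d \<and> (\<forall>\<rho>\<in>carrier_mat d d. mtrace (mat_adjoint Y * \<rho>) = mtrace (mat_adjoint (1\<^sub>m d) * PhiStar esb L K \<Theta> \<omega> \<rho>))"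
    thus "Y = Z" using mtrace_adjoint_mult_unique[OF _ Zc, of Y] key by metis
  qed
  thus "emb (Phi esb L K \<Theta> \<omega> (1\<^sub>m d)) = (\<Sum>i<2*L. \<Sum>k<2*L. sc (?A i k) (g k * g i))"
    and "Phi esb L K \<Theta> \<omega> (1\<^sub>m d) \<in> carrier_mat d d" using Ze Zc by auto
qed

lemma opm_lindbladian:
  assumes w: "bath_state (2 ^ K) \<omega>" and \<rho>: "\<rho> \<in> carrier_mat d d"
  shows "emb (lindbladian esb L K T \<Theta> \<omega> \<rho>) = gen N (noise K W \<omega>) (emb \<rho>)"
    and "lindbladian esb L K T \<Theta> \<omega> \<rho> \<in> carrier_mat d d"
proof -
  have \<omega>: "\<omega> \<in> carrier_mat (2 ^ K) (2 ^ K)" using w by (simp add: bath_state_def)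
  let ?A = "noise K W \<omega>" and ?H = "sys_H L T" and ?F = "Phi esb L K \<Theta> \<omega> (1\<^sub>m d)" and ?x = "emb \<rho>"
  let ?C = "PhiStar esb L K \<Theta> \<omega> \<rho>"
  note H = sys_H_carrier and F = Phi_one(2)[OF w] and C = opm_PhiStar(2)[OF \<rho> \<omega>]
  note h1 = mult_sq_carrier[OF H \<rho>] mult_sq_carrier[OF \<rho> H] and f1 = mult_sq_carrier[OF F \<rho>] mult_sq_carrier[OF \<rho> F]
  note c1 = smult_carrier_mat[OF minus_carrier_mat[OF h1(2), of "?H * \<rho>"], of "- \<i>"]
  note c2 = add_carrier_mat[OF C, of "- \<i> \<cdot>\<^sub>m (?H * \<rho> - \<rho> * ?H)"]
  note c3 = smult_carrier_mat[OF add_carrier_mat[OF f1(2), of "?F * \<rho>"], of "1/2"]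
  show "lindbladian esb L K T \<Theta> \<omega> \<rho> \<in> carrier_mat d d"
    unfolding lindbladian_def by (rule minus_carrier_mat[OF c3])
  have d0: "0 < d" by simp
  have "emb (lindbladian esb L K T \<Theta> \<omega> \<rho>)
    = sc (- \<i>) (emb ?H * ?x - ?x * emb ?H) + emb ?C - sc (1/2) (emb ?F * ?x + ?x * emb ?F)"
    unfolding lindbladian_def opm_diff[OF d0 c2 c3] opm_add[OF d0 c1 C] opm_smult[OF d0 minus_carrier_mat[OF h1(2)]]
      opm_diff[OF d0 h1] opm_mult[OF d0 H \<rho>] opm_mult[OF d0 \<rho> H] opm_smult[OF d0 add_carrier_mat[OF f1(2)]]
      opm_add[OF d0 f1] opm_mult[OF d0 F \<rho>] opm_mult[OF d0 \<rho> F] ..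
  \<comment> \<open>The factor \<open>- \<i>\<close> of the commutator, the 1/2 of the Hamiltonian
    and the \<open>\<i>\<close> in \<open>T\<close> multiply to the real coefficient
    \<open>R / 2\<close>.\<close>
  also have "sc (- \<i>) (emb ?H * ?x - ?x * emb ?H) = (\<Sum>i<2*L. \<Sum>j<2*L. sc (of_real (R\<^sub>f i j) / 2) (g i * g j * ?x - ?x * g i * g j))"
    unfolding sys_H_eq
    by (simp add: sum_distrib_left sum_distrib_right sc_sum_right sum_subtractf sc_diff_right mult.assoc)
  also have "emb ?C = (\<Sum>i<2*L. \<Sum>j<2*L. sc (?A i j) (g i * tw ?x * g j))" by (rule opm_PhiStar(1)[OF \<rho> \<omega>])
  also have "sc (1/2) (emb ?F * ?x + ?x * emb ?F) = (\<Sum>i<2*L. \<Sum>j<2*L. sc (?A i j) (sc (1/2) (g j * g i * ?x + ?x * g j * g i)))"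
    unfolding Phi_one(1)[OF w]
    by (simp add: sum_distrib_left sum_distrib_right sc_sum_right sum.distrib sc_add_right mult.assoc)
  finally have "emb (lindbladian esb L K T \<Theta> \<omega> \<rho>) = (\<Sum>i<2*L. \<Sum>j<2*L. sc (of_real (R\<^sub>f i j) / 2) (g i * g j * ?x - ?x * g i * g j))
     + (\<Sum>i<2*L. \<Sum>j<2*L. sc (?A i j) (g i * tw ?x * g j - sc (1/2) (g j * g i * ?x + ?x * g j * g i)))"
    by (simp add: sum_subtractf sc_diff_right)
  also have "\<dots> = gen N ?A ?x"
  proof (rule gen_eq[OF noise_sum[OF w]])
    fix i j assume "i < 2 * L" "j < 2 * L"
    from Ra[OF this] show "R\<^sub>f i j = (R\<^sub>f i j - R\<^sub>f j i) / 2" by simp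
  qed
  finally show "emb (lindbladian esb L K T \<Theta> \<omega> \<rho>) = gen N ?A ?x" .
qed

end

section \<open>Stationary operator and relaxation\<close>

definition linear_superop :: "nat \<Rightarrow> (complex mat \<Rightarrow> complex mat) \<Rightarrow> bool" where
  "linear_superop d F \<longleftrightarrow> (\<forall>\<rho>\<in>carrier_mat d d. F \<rho> \<in> carrier_mat d d) \<and>
    (\<forall>\<rho>\<in>carrier_mat d d. \<forall>\<sigma>\<in>carrier_mat d d. F (\<rho> + \<sigma>) = F \<rho> + F \<sigma>) \<and>
    (\<forall>c. \<forall>\<rho>\<in>carrier_mat d d. F (c \<cdot>\<^sub>m \<rho>) = c \<cdot>\<^sub>m F \<rho>)"

lemma linear_superop_carrier: "linear_superop d F \<Longrightarrow> \<rho> \<in> carrier_mat d d \<Longrightarrow> F \<rho> \<in> carrier_mat d d"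
  by (simp add: linear_superop_def)

lemma linear_superop_msum:
  assumes F: "linear_superop d F" and f: "\<And>k. k \<in> I \<Longrightarrow> f k \<in> carrier_mat d d" and I: "finite I"
  shows "F (msum d d f I) = msum d d (\<lambda>k. F (f k)) I"
  using I f
proof (induct I rule: finite_induct)
  case empty
  have z: "msum d d g {} = 0 \<cdot>\<^sub>m 1\<^sub>m d" for g :: "'a \<Rightarrow> complex mat" by (rule eq_matI) auto
  have c: "F (1\<^sub>m d) \<in> carrier_mat d d" by (rule linear_superop_carrier[OF F one_carrier_mat])
  have "F (0 \<cdot>\<^sub>m 1\<^sub>m d) = 0 \<cdot>\<^sub>m F (1\<^sub>m d)" using F one_carrier_mat unfolding linear_superop_def by blast
  also have "\<dots> = 0 \<cdot>\<^sub>m 1\<^sub>m d" by (rule eq_matI) (use c in auto)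
  finally show ?case unfolding z .
next
  case (insert k I)
  have s: "msum d d g (insert k I) = g k + msum d d g I" if "g k \<in> carrier_mat d d" for g :: "'a \<Rightarrow> complex mat"
    by (rule eq_matI) (use insert that in auto)
  have fk: "f k \<in> carrier_mat d d" using insert by simp
  have "F (f k + msum d d f I) = F (f k) + F (msum d d f I)"
    using F fk msum_carrier unfolding linear_superop_def by blast
  thus ?case unfolding s[of f, OF fk] s[of "\<lambda>k. F (f k)", OF linear_superop_carrier[OF F fk]]
    using insert by simp
qed

section \<open>Superoperators as matrices on vectorized operators\<close>

lemma unit_mat_at_carrier [simp]: "unit_mat_at d b \<in> carrier_mat d d" by (simp add: unit_mat_at_def)
lemma vec_of_carrier [simp]: "vec_of d \<rho> \<in> carrier_vec (d * d)" by (simp add: vec_of_def)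
lemma dim_vec_of [simp]: "dim_vec (vec_of d \<rho>) = d * d" by (simp add: vec_of_def)
lemma index_vec_of [simp]: "a < d * d \<Longrightarrow> vec_of d \<rho> $ a = \<rho> $$ (a div d, a mod d)" by (simp add: vec_of_def)
lemma unvec_carrier [simp]: "unvec d v \<in> carrier_mat d d" by (simp add: unvec_def)
lemma superop_mat_carrier [simp]: "superop_mat d F \<in> carrier_mat (d * d) (d * d)" by (simp add: superop_mat_def)

lemma dim_superop_mat [simp]: "dim_row (superop_mat d F) = d * d" "dim_col (superop_mat d F) = d * d"
  by (simp_all add: superop_mat_def)

lemma vec_of_unvec: "v \<in> carrier_vec (d * d) \<Longrightarrow> vec_of d (unvec d v) = v"
  by (rule eq_vecI) (auto simp: unvec_def div_mod_less)

lemma unvec_vec_of: "\<rho> \<in> carrier_mat d d \<Longrightarrow> unvec d (vec_of d \<rho>) = \<rho>"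
  by (rule eq_matI) (auto simp: unvec_def index_pair_less)

lemma unit_mat_expansion:
  assumes \<rho>: "\<rho> \<in> carrier_mat d d"
  shows "\<rho> = msum d d (\<lambda>b. \<rho> $$ (b div d, b mod d) \<cdot>\<^sub>m unit_mat_at d b) {..<d * d}"
proof (rule eq_matI)
  fix i j assume "i < dim_row (msum d d (\<lambda>b. \<rho> $$ (b div d, b mod d) \<cdot>\<^sub>m unit_mat_at d b) {..<d * d})"
    "j < dim_col (msum d d (\<lambda>b. \<rho> $$ (b div d, b mod d) \<cdot>\<^sub>m unit_mat_at d b) {..<d * d})"
  hence ij: "i < d" "j < d" by auto
  have "msum d d (\<lambda>b. \<rho> $$ (b div d, b mod d) \<cdot>\<^sub>m unit_mat_at d b) {..<d * d} $$ (i,j)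
    = (\<Sum>b<d * d. if i = b div d then (if j = b mod d then \<rho> $$ (b div d, b mod d) else 0) else 0)"
    unfolding index_msum[OF ij] using ij by (intro sum.cong refl) (auto simp: unit_mat_at_def)
  also have "\<dots> = (\<Sum>a<d. \<Sum>b<d. if i = a then (if j = b then \<rho> $$ (a, b) else 0) else 0)"
    by (rule sum_div_mod)
  also have "\<dots> = (\<Sum>a<d. if i = a then (\<Sum>b<d. if j = b then \<rho> $$ (a, b) else 0) else 0)"
    by (intro sum.cong refl) auto
  also have "\<dots> = \<rho> $$ (i,j)" using ij by simp
  finally show "\<rho> $$ (i,j) = msum d d (\<lambda>b. \<rho> $$ (b div d, b mod d) \<cdot>\<^sub>m unit_mat_at d b) {..<d * d} $$ (i,j)" ..
qed (use \<rho> in auto)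

lemma superop_mat_vec_of:
  assumes F: "linear_superop d F" and \<rho>: "\<rho> \<in> carrier_mat d d"
  shows "superop_mat d F *\<^sub>v vec_of d \<rho> = vec_of d (F \<rho>)"
proof (rule eq_vecI)
  fix a assume "a < dim_vec (vec_of d (F \<rho>))"
  hence a: "a < d * d" by simp
  note ad = div_mod_less[OF a]
  have h: "F (c \<cdot>\<^sub>m unit_mat_at d b) = c \<cdot>\<^sub>m F (unit_mat_at d b)" for c b
    using F unit_mat_at_carrier unfolding linear_superop_def by blast
  have Fu: "dim_row (F (unit_mat_at d b)) = d" "dim_col (F (unit_mat_at d b)) = d" for b
    using linear_superop_carrier[OF F unit_mat_at_carrier[of d b]] by auto
  have "F \<rho> = msum d d (\<lambda>b. F (\<rho> $$ (b div d, b mod d) \<cdot>\<^sub>m unit_mat_at d b)) {..<d * d}"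
    by (subst unit_mat_expansion[OF \<rho>], rule linear_superop_msum[OF F]) auto
  hence "vec_of d (F \<rho>) $ a = (\<Sum>b<d * d. \<rho> $$ (b div d, b mod d) * F (unit_mat_at d b) $$ (a div d, a mod d))"
    using a ad Fu by (simp add: h)
  also have "\<dots> = (superop_mat d F *\<^sub>v vec_of d \<rho>) $ a"
    unfolding index_mult_vec_sum[OF superop_mat_carrier vec_of_carrier a]
    using a by (intro sum.cong refl) (simp add: superop_mat_def mult.commute)
  finally show "(superop_mat d F *\<^sub>v vec_of d \<rho>) $ a = vec_of d (F \<rho>) $ a" ..
qed (simp add: superop_mat_def)

text \<open>The range of \<open>A\<close> lies in the kernel of \<open>u\<close>, and on this kernel
  \<open>A\<close> and \<open>B\<close> coincide; so all their powers agree on a vector of the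
  kernel. With \<open>u\<close> the trace, this exchanges the generator for its corrected version on
  traceless operators.\<close>

lemma mat_exp_agree:
  assumes A: "A \<in> carrier_mat n n" and B: "B \<in> carrier_mat n n" and v: "v \<in> carrier_vec n" "(\<Sum>i<n. u i * v $ i) = 0"
    and uA: "\<And>j. j < n \<Longrightarrow> (\<Sum>i<n. u i * A $$ (i,j)) = 0"
    and AB: "\<And>w. w \<in> carrier_vec n \<Longrightarrow> (\<Sum>i<n. u i * w $ i) = 0 \<Longrightarrow> A *\<^sub>v w = B *\<^sub>v w"
  shows "mat_exp A *\<^sub>v v = mat_exp B *\<^sub>v v"
proof -
  have shift: "C ^\<^sub>m Suc k *\<^sub>v w = C ^\<^sub>m k *\<^sub>v (C *\<^sub>v w)" if "C \<in> carrier_mat n n" "w \<in> carrier_vec n" for C :: "complex mat" and w k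
    using assoc_mult_mat_vec[OF pow_carrier_mat[OF that(1)] that] by simp
  have uAw: "(\<Sum>i<n. u i * (A *\<^sub>v w) $ i) = 0" if w: "w \<in> carrier_vec n" for w
  proof -
    have "(\<Sum>i<n. u i * (A *\<^sub>v w) $ i) = (\<Sum>i<n. \<Sum>j<n. u i * A $$ (i,j) * w $ j)"
      by (intro sum.cong refl) (simp add: index_mult_vec_sum[OF A w] sum_distrib_left mult.assoc del: index_mult_mat_vec)
    also have "\<dots> = (\<Sum>j<n. (\<Sum>i<n. u i * A $$ (i,j)) * w $ j)"
      unfolding sum_distrib_right by (rule sum.swap)
    finally show ?thesis by (simp add: uA)
  qed
  have pow: "w \<in> carrier_vec n \<Longrightarrow> (\<Sum>i<n. u i * w $ i) = 0 \<Longrightarrow> A ^\<^sub>m k *\<^sub>v w = B ^\<^sub>m k *\<^sub>v w" for k w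
  proof (induct k arbitrary: w)
    case 0 thus ?case using A B by simp
  next
    case (Suc k)
    note Aw = mult_mat_vec_carrier[OF A Suc.prems(1)]
    show ?case unfolding shift[OF A Suc.prems(1)] shift[OF B Suc.prems(1)] Suc.hyps[OF Aw uAw[OF Suc.prems(1)]]
      using AB[OF Suc.prems] by simp
  qed
  have ex: "(mat_exp C *\<^sub>v v) $ i = (\<Sum>k. (C ^\<^sub>m k *\<^sub>v v) $ i / fact k)" if C: "C \<in> carrier_mat n n" and i: "i < n" for C i
  proof -
    have "(mat_exp C *\<^sub>v v) $ i = (\<Sum>j<n. (\<Sum>k. (C ^\<^sub>m k) $$ (i,j) / fact k * v $ j))"
      unfolding index_mult_vec_sum[OF iffD2[OF mat_exp_carrier C] v(1) i]
    proof (intro sum.cong refl)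
      fix j assume "j \<in> {..<n}" hence j: "j < n" by simp
      show "mat_exp C $$ (i,j) * v $ j = (\<Sum>k. (C ^\<^sub>m k) $$ (i,j) / fact k * v $ j)"
        unfolding index_mat_exp(1)[OF C i j] by (rule suminf_mult2[OF index_mat_exp(2)[OF C i j]])
    qed
    also have "\<dots> = (\<Sum>k. \<Sum>j<n. (C ^\<^sub>m k) $$ (i,j) / fact k * v $ j)"
      by (rule suminf_sum[symmetric]) (rule summable_mult2[OF index_mat_exp(2)[OF C i]], simp)
    also have "\<dots> = (\<Sum>k. (C ^\<^sub>m k *\<^sub>v v) $ i / fact k)"
      unfolding index_mult_vec_sum[OF pow_carrier_mat[OF C] v(1) i] by (simp add: sum_divide_distrib)
    finally show ?thesis .
  qed
  show ?thesis
  proof (rule eq_vecI)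
    fix i assume "i < dim_vec (mat_exp B *\<^sub>v v)"
    hence i: "i < n" using B by simp
    show "(mat_exp A *\<^sub>v v) $ i = (mat_exp B *\<^sub>v v) $ i" unfolding ex[OF A i] ex[OF B i] pow[OF v] ..
  qed (use A B in simp)
qed

lemma inverse_of_injective:
  assumes A: "(A :: complex mat) \<in> carrier_mat n n" and inj: "\<And>v. v \<in> carrier_vec n \<Longrightarrow> A *\<^sub>v v = 0\<^sub>v n \<Longrightarrow> v = 0\<^sub>v n"
  obtains B where "B \<in> carrier_mat n n" "A * B = 1\<^sub>m n" "B * A = 1\<^sub>m n"
proof -
  have "det A \<noteq> 0" using det_0_iff_vec_prod_zero_field[OF A] inj by blast
  from det_non_zero_imp_unit[OF A this, of "()"] obtain B where "B \<in> carrier_mat n n" "A * B = 1\<^sub>m n" "B * A = 1\<^sub>m n"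
    unfolding Units_def ring_mat_def by auto
  thus ?thesis by (rule that)
qed

context majorana_algebra
begin

lemma gen_add: "gen N A (x + y) = gen N A x + gen N A y"
  by (simp add: gen_def a_add b_add sc_add_right sum.distrib algebra_simps)

lemma gen_sc: "gen N A (sc c x) = sc c (gen N A x)"
  by (simp add: gen_def a_sc b_sc sc_add_right sc_sum_right mult.commute)

text \<open>By \<open>tr_b\<close> the two terms of \<open>a i\<close> have equal trace, so
  first-order correlation functions are ordinary Majorana expectations.\<close>

lemma tr_a: assumes "i < n" "x \<in> \<M>" shows "tr (a i x) = tr (g i * x)"
proof -
  have "tr (g i * x + tw x * g i) = 0" using tr_b[OF assms] by (simp add: b_def tr_sc)
  hence "tr (tw x * g i) = - tr (g i * x)" by (simp add: tr_add eq_neg_iff_add_eq_0 add.commute)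
  thus ?thesis by (simp add: a_def tr_sc tr_diff)
qed

lemma tr_g: assumes "i < n" shows "tr (g i) = 0"
proof -
  have "tr (a i 1) = tr (g i)" using tr_a[OF assms one_M] by simp
  moreover have "a i 1 = 0" by (simp add: a_def tw_def PP)
  ultimately show ?thesis by simp
qed

lemma tr_g_g: assumes "i < n" "j < n" shows "tr (g i * g j) = (if i = j then tr 1 else 0)"
proof (cases "i = j")
  case False
  have "tr (g i * g j + g j * g i) = 0" using CAR[OF assms] False by simp
  moreover have "tr (g j * g i) = tr (g i * g j)" by (rule tr_mult_comm[OF g_M[OF assms(2)] g_M[OF assms(1)]])
  ultimately show ?thesis using False by (simp add: tr_add)
qed (use g_sq assms in simp)

end

section \<open>Spectrum of the generator and existence of the stationary operator\<close>

context fermion_model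
begin

definition unemb :: "lop \<Rightarrow> complex mat" where "unemb = inv_into (carrier_mat d d) emb"

lemma emb_unemb: "x \<in> emb ` carrier_mat d d \<Longrightarrow> emb (unemb x) = x"
  and unemb_carrier: "x \<in> emb ` carrier_mat d d \<Longrightarrow> unemb x \<in> carrier_mat d d"
  unfolding unemb_def by (rule f_inv_into_f, assumption) (rule inv_into_into)

text \<open>The noise matrix \<open>A\<close> is kept arbitrary because the Gaussian approximations of the stationary state
  are stationary for perturbed noise.\<close>
definition generator :: "(nat \<Rightarrow> nat \<Rightarrow> complex) \<Rightarrow> complex mat \<Rightarrow> complex mat" where
  "generator A \<rho> = unemb (gen N A (emb \<rho>))"

lemma generator_carrier: "\<rho> \<in> carrier_mat d d \<Longrightarrow> generator A \<rho> \<in> carrier_mat d d"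
  and emb_generator: "\<rho> \<in> carrier_mat d d \<Longrightarrow> emb (generator A \<rho>) = gen N A (emb \<rho>)"
  unfolding generator_def by (rule unemb_carrier emb_unemb, rule gen_M, simp)+

lemma generator_eqI: "\<rho> \<in> carrier_mat d d \<Longrightarrow> \<sigma> \<in> carrier_mat d d \<Longrightarrow> gen N A (emb \<rho>) = emb \<sigma> \<Longrightarrow> generator A \<rho> = \<sigma>"
  by (rule opm_inj[of _ d]) (simp_all add: generator_carrier emb_generator)

lemma generator_noise:
  assumes "bath_state (2 ^ K) \<omega>" "\<rho> \<in> carrier_mat d d"
  shows "lindbladian esb L K T \<Theta> \<omega> \<rho> = generator (noise K W \<omega>) \<rho>"
  by (rule generator_eqI[symmetric]) (use opm_lindbladian[OF assms] assms in auto)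

lemma linear_generator: "linear_superop d (generator A)"
  unfolding linear_superop_def
proof (intro conjI ballI allI)
  fix \<rho> \<sigma> :: "complex mat" and c assume c: "\<rho> \<in> carrier_mat d d"
  show "generator A \<rho> \<in> carrier_mat d d" by (rule generator_carrier[OF c])
  show "generator A (c \<cdot>\<^sub>m \<rho>) = c \<cdot>\<^sub>m generator A \<rho>"
    by (rule generator_eqI) (use c generator_carrier[OF c] in \<open>simp_all add: opm_smult gen_sc emb_generator\<close>)
  assume c': "\<sigma> \<in> carrier_mat d d"
  show "generator A (\<rho> + \<sigma>) = generator A \<rho> + generator A \<sigma>"
    by (rule generator_eqI) (use c c' generator_carrier[OF c] generator_carrier[OF c'] in \<open>simp_all add: opm_add gen_add emb_generator\<close>)
qed

lemma mtrace_generator: "\<rho> \<in> carrier_mat d d \<Longrightarrow> mtrace (generator A \<rho>) = 0"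
  using ltr_opm[OF generator_carrier] tr_gen[of "emb \<rho>" N A] by (simp add: emb_generator)

text \<open>Subtracting the projection onto the trace removes the eigenvalue 0 without changing the
  generator on traceless matrices.\<close>
definition generator' :: "(nat \<Rightarrow> nat \<Rightarrow> complex) \<Rightarrow> complex mat \<Rightarrow> complex mat" where
  "generator' A \<rho> = generator A \<rho> + (- mtrace \<rho> / of_nat d) \<cdot>\<^sub>m 1\<^sub>m d"

lemma linear_generator': "linear_superop d (generator' A)"
  unfolding linear_superop_def
proof (intro conjI ballI allI)
  note lin = linear_generator[of A, unfolded linear_superop_def]
  fix \<rho> \<sigma> :: "complex mat" and c assume c: "\<rho> \<in> carrier_mat d d"
  note gc = generator_carrier[OF c, of A]
  show "generator' A \<rho> \<in> carrier_mat d d" by (simp add: generator'_def)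
  have "generator A (c \<cdot>\<^sub>m \<rho>) = c \<cdot>\<^sub>m generator A \<rho>" using lin c by blast
  thus "generator' A (c \<cdot>\<^sub>m \<rho>) = c \<cdot>\<^sub>m generator' A \<rho>"
    unfolding generator'_def mtrace_smult[OF c] using gc by (intro eq_matI) (auto simp: algebra_simps)
  assume c': "\<sigma> \<in> carrier_mat d d"
  note gc' = generator_carrier[OF c', of A]
  have "generator A (\<rho> + \<sigma>) = generator A \<rho> + generator A \<sigma>" using lin c c' by blast
  thus "generator' A (\<rho> + \<sigma>) = generator' A \<rho> + generator' A \<sigma>"
    unfolding generator'_def mtrace_add[OF c c'] using gc gc' by (intro eq_matI) (auto simp: algebra_simps add_divide_distrib diff_divide_distrib)
qed

lemma mtrace_generator': "\<rho> \<in> carrier_mat d d \<Longrightarrow> mtrace (generator' A \<rho>) = - mtrace \<rho>"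
  unfolding generator'_def
  by (subst mtrace_add[of _ d]) (simp_all add: generator_carrier mtrace_generator mtrace_smult[of _ d] mtrace_one)

lemma generator'_traceless: "\<rho> \<in> carrier_mat d d \<Longrightarrow> mtrace \<rho> = 0 \<Longrightarrow> generator' A \<rho> = generator A \<rho>"
  unfolding generator'_def using generator_carrier[of \<rho> A] by (intro eq_matI) auto

definition controllable :: bool where "controllable \<longleftrightarrow> krylov (2 * L) (2 * K) R\<^sub>f W\<^sub>f"

text \<open>The corrected generator reverses the sign of the trace. An eigenvector with nonzero
  trace thus has eigenvalue -1; on a traceless one the correction vanishes and
  \<open>gen_eigenvalue\<close> applies.\<close>

lemma superop_generator'_eigenvalue:
  assumes controllable: controllable and ev: "eigenvalue (superop_mat d (generator' A)) \<mu>"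
  shows "Re \<mu> < 0"
proof -
  let ?S = "superop_mat d (generator' A)"
  have dS: "dim_row ?S = d * d" by (simp add: superop_mat_def)
  from ev obtain v where v: "v \<in> carrier_vec (d * d)" "v \<noteq> 0\<^sub>v (d * d)" "?S *\<^sub>v v = \<mu> \<cdot>\<^sub>v v"
    unfolding eigenvalue_def eigenvector_def dS by auto
  define \<rho> where "\<rho> = unvec d v"
  have \<rho>: "\<rho> \<in> carrier_mat d d" and v\<rho>: "vec_of d \<rho> = v" unfolding \<rho>_def using v(1) by (auto simp: vec_of_unvec)
  have "vec_of d (generator' A \<rho>) = \<mu> \<cdot>\<^sub>v vec_of d \<rho>"
    using superop_mat_vec_of[OF linear_generator' \<rho>, of A] v(3) v\<rho> by simp
  also have "\<dots> = vec_of d (\<mu> \<cdot>\<^sub>m \<rho>)" by (rule eq_vecI) (use \<rho> in \<open>auto simp: div_mod_less\<close>)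
  finally have "unvec d (vec_of d (generator' A \<rho>)) = unvec d (vec_of d (\<mu> \<cdot>\<^sub>m \<rho>))" by simp
  hence eq: "generator' A \<rho> = \<mu> \<cdot>\<^sub>m \<rho>"
    using unvec_vec_of[OF linear_superop_carrier[OF linear_generator' \<rho>], of A] unvec_vec_of[OF smult_carrier_mat[OF \<rho>], of \<mu>] by simp
  have t: "- mtrace \<rho> = \<mu> * mtrace \<rho>" using mtrace_generator'[OF \<rho>, of A] mtrace_smult[OF \<rho>, of \<mu>] eq by simp
  show ?thesis
  proof (cases "mtrace \<rho> = 0")
    case False
    have "(\<mu> + 1) * mtrace \<rho> = \<mu> * mtrace \<rho> + mtrace \<rho>" by (simp add: distrib_right)
    also have "\<dots> = 0" unfolding t[symmetric] by simp
    finally have "(\<mu> + 1) * mtrace \<rho> = 0" .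
    with False have "\<mu> = - 1" by (simp add: add_eq_0_iff2)
    thus ?thesis by simp
  next
    case True
    have "emb \<rho> \<noteq> 0"
    proof
      assume "emb \<rho> = 0"
      hence "emb \<rho> = emb (0 \<cdot>\<^sub>m \<rho>)" using \<rho> by (simp add: opm_smult)
      hence "\<rho> = 0 \<cdot>\<^sub>m \<rho>" by (intro opm_inj[OF \<rho> smult_carrier_mat[OF \<rho>]])
      hence "v = vec_of d (0 \<cdot>\<^sub>m \<rho>)" using v\<rho> by simp
      also have "\<dots> = 0\<^sub>v (d * d)" by (rule eq_vecI) (use \<rho> in \<open>auto simp: div_mod_less\<close>)
      finally show False using v(2) by simp
    qed
    moreover have "gen N A (emb \<rho>) = sc \<mu> (emb \<rho>)"
      using eq generator'_traceless[OF \<rho> True, of A] emb_generator[OF \<rho>, of A] \<rho> by (simp add: opm_smult)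
    moreover have "ltr d (emb \<rho>) = 0" using True ltr_opm[OF \<rho>] by simp
    ultimately show ?thesis
      using gen_eigenvalue[where R = R\<^sub>f and W = W\<^sub>f and m = "2 * K" and x = "emb \<rho>" and A = A and \<mu> = \<mu>, OF Ra _ imageI[OF \<rho>]]
        controllable unfolding controllable_def by blast
  qed
qed

lemma generator'_inverse:
  assumes controllable: controllable
  obtains B where "B \<in> carrier_mat (d * d) (d * d)" "superop_mat d (generator' A) * B = 1\<^sub>m (d * d)" "B * superop_mat d (generator' A) = 1\<^sub>m (d * d)"
proof (rule inverse_of_injective[OF superop_mat_carrier[of d "generator' A"]])
  fix v :: "complex vec" assume v: "v \<in> carrier_vec (d * d)" "superop_mat d (generator' A) *\<^sub>v v = 0\<^sub>v (d * d)"
  show "v = 0\<^sub>v (d * d)"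
  proof (rule ccontr)
    assume "v \<noteq> 0\<^sub>v (d * d)"
    hence "eigenvalue (superop_mat d (generator' A)) 0"
      unfolding eigenvalue_def eigenvector_def using v by (intro exI[of _ v]) (auto simp: superop_mat_def)
    from superop_generator'_eigenvalue[OF controllable this] show False by simp
  qed
qed

text \<open>Invertibility of the corrected generator solves
  \<open>generator' A \<rho> = - 1 / d\<close>. Taking traces gives
  \<open>mtrace \<rho> = 1\<close>, and then the correction term equals the right side, leaving
  \<open>generator A \<rho> = 0\<close>.\<close>

lemma stationary_exists:
  assumes controllable: controllable
  obtains \<rho> where "\<rho> \<in> carrier_mat d d" "mtrace \<rho> = 1" "generator A \<rho> = 0 \<cdot>\<^sub>m 1\<^sub>m d"
proof -
  let ?S = "superop_mat d (generator' A)"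
  from generator'_inverse[OF controllable, of A] obtain B where B: "B \<in> carrier_mat (d * d) (d * d)" "?S * B = 1\<^sub>m (d * d)" by blast
  let ?I = "(- 1 / of_nat d) \<cdot>\<^sub>m 1\<^sub>m d :: complex mat"
  define \<rho> where "\<rho> = unvec d (B *\<^sub>v vec_of d ?I)"
  have \<rho>: "\<rho> \<in> carrier_mat d d" by (simp add: \<rho>_def)
  have "vec_of d (generator' A \<rho>) = ?S *\<^sub>v vec_of d \<rho>" by (rule superop_mat_vec_of[OF linear_generator' \<rho>, symmetric])
  also have "vec_of d \<rho> = B *\<^sub>v vec_of d ?I" unfolding \<rho>_def by (rule vec_of_unvec[OF mult_mat_vec_carrier[OF B(1) vec_of_carrier]])
  also have "?S *\<^sub>v (B *\<^sub>v vec_of d ?I) = (?S * B) *\<^sub>v vec_of d ?I"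
    by (rule assoc_mult_mat_vec[symmetric, OF superop_mat_carrier B(1) vec_of_carrier])
  also have "\<dots> = vec_of d ?I" unfolding B(2) by (rule one_mult_mat_vec[OF vec_of_carrier])
  finally have "unvec d (vec_of d (generator' A \<rho>)) = unvec d (vec_of d ?I)" by simp
  hence eq: "generator' A \<rho> = ?I" using unvec_vec_of[OF linear_superop_carrier[OF linear_generator' \<rho>], of A] unvec_vec_of[of ?I d] by simp
  have "- mtrace \<rho> = mtrace ?I" using mtrace_generator'[OF \<rho>, of A] eq by simp
  also have "\<dots> = - 1" by (simp add: mtrace_smult[of _ d] mtrace_one)
  finally have t: "mtrace \<rho> = 1" by simp
  have "generator A \<rho> = 0 \<cdot>\<^sub>m 1\<^sub>m d"
  proof (rule eq_matI)
    fix i j assume ij: "i < dim_row (0 \<cdot>\<^sub>m 1\<^sub>m d :: complex mat)" "j < dim_col (0 \<cdot>\<^sub>m 1\<^sub>m d :: complex mat)"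
    have "generator' A \<rho> $$ (i,j) = ?I $$ (i,j)" unfolding eq ..
    thus "generator A \<rho> $$ (i,j) = (0 \<cdot>\<^sub>m 1\<^sub>m d) $$ (i,j)" using ij by (simp add: generator'_def t)
  qed (use generator_carrier[OF \<rho>, of A] in auto)
  with \<rho> t show ?thesis by (rule that)
qed

section \<open>The flow, its convergence and its first moments\<close>

definition flow :: "(nat \<Rightarrow> nat \<Rightarrow> complex) \<Rightarrow> real \<Rightarrow> complex mat \<Rightarrow> complex mat" where
  "flow A t \<rho> = unvec d (mat_exp (of_real t \<cdot>\<^sub>m superop_mat d (generator A)) *\<^sub>v vec_of d \<rho>)"

lemma semigroup_flow:
  assumes w: "bath_state (2 ^ K) \<omega>"
  shows "semigroup esb L K T \<Theta> \<omega> t \<rho> = flow (noise K W \<omega>) t \<rho>"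
proof -
  have "superop_mat d (lindbladian esb L K T \<Theta> \<omega>) = superop_mat d (generator (noise K W \<omega>))"
    unfolding superop_mat_def using generator_noise[OF w unit_mat_at_carrier] by simp
  thus ?thesis by (simp add: semigroup_def flow_def)
qed

lemma flow_carrier [simp]: "flow A t \<rho> \<in> carrier_mat d d" by (simp add: flow_def)

lemma flow_stationary:
  assumes \<rho>: "\<rho> \<in> carrier_mat d d" and st: "generator A \<rho> = 0 \<cdot>\<^sub>m 1\<^sub>m d" shows "flow A t \<rho> = \<rho>"
proof -
  let ?S = "superop_mat d (generator A)"
  have z: "?S *\<^sub>v vec_of d \<rho> = 0\<^sub>v (d * d)"
    unfolding superop_mat_vec_of[OF linear_generator \<rho>] st by (rule eq_vecI) (auto simp: div_mod_less)
  have "(of_real t \<cdot>\<^sub>m ?S) *\<^sub>v vec_of d \<rho> = of_real t \<cdot>\<^sub>v (?S *\<^sub>v vec_of d \<rho>)"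
    by (rule eq_vecI) (auto simp: superop_mat_def)
  also have "\<dots> = 0\<^sub>v (d * d)" unfolding z by (rule eq_vecI) auto
  finally have "mat_exp (of_real t \<cdot>\<^sub>m ?S) *\<^sub>v vec_of d \<rho> = vec_of d \<rho>"
    by (intro mat_exp_kernel[OF smult_carrier_mat[OF superop_mat_carrier] vec_of_carrier])
  thus ?thesis unfolding flow_def using \<rho> by (simp add: unvec_vec_of)
qed

lemma sum_trace_vec: "\<rho> \<in> carrier_mat d d \<Longrightarrow> (\<Sum>a<d * d. (if a div d = a mod d then 1 else 0) * vec_of d \<rho> $ a) = mtrace \<rho>"
proof -
  assume \<rho>: "\<rho> \<in> carrier_mat d d"
  have "(\<Sum>a<d * d. (if a div d = a mod d then 1 else 0) * vec_of d \<rho> $ a) = (\<Sum>a<d * d. if a mod d = a div d then \<rho> $$ (a div d, a mod d) else 0)"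
    by (intro sum.cong refl) auto
  also have "\<dots> = (\<Sum>a<d. \<Sum>b<d. if b = a then \<rho> $$ (a,b) else 0)" by (rule sum_div_mod)
  also have "\<dots> = mtrace \<rho>" using \<rho> by (simp add: mtrace_def)
  finally show ?thesis .
qed

text \<open>The difference of the two operators is traceless, so it evolves under the corrected
  generator as well, and that one is Hurwitz.\<close>

lemma flow_tendsto:
  assumes controllable: controllable and \<rho>: "\<rho> \<in> carrier_mat d d" "mtrace \<rho> = 1" "generator A \<rho> = 0 \<cdot>\<^sub>m 1\<^sub>m d"
    and \<sigma>: "\<sigma> \<in> carrier_mat d d" "mtrace \<sigma> = 1"
  shows "mat_tendsto (\<lambda>t. flow A t \<sigma>) \<rho> at_top"
  unfolding mat_tendsto_def
proof (intro conjI allI impI)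
  show "\<forall>\<^sub>F x in at_top. flow A x \<sigma> \<in> carrier_mat (dim_row \<rho>) (dim_col \<rho>)" using \<rho> by simp
  let ?S = "superop_mat d (generator A)" and ?S' = "superop_mat d (generator' A)" and ?n = "d * d"
  let ?u = "\<lambda>a. if a div d = a mod d then 1 else 0 :: complex"
  define \<tau> where "\<tau> = \<sigma> + - 1 \<cdot>\<^sub>m \<rho>"
  have \<tau>: "\<tau> \<in> carrier_mat d d" unfolding \<tau>_def using \<rho> \<sigma> by simp
  have t0: "mtrace \<tau> = 0" unfolding \<tau>_def using \<rho> \<sigma> by (simp add: mtrace_add[of _ d] mtrace_smult[of _ d])
  have same: "mat_exp (of_real t \<cdot>\<^sub>m ?S) *\<^sub>v vec_of d \<tau> = mat_exp (of_real t \<cdot>\<^sub>m ?S') *\<^sub>v vec_of d \<tau>" for t :: real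
  proof (rule mat_exp_agree[of _ ?n _ _ ?u])
    show "(\<Sum>i<?n. ?u i * vec_of d \<tau> $ i) = 0" using sum_trace_vec[OF \<tau>] t0 by simp
    show "(\<Sum>i<?n. ?u i * (of_real t \<cdot>\<^sub>m ?S) $$ (i,j)) = 0" if j: "j < ?n" for j
    proof -
      have "(\<Sum>i<?n. ?u i * (of_real t \<cdot>\<^sub>m ?S) $$ (i,j)) = of_real t * (\<Sum>i<?n. ?u i * vec_of d (generator A (unit_mat_at d j)) $ i)"
        unfolding sum_distrib_left using j by (intro sum.cong refl) (simp add: superop_mat_def)
      also have "\<dots> = 0" unfolding sum_trace_vec[OF generator_carrier[OF unit_mat_at_carrier]] by (simp add: mtrace_generator)
      finally show ?thesis .
    qed
    show "(of_real t \<cdot>\<^sub>m ?S) *\<^sub>v w = (of_real t \<cdot>\<^sub>m ?S') *\<^sub>v w" if w: "w \<in> carrier_vec ?n" "(\<Sum>i<?n. ?u i * w $ i) = 0" for w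
    proof -
      have u: "mtrace (unvec d w) = 0" using sum_trace_vec[of "unvec d w"] w by (simp add: vec_of_unvec)
      have "?S *\<^sub>v w = ?S' *\<^sub>v w"
        using superop_mat_vec_of[OF linear_generator[of A] unvec_carrier[of d w]] superop_mat_vec_of[OF linear_generator'[of A] unvec_carrier[of d w]]
          generator'_traceless[OF unvec_carrier u, of A] vec_of_unvec[OF w(1)] by simp
      moreover have "(c \<cdot>\<^sub>m M) *\<^sub>v w = c \<cdot>\<^sub>v (M *\<^sub>v w)" if "M \<in> carrier_mat ?n ?n" for c and M :: "complex mat"
        by (rule eq_vecI) (use that w in auto)
      ultimately show ?thesis by simp
    qed
  qed (simp_all add: smult_carrier_mat)
  fix i j assume "i < dim_row \<rho>" "j < dim_col \<rho>"
  hence ij: "i < d" "j < d" using \<rho> by auto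
  have k: "i * d + j < ?n" using ij by (rule index_pair_less)
  have "flow A t \<sigma> $$ (i,j) = \<rho> $$ (i,j) + (\<Sum>b<?n. mat_exp (of_real t \<cdot>\<^sub>m ?S') $$ (i * d + j, b) * vec_of d \<tau> $ b)" for t
  proof -
    let ?E = "mat_exp (of_real t \<cdot>\<^sub>m ?S)" and ?E' = "mat_exp (of_real t \<cdot>\<^sub>m ?S')"
    have E: "?E \<in> carrier_mat ?n ?n" and E': "?E' \<in> carrier_mat ?n ?n" by (simp_all add: smult_carrier_mat)
    have fl: "flow A t M $$ (i,j) = (?E *\<^sub>v vec_of d M) $ (i * d + j)" for M using ij by (simp add: flow_def unvec_def)
    have "vec_of d \<sigma> = vec_of d \<rho> + vec_of d \<tau>"
      unfolding \<tau>_def by (rule eq_vecI) (use \<rho> \<sigma> in \<open>auto simp: div_mod_less\<close>)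
    hence "?E *\<^sub>v vec_of d \<sigma> = ?E *\<^sub>v vec_of d \<rho> + ?E' *\<^sub>v vec_of d \<tau>"
      using mult_add_distrib_mat_vec[OF E vec_of_carrier vec_of_carrier, of \<rho> \<tau>] same by simp
    hence "flow A t \<sigma> $$ (i,j) = flow A t \<rho> $$ (i,j) + (?E' *\<^sub>v vec_of d \<tau>) $ (i * d + j)"
      unfolding fl using E' k by simp
    thus ?thesis unfolding flow_stationary[OF \<rho>(1,3)] index_mult_vec_sum[OF E' vec_of_carrier k] .
  qed
  moreover have "((\<lambda>t. \<rho> $$ (i,j) + (\<Sum>b<?n. mat_exp (of_real t \<cdot>\<^sub>m ?S') $$ (i * d + j, b) * vec_of d \<tau> $ b))
     \<longlongrightarrow> \<rho> $$ (i,j) + (\<Sum>b<?n. 0 * vec_of d \<tau> $ b)) at_top"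
    by (intro tendsto_intros hurwitz_mat_exp_tendsto_0[OF superop_mat_carrier] superop_generator'_eigenvalue[OF controllable] k) auto
  ultimately show "((\<lambda>t. flow A t \<sigma> $$ (i,j)) \<longlongrightarrow> \<rho> $$ (i,j)) at_top" by simp
qed

text \<open>First moments obey a closed equation with matrix \<open>N\<close>, whatever the noise. A
  left eigenvector of \<open>N\<close> therefore gives a left eigenvector of the superoperator
  matrix.\<close>

lemma flow_eigenfunctional:
  assumes ev: "\<And>j. j < 2 * L \<Longrightarrow> (\<Sum>i<2*L. v i * N i j) = \<mu> * v j" and \<rho>: "\<rho> \<in> carrier_mat d d"
  shows "(\<Sum>i<2*L. v i * mtrace (majo esb L i * flow A t \<rho>)) = exp (\<mu> * of_real t) * (\<Sum>i<2*L. v i * mtrace (majo esb L i * \<rho>))"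
proof -
  let ?l = "\<lambda>\<rho>. \<Sum>i<2*L. v i * mtrace (majo esb L i * \<rho>)" and ?n = "d * d"
  let ?u = "\<lambda>b. ?l (unit_mat_at d b)" and ?S = "superop_mat d (generator A)"
  have l_tr: "?l \<rho> = (\<Sum>i<2*L. v i * ltr d (a i (emb \<rho>)))" if \<rho>: "\<rho> \<in> carrier_mat d d" for \<rho>
  proof (intro sum.cong refl arg_cong2[of _ _ _ _ "(*)"])
    fix i assume "i \<in> {..<2*L}" hence i: "i < 2*L" by simp
    show "mtrace (majo esb L i * \<rho>) = ltr d (a i (emb \<rho>))"
      unfolding tr_a[OF i imageI[OF \<rho>]] ltr_opm[OF mult_sq_carrier[OF majo_carrier[OF i] \<rho>], symmetric]
        opm_mult[OF two_pow_pos majo_carrier[OF i] \<rho>] ..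
  qed
  have l_generator: "?l (generator A \<rho>) = \<mu> * ?l \<rho>" if \<rho>: "\<rho> \<in> carrier_mat d d" for \<rho>
  proof -
    have "?l (generator A \<rho>) = (\<Sum>i<2*L. \<Sum>j<2*L. v i * N i j * ltr d (a j (emb \<rho>)))"
      unfolding l_tr[OF generator_carrier[OF \<rho>]] emb_generator[OF \<rho>]
      by (intro sum.cong refl) (simp add: tr_a_gen[OF _ imageI[OF \<rho>]] sum_distrib_left mult.assoc)
    also have "\<dots> = (\<Sum>j<2*L. (\<Sum>i<2*L. v i * N i j) * ltr d (a j (emb \<rho>)))"
      unfolding sum_distrib_right by (rule sum.swap)
    also have "\<dots> = \<mu> * ?l \<rho>" unfolding l_tr[OF \<rho>] sum_distrib_left
      by (intro sum.cong refl) (simp add: ev mult.assoc)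
    finally show ?thesis .
  qed
  have l_vec: "?l \<rho> = (\<Sum>b<?n. ?u b * vec_of d \<rho> $ b)" if \<rho>: "\<rho> \<in> carrier_mat d d" for \<rho>
  proof -
    have "mtrace (majo esb L i * \<rho>) = (\<Sum>b<?n. mtrace (majo esb L i * unit_mat_at d b) * vec_of d \<rho> $ b)" if i: "i < 2*L" for i
    proof -
      note m = majo_carrier[OF i, of esb]
      have "majo esb L i * \<rho> = msum d d (\<lambda>b. majo esb L i * (\<rho> $$ (b div d, b mod d) \<cdot>\<^sub>m unit_mat_at d b)) {..<?n}"
        by (subst unit_mat_expansion[OF \<rho>], rule mult_msum[OF _ m]) simp
      hence "mtrace (majo esb L i * \<rho>) = (\<Sum>b<?n. mtrace (majo esb L i * (\<rho> $$ (b div d, b mod d) \<cdot>\<^sub>m unit_mat_at d b)))"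
        by (simp only:) (rule mtrace_msum, rule mult_sq_carrier[OF m], simp)
      also have "\<dots> = (\<Sum>b<?n. mtrace (majo esb L i * unit_mat_at d b) * vec_of d \<rho> $ b)"
        by (intro sum.cong refl)
          (simp add: mult_smult_distrib[OF m unit_mat_at_carrier] mtrace_smult[OF mult_sq_carrier[OF m unit_mat_at_carrier]] mult.commute)
      finally show ?thesis .
    qed
    hence "?l \<rho> = (\<Sum>i<2*L. \<Sum>b<?n. v i * mtrace (majo esb L i * unit_mat_at d b) * vec_of d \<rho> $ b)"
      by (intro sum.cong refl) (simp add: sum_distrib_left mult.assoc)
    thus ?thesis unfolding sum_distrib_right by (subst (asm) sum.swap)
  qed
  have left: "(\<Sum>a<?n. ?u a * (of_real t \<cdot>\<^sub>m ?S) $$ (a,b)) = (\<mu> * of_real t) * ?u b" if b: "b < ?n" for b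
  proof -
    have "(\<Sum>a<?n. ?u a * (of_real t \<cdot>\<^sub>m ?S) $$ (a,b)) = of_real t * (\<Sum>a<?n. ?u a * vec_of d (generator A (unit_mat_at d b)) $ a)"
      unfolding sum_distrib_left[of "of_real t"] using b by (intro sum.cong refl) (simp add: superop_mat_def)
    also have "\<dots> = of_real t * (\<mu> * ?u b)"
      unfolding l_vec[OF generator_carrier[OF unit_mat_at_carrier], symmetric] l_generator[OF unit_mat_at_carrier] ..
    finally show ?thesis by (simp only: mult_ac)
  qed
  let ?E = "mat_exp (of_real t \<cdot>\<^sub>m ?S)"
  have E: "?E \<in> carrier_mat ?n ?n" by (simp add: smult_carrier_mat)
  have "?l (flow A t \<rho>) = (\<Sum>a<?n. ?u a * (?E *\<^sub>v vec_of d \<rho>) $ a)"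
    unfolding l_vec[OF flow_carrier] unfolding flow_def vec_of_unvec[OF mult_mat_vec_carrier[OF E vec_of_carrier]] ..
  also have "\<dots> = (\<Sum>a<?n. \<Sum>b<?n. ?u a * ?E $$ (a,b) * vec_of d \<rho> $ b)"
  proof (rule sum.cong[OF refl])
    fix a assume "a \<in> {..<?n}" hence a: "a < ?n" by simp
    show "?u a * (?E *\<^sub>v vec_of d \<rho>) $ a = (\<Sum>b<?n. ?u a * ?E $$ (a,b) * vec_of d \<rho> $ b)"
      unfolding index_mult_vec_sum[OF E vec_of_carrier a] sum_distrib_left[of "?u a"] by (simp only: mult.assoc)
  qed
  also have "\<dots> = (\<Sum>b<?n. (\<Sum>a<?n. ?u a * ?E $$ (a,b)) * vec_of d \<rho> $ b)"
    unfolding sum_distrib_right[of _ "{..<?n}"] by (rule sum.swap)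
  also have "\<dots> = (\<Sum>b<?n. exp (\<mu> * of_real t) * ?u b * vec_of d \<rho> $ b)"
    by (intro sum.cong refl arg_cong2[of _ _ _ _ "(*)"] mat_exp_left_eigen[OF smult_carrier_mat[OF superop_mat_carrier] left]) auto
  also have "\<dots> = exp (\<mu> * of_real t) * ?l \<rho>"
    unfolding l_vec[OF \<rho>] sum_distrib_left[of "exp (\<mu> * of_real t)" "\<lambda>b. ?u b * vec_of d \<rho> $ b" "{..<?n}"]
    by (simp only: mult.assoc)
  finally show ?thesis .
qed

end

section \<open>Hermitian matrices\<close>

definition ip :: "nat \<Rightarrow> complex vec \<Rightarrow> complex vec \<Rightarrow> complex" where
  "ip n u v = (\<Sum>i<n. u $ i * cnj (v $ i))"

lemma ip_self: "ip n v v = of_real (\<Sum>i<n. (cmod (v $ i))\<^sup>2)"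
  unfolding ip_def of_real_sum by (intro sum.cong refl) (rule complex_norm_square[symmetric])

lemma ip_self_eq_0: "v \<in> carrier_vec n \<Longrightarrow> ip n v v = 0 \<longleftrightarrow> v = 0\<^sub>v n"
proof
  assume v: "v \<in> carrier_vec n" and z: "ip n v v = 0"
  have "(\<Sum>i<n. (cmod (v $ i))\<^sup>2) = 0" using z unfolding ip_self of_real_eq_0_iff .
  hence "\<forall>i<n. v $ i = 0" by (subst (asm) sum_nonneg_eq_0_iff) auto
  thus "v = 0\<^sub>v n" using v by (intro eq_vecI) auto
qed (simp add: ip_def)

lemma ip_mult_left:
  assumes A: "A \<in> carrier_mat n m" and u: "u \<in> carrier_vec m" and v: "v \<in> carrier_vec n"
  shows "ip n (A *\<^sub>v u) v = ip m u (mat_adjoint A *\<^sub>v v)"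
proof -
  have Aa: "mat_adjoint A \<in> carrier_mat m n" using A by simp
  have "ip n (A *\<^sub>v u) v = (\<Sum>i<n. \<Sum>k<m. A $$ (i,k) * u $ k * cnj (v $ i))"
    unfolding ip_def sum_distrib_right[symmetric]
    by (intro sum.cong refl arg_cong2[of _ _ _ _ "(*)"] index_mult_vec_sum[OF A u]) simp
  also have "\<dots> = (\<Sum>k<m. \<Sum>i<n. A $$ (i,k) * u $ k * cnj (v $ i))" by (rule sum.swap)
  also have "\<dots> = ip m u (mat_adjoint A *\<^sub>v v)"
    unfolding ip_def
  proof (intro sum.cong refl)
    fix k assume "k \<in> {..<m}" hence k: "k < m" by simp
    have "(\<Sum>i<n. A $$ (i,k) * u $ k * cnj (v $ i)) = u $ k * (\<Sum>i<n. A $$ (i,k) * cnj (v $ i))"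
      unfolding sum_distrib_left by (intro sum.cong refl) simp
    also have "(\<Sum>i<n. A $$ (i,k) * cnj (v $ i)) = cnj ((mat_adjoint A *\<^sub>v v) $ k)"
      unfolding index_mult_vec_sum[OF Aa v k] cnj_sum using A k by (intro sum.cong refl) auto
    finally show "(\<Sum>i<n. A $$ (i,k) * u $ k * cnj (v $ i)) = u $ k * cnj ((mat_adjoint A *\<^sub>v v) $ k)" .
  qed
  finally show ?thesis .
qed

lemma ip_smult_left: "u \<in> carrier_vec n \<Longrightarrow> ip n (c \<cdot>\<^sub>v u) v = c * ip n u v"
  by (simp add: ip_def sum_distrib_left mult.assoc)

lemma ip_smult_right: "v \<in> carrier_vec n \<Longrightarrow> ip n u (c \<cdot>\<^sub>v v) = cnj c * ip n u v"
  unfolding ip_def sum_distrib_left by (intro sum.cong refl) simp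

lemma ip_add_left: "u \<in> carrier_vec n \<Longrightarrow> w \<in> carrier_vec n \<Longrightarrow> ip n (u + w) v = ip n u v + ip n w v"
  by (simp add: ip_def distrib_right sum.distrib)

lemma hermitian_eigenvalue_real:
  assumes A: "A \<in> carrier_mat n n" "mat_adjoint A = A" and v: "v \<in> carrier_vec n" "v \<noteq> 0\<^sub>v n" "A *\<^sub>v v = e \<cdot>\<^sub>v v"
  shows "cnj e = e"
proof -
  have "e * ip n v v = cnj e * ip n v v"
    using ip_mult_left[OF A(1) v(1) v(1)] unfolding A(2) v(3) ip_smult_left[OF v(1)] ip_smult_right[OF v(1)] .
  moreover have "ip n v v \<noteq> 0" using ip_self_eq_0[OF v(1)] v(2) by simp
  ultimately show ?thesis by simp
qed

lemma hermitian_eigenvectors_orthogonal: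
  assumes A: "A \<in> carrier_mat n n" "mat_adjoint A = A" and u: "u \<in> carrier_vec n" "A *\<^sub>v u = e \<cdot>\<^sub>v u"
    and v: "v \<in> carrier_vec n" "A *\<^sub>v v = f \<cdot>\<^sub>v v" and ef: "e \<noteq> f"
  shows "ip n u v = 0"
proof (cases "v = 0\<^sub>v n")
  case False
  from hermitian_eigenvalue_real[OF A v(1) False v(2)] have f: "cnj f = f" .
  have "e * ip n u v = f * ip n u v"
    using ip_mult_left[OF A(1) u(1) v(1)] unfolding A(2) u(2) v(2) ip_smult_left[OF u(1)] ip_smult_right[OF v(1)] f .
  thus ?thesis using ef by simp
qed (simp add: ip_def)

text \<open>Folding this map over a list \<open>es\<close> applies the polynomial with roots
  \<open>es\<close>, the product of the factors \<open>A - e\<close>.\<close>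

definition shifted :: "complex mat \<Rightarrow> complex \<Rightarrow> complex vec \<Rightarrow> complex vec" where
  "shifted A e v = A *\<^sub>v v + (- e) \<cdot>\<^sub>v v"

lemma shifted_carrier: "A \<in> carrier_mat n n \<Longrightarrow> v \<in> carrier_vec n \<Longrightarrow> shifted A e v \<in> carrier_vec n"
  by (simp add: shifted_def)

lemma fold_shifted_carrier: "A \<in> carrier_mat n n \<Longrightarrow> v \<in> carrier_vec n \<Longrightarrow> fold (shifted A) es v \<in> carrier_vec n"
  by (induct es arbitrary: v) (auto simp: shifted_carrier)

text \<open>The Cayley-Hamilton theorem in factored form. In the Schur basis, the factors for the
  diagonal entries, taken from the last to the first, each remove one more coordinate.\<close>

lemma annihilating_list:
  assumes A: "(A :: complex mat) \<in> carrier_mat n n"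
  obtains es where "length es = n" "\<And>v. v \<in> carrier_vec n \<Longrightarrow> fold (shifted A) es v = 0\<^sub>v n"
proof -
  from triangularize[OF A] obtain B P Q where w: "similar_mat_wit A B P Q" and u: "upper_triangular B"
    and B: "B \<in> carrier_mat n n" and "\<And>i. i < n \<Longrightarrow> eigenvalue A (B $$ (i,i))" by blast
  from similar_mat_witD2[OF A w] have P: "P \<in> carrier_mat n n" and Q: "Q \<in> carrier_mat n n"
    and PQ: "P * Q = 1\<^sub>m n" "Q * P = 1\<^sub>m n" and APQ: "A = P * B * Q" by auto
  have QA: "Q * A = B * Q"
  proof -
    have "Q * A = Q * (P * (B * Q))" unfolding APQ using assoc_mult_mat[OF P B Q] by simp
    also have "\<dots> = (Q * P) * (B * Q)" by (rule assoc_mult_mat[OF Q P mult_carrier_mat[OF B Q], symmetric])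
    finally show ?thesis unfolding PQ left_mult_one_mat[OF mult_carrier_mat[OF B Q]] .
  qed
  have Qs: "Q *\<^sub>v shifted A e v = shifted B e (Q *\<^sub>v v)" if v: "v \<in> carrier_vec n" for e v
  proof -
    have "Q *\<^sub>v shifted A e v = Q *\<^sub>v (A *\<^sub>v v) + Q *\<^sub>v ((- e) \<cdot>\<^sub>v v)"
      unfolding shifted_def by (rule mult_add_distrib_mat_vec[OF Q]) (use A v in auto)
    also have "Q *\<^sub>v (A *\<^sub>v v) = B *\<^sub>v (Q *\<^sub>v v)"
      unfolding assoc_mult_mat_vec[OF Q A v, symmetric] QA by (rule assoc_mult_mat_vec[OF B Q v])
    also have "Q *\<^sub>v ((- e) \<cdot>\<^sub>v v) = (- e) \<cdot>\<^sub>v (Q *\<^sub>v v)" by (rule mult_mat_vec[OF Q v])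
    finally show ?thesis unfolding shifted_def .
  qed
  have Qf: "Q *\<^sub>v fold (shifted A) es v = fold (shifted B) es (Q *\<^sub>v v)" if "v \<in> carrier_vec n" for es v
    using that by (induct es arbitrary: v) (simp_all add: shifted_carrier[OF A] Qs)
  \<comment> \<open>If \<open>v\<close> is supported on the first \<open>k + 1\<close> coordinates,
    subtracting the diagonal entry \<open>k\<close> annihilates coordinate \<open>k\<close>, and
    triangularity keeps the later ones zero.\<close>
  have kill: "k \<le> n \<Longrightarrow> v \<in> carrier_vec n \<Longrightarrow> (\<And>i. k \<le> i \<Longrightarrow> i < n \<Longrightarrow> v $ i = 0) \<Longrightarrow>
      fold (shifted B) (map (\<lambda>i. B $$ (i,i)) (rev [0..<k])) v = 0\<^sub>v n" for k v
  proof (induct k arbitrary: v)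
    case 0 thus ?case by (intro eq_vecI) auto
  next
    case (Suc k)
    have kn: "k < n" using Suc.prems(1) by simp
    have "shifted B (B $$ (k,k)) v $ i = 0" if i: "k \<le> i" "i < n" for i
    proof -
      have "(B *\<^sub>v v) $ i = (\<Sum>j<n. if j = k then B $$ (i,k) * v $ k else 0)"
        unfolding index_mult_vec_sum[OF B Suc.prems(2) i(2)]
      proof (intro sum.cong refl)
        fix j assume "j \<in> {..<n}" hence j: "j < n" by simp
        show "B $$ (i,j) * v $ j = (if j = k then B $$ (i,k) * v $ k else 0)"
        proof (cases "j < k")
          case True
          hence "B $$ (i,j) = 0" using u i B by (intro upper_triangularD) auto
          thus ?thesis using True by simp
        next
          case False
          thus ?thesis using Suc.prems(3)[of j] j by (cases "j = k") auto
        qed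
      qed
      also have "\<dots> = B $$ (i,k) * v $ k" using kn by simp
      finally have Bv: "(B *\<^sub>v v) $ i = B $$ (i,k) * v $ k" .
      show ?thesis
      proof (cases "i = k")
        case True
        thus ?thesis using Bv Suc.prems(2) i B by (simp add: shifted_def del: index_mult_mat_vec)
      next
        case False
        hence "B $$ (i,k) = 0" using u i B by (intro upper_triangularD) auto
        moreover have "v $ i = 0" using Suc.prems(3)[of i] i False by simp
        ultimately show ?thesis using Bv Suc.prems(2) i B by (simp add: shifted_def del: index_mult_mat_vec)
      qed
    qed
    from Suc.hyps[OF _ shifted_carrier[OF B Suc.prems(2)] this] show ?case using kn by simp
  qed
  let ?es = "map (\<lambda>i. B $$ (i,i)) (rev [0..<n])"
  have "fold (shifted A) ?es v = 0\<^sub>v n" if v: "v \<in> carrier_vec n" for v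
  proof -
    let ?w = "fold (shifted A) ?es v"
    have w: "?w \<in> carrier_vec n" by (rule fold_shifted_carrier[OF A v])
    have "Q *\<^sub>v ?w = 0\<^sub>v n" unfolding Qf[OF v] by (rule kill) (use Q v in auto)
    moreover have "P *\<^sub>v 0\<^sub>v n = 0\<^sub>v n" by (rule eq_vecI) (use P in auto)
    ultimately have "P *\<^sub>v (Q *\<^sub>v ?w) = 0\<^sub>v n" by simp
    thus ?thesis unfolding assoc_mult_mat_vec[OF P Q w, symmetric] PQ using w by simp
  qed
  thus ?thesis by (intro that[of ?es]) auto
qed

lemma mult_mat_vec_sum_index:
  assumes A: "A \<in> carrier_mat n n" and Z: "\<And>e. e \<in> S \<Longrightarrow> Z e \<in> carrier_vec n" and i: "i < n"
  shows "(A *\<^sub>v vec n (\<lambda>i. \<Sum>e\<in>S. Z e $ i)) $ i = (\<Sum>e\<in>S. (A *\<^sub>v Z e) $ i)"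
proof -
  have "(A *\<^sub>v vec n (\<lambda>i. \<Sum>e\<in>S. Z e $ i)) $ i = (\<Sum>j<n. \<Sum>e\<in>S. A $$ (i,j) * Z e $ j)"
    unfolding index_mult_vec_sum[OF A vec_carrier i] by (intro sum.cong refl) (simp add: sum_distrib_left)
  also have "\<dots> = (\<Sum>e\<in>S. \<Sum>j<n. A $$ (i,j) * Z e $ j)" by (rule sum.swap)
  also have "\<dots> = (\<Sum>e\<in>S. (A *\<^sub>v Z e) $ i)"
    by (intro sum.cong refl index_mult_vec_sum[OF A _ i, symmetric] Z)
  finally show ?thesis .
qed

lemma pow_mat_vec_Suc:
  assumes A: "A \<in> carrier_mat n n" and v: "v \<in> carrier_vec n"
  shows "A ^\<^sub>m Suc k *\<^sub>v v = A ^\<^sub>m k *\<^sub>v (A *\<^sub>v v)"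
  using assoc_mult_mat_vec[OF pow_carrier_mat[OF A] A v, of k] by simp

text \<open>The eigencomponents \<open>Z e\<close> are polynomials in \<open>A\<close> of degree below \<open>length es\<close> applied to \<open>v\<close>;
  the last clause is the dual formulation of this.\<close>
lemma hermitian_eigen_decomposition:
  assumes A: "A \<in> carrier_mat n n" "mat_adjoint A = A" and v: "v \<in> carrier_vec n" and z: "fold (shifted A) es v = 0\<^sub>v n"
  shows "\<exists>Z. (\<forall>e\<in>set es. Z e \<in> carrier_vec n \<and> A *\<^sub>v Z e = e \<cdot>\<^sub>v Z e) \<and> (\<forall>i<n. v $ i = (\<Sum>e\<in>set es. Z e $ i))
    \<and> (\<forall>c. (\<forall>k<length es. (\<Sum>i<n. c i * (A ^\<^sub>m k *\<^sub>v v) $ i) = 0) \<longrightarrow> (\<forall>e\<in>set es. (\<Sum>i<n. c i * Z e $ i) = 0))"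
  using v z
proof (induct es arbitrary: v)
  case Nil thus ?case by simp
next
  case (Cons e es)
  note v = Cons.prems(1)
  define w where "w = shifted A e v"
  have w: "w \<in> carrier_vec n" unfolding w_def by (rule shifted_carrier[OF A(1) v])
  have wz: "fold (shifted A) es w = 0\<^sub>v n" using Cons.prems(2) by (simp add: w_def)
  from Cons.hyps[OF w wz] obtain X where X: "\<And>f. f \<in> set es \<Longrightarrow> X f \<in> carrier_vec n" "\<And>f. f \<in> set es \<Longrightarrow> A *\<^sub>v X f = f \<cdot>\<^sub>v X f"
    and Xw: "\<And>i. i < n \<Longrightarrow> w $ i = (\<Sum>f\<in>set es. X f $ i)"
    and Xc: "\<And>c f. (\<And>k. k < length es \<Longrightarrow> (\<Sum>i<n. c i * (A ^\<^sub>m k *\<^sub>v w) $ i) = 0) \<Longrightarrow> f \<in> set es \<Longrightarrow> (\<Sum>i<n. c i * X f $ i) = 0"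
    by blast
  define F where "F = set es - {e}"
  \<comment> \<open>The vector \<open>w\<close> lies in the range of \<open>A - e\<close>, which is
    orthogonal to the eigenvectors for \<open>e\<close>; so \<open>w\<close> has no component there.
    This excludes Jordan blocks.\<close>
  have Xe: "X e = 0\<^sub>v n" if e: "e \<in> set es"
  proof (rule ccontr)
    assume ne: "X e \<noteq> 0\<^sub>v n"
    have real: "cnj e = e" by (rule hermitian_eigenvalue_real[OF A X(1)[OF e] ne X(2)[OF e]])
    have "ip n w (X e) = ip n (A *\<^sub>v v) (X e) + ip n ((- e) \<cdot>\<^sub>v v) (X e)"
      unfolding w_def shifted_def by (rule ip_add_left) (use A v in auto)
    also have "\<dots> = 0"
      unfolding ip_mult_left[OF A(1) v X(1)[OF e]] A(2) X(2)[OF e] ip_smult_right[OF X(1)[OF e]] ip_smult_left[OF v] real by simp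
    finally have 1: "ip n w (X e) = 0" .
    have "ip n w (X e) = (\<Sum>i<n. \<Sum>f\<in>set es. X f $ i * cnj (X e $ i))"
      unfolding ip_def by (intro sum.cong refl) (simp add: Xw sum_distrib_right)
    also have "\<dots> = (\<Sum>f\<in>set es. ip n (X f) (X e))" unfolding ip_def by (rule sum.swap)
    also have "\<dots> = (\<Sum>f\<in>set es. if f = e then ip n (X e) (X e) else 0)"
    proof (rule sum.cong[OF refl])
      fix f assume f: "f \<in> set es"
      show "ip n (X f) (X e) = (if f = e then ip n (X e) (X e) else 0)"
        using hermitian_eigenvectors_orthogonal[OF A X(1)[OF f] X(2)[OF f] X(1)[OF e] X(2)[OF e]] by simp
    qed
    also have "\<dots> = ip n (X e) (X e)" using e by simp
    finally have "ip n (X e) (X e) = 0" using 1 by simp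
    with ne show False using ip_self_eq_0[OF X(1)[OF e]] by simp
  qed
  have XF: "w $ i = (\<Sum>f\<in>F. X f $ i)" if i: "i < n" for i
    unfolding Xw[OF i] F_def
    by (rule sum.mono_neutral_right) (use Xe i in auto)
  \<comment> \<open>For \<open>f\<close> different from \<open>e\<close> the component of
    \<open>v\<close> is that of \<open>(A - e) v\<close> divided by \<open>f - e\<close>; what is
    left of \<open>v\<close> is its component for \<open>e\<close>.\<close>
  define Z where "Z f = (if f = e then v + (- 1) \<cdot>\<^sub>v vec n (\<lambda>i. \<Sum>f\<in>F. (1 / (f - e)) * X f $ i) else (1 / (f - e)) \<cdot>\<^sub>v X f)" for f
  have FX: "f \<in> F \<Longrightarrow> X f \<in> carrier_vec n" "f \<in> F \<Longrightarrow> A *\<^sub>v X f = f \<cdot>\<^sub>v X f" "f \<in> F \<Longrightarrow> f \<noteq> e" for f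
    using X unfolding F_def by auto
  have ZF: "Z f \<in> carrier_vec n" "A *\<^sub>v Z f = f \<cdot>\<^sub>v Z f" if "f \<in> F" for f
  proof -
    show "Z f \<in> carrier_vec n" using FX[OF that] by (simp add: Z_def)
    have "A *\<^sub>v Z f = (1 / (f - e)) \<cdot>\<^sub>v (A *\<^sub>v X f)"
      using FX[OF that] by (simp add: Z_def mult_mat_vec[OF A(1)])
    also have "\<dots> = f \<cdot>\<^sub>v Z f" unfolding FX(2)[OF that] using FX[OF that] by (simp add: Z_def smult_smult_assoc mult.commute)
    finally show "A *\<^sub>v Z f = f \<cdot>\<^sub>v Z f" .
  qed
  have Ze: "Z e \<in> carrier_vec n" using v by (simp add: Z_def)
  have Zei: "Z e $ i = v $ i - (\<Sum>f\<in>F. Z f $ i)" if i: "i < n" for i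
  proof -
    have "(\<Sum>f\<in>F. Z f $ i) = (\<Sum>f\<in>F. (1 / (f - e)) * X f $ i)"
    proof (rule sum.cong[OF refl])
      fix f assume f: "f \<in> F"
      show "Z f $ i = (1 / (f - e)) * X f $ i" using FX(1,3)[OF f] i by (simp add: Z_def)
    qed
    thus ?thesis using i v by (simp add: Z_def)
  qed
  have AZe: "A *\<^sub>v Z e = e \<cdot>\<^sub>v Z e"
  proof (rule eq_vecI)
    fix i assume "i < dim_vec (e \<cdot>\<^sub>v Z e)"
    hence i: "i < n" using Ze by simp
    have "Z e = v + (- 1) \<cdot>\<^sub>v vec n (\<lambda>i. \<Sum>f\<in>F. Z f $ i)"
      by (rule eq_vecI) (use Zei Ze v in auto)
    hence "A *\<^sub>v Z e = A *\<^sub>v v + (- 1) \<cdot>\<^sub>v (A *\<^sub>v vec n (\<lambda>i. \<Sum>f\<in>F. Z f $ i))"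
      using mult_add_distrib_mat_vec[OF A(1) v, of "(- 1) \<cdot>\<^sub>v vec n (\<lambda>i. \<Sum>f\<in>F. Z f $ i)"]
        mult_mat_vec[OF A(1), of "vec n (\<lambda>i. \<Sum>f\<in>F. Z f $ i)" "- 1"] by simp
    hence "(A *\<^sub>v Z e) $ i = (A *\<^sub>v v) $ i - (\<Sum>f\<in>F. (A *\<^sub>v Z f) $ i)"
      using i A mult_mat_vec_sum_index[OF A(1) ZF(1) i] by (simp del: index_mult_mat_vec)
    also have "(A *\<^sub>v v) $ i = w $ i + e * v $ i" using i v A by (simp add: w_def shifted_def del: index_mult_mat_vec)
    also have "(\<Sum>f\<in>F. (A *\<^sub>v Z f) $ i) = (\<Sum>f\<in>F. X f $ i + e * Z f $ i)"
    proof (rule sum.cong[OF refl])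
      fix f assume f: "f \<in> F"
      have "f * Z f $ i = (f - e) * Z f $ i + e * Z f $ i" by (simp add: left_diff_distrib)
      also have "(f - e) * Z f $ i = X f $ i" using FX[OF f] i by (simp add: Z_def)
      finally show "(A *\<^sub>v Z f) $ i = X f $ i + e * Z f $ i" unfolding ZF(2)[OF f] using ZF(1)[OF f] i by simp
    qed
    also have "\<dots> = w $ i + e * (\<Sum>f\<in>F. Z f $ i)" unfolding XF[OF i] sum_distrib_left sum.distrib ..
    finally show "(A *\<^sub>v Z e) $ i = (e \<cdot>\<^sub>v Z e) $ i" using i Ze by (simp add: Zei algebra_simps del: index_mult_mat_vec)
  qed (use A Ze in auto)
  have set_eq: "set (e # es) = insert e F" by (auto simp: F_def)
  show ?case
  proof (intro exI[of _ Z] conjI ballI allI impI)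
    show "Z f \<in> carrier_vec n" if "f \<in> set (e # es)" for f using that Ze ZF(1) unfolding set_eq by auto
    show "A *\<^sub>v Z f = f \<cdot>\<^sub>v Z f" if "f \<in> set (e # es)" for f using that AZe ZF(2) unfolding set_eq by auto
    show "v $ i = (\<Sum>f\<in>set (e # es). Z f $ i)" if "i < n" for i
      unfolding set_eq using Zei[OF that] by (subst sum.insert) (auto simp: F_def)
    fix c f assume c: "\<forall>k<length (e # es). (\<Sum>i<n. c i * (A ^\<^sub>m k *\<^sub>v v) $ i) = 0" and f: "f \<in> set (e # es)"
    have cw: "(\<Sum>i<n. c i * (A ^\<^sub>m k *\<^sub>v w) $ i) = 0" if k: "k < length es" for k
    proof -
      have "A ^\<^sub>m k *\<^sub>v w = A ^\<^sub>m Suc k *\<^sub>v v + (- e) \<cdot>\<^sub>v (A ^\<^sub>m k *\<^sub>v v)"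
        unfolding w_def shifted_def pow_mat_vec_Suc[OF A(1) v]
        using mult_add_distrib_mat_vec[OF pow_carrier_mat[OF A(1)], of "A *\<^sub>v v" "(- e) \<cdot>\<^sub>v v" k] A(1) v
          mult_mat_vec[OF pow_carrier_mat[OF A(1)] v, of k "- e"] by simp
      hence "(\<Sum>i<n. c i * (A ^\<^sub>m k *\<^sub>v w) $ i) = (\<Sum>i<n. c i * (A ^\<^sub>m Suc k *\<^sub>v v) $ i - e * (c i * (A ^\<^sub>m k *\<^sub>v v) $ i))"
        using A by (intro sum.cong refl) (simp add: algebra_simps del: index_mult_mat_vec pow_mat.simps)
      also have "\<dots> = (\<Sum>i<n. c i * (A ^\<^sub>m Suc k *\<^sub>v v) $ i) - e * (\<Sum>i<n. c i * (A ^\<^sub>m k *\<^sub>v v) $ i)"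
        by (simp only: sum_subtractf sum_distrib_left)
      also have "\<dots> = 0" using c[rule_format, of k] c[rule_format, of "Suc k"] k by (simp del: index_mult_mat_vec pow_mat.simps)
      finally show ?thesis .
    qed
    have cF: "(\<Sum>i<n. c i * Z f $ i) = 0" if f: "f \<in> F" for f
    proof -
      have "(\<Sum>i<n. c i * Z f $ i) = (1 / (f - e)) * (\<Sum>i<n. c i * X f $ i)"
        unfolding sum_distrib_left using FX[OF f] by (intro sum.cong refl) (simp add: Z_def)
      also have "\<dots> = 0" using Xc[OF cw, of f] f by (simp add: F_def)
      finally show ?thesis .
    qed
    show "(\<Sum>i<n. c i * Z f $ i) = 0"
    proof (cases "f = e")
      case False thus ?thesis using f cF unfolding set_eq by auto
    next
      case True
      have "(\<Sum>i<n. c i * v $ i) = 0" using c[rule_format, of 0] A v by simp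
      moreover have "(\<Sum>i<n. c i * Z e $ i) = (\<Sum>i<n. c i * v $ i - (\<Sum>f\<in>F. c i * Z f $ i))"
        by (intro sum.cong refl) (simp add: Zei right_diff_distrib sum_distrib_left)
      moreover have "(\<Sum>i<n. \<Sum>f\<in>F. c i * Z f $ i) = 0"
        by (subst sum.swap) (simp add: cF)
      ultimately show ?thesis using True by (simp add: sum_subtractf)
    qed
  qed
qed

text \<open>A nonzero eigencomponent of \<open>v\<close> is a combination of the vectors
  \<open>A^k v\<close> with \<open>k < n\<close>, so it inherits every linear condition that they
  satisfy. This is the core of the Hautus test.\<close>

lemma hermitian_krylov_eigenvector:
  fixes A :: "complex mat"
  assumes A: "A \<in> carrier_mat n n" "mat_adjoint A = A" and v: "v \<in> carrier_vec n" "v \<noteq> 0\<^sub>v n"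
    and C: "\<And>k j. k < n \<Longrightarrow> j \<in> J \<Longrightarrow> (\<Sum>i<n. C j i * (A ^\<^sub>m k *\<^sub>v v) $ i) = 0"
  obtains u e where "u \<in> carrier_vec n" "u \<noteq> 0\<^sub>v n" "A *\<^sub>v u = e \<cdot>\<^sub>v u" "\<And>j. j \<in> J \<Longrightarrow> (\<Sum>i<n. C j i * u $ i) = 0"
proof -
  obtain es where es: "length es = n" "\<And>v. v \<in> carrier_vec n \<Longrightarrow> fold (shifted A) es v = 0\<^sub>v n"
    by (rule annihilating_list[OF A(1)]) blast
  from hermitian_eigen_decomposition[OF A v(1) es(2)[OF v(1)]] obtain Z where
    Z: "\<And>e. e \<in> set es \<Longrightarrow> Z e \<in> carrier_vec n" "\<And>e. e \<in> set es \<Longrightarrow> A *\<^sub>v Z e = e \<cdot>\<^sub>v Z e"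
      "\<And>i. i < n \<Longrightarrow> v $ i = (\<Sum>e\<in>set es. Z e $ i)"
    and Zc: "\<And>c. (\<forall>k<length es. (\<Sum>i<n. c i * (A ^\<^sub>m k *\<^sub>v v) $ i) = 0) \<Longrightarrow> (\<forall>e\<in>set es. (\<Sum>i<n. c i * Z e $ i) = 0)"
    by blast
  have "\<exists>e\<in>set es. Z e \<noteq> 0\<^sub>v n"
  proof (rule ccontr)
    assume "\<not> (\<exists>e\<in>set es. Z e \<noteq> 0\<^sub>v n)"
    hence "v = 0\<^sub>v n" using v(1) by (intro eq_vecI) (auto simp: Z(3))
    with v(2) show False by simp
  qed
  then obtain e where e: "e \<in> set es" "Z e \<noteq> 0\<^sub>v n" by blast
  show ?thesis
  proof (rule that[OF Z(1)[OF e(1)] e(2) Z(2)[OF e(1)]])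
    fix j assume "j \<in> J"
    thus "(\<Sum>i<n. C j i * Z e $ i) = 0" using Zc[of "C j"] C es(1) e(1) by simp
  qed
qed

text \<open>Column \<open>j\<close> of \<open>E e\<close> is the eigencomponent of the unit vector
  \<open>j\<close>. Summing the components restores the identity, and orthogonality of eigenvectors
  yields the projection rules.\<close>

lemma hermitian_spectral_projections:
  fixes A :: "complex mat"
  assumes A: "A \<in> carrier_mat n n" "mat_adjoint A = A"
  obtains S E where "finite S" "\<And>e. e \<in> S \<Longrightarrow> E e \<in> carrier_mat n n" "\<And>e. e \<in> S \<Longrightarrow> A * E e = e \<cdot>\<^sub>m E e"
    "msum n n E S = 1\<^sub>m n" "\<And>e. e \<in> S \<Longrightarrow> eigenvalue A e" "\<And>e. e \<in> S \<Longrightarrow> cnj e = e"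
    "\<And>e. e \<in> S \<Longrightarrow> mat_adjoint (E e) = E e"
    "\<And>e f. e \<in> S \<Longrightarrow> f \<in> S \<Longrightarrow> E e * E f = (if e = f then 1 else 0) \<cdot>\<^sub>m E e"
proof -
  obtain es where es: "length es = n" "\<And>v. v \<in> carrier_vec n \<Longrightarrow> fold (shifted A) es v = 0\<^sub>v n"
    by (rule annihilating_list[OF A(1)]) blast
  have "\<forall>j. \<exists>Z. (\<forall>e\<in>set es. Z e \<in> carrier_vec n \<and> A *\<^sub>v Z e = e \<cdot>\<^sub>v Z e) \<and> (\<forall>i<n. unit_vec n j $ i = (\<Sum>e\<in>set es. Z e $ i))"
    using hermitian_eigen_decomposition[OF A unit_vec_carrier es(2)[OF unit_vec_carrier]] by blast
  then obtain Z where Z0: "\<forall>j. (\<forall>e\<in>set es. Z j e \<in> carrier_vec n \<and> A *\<^sub>v Z j e = e \<cdot>\<^sub>v Z j e) \<and> (\<forall>i<n. unit_vec n j $ i = (\<Sum>e\<in>set es. Z j e $ i))"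
    by metis
  hence Z: "\<And>e j. e \<in> set es \<Longrightarrow> Z j e \<in> carrier_vec n" "\<And>e j. e \<in> set es \<Longrightarrow> A *\<^sub>v Z j e = e \<cdot>\<^sub>v Z j e"
      "\<And>i j. i < n \<Longrightarrow> unit_vec n j $ i = (\<Sum>e\<in>set es. Z j e $ i)" by blast+
  define E where "E e = mat n n (\<lambda>(i,j). Z j e $ i)" for e
  \<comment> \<open>Entries whose matrix \<open>E e\<close> is zero are discarded, so that each
    remaining \<open>e\<close> has an eigenvector.\<close>
  define S where "S = {e \<in> set es. \<exists>j<n. Z j e \<noteq> 0\<^sub>v n}"
  have S: "finite S" "S \<subseteq> set es" by (auto simp: S_def)
  have Ec: "E e \<in> carrier_mat n n" for e by (simp add: E_def)
  have AE: "A * E e = e \<cdot>\<^sub>m E e" if e: "e \<in> S" for e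
  proof (rule eq_matI)
    fix i j assume "i < dim_row (e \<cdot>\<^sub>m E e)" "j < dim_col (e \<cdot>\<^sub>m E e)"
    hence ij: "i < n" "j < n" by (auto simp: E_def)
    have es': "e \<in> set es" using e S by auto
    have "(A * E e) $$ (i,j) = (A *\<^sub>v Z j e) $ i"
      unfolding index_mult_sum[OF A(1) Ec ij] index_mult_vec_sum[OF A(1) Z(1)[OF es'] ij(1)]
      by (intro sum.cong refl) (simp add: E_def ij)
    also have "\<dots> = (e \<cdot>\<^sub>m E e) $$ (i,j)" unfolding Z(2)[OF es'] using Z(1)[OF es', of j] ij by (simp add: E_def)
    finally show "(A * E e) $$ (i,j) = (e \<cdot>\<^sub>m E e) $$ (i,j)" .
  qed (use A in \<open>auto simp: E_def\<close>)
  have sum1: "msum n n E S = 1\<^sub>m n"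
  proof (rule eq_matI)
    fix i j assume "i < dim_row (1\<^sub>m n :: complex mat)" "j < dim_col (1\<^sub>m n :: complex mat)"
    hence ij: "i < n" "j < n" by auto
    have "msum n n E S $$ (i,j) = (\<Sum>e\<in>S. Z j e $ i)" using ij by (simp add: E_def)
    also have "\<dots> = (\<Sum>e\<in>set es. Z j e $ i)"
      by (rule sum.mono_neutral_left) (use ij S in \<open>auto simp: S_def\<close>)
    also have "\<dots> = 1\<^sub>m n $$ (i,j)" unfolding Z(3)[OF ij(1), symmetric] using ij by auto
    finally show "msum n n E S $$ (i,j) = 1\<^sub>m n $$ (i,j)" .
  qed auto
  have ev: "eigenvalue A e" "cnj e = e" if e: "e \<in> S" for e
  proof -
    from e obtain j where j: "Z j e \<noteq> 0\<^sub>v n" and es': "e \<in> set es" by (auto simp: S_def)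
    show "eigenvalue A e" unfolding eigenvalue_def eigenvector_def
      using j Z(1,2)[OF es', of j] A by (intro exI[of _ "Z j e"]) auto
    show "cnj e = e" by (rule hermitian_eigenvalue_real[OF A Z(1)[OF es'] j Z(2)[OF es']])
  qed
  have orth: "mat_adjoint (E e) * E f = 0 \<cdot>\<^sub>m 1\<^sub>m n" if ef: "e \<in> S" "f \<in> S" "e \<noteq> f" for e f
  proof (rule eq_matI)
    fix i j assume "i < dim_row (0 \<cdot>\<^sub>m 1\<^sub>m n :: complex mat)" "j < dim_col (0 \<cdot>\<^sub>m 1\<^sub>m n :: complex mat)"
    hence ij: "i < n" "j < n" by auto
    have es': "e \<in> set es" "f \<in> set es" using ef S by auto
    have Ea: "mat_adjoint (E e) \<in> carrier_mat n n" using Ec by simp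
    have "(mat_adjoint (E e) * E f) $$ (i,j) = ip n (Z j f) (Z i e)"
      unfolding index_mult_sum[OF Ea Ec ij] ip_def
      by (intro sum.cong refl) (simp add: E_def ij)
    also have "\<dots> = 0" by (rule hermitian_eigenvectors_orthogonal[OF A Z(1,2)[OF es'(2)] Z(1,2)[OF es'(1)]]) (use ef in simp)
    finally show "(mat_adjoint (E e) * E f) $$ (i,j) = (0 \<cdot>\<^sub>m 1\<^sub>m n) $$ (i,j)" using ij by simp
  qed (simp_all add: E_def)
  \<comment> \<open>Multiplying the resolution of the identity by the adjoint of \<open>E e\<close>
    leaves only one term. The resulting right side is self-adjoint, so \<open>E e\<close> is both
    hermitian and idempotent.\<close>
  have Ea: "mat_adjoint (E e) = mat_adjoint (E e) * E e" if e: "e \<in> S" for e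
  proof -
    have c: "mat_adjoint (E e) \<in> carrier_mat n n" using Ec by simp
    have "mat_adjoint (E e) = mat_adjoint (E e) * msum n n E S" unfolding sum1 by (rule right_mult_one_mat[OF c, symmetric])
    also have "\<dots> = msum n n (\<lambda>f. mat_adjoint (E e) * E f) S" by (rule mult_msum[OF Ec c])
    also have "\<dots> = msum n n (\<lambda>f. if f = e then mat_adjoint (E e) * E e else 0 \<cdot>\<^sub>m 1\<^sub>m n) S"
      by (rule msum_cong) (use orth[OF e] in auto)
    also have "\<dots> = mat_adjoint (E e) * E e"
    proof (rule eq_matI)
      fix i j assume "i < dim_row (mat_adjoint (E e) * E e)" "j < dim_col (mat_adjoint (E e) * E e)"
      hence ij: "i < n" "j < n" by (auto simp: E_def)
      have "msum n n (\<lambda>f. if f = e then mat_adjoint (E e) * E e else 0 \<cdot>\<^sub>m 1\<^sub>m n) S $$ (i,j)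
        = (\<Sum>f\<in>S. if f = e then (mat_adjoint (E e) * E e) $$ (i,j) else 0)"
        unfolding index_msum[OF ij] using ij by (intro sum.cong refl) auto
      also have "\<dots> = (mat_adjoint (E e) * E e) $$ (i,j)" using e S by simp
      finally show "msum n n (\<lambda>f. if f = e then mat_adjoint (E e) * E e else 0 \<cdot>\<^sub>m 1\<^sub>m n) S $$ (i,j) = (mat_adjoint (E e) * E e) $$ (i,j)" .
    qed (simp_all add: E_def)
    finally show ?thesis .
  qed
  have herm: "mat_adjoint (E e) = E e" if e: "e \<in> S" for e
  proof -
    have "mat_adjoint (mat_adjoint (E e)) = mat_adjoint (mat_adjoint (E e) * E e)" using Ea[OF e] by simp
    also have "\<dots> = mat_adjoint (E e) * mat_adjoint (mat_adjoint (E e))"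
      by (rule mat_adjoint_mult[of _ n n]) (use Ec in simp_all)
    finally show ?thesis using Ea[OF e] by simp
  qed
  have idem: "E e * E f = (if e = f then 1 else 0) \<cdot>\<^sub>m E e" if ef: "e \<in> S" "f \<in> S" for e f
  proof (cases "e = f")
    case True thus ?thesis using Ea[OF ef(1)] herm[OF ef(1)] by simp
  next
    case False
    have "0 \<cdot>\<^sub>m 1\<^sub>m n = 0 \<cdot>\<^sub>m E e" by (rule eq_matI) (auto simp: E_def)
    thus ?thesis using orth[OF ef False] herm[OF ef(1)] False by simp
  qed
  show ?thesis by (rule that[of S E]) (use S Ec AE sum1 ev herm idem in auto)
qed

section \<open>Controllability\<close>

text \<open>Powers of \<open>R\<close> are moved from the columns of \<open>W\<close> to the test
  vector, which links \<open>krylov\<close> to the kernel of \<open>W^T\<close> along an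
  orbit.\<close>

lemma skew_power_transpose:
  assumes R: "\<And>i j. i < n \<Longrightarrow> j < n \<Longrightarrow> R i j = - R j i"
  shows "(\<Sum>i<n. (mv n R ^^ r) w i * z i) = (- 1) ^ r * (\<Sum>i<n. w i * (mv n R ^^ r) z i)"
proof (induct r arbitrary: w)
  case (Suc r)
  have base: "(\<Sum>i<n. mv n R w i * y i) = - (\<Sum>i<n. w i * mv n R y i)" for y
  proof -
    have "(\<Sum>i<n. mv n R w i * y i) = (\<Sum>i<n. \<Sum>j<n. of_real (R i j) * w j * y i)"
      by (simp add: mv_def sum_distrib_right)
    also have "\<dots> = (\<Sum>j<n. \<Sum>i<n. of_real (R i j) * w j * y i)" by (rule sum.swap)
    also have "\<dots> = (\<Sum>j<n. - (w j * mv n R y j))"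
    proof (rule sum.cong[OF refl])
      fix j assume "j \<in> {..<n}" hence j: "j < n" by simp
      have "(\<Sum>i<n. of_real (R i j) * w j * y i) = (\<Sum>i<n. - (w j * (of_real (R j i) * y i)))"
        by (intro sum.cong refl, subst R) (auto simp: j)
      thus "(\<Sum>i<n. of_real (R i j) * w j * y i) = - (w j * mv n R y j)"
        by (simp add: mv_def sum_negf sum_distrib_left)
    qed
    finally show ?thesis by (simp add: sum_negf)
  qed
  have "(\<Sum>i<n. (mv n R ^^ Suc r) w i * z i) = (\<Sum>i<n. (mv n R ^^ r) (mv n R w) i * z i)"
    by (simp add: funpow_swap1)
  also have "\<dots> = (- 1) ^ r * (\<Sum>i<n. mv n R w i * (mv n R ^^ r) z i)" by (rule Suc)
  also have "\<dots> = (- 1) ^ Suc r * (\<Sum>i<n. w i * (mv n R ^^ Suc r) z i)" unfolding base by simp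
  finally show ?case .
qed simp

context fermion_model
begin

definition no_common_eigenvector :: bool where
  "no_common_eigenvector \<longleftrightarrow> \<not> (\<exists>v \<mu>. eigenvector T v \<mu> \<and> mat_adjoint \<Theta> *\<^sub>v v = 0\<^sub>v (2 * K))"

lemma T_carrier: "T \<in> carrier_mat (2*L) (2*L)" using Rc by (simp add: T_def)
lemma \<Theta>_carrier: "\<Theta> \<in> carrier_mat (2*L) (2*K)" using Wc by (simp add: \<Theta>_def)

lemma T_adjoint: "mat_adjoint T = T"
proof (rule eq_matI)
  fix i j assume "i < dim_row T" "j < dim_col T"
  hence ij: "i < 2*L" "j < 2*L" using T_carrier by auto
  have "R $$ (j,i) = - R $$ (i,j)" by (rule Ra[OF ij(2,1)])
  thus "mat_adjoint T $$ (i,j) = T $$ (i,j)" using ij Rc by (simp add: T_def)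
qed (use T_carrier in auto)

lemma adjoint_\<Theta>_eq_0:
  assumes v: "v \<in> carrier_vec (2*L)"
  shows "mat_adjoint \<Theta> *\<^sub>v v = 0\<^sub>v (2*K) \<longleftrightarrow> (\<forall>k<2*K. (\<Sum>i<2*L. of_real (W\<^sub>f i k) * v $ i) = 0)"
proof -
  have Ta: "mat_adjoint \<Theta> \<in> carrier_mat (2*K) (2*L)" using \<Theta>_carrier by simp
  have e: "(mat_adjoint \<Theta> *\<^sub>v v) $ k = - \<i> * (\<Sum>i<2*L. of_real (W\<^sub>f i k) * v $ i)" if k: "k < 2*K" for k
    unfolding index_mult_vec_sum[OF Ta v k] sum_distrib_left
    by (intro sum.cong refl) (use k Wc in \<open>simp add: \<Theta>_def\<close>)
  have "mat_adjoint \<Theta> *\<^sub>v v = 0\<^sub>v (2*K) \<longleftrightarrow> (\<forall>k<2*K. (mat_adjoint \<Theta> *\<^sub>v v) $ k = 0)"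
    unfolding vec_eq_iff using Ta by (simp del: index_mult_mat_vec)
  thus ?thesis by (simp add: e del: index_mult_mat_vec)
qed

text \<open>If \<open>W^T\<close> vanished along the orbit of a nonzero vector under
  \<open>T\<close>, it would vanish on an eigenvector of \<open>T\<close> by the Hautus argument.
  The powers below \<open>2 * L\<close> are enough since \<open>T\<close> has that size.\<close>

lemma no_common_eigenvector_kernel:
  assumes c: no_common_eigenvector and z: "z \<in> carrier_vec (2*L)"
    and k: "\<And>r k. r < 2*L \<Longrightarrow> k < 2*K \<Longrightarrow> (\<Sum>i<2*L. of_real (W\<^sub>f i k) * (T ^\<^sub>m r *\<^sub>v z) $ i) = 0"
  shows "z = 0\<^sub>v (2*L)"
proof (rule ccontr)
  assume "z \<noteq> 0\<^sub>v (2*L)"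
  from hermitian_krylov_eigenvector[OF T_carrier T_adjoint z this, of "{..<2*K}" "\<lambda>k i. of_real (W\<^sub>f i k)"] k
  obtain u e where u: "u \<in> carrier_vec (2*L)" "u \<noteq> 0\<^sub>v (2*L)" "T *\<^sub>v u = e \<cdot>\<^sub>v u"
    "\<And>k. k < 2*K \<Longrightarrow> (\<Sum>i<2*L. of_real (W\<^sub>f i k) * u $ i) = 0" by auto
  hence "eigenvector T u e \<and> mat_adjoint \<Theta> *\<^sub>v u = 0\<^sub>v (2*K)"
    unfolding eigenvector_def adjoint_\<Theta>_eq_0[OF u(1)] using T_carrier by auto
  with c show False unfolding no_common_eigenvector_def by blast
qed

lemma T_power_mv:
  assumes "i < 2*L"
  shows "(T ^\<^sub>m r *\<^sub>v vec (2*L) z) $ i = \<i> ^ r * (mv (2*L) R\<^sub>f ^^ r) z i"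
proof (induct r arbitrary: z)
  case 0 thus ?case using assms T_carrier by simp
next
  case (Suc r)
  have "T *\<^sub>v vec (2*L) z = \<i> \<cdot>\<^sub>v vec (2*L) (mv (2*L) R\<^sub>f z)"
  proof (rule eq_vecI)
    fix i assume "i < dim_vec (\<i> \<cdot>\<^sub>v vec (2*L) (mv (2*L) R\<^sub>f z))"
    hence i: "i < 2*L" by simp
    show "(T *\<^sub>v vec (2*L) z) $ i = (\<i> \<cdot>\<^sub>v vec (2*L) (mv (2*L) R\<^sub>f z)) $ i"
      unfolding index_mult_vec_sum[OF T_carrier vec_carrier i] using i Rc by (simp add: mv_def T_def sum_distrib_left mult.assoc)
  qed (use T_carrier in simp)
  hence "T ^\<^sub>m Suc r *\<^sub>v vec (2*L) z = \<i> \<cdot>\<^sub>v (T ^\<^sub>m r *\<^sub>v vec (2*L) (mv (2*L) R\<^sub>f z))"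
    unfolding pow_mat_vec_Suc[OF T_carrier vec_carrier] by (simp only:) (rule mult_mat_vec[OF pow_carrier_mat[OF T_carrier] vec_carrier])
  moreover have "dim_row (T ^\<^sub>m r) = 2*L" using T_carrier by simp
  ultimately have "(T ^\<^sub>m Suc r *\<^sub>v vec (2*L) z) $ i = \<i> * (T ^\<^sub>m r *\<^sub>v vec (2*L) (mv (2*L) R\<^sub>f z)) $ i"
    using assms by (simp del: index_mult_mat_vec pow_mat.simps)
  thus ?case unfolding Suc by (simp add: funpow_swap1)
qed

lemma controllable_if_no_common_eigenvector: assumes no_common_eigenvector shows controllable
  unfolding controllable_def krylov_def
proof (intro allI impI)
  fix z :: "nat \<Rightarrow> complex" and i
  assume h: "\<forall>r. \<forall>k<2*K. (\<Sum>i<2*L. (mv (2*L) R\<^sub>f ^^ r) (\<lambda>i. of_real (W\<^sub>f i k)) i * z i) = 0" and i: "i < 2*L"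
  have "vec (2*L) z = 0\<^sub>v (2*L)"
  proof (rule no_common_eigenvector_kernel[OF assms vec_carrier])
    fix r k assume k: "k < 2*K"
    have "(\<Sum>i<2*L. of_real (W\<^sub>f i k) * (mv (2*L) R\<^sub>f ^^ r) z i) = 0"
      using h[rule_format, OF k, of r] skew_power_transpose[where n = "2*L" and R = R\<^sub>f and r = r
          and w = "\<lambda>i. of_real (W\<^sub>f i k)" and z = z, OF Ra] by simp
    moreover have "(\<Sum>i<2*L. of_real (W\<^sub>f i k) * (T ^\<^sub>m r *\<^sub>v vec (2*L) z) $ i)
      = \<i> ^ r * (\<Sum>i<2*L. of_real (W\<^sub>f i k) * (mv (2*L) R\<^sub>f ^^ r) z i)"
      unfolding sum_distrib_left by (intro sum.cong refl) (simp add: T_power_mv del: index_mult_mat_vec)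
    ultimately show "(\<Sum>i<2*L. of_real (W\<^sub>f i k) * (T ^\<^sub>m r *\<^sub>v vec (2*L) z) $ i) = 0" by simp
  qed
  hence "vec (2*L) z $ i = 0" using i by simp
  thus "z i = 0" using i by simp
qed

text \<open>One direction inverts a controllability Gramian. In the other, a common eigenvector is
  orthogonal to every range and, if these span, to itself.\<close>

lemma no_common_eigenvector_iff_span:
  "no_common_eigenvector \<longleftrightarrow> cspan (2*L) (\<Union>k \<in> {0..2*L}. Ran (T ^\<^sub>m k * \<Theta>)) = carrier_vec (2*L)"
proof -
  let ?n = "2 * L" and ?S = "\<Union>k \<in> {0..2*L}. Ran (T ^\<^sub>m k * \<Theta>)"
  interpret V: vec_space "TYPE(complex)" ?n .
  have cs: "cspan ?n ?S = V.span ?S" by (simp add: cspan_def)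
  have TTh: "T ^\<^sub>m k * \<Theta> \<in> carrier_mat ?n (2*K)" for k
    by (rule mult_carrier_mat[OF pow_carrier_mat[OF T_carrier] \<Theta>_carrier])
  have RanT: "Ran (T ^\<^sub>m k * \<Theta>) = {(T ^\<^sub>m k * \<Theta>) *\<^sub>v x | x. x \<in> carrier_vec (2*K)}" for k
    unfolding Ran_def carrier_matD(2)[OF TTh] ..
  have S: "?S \<subseteq> carrier_vec ?n"
  proof
    fix u assume "u \<in> ?S"
    then obtain k x where "u = (T ^\<^sub>m k * \<Theta>) *\<^sub>v x" "x \<in> carrier_vec (2*K)"
      unfolding RanT by blast
    thus "u \<in> carrier_vec ?n" using mult_mat_vec_carrier[OF TTh] by simp
  qed
  have Tk_adj: "mat_adjoint (T ^\<^sub>m k) = T ^\<^sub>m k" for k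
    unfolding pow_mat_adjoint[OF T_carrier] T_adjoint ..
  have adj: "mat_adjoint (T ^\<^sub>m k * \<Theta>) *\<^sub>v v = mat_adjoint \<Theta> *\<^sub>v (T ^\<^sub>m k *\<^sub>v v)" if "v \<in> carrier_vec ?n" for k v
    unfolding mat_adjoint_mult[OF pow_carrier_mat[OF T_carrier] \<Theta>_carrier] Tk_adj
    by (rule assoc_mult_mat_vec[OF _ pow_carrier_mat[OF T_carrier] that]) (use \<Theta>_carrier in simp)
  show ?thesis
  proof
    assume c: no_common_eigenvector
    \<comment> \<open>The Gramian: its quadratic form is the sum of the squared norms of
      \<open>(T^k \<Theta>)^* z\<close>, so it is injective by the kernel lemma, and its range lies
      in the span.\<close>
    define G where "G = msum ?n ?n (\<lambda>k. (T ^\<^sub>m k * \<Theta>) * mat_adjoint (T ^\<^sub>m k * \<Theta>)) {0..?n}"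
    have G: "G \<in> carrier_mat ?n ?n" by (simp add: G_def)
    have Mc: "(T ^\<^sub>m k * \<Theta>) * mat_adjoint (T ^\<^sub>m k * \<Theta>) \<in> carrier_mat ?n ?n" for k
      by (rule mult_carrier_mat[OF TTh]) (use TTh[of k] in simp)
    have Gx: "G *\<^sub>v x = vec ?n (\<lambda>i. \<Sum>k\<in>{0..?n}. ((T ^\<^sub>m k * \<Theta>) *\<^sub>v (mat_adjoint (T ^\<^sub>m k * \<Theta>) *\<^sub>v x)) $ i)"
      if x: "x \<in> carrier_vec ?n" for x
    proof (rule eq_vecI)
      fix i assume "i < dim_vec (vec ?n (\<lambda>i. \<Sum>k\<in>{0..?n}. ((T ^\<^sub>m k * \<Theta>) *\<^sub>v (mat_adjoint (T ^\<^sub>m k * \<Theta>) *\<^sub>v x)) $ i))"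
      hence i: "i < ?n" by simp
      have "(G *\<^sub>v x) $ i = (\<Sum>j<?n. G $$ (i,j) * x $ j)" by (rule index_mult_vec_sum[OF G x i])
      also have "\<dots> = (\<Sum>j<?n. \<Sum>k\<in>{0..?n}. ((T ^\<^sub>m k * \<Theta>) * mat_adjoint (T ^\<^sub>m k * \<Theta>)) $$ (i,j) * x $ j)"
        unfolding G_def by (intro sum.cong refl) (simp only: index_msum[OF i] lessThan_iff sum_distrib_right)
      also have "\<dots> = (\<Sum>k\<in>{0..?n}. \<Sum>j<?n. ((T ^\<^sub>m k * \<Theta>) * mat_adjoint (T ^\<^sub>m k * \<Theta>)) $$ (i,j) * x $ j)"
        by (rule sum.swap)
      also have "\<dots> = (\<Sum>k\<in>{0..?n}. ((T ^\<^sub>m k * \<Theta>) *\<^sub>v (mat_adjoint (T ^\<^sub>m k * \<Theta>) *\<^sub>v x)) $ i)"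
      proof (rule sum.cong[OF refl])
        fix k
        have Ma: "mat_adjoint (T ^\<^sub>m k * \<Theta>) \<in> carrier_mat (2*K) ?n" using TTh[of k] by simp
        show "(\<Sum>j<?n. ((T ^\<^sub>m k * \<Theta>) * mat_adjoint (T ^\<^sub>m k * \<Theta>)) $$ (i,j) * x $ j)
          = ((T ^\<^sub>m k * \<Theta>) *\<^sub>v (mat_adjoint (T ^\<^sub>m k * \<Theta>) *\<^sub>v x)) $ i"
          unfolding assoc_mult_mat_vec[OF TTh Ma x, symmetric] by (rule index_mult_vec_sum[OF Mc x i, symmetric])
      qed
      finally show "(G *\<^sub>v x) $ i = vec ?n (\<lambda>i. \<Sum>k\<in>{0..?n}. ((T ^\<^sub>m k * \<Theta>) *\<^sub>v (mat_adjoint (T ^\<^sub>m k * \<Theta>) *\<^sub>v x)) $ i) $ i"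
        using i by (simp del: index_mult_mat_vec)
    qed (use G in simp)
    have inj: "z = 0\<^sub>v ?n" if z: "z \<in> carrier_vec ?n" "G *\<^sub>v z = 0\<^sub>v ?n" for z
    proof (rule no_common_eigenvector_kernel[OF c z(1)])
      let ?y = "\<lambda>k. mat_adjoint (T ^\<^sub>m k * \<Theta>) *\<^sub>v z"
      have y: "?y k \<in> carrier_vec (2*K)" for k
        by (rule mult_mat_vec_carrier[OF _ z(1)]) (use TTh[of k] in simp)
      have "0 = ip ?n (G *\<^sub>v z) z" unfolding z(2) by (simp add: ip_def)
      also have "\<dots> = (\<Sum>i<?n. \<Sum>k\<in>{0..?n}. ((T ^\<^sub>m k * \<Theta>) *\<^sub>v ?y k) $ i * cnj (z $ i))"
        unfolding Gx[OF z(1)] ip_def by (intro sum.cong refl) (simp add: sum_distrib_right del: index_mult_mat_vec)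
      also have "\<dots> = (\<Sum>k\<in>{0..?n}. ip ?n ((T ^\<^sub>m k * \<Theta>) *\<^sub>v ?y k) z)" unfolding ip_def by (rule sum.swap)
      also have "\<dots> = (\<Sum>k\<in>{0..?n}. ip (2*K) (?y k) (?y k))"
        by (intro sum.cong refl ip_mult_left[OF TTh y z(1)])
      also have "\<dots> = of_real (\<Sum>k\<in>{0..?n}. \<Sum>i<2*K. (cmod (?y k $ i))\<^sup>2)"
        unfolding ip_self of_real_sum ..
      finally have "complex_of_real (\<Sum>k\<in>{0..?n}. \<Sum>i<2*K. (cmod (?y k $ i))\<^sup>2) = 0" by (rule sym)
      hence s: "(\<Sum>k\<in>{0..?n}. \<Sum>i<2*K. (cmod (?y k $ i))\<^sup>2) = 0" by (rule of_real_eq_0_iff[THEN iffD1])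
      fix r k assume rk: "r < 2*L" "k < 2*K"
      have "(\<Sum>i<2*K. (cmod (?y r $ i))\<^sup>2) = 0"
        using sum_nonneg_eq_0_iff[of "{0..?n}" "\<lambda>k. \<Sum>i<2*K. (cmod (?y k $ i))\<^sup>2"] s rk(1)
        by (simp add: sum_nonneg del: index_mult_mat_vec)
      hence "ip (2*K) (?y r) (?y r) = 0" unfolding ip_self by simp
      hence "?y r = 0\<^sub>v (2*K)" using ip_self_eq_0[OF y] by simp
      thus "(\<Sum>i<2*L. of_real (W\<^sub>f i k) * (T ^\<^sub>m r *\<^sub>v z) $ i) = 0"
        unfolding adj[OF z(1)] using adjoint_\<Theta>_eq_0[OF mult_mat_vec_carrier[OF pow_carrier_mat[OF T_carrier] z(1)]] rk by blast
    qed
    obtain B where B: "B \<in> carrier_mat ?n ?n" "G * B = 1\<^sub>m ?n" by (rule inverse_of_injective[OF G inj]) blast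
    have sub: "vec ?n (\<lambda>i. \<Sum>k\<in>I. f k $ i) \<in> V.span ?S" if "finite I" "\<And>k. k \<in> I \<Longrightarrow> f k \<in> ?S" for I :: "nat set" and f
      using that
    proof (induct I rule: finite_induct)
      case empty
      have "vec ?n (\<lambda>i. \<Sum>k\<in>{}. f k $ i) = 0\<^sub>v ?n" by (rule eq_vecI) auto
      moreover have "V.lincomb (\<lambda>_. 0) {} \<in> V.span ?S" unfolding V.span_def by blast
      ultimately show ?case by simp
    next
      case (insert k I)
      have fk: "f k \<in> V.span ?S" using insert V.in_own_span[OF S] by blast
      have "f k \<in> carrier_vec ?n" using insert S by blast
      hence "vec ?n (\<lambda>i. \<Sum>k\<in>insert k I. f k $ i) = f k + vec ?n (\<lambda>i. \<Sum>k\<in>I. f k $ i)"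
        by (intro eq_vecI) (use insert in auto)
      thus ?case using V.span_add1[OF S fk insert(3)] insert by simp
    qed
    have "x \<in> V.span ?S" if x: "x \<in> carrier_vec ?n" for x
    proof -
      have Bx: "B *\<^sub>v x \<in> carrier_vec ?n" by (rule mult_mat_vec_carrier[OF B(1) x])
      have "x = G *\<^sub>v (B *\<^sub>v x)" unfolding assoc_mult_mat_vec[OF G B(1) x, symmetric] B(2) using x by simp
      also have "\<dots> \<in> V.span ?S"
        unfolding Gx[OF Bx]
      proof (rule sub)
        fix k assume k: "k \<in> {0..?n}"
        have "mat_adjoint (T ^\<^sub>m k * \<Theta>) *\<^sub>v (B *\<^sub>v x) \<in> carrier_vec (2*K)"
          by (rule mult_mat_vec_carrier[OF _ Bx]) (use TTh[of k] in simp)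
        thus "(T ^\<^sub>m k * \<Theta>) *\<^sub>v (mat_adjoint (T ^\<^sub>m k * \<Theta>) *\<^sub>v (B *\<^sub>v x)) \<in> ?S"
          using k unfolding RanT by blast
      qed simp
      finally show ?thesis .
    qed
    thus "cspan ?n ?S = carrier_vec ?n" unfolding cs using V.span_closed[OF S] by blast
  next
    assume full: "cspan ?n ?S = carrier_vec ?n"
    show no_common_eigenvector
      unfolding no_common_eigenvector_def
    proof (intro notI, elim exE conjE)
      fix v \<mu> assume ev: "eigenvector T v \<mu>" and th: "mat_adjoint \<Theta> *\<^sub>v v = 0\<^sub>v (2*K)"
      from ev have v: "v \<in> carrier_vec ?n" "v \<noteq> 0\<^sub>v ?n" "T *\<^sub>v v = \<mu> \<cdot>\<^sub>v v"
        using T_carrier by (auto simp: eigenvector_def)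
      have Tk: "T ^\<^sub>m k *\<^sub>v v = \<mu> ^ k \<cdot>\<^sub>v v" for k
      proof (induct k)
        case 0 thus ?case using v T_carrier by simp
      next
        case (Suc k)
        have "T ^\<^sub>m Suc k *\<^sub>v v = \<mu> \<cdot>\<^sub>v (T ^\<^sub>m k *\<^sub>v v)"
          unfolding pow_mat_vec_Suc[OF T_carrier v(1)] v(3) by (rule mult_mat_vec[OF pow_carrier_mat[OF T_carrier] v(1)])
        thus ?case unfolding Suc by (simp add: smult_smult_assoc)
      qed
      \<comment> \<open>Self-adjointness moves \<open>T^k\<close> onto \<open>v\<close>, where it
        acts as the scalar \<open>\<mu>^k\<close>, and then the adjoint of \<Theta> kills
        \<open>v\<close>.\<close>
      have S0: "ip ?n u v = 0" if u: "u \<in> ?S" for u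
      proof -
        from u obtain k x where u: "u = (T ^\<^sub>m k * \<Theta>) *\<^sub>v x" "x \<in> carrier_vec (2*K)"
          unfolding RanT by blast
        have "ip ?n u v = ip (2*K) x (mat_adjoint \<Theta> *\<^sub>v (\<mu> ^ k \<cdot>\<^sub>v v))"
          unfolding u(1) ip_mult_left[OF TTh u(2) v(1)] adj[OF v(1)] Tk ..
        also have "mat_adjoint \<Theta> *\<^sub>v (\<mu> ^ k \<cdot>\<^sub>v v) = \<mu> ^ k \<cdot>\<^sub>v 0\<^sub>v (2*K)"
          unfolding th[symmetric] by (rule mult_mat_vec[OF _ v(1)]) (use \<Theta>_carrier in simp)
        finally show ?thesis by (simp add: ip_def)
      qed
      have "v \<in> V.span ?S" using v(1) full unfolding cs by simp
      then obtain c A where A: "finite A" "A \<subseteq> ?S" "v = V.lincomb c A" unfolding V.span_def by auto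
      have "ip ?n v v = (\<Sum>i<?n. (\<Sum>u\<in>A. c u * u $ i) * cnj (v $ i))"
      proof -
        have "v $ i = (\<Sum>u\<in>A. c u * u $ i)" if "i < ?n" for i
          using V.lincomb_index[OF that, of A c] A S by auto
        thus ?thesis unfolding ip_def by (intro sum.cong refl) simp
      qed
      also have "\<dots> = (\<Sum>i<?n. \<Sum>u\<in>A. c u * (u $ i * cnj (v $ i)))"
        by (simp add: sum_distrib_right mult.assoc)
      also have "\<dots> = (\<Sum>u\<in>A. c u * ip ?n u v)" unfolding ip_def sum_distrib_left by (rule sum.swap)
      also have "\<dots> = 0"
      proof (intro sum.neutral ballI)
        fix u assume "u \<in> A"
        hence "u \<in> ?S" using A(2) by blast
        from S0[OF this] show "c u * ip ?n u v = 0" by simp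
      qed
      finally show False using ip_self_eq_0[OF v(1)] v(2) by simp
    qed
  qed
qed

end

section \<open>Gaussian and quasi-free states\<close>

lemma inner_prod_ip: "u \<in> carrier_vec n \<Longrightarrow> v \<in> carrier_vec n \<Longrightarrow> u \<bullet>c v = ip n u v"
  unfolding scalar_prod_def ip_def by (auto simp: atLeast0LessThan intro!: sum.cong)

lemma mtrace_mult_sum:
  assumes A: "A \<in> carrier_mat n n" and B: "B \<in> carrier_mat n n"
  shows "mtrace (A * B) = (\<Sum>i<n. \<Sum>j<n. A $$ (i,j) * B $$ (j,i))"
proof -
  have "mtrace (A * B) = (\<Sum>i<n. (A * B) $$ (i,i))"
    unfolding mtrace_def carrier_matD(1)[OF mult_sq_carrier[OF A B]] ..
  also have "\<dots> = (\<Sum>i<n. \<Sum>j<n. A $$ (i,j) * B $$ (j,i))"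
    by (intro sum.cong refl) (simp only: lessThan_iff index_mult_sum[OF A B])
  finally show ?thesis .
qed

lemma mtrace_mult_adjoint:
  assumes M: "M \<in> carrier_mat n n"
  shows "mtrace (M * mat_adjoint M) = of_real (\<Sum>i<n. \<Sum>j<n. (cmod (M $$ (i,j)))\<^sup>2)"
proof -
  have Ma: "mat_adjoint M \<in> carrier_mat n n" using M by simp
  have "mtrace (M * mat_adjoint M) = (\<Sum>i<n. \<Sum>j<n. M $$ (i,j) * mat_adjoint M $$ (j,i))"
    by (rule mtrace_mult_sum[OF M Ma])
  also have "\<dots> = (\<Sum>i<n. \<Sum>j<n. of_real ((cmod (M $$ (i,j)))\<^sup>2))"
    by (intro sum.cong refl) (use M in \<open>simp add: complex_norm_square[symmetric]\<close>)
  finally show ?thesis by simp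
qed

lemma mtrace_hermitian_square:
  assumes M: "M \<in> carrier_mat n n" "mat_adjoint M = M"
  shows "mtrace (M * M) = of_real (\<Sum>i<n. \<Sum>j<n. (cmod (M $$ (i,j)))\<^sup>2)"
  using mtrace_mult_adjoint[OF M(1)] unfolding M(2) .

lemma row_norm_le:
  assumes "i < n" shows "(\<Sum>k<n. (cmod (M $$ (i,k)))\<^sup>2) \<le> (\<Sum>i<n. \<Sum>j<n. (cmod (M $$ (i,j)))\<^sup>2)"
  by (rule member_le_sum[of i "{..<n}" "\<lambda>i. \<Sum>k<n. (cmod (M $$ (i,k)))\<^sup>2"]) (use assms in \<open>auto intro: sum_nonneg\<close>)

text \<open>The quadratic form of \<open>M * M\<close> is a squared norm. Entries are bounded by
  products of two row norms, each at most the Hilbert-Schmidt norm, whose square is the normalizing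
  trace. The bound does not depend on \<open>M\<close>, which makes the later approximation uniform
  over Gaussian states.\<close>

lemma hermitian_square_state:
  assumes M: "M \<in> carrier_mat n n" "mat_adjoint M = M" and nz: "mtrace (M * M) \<noteq> 0"
  defines "\<sigma> \<equiv> (1 / mtrace (M * M)) \<cdot>\<^sub>m (M * M)"
  shows "is_state n \<sigma>" and "i < n \<Longrightarrow> j < n \<Longrightarrow> cmod (\<sigma> $$ (i,j)) \<le> 1"
proof -
  define s where "s = (\<Sum>i<n. \<Sum>j<n. (cmod (M $$ (i,j)))\<^sup>2)"
  have Z: "mtrace (M * M) = of_real s" unfolding s_def by (rule mtrace_hermitian_square[OF M])
  have "0 \<le> s" unfolding s_def by (intro sum_nonneg) simp
  moreover have "s \<noteq> 0" using nz Z by auto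
  ultimately have s: "0 < s" by simp
  have MM: "M * M \<in> carrier_mat n n" by (rule mult_sq_carrier[OF M(1) M(1)])
  show "is_state n \<sigma>"
    unfolding is_state_def
  proof (intro conjI ballI)
    show "\<sigma> \<in> carrier_mat n n" using MM by (simp add: \<sigma>_def)
    show "mtrace \<sigma> = 1" unfolding \<sigma>_def mtrace_smult[OF MM] using nz by simp
    fix v :: "complex vec" assume v: "v \<in> carrier_vec n"
    have Mv: "M *\<^sub>v v \<in> carrier_vec n" by (rule mult_mat_vec_carrier[OF M(1) v])
    have "(c \<cdot>\<^sub>m (M * M)) *\<^sub>v v = c \<cdot>\<^sub>v ((M * M) *\<^sub>v v)" for c :: complex
      by (rule eq_vecI) (use MM v in auto)
    hence "\<sigma> *\<^sub>v v = (1 / of_real s) \<cdot>\<^sub>v (M *\<^sub>v (M *\<^sub>v v))"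
      unfolding \<sigma>_def Z assoc_mult_mat_vec[OF M(1) M(1) v, symmetric] by simp
    moreover have MMv: "M *\<^sub>v (M *\<^sub>v v) \<in> carrier_vec n" by (rule mult_mat_vec_carrier[OF M(1) Mv])
    ultimately have "(\<sigma> *\<^sub>v v) \<bullet>c v = (1 / of_real s) * ip n (M *\<^sub>v (M *\<^sub>v v)) v"
      using v by (simp add: inner_prod_ip ip_smult_left)
    also have "ip n (M *\<^sub>v (M *\<^sub>v v)) v = ip n (M *\<^sub>v v) (M *\<^sub>v v)"
      unfolding ip_mult_left[OF M(1) Mv v] M(2) ..
    also have "(1 / complex_of_real s) * \<dots> = of_real (1 / s * (\<Sum>i<n. (cmod ((M *\<^sub>v v) $ i))\<^sup>2))"
      unfolding ip_self of_real_mult of_real_divide of_real_1 ..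
    finally have e: "(\<sigma> *\<^sub>v v) \<bullet>c v = of_real (1 / s * (\<Sum>i<n. (cmod ((M *\<^sub>v v) $ i))\<^sup>2))" .
    show "Im ((\<sigma> *\<^sub>v v) \<bullet>c v) = 0" unfolding e by (rule Im_complex_of_real)
    show "0 \<le> Re ((\<sigma> *\<^sub>v v) \<bullet>c v)" unfolding e Re_complex_of_real
      by (intro mult_nonneg_nonneg sum_nonneg) (use s in auto)
  qed
  assume ij: "i < n" "j < n"
  have "M $$ (k,j) = cnj (M $$ (j,k))" if "k < n" for k
    using arg_cong[OF M(2), of "\<lambda>X. X $$ (k,j)"] index_mat_adjoint[of k M j] M(1) that ij by simp
  hence "(M * M) $$ (i,j) = (\<Sum>k<n. M $$ (i,k) * cnj (M $$ (j,k)))"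
    unfolding index_mult_sum[OF M(1) M(1) ij] by (intro sum.cong refl) auto
  hence "cmod ((M * M) $$ (i,j)) \<le> (\<Sum>k<n. cmod (M $$ (i,k)) * cmod (M $$ (j,k)))"
    by (simp only:) (rule order_trans[OF norm_sum], simp add: norm_mult)
  also have "\<dots> \<le> (\<Sum>k<n. ((cmod (M $$ (i,k)))\<^sup>2 + (cmod (M $$ (j,k)))\<^sup>2) / 2)"
  proof (rule sum_mono)
    fix k
    have "0 \<le> (cmod (M $$ (i,k)) - cmod (M $$ (j,k)))\<^sup>2" by simp
    thus "cmod (M $$ (i,k)) * cmod (M $$ (j,k)) \<le> ((cmod (M $$ (i,k)))\<^sup>2 + (cmod (M $$ (j,k)))\<^sup>2) / 2"
      unfolding power2_diff by simp
  qed
  also have "\<dots> = ((\<Sum>k<n. (cmod (M $$ (i,k)))\<^sup>2) + (\<Sum>k<n. (cmod (M $$ (j,k)))\<^sup>2)) / 2"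
    by (simp only: sum.distrib sum_divide_distrib[symmetric])
  also have "\<dots> \<le> s" using row_norm_le[OF ij(1), of M] row_norm_le[OF ij(2), of M] unfolding s_def by simp
  finally have "cmod ((M * M) $$ (i,j)) \<le> s" .
  moreover have "\<sigma> $$ (i,j) = (M * M) $$ (i,j) / of_real s"
    using M(1) ij by (simp add: \<sigma>_def Z del: index_mult_mat(1))
  ultimately show "cmod (\<sigma> $$ (i,j)) \<le> 1" using s by (simp add: norm_divide del: index_mult_mat(1))
qed

text \<open>Halving the exponent exhibits the exponential as the square of a hermitian matrix; its
  trace is a squared Hilbert-Schmidt norm, nonzero because exponentials are invertible.\<close>

lemma gaussian_state_square:
  assumes "gaussian_state n \<sigma>"
  obtains M where "M \<in> carrier_mat (2 ^ n) (2 ^ n)" "mat_adjoint M = M" "mtrace (M * M) \<noteq> 0"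
    "\<sigma> = (1 / mtrace (M * M)) \<cdot>\<^sub>m (M * M)"
proof -
  let ?d = "2 ^ n :: nat"
  from assms obtain \<beta> :: real and H where q: "quadratic_hamiltonian n H"
    and \<sigma>: "\<sigma> = (1 / mtrace (mat_exp ((- of_real \<beta>) \<cdot>\<^sub>m H))) \<cdot>\<^sub>m mat_exp ((- of_real \<beta>) \<cdot>\<^sub>m H)"
    unfolding gaussian_state_def by (elim exE conjE) (rule that)
  have H1: "mat_adjoint H = H" by (rule sym, rule conjunct1[OF q[unfolded quadratic_hamiltonian_def]])
  from q obtain T where T: "H = msum ?d ?d (\<lambda>(i,j). T $$ (i,j) \<cdot>\<^sub>m (majorana n i * majorana n j)) ({..<2*n} \<times> {..<2*n})"
    unfolding quadratic_hamiltonian_def by (elim conjE bexE) (rule that)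
  have H2: "H \<in> carrier_mat ?d ?d" by (subst T, rule msum_carrier)
  define X where "X = (- of_real \<beta>) \<cdot>\<^sub>m H"
  have X: "X \<in> carrier_mat ?d ?d" "mat_adjoint X = X"
    unfolding X_def using H2 by (simp, simp add: mat_adjoint_smult H1)
  define M where "M = mat_exp ((1/2) \<cdot>\<^sub>m X)"
  have M: "M \<in> carrier_mat ?d ?d" using X by (simp add: M_def)
  have Ma: "mat_adjoint M = M"
    unfolding M_def mat_exp_adjoint[OF smult_carrier_mat[OF X(1)]] by (simp add: mat_adjoint_smult X(2))
  have e: "mat_exp X = M * M" using mat_exp_add[OF X(1), of "1/2" "1/2"] by (simp add: M_def)
  have "mtrace (M * M) \<noteq> 0"
  proof
    assume z: "mtrace (M * M) = 0"
    have "complex_of_real (\<Sum>i<?d. \<Sum>j<?d. (cmod (M $$ (i,j)))\<^sup>2) = 0"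
      unfolding mtrace_hermitian_square[OF M Ma, symmetric] by (rule z)
    hence s0: "(\<Sum>i<?d. \<Sum>j<?d. (cmod (M $$ (i,j)))\<^sup>2) = 0" by (rule of_real_eq_0_iff[THEN iffD1])
    have M0: "M $$ (i,j) = 0" if ij: "i < ?d" "j < ?d" for i j
    proof -
      have "(cmod (M $$ (i,j)))\<^sup>2 \<le> (\<Sum>k<?d. (cmod (M $$ (i,k)))\<^sup>2)"
        by (rule member_le_sum[of j "{..<?d}" "\<lambda>k. (cmod (M $$ (i,k)))\<^sup>2"]) (use ij in auto)
      from order_trans[OF this row_norm_le[OF ij(1), of M]] have "(cmod (M $$ (i,j)))\<^sup>2 \<le> 0" unfolding s0 .
      thus ?thesis by simp
    qed
    let ?M' = "mat_exp (- 1 \<cdot>\<^sub>m ((1/2) \<cdot>\<^sub>m X))"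
    have M': "?M' \<in> carrier_mat ?d ?d" using X by simp
    have "(M * ?M') $$ (0,0) = (1\<^sub>m ?d) $$ (0,0)"
      unfolding M_def by (simp only: mat_exp_inverse[OF smult_carrier_mat[OF X(1)]])
    moreover have "(M * ?M') $$ (0,0) = 0"
      unfolding index_mult_sum[OF M M' two_pow_pos two_pow_pos] using M0 by simp
    ultimately show False by simp
  qed
  with M Ma show ?thesis by (rule that) (simp only: \<sigma> X_def[symmetric] e)
qed

lemma gaussian_is_state: "gaussian_state n \<sigma> \<Longrightarrow> is_state (2 ^ n) \<sigma>"
  and gaussian_entry_le: "gaussian_state n \<sigma> \<Longrightarrow> i < 2 ^ n \<Longrightarrow> j < 2 ^ n \<Longrightarrow> cmod (\<sigma> $$ (i,j)) \<le> 1"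
proof -
  assume "gaussian_state n \<sigma>"
  then obtain M where M: "M \<in> carrier_mat (2 ^ n) (2 ^ n)" "mat_adjoint M = M" "mtrace (M * M) \<noteq> 0"
    "\<sigma> = (1 / mtrace (M * M)) \<cdot>\<^sub>m (M * M)" by (rule gaussian_state_square)
  show "is_state (2 ^ n) \<sigma>" unfolding M(4) by (rule hermitian_square_state(1)[OF M(1-3)])
  show "i < 2 ^ n \<Longrightarrow> j < 2 ^ n \<Longrightarrow> cmod (\<sigma> $$ (i,j)) \<le> 1"
    unfolding M(4) by (rule hermitian_square_state(2)[OF M(1-3)])
qed

lemma quadratic_form_sum:
  assumes A: "A \<in> carrier_mat n n" and v: "v \<in> carrier_vec n"
  shows "(A *\<^sub>v v) \<bullet>c v = (\<Sum>i<n. \<Sum>j<n. A $$ (i,j) * v $ j * cnj (v $ i))"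
  unfolding inner_prod_ip[OF mult_mat_vec_carrier[OF A v] v] ip_def
  by (intro sum.cong refl) (simp add: index_mult_vec_sum[OF A v] sum_distrib_right del: index_mult_mat_vec)

lemma is_state_limit:
  assumes s: "\<And>k. is_state n (s k)" and lim: "mat_tendsto s \<rho> sequentially" and \<rho>: "\<rho> \<in> carrier_mat n n"
  shows "is_state n \<rho>"
proof -
  have sc: "s k \<in> carrier_mat n n" for k using s[of k] by (simp add: is_state_def)
  have e: "(\<lambda>k. s k $$ (i,j)) \<longlonglongrightarrow> \<rho> $$ (i,j)" if "i < n" "j < n" for i j
    using lim \<rho> that by (simp add: mat_tendsto_def)
  show ?thesis
    unfolding is_state_def
  proof (intro conjI ballI)
    show "\<rho> \<in> carrier_mat n n" by (rule \<rho>)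
    have "(\<lambda>k. mtrace (s k)) \<longlonglongrightarrow> mtrace \<rho>"
      unfolding mtrace_def carrier_matD(1)[OF sc] carrier_matD(1)[OF \<rho>] by (intro tendsto_sum e) auto
    moreover have "mtrace (s k) = 1" for k using s[of k] by (simp add: is_state_def)
    ultimately have "(\<lambda>k. 1) \<longlonglongrightarrow> mtrace \<rho>" by simp
    thus "mtrace \<rho> = 1" by (simp add: LIMSEQ_const_iff)
    fix v :: "complex vec" assume v: "v \<in> carrier_vec n"
    have l: "(\<lambda>k. (s k *\<^sub>v v) \<bullet>c v) \<longlonglongrightarrow> (\<rho> *\<^sub>v v) \<bullet>c v"
      unfolding quadratic_form_sum[OF sc v] quadratic_form_sum[OF \<rho> v] by (intro tendsto_intros e) auto
    have i: "Im ((s k *\<^sub>v v) \<bullet>c v) = 0" "0 \<le> Re ((s k *\<^sub>v v) \<bullet>c v)" for k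
      using s[of k] v unfolding is_state_def by blast+
    have "(\<lambda>k. 0) \<longlonglongrightarrow> Im ((\<rho> *\<^sub>v v) \<bullet>c v)" using tendsto_Im[OF l] unfolding i .
    thus "Im ((\<rho> *\<^sub>v v) \<bullet>c v) = 0" by (simp add: LIMSEQ_const_iff)
    show "0 \<le> Re ((\<rho> *\<^sub>v v) \<bullet>c v)"
      by (rule LIMSEQ_le_const[OF tendsto_Re[OF l]]) (use i in blast)
  qed
qed

lemma is_state_bath_state:
  assumes "is_state n \<omega>" shows "bath_state n \<omega>"
proof -
  from assms have w: "\<omega> \<in> carrier_mat n n" "mtrace \<omega> = 1"
    and pos: "\<And>v. v \<in> carrier_vec n \<Longrightarrow> Im ((\<omega> *\<^sub>v v) \<bullet>c v) = 0 \<and> 0 \<le> Re ((\<omega> *\<^sub>v v) \<bullet>c v)"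
    by (auto simp: is_state_def)
  \<comment> \<open>The quadratic form at \<open>e_p + c e_q\<close>. The choices 0, 1 and
    \<open>\<i>\<close> of \<open>c\<close> below turn reality of the form into hermiticity of the
    matrix.\<close>
  have q: "Im ((\<omega> $$ (p,p) + c * \<omega> $$ (p,q)) + cnj c * (\<omega> $$ (q,p) + c * \<omega> $$ (q,q))) = 0"
    if pq: "p < n" "q < n" for p q c
  proof -
    define v where "v = vec n (\<lambda>i. (if i = p then 1 else 0) + (if i = q then c else 0))"
    have v: "v \<in> carrier_vec n" by (simp add: v_def)
    have s: "(\<Sum>j<n. f j * ((if j = p then 1 else 0) + (if j = q then c' else 0))) = f p + c' * f q" for f :: "nat \<Rightarrow> complex" and c'
      using pq by (simp add: distrib_left sum.distrib if_distrib[of "\<lambda>x. _ * x"] mult.commute cong: if_cong)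
    have "(\<omega> *\<^sub>v v) \<bullet>c v = (\<Sum>i<n. (\<Sum>j<n. \<omega> $$ (i,j) * ((if j = p then 1 else 0) + (if j = q then c else 0)))
         * ((if i = p then 1 else 0) + (if i = q then cnj c else 0)))"
      unfolding quadratic_form_sum[OF w(1) v] sum_distrib_right
      by (intro sum.cong refl) (simp add: v_def)
    also have "\<dots> = (\<omega> $$ (p,p) + c * \<omega> $$ (p,q)) + cnj c * (\<omega> $$ (q,p) + c * \<omega> $$ (q,q))" unfolding s ..
    finally show ?thesis using pos[OF v] by simp
  qed
  have h: "cnj (\<omega> $$ (q,p)) = \<omega> $$ (p,q)" if pq: "p < n" "q < n" for p q
  proof (rule complex_eqI)
    have d: "Im (\<omega> $$ (p,p)) = 0" "Im (\<omega> $$ (q,q)) = 0" using q[OF pq(1,1), of 0] q[OF pq(2,2), of 0] by simp_all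
    show "Re (cnj (\<omega> $$ (q,p))) = Re (\<omega> $$ (p,q))" using q[OF pq, of \<i>] d by simp
    show "Im (cnj (\<omega> $$ (q,p))) = Im (\<omega> $$ (p,q))" using q[OF pq, of 1] d by simp
  qed
  have adj: "mat_adjoint \<omega> = \<omega>" by (rule eq_matI) (use w h in auto)
  \<comment> \<open>The trace is the sum of the quadratic form over the columns of
    \<open>M\<close>.\<close>
  have "0 \<le> Re (mtrace (\<omega> * (M * mat_adjoint M)))" if M: "M \<in> carrier_mat n n" for M
  proof -
    have Ma: "mat_adjoint M \<in> carrier_mat n n" using M by simp
    have "mtrace (\<omega> * (M * mat_adjoint M)) = (\<Sum>i<n. \<Sum>j<n. \<omega> $$ (i,j) * (M * mat_adjoint M) $$ (j,i))"
      by (rule mtrace_mult_sum[OF w(1) mult_sq_carrier[OF M Ma]])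
    also have "\<dots> = (\<Sum>i<n. \<Sum>j<n. \<Sum>k<n. \<omega> $$ (i,j) * (M $$ (j,k) * cnj (M $$ (i,k))))"
    proof (intro sum.cong refl)
      fix i j assume "i \<in> {..<n}" "j \<in> {..<n}"
      hence ij: "i < n" "j < n" by auto
      have "(M * mat_adjoint M) $$ (j,i) = (\<Sum>k<n. M $$ (j,k) * cnj (M $$ (i,k)))"
        unfolding index_mult_sum[OF M Ma ij(2,1)] by (intro sum.cong refl) (use M ij in simp)
      thus "\<omega> $$ (i,j) * (M * mat_adjoint M) $$ (j,i) = (\<Sum>k<n. \<omega> $$ (i,j) * (M $$ (j,k) * cnj (M $$ (i,k))))"
        by (simp only: sum_distrib_left)
    qed
    also have "\<dots> = (\<Sum>i<n. \<Sum>k<n. \<Sum>j<n. \<omega> $$ (i,j) * (M $$ (j,k) * cnj (M $$ (i,k))))"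
      by (rule sum.cong[OF refl], rule sum.swap)
    also have "\<dots> = (\<Sum>k<n. \<Sum>i<n. \<Sum>j<n. \<omega> $$ (i,j) * (M $$ (j,k) * cnj (M $$ (i,k))))" by (rule sum.swap)
    also have "\<dots> = (\<Sum>k<n. (\<omega> *\<^sub>v vec n (\<lambda>j. M $$ (j,k))) \<bullet>c vec n (\<lambda>j. M $$ (j,k)))"
      unfolding quadratic_form_sum[OF w(1) vec_carrier] by (intro sum.cong refl) (simp add: mult.assoc)
    finally show ?thesis using pos by (simp add: sum_nonneg)
  qed
  with w adj show ?thesis unfolding bath_state_def by blast
qed

lemma quasi_free_is_state:
  assumes "quasi_free n \<rho>" shows "is_state (2 ^ n) \<rho>"
proof -
  from assms obtain s where s: "\<And>k. gaussian_state n (s k)" "mat_tendsto s \<rho> sequentially" "\<rho> \<in> carrier_mat (2 ^ n) (2 ^ n)"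
    unfolding quasi_free_def by blast
  show ?thesis by (rule is_state_limit[OF gaussian_is_state[OF s(1)] s(2,3)])
qed

section \<open>Covariance of the stationary operator\<close>

context fermion_model
begin

text \<open>Off the diagonal this is the expectation of \<open>g j * g i\<close>, and on the
  diagonal it is zero.\<close>

definition covariance :: "complex mat \<Rightarrow> nat \<Rightarrow> nat \<Rightarrow> complex" where
  "covariance \<rho> i j = ltr d (a j (a i (emb \<rho>)))"

lemma covariance_antisymmetric:
  assumes "i < 2*L" "j < 2*L" shows "covariance \<rho> j i = - covariance \<rho> i j"
  unfolding covariance_def aa[OF assms] by (rule tr_uminus)

text \<open>Stationarity of the second moments, \<open>N Y + Y N^T = - 2 (A - A^T)\<close>, read off
  from \<open>tr_aa_gen\<close>.\<close>

lemma covariance_lyapunov: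
  assumes \<rho>: "\<rho> \<in> carrier_mat d d" "mtrace \<rho> = 1" "generator A \<rho> = 0 \<cdot>\<^sub>m 1\<^sub>m d" and ij: "i < 2*L" "j < 2*L"
  shows "(\<Sum>k<2*L. N i k * covariance \<rho> k j) + (\<Sum>k<2*L. covariance \<rho> i k * N j k) = - 2 * (A i j - A j i)"
proof -
  have "gen N A (emb \<rho>) = 0" using emb_generator[OF \<rho>(1), of A] unfolding \<rho>(3) by (simp add: opm_smult)
  hence "0 = ltr d (a j (a i (gen N A (emb \<rho>))))" by simp
  also have "\<dots> = (\<Sum>k<2*L. N i k * covariance \<rho> k j) + (\<Sum>k<2*L. N j k * covariance \<rho> i k) + 2 * (A i j - A j i)"
    unfolding tr_aa_gen[OF ij imageI[OF \<rho>(1)]] ltr_opm[OF \<rho>(1)] \<rho>(2) covariance_def by simp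
  finally have h: "(\<Sum>k<2*L. N i k * covariance \<rho> k j) + (\<Sum>k<2*L. N j k * covariance \<rho> i k) + 2 * (A i j - A j i) = 0" by (rule sym)
  have c: "(\<Sum>k<2*L. covariance \<rho> i k * N j k) = (\<Sum>k<2*L. N j k * covariance \<rho> i k)"
    by (intro sum.cong refl) (rule mult.commute)
  from h show ?thesis unfolding c by (simp only: eq_neg_iff_add_eq_0 mult_minus_left)
qed

lemma N_real: "cnj (N i j) = N i j" by (simp add: drift_def)

lemma covariance_cnj:
  assumes controllable: controllable and \<rho>: "\<rho> \<in> carrier_mat d d" "mtrace \<rho> = 1" "generator A \<rho> = 0 \<cdot>\<^sub>m 1\<^sub>m d"
    and A: "\<And>i j. i < 2*L \<Longrightarrow> j < 2*L \<Longrightarrow> cnj (A i j) = A j i" and ij: "i < 2*L" "j < 2*L"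
  shows "cnj (covariance \<rho> i j) = - covariance \<rho> i j"
proof -
  let ?Y = "covariance \<rho>"
  define t where "t = (\<lambda>is. ?Y (is ! 0) (is ! 1) + cnj (?Y (is ! 0) (is ! 1)))"
  have ev: "leibniz (2*L) N is t = 0 * t is" if "is": "is \<in> words (2*L) (Suc 1)" for "is"
  proof -
    from "is" obtain p q where pq: "is = [p, q]" "p < 2*L" "q < 2*L"
      unfolding words_def by (auto simp: length_Suc_conv)
    note l = covariance_lyapunov[OF \<rho> pq(2,3)]
    have c1: "(\<Sum>k<2*L. N p k * (?Y k q + cnj (?Y k q))) = (\<Sum>k<2*L. N p k * ?Y k q) + cnj (\<Sum>k<2*L. N p k * ?Y k q)"
      unfolding cnj_sum sum.distrib[symmetric] by (intro sum.cong refl) (simp only: complex_cnj_mult N_real distrib_left)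
    have c2: "(\<Sum>k<2*L. N q k * (?Y p k + cnj (?Y p k))) = (\<Sum>k<2*L. ?Y p k * N q k) + cnj (\<Sum>k<2*L. ?Y p k * N q k)"
      unfolding cnj_sum sum.distrib[symmetric] complex_cnj_mult N_real
      by (intro sum.cong refl) (simp only: distrib_left distrib_right mult.commute)
    have "leibniz (2*L) N is t = (\<Sum>k<2*L. N p k * (?Y k q + cnj (?Y k q))) + (\<Sum>k<2*L. N q k * (?Y p k + cnj (?Y p k)))"
      by (simp add: pq(1) t_def)
    also have "\<dots> = ((\<Sum>k<2*L. N p k * ?Y k q) + (\<Sum>k<2*L. ?Y p k * N q k))
       + cnj ((\<Sum>k<2*L. N p k * ?Y k q) + (\<Sum>k<2*L. ?Y p k * N q k))"
      unfolding c1 c2 complex_cnj_add by (simp only: add_ac)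
    also have "\<dots> = 0" unfolding l by (simp add: A pq)
    finally show ?thesis by simp
  qed
  have w: "[i, j] \<in> words (2*L) (Suc 1)" using ij by (simp add: words_def)
  have "t [i, j] = 0"
    by (rule leibniz_eigen_zero[where R = R\<^sub>f and W = W\<^sub>f and m = "2*K" and \<mu> = 0 and q = 1 and n = "2*L", OF Ra _ ev _ w])
      (use controllable in \<open>simp_all add: controllable_def\<close>)
  thus ?thesis by (simp add: t_def add_eq_0_iff)
qed

text \<open>Positivity of the noise forces an eigenvector of \<open>Y\<close> with eigenvalue below
  -1 into the kernel of \<open>W^T\<close>, and then \<open>R\<close> maps it to an eigenvector with
  the same eigenvalue. Its whole orbit lies in that kernel, which controllability excludes.\<close>

lemma noise_eigenspace_vanishes:
  assumes controllable: controllable and w: "bath_state (2 ^ K) \<omega>"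
    and \<rho>: "\<rho> \<in> carrier_mat d d" "mtrace \<rho> = 1" "generator (noise K W \<omega>) \<rho> = 0 \<cdot>\<^sub>m 1\<^sub>m d"
    and u: "\<And>i. i < 2*L \<Longrightarrow> (\<Sum>j<2*L. covariance \<rho> i j * u j) = y * u i" and y: "cnj y = y" "Re y < - 1" and i: "i < 2*L"
  shows "u i = 0"
proof -
  let ?n = "2 * L" and ?m = "2 * K" and ?A = "noise K W \<omega>" and ?Y = "covariance \<rho>"
  define G where "G i u = (\<Sum>k<?m. of_real (W\<^sub>f i k) * (\<Sum>j<?n. of_real (W\<^sub>f j k) * u j))" for i and u :: "nat \<Rightarrow> complex"
  let ?R = "mv ?n R\<^sub>f" and ?Au = "\<lambda>u i. \<Sum>j<?n. ?A i j * u j" and ?Yu = "\<lambda>u i. \<Sum>j<?n. ?Y i j * u j"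
  have Ycnj: "cnj (?Y i k) = ?Y k i" if "i < ?n" "k < ?n" for i k
    using covariance_cnj[OF controllable \<rho> noise_cnj[OF w] that] covariance_antisymmetric[OF that] by simp
  have Gsum: "G i u = (\<Sum>j<?n. of_real (\<Sum>k<?m. W\<^sub>f i k * W\<^sub>f j k) * u j)" for i u
  proof -
    have "G i u = (\<Sum>k<?m. \<Sum>j<?n. of_real (W\<^sub>f i k * W\<^sub>f j k) * u j)"
      unfolding G_def sum_distrib_left by (simp add: mult.assoc)
    also have "\<dots> = (\<Sum>j<?n. \<Sum>k<?m. of_real (W\<^sub>f i k * W\<^sub>f j k) * u j)" by (rule sum.swap)
    finally show ?thesis by (simp add: sum_distrib_right)
  qed
  have Nu: "(\<Sum>j<?n. N i j * u j) = 2 * ?R u i - 2 * G i u" for i u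
    unfolding Gsum mv_def sum_distrib_left sum_subtractf[symmetric]
    by (intro sum.cong refl) (simp add: drift_def algebra_simps)
  have NTu: "(\<Sum>j<?n. N j i * u j) = - 2 * ?R u i - 2 * G i u" if i: "i < ?n" for i u
    unfolding Gsum mv_def sum_distrib_left sum_subtractf[symmetric]
  proof (intro sum.cong refl)
    fix j assume "j \<in> {..<?n}"
    hence j: "j < ?n" by simp
    have "N j i = of_real (2 * (- R\<^sub>f i j - (\<Sum>k<?m. W\<^sub>f i k * W\<^sub>f j k)))"
      unfolding drift_def Ra[OF j i] by (simp only: mult.commute)
    show "N j i * u j = - 2 * (of_real (R\<^sub>f i j) * u j) - 2 * (of_real (\<Sum>k<?m. W\<^sub>f i k * W\<^sub>f j k) * u j)"
      unfolding \<open>N j i = _\<close> by (simp add: algebra_simps)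
  qed
  have ATu: "(\<Sum>j<?n. ?A j i * u j) = 2 * G i u - ?Au u i" for i u
  proof -
    have "(\<Sum>j<?n. ?A j i * u j) + ?Au u i = (\<Sum>j<?n. (?A i j + ?A j i) * u j)"
      by (simp add: distrib_right sum.distrib add.commute)
    also have "\<dots> = 2 * G i u"
      unfolding Gsum sum_distrib_left by (intro sum.cong refl) (simp add: noise_sum[OF w])
    finally show ?thesis by (simp add: algebra_simps)
  qed
  \<comment> \<open>The Lyapunov equation applied to an eigenvector \<open>u\<close>, with
    \<open>N\<close> and its transpose expanded into \<open>R\<close> and \<open>G = W W^T\<close>,
    and with \<open>A^T\<close> replaced by \<open>2 G - A\<close>.\<close>
  have key: "2 * y * ?R u i - 2 * y * G i u - 2 * ?Yu (?R u) i - 2 * ?Yu (\<lambda>i. G i u) i = - 4 * ?Au u i + 4 * G i u"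
    if i: "i < ?n" and u: "\<And>i. i < 2*L \<Longrightarrow> ?Yu u i = y * u i" for i u
  proof -
    have "(\<Sum>j<?n. ((\<Sum>k<?n. N i k * ?Y k j) + (\<Sum>k<?n. ?Y i k * N j k)) * u j)
       = (\<Sum>j<?n. \<Sum>k<?n. N i k * ?Y k j * u j) + (\<Sum>j<?n. \<Sum>k<?n. ?Y i k * N j k * u j)"
      by (simp add: distrib_right sum.distrib sum_distrib_right)
    also have "(\<Sum>j<?n. \<Sum>k<?n. N i k * ?Y k j * u j) = (\<Sum>k<?n. \<Sum>j<?n. N i k * ?Y k j * u j)" by (rule sum.swap)
    also have "\<dots> = (\<Sum>k<?n. N i k * ?Yu u k)" by (simp add: sum_distrib_left mult.assoc)
    also have "\<dots> = (\<Sum>k<?n. y * (N i k * u k))" by (intro sum.cong refl) (simp add: u)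
    also have "\<dots> = y * (\<Sum>k<?n. N i k * u k)" by (rule sum_distrib_left[symmetric])
    also have "(\<Sum>j<?n. \<Sum>k<?n. ?Y i k * N j k * u j) = (\<Sum>k<?n. \<Sum>j<?n. ?Y i k * N j k * u j)" by (rule sum.swap)
    also have "\<dots> = (\<Sum>k<?n. ?Y i k * (\<Sum>j<?n. N j k * u j))" by (simp add: sum_distrib_left mult.assoc)
    also have "\<dots> = (\<Sum>k<?n. ?Y i k * (- 2 * ?R u k - 2 * G k u))"
      by (intro sum.cong refl) (simp only: NTu lessThan_iff)
    also have "\<dots> = - 2 * ?Yu (?R u) i - 2 * ?Yu (\<lambda>i. G i u) i"
      by (simp add: right_diff_distrib sum_subtractf sum_negf sum_distrib_left mult.left_commute)
    finally have "(\<Sum>j<?n. ((\<Sum>k<?n. N i k * ?Y k j) + (\<Sum>k<?n. ?Y i k * N j k)) * u j)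
      = y * (2 * ?R u i - 2 * G i u) + (- 2 * ?Yu (?R u) i - 2 * ?Yu (\<lambda>i. G i u) i)" unfolding Nu .
    moreover have "(\<Sum>j<?n. ((\<Sum>k<?n. N i k * ?Y k j) + (\<Sum>k<?n. ?Y i k * N j k)) * u j)
      = (\<Sum>j<?n. (- 2 * (?A i j - ?A j i)) * u j)"
      by (intro sum.cong refl) (simp only: covariance_lyapunov[OF \<rho> i] lessThan_iff)
    moreover have "\<dots> = - 2 * (?Au u i - (\<Sum>j<?n. ?A j i * u j))"
      unfolding sum_subtractf[symmetric] sum_distrib_left by (intro sum.cong refl) (simp add: algebra_simps)
    ultimately have "y * (2 * ?R u i - 2 * G i u) + (- 2 * ?Yu (?R u) i - 2 * ?Yu (\<lambda>i. G i u) i)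
      = - 2 * (?Au u i - (2 * G i u - ?Au u i))" unfolding ATu by (simp only:)
    moreover have "y * (2 * r - 2 * g) + (- 2 * p - 2 * q) = - 2 * (a - (2 * g - a)) \<Longrightarrow>
      2 * y * r - 2 * y * g - 2 * p - 2 * q = - 4 * a + 4 * g" for r g p q a :: complex
      by (simp add: algebra_simps)
    ultimately show ?thesis by blast
  qed
  \<comment> \<open>Pairing with \<open>u\<close> cancels the terms with \<open>R\<close>, since
    \<open>Y\<close> is hermitian and \<open>y\<close> real, and leaves
    \<open><u, A u> = (1 + y) |W^T u|^2\<close>. The left side is nonnegative and
    \<open>1 + y\<close> is negative, so \<open>W^T u = 0\<close> and \<open>A u = 0\<close>. What
    remains of \<open>key\<close> is \<open>Y R u = y R u\<close>.\<close>
  have step: "(\<forall>k<?m. (\<Sum>i<?n. of_real (W\<^sub>f i k) * u i) = 0) \<and> (\<forall>i<?n. ?Yu (?R u) i = y * ?R u i)"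
    if u: "\<And>i. i < 2*L \<Longrightarrow> ?Yu u i = y * u i" for u
  proof -
    let ?ip = "\<lambda>z. \<Sum>i<?n. cnj (u i) * z i"
    have lin1: "?ip (\<lambda>i. p * f1 i - q * f2 i - 2 * f3 i - 2 * f4 i) = p * ?ip f1 - q * ?ip f2 - 2 * ?ip f3 - 2 * ?ip f4" for p q f1 f2 f3 f4
      unfolding sum_distrib_left sum_subtractf[symmetric] by (intro sum.cong refl) (simp only: right_diff_distrib mult_ac)
    have lin2: "?ip (\<lambda>i. p * f1 i + q * f2 i) = p * ?ip f1 + q * ?ip f2" for p q f1 f2
      unfolding sum_distrib_left sum.distrib[symmetric] by (intro sum.cong refl) (simp only: distrib_left mult_ac)
    have Yip: "?ip (?Yu z) = y * ?ip z" for z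
    proof -
      have "?ip (?Yu z) = (\<Sum>i<?n. \<Sum>j<?n. cnj (u i) * (?Y i j * z j))" by (simp only: sum_distrib_left)
      also have "\<dots> = (\<Sum>j<?n. \<Sum>i<?n. cnj (u i) * (?Y i j * z j))" by (rule sum.swap)
      also have "\<dots> = (\<Sum>j<?n. cnj (?Yu u j) * z j)"
        unfolding cnj_sum sum_distrib_right by (intro sum.cong refl) (simp add: Ycnj)
      also have "\<dots> = (\<Sum>j<?n. y * (cnj (u j) * z j))" by (intro sum.cong refl) (simp add: u y(1))
      also have "\<dots> = y * ?ip z" by (rule sum_distrib_left[symmetric])
      finally show ?thesis .
    qed
    have "?ip (\<lambda>i. 2 * y * ?R u i - 2 * y * G i u - 2 * ?Yu (?R u) i - 2 * ?Yu (\<lambda>i. G i u) i)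
      = ?ip (\<lambda>i. - 4 * ?Au u i + 4 * G i u)"
      by (intro sum.cong refl) (simp only: key[OF _ u] lessThan_iff)
    moreover have "?ip (\<lambda>i. 2 * y * ?R u i - 2 * y * G i u - 2 * ?Yu (?R u) i - 2 * ?Yu (\<lambda>i. G i u) i)
      = 2 * y * ?ip (?R u) - 2 * y * ?ip (\<lambda>i. G i u) - 2 * ?ip (?Yu (?R u)) - 2 * ?ip (?Yu (\<lambda>i. G i u))"
      by (rule lin1)
    moreover have "?ip (\<lambda>i. - 4 * ?Au u i + 4 * G i u) = - 4 * ?ip (?Au u) + 4 * ?ip (\<lambda>i. G i u)"
      by (rule lin2)
    ultimately have "4 * ?ip (?Au u) = 4 * ((1 + y) * ?ip (\<lambda>i. G i u))" unfolding Yip by (simp add: algebra_simps)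
    hence eq: "?ip (?Au u) = (1 + y) * ?ip (\<lambda>i. G i u)" by simp
    define w' where "w' k = (\<Sum>i<?n. of_real (W\<^sub>f i k) * u i)" for k
    have "?ip (\<lambda>i. G i u) = (\<Sum>i<?n. \<Sum>k<?m. cnj (u i) * (of_real (W\<^sub>f i k) * w' k))"
      unfolding G_def w'_def by (simp only: sum_distrib_left)
    also have "\<dots> = (\<Sum>k<?m. \<Sum>i<?n. cnj (u i) * (of_real (W\<^sub>f i k) * w' k))" by (rule sum.swap)
    also have "\<dots> = (\<Sum>k<?m. of_real ((cmod (w' k))\<^sup>2))"
    proof (rule sum.cong[OF refl])
      fix k
      have "(\<Sum>i<?n. cnj (u i) * (of_real (W\<^sub>f i k) * w' k)) = (\<Sum>i<?n. cnj (u i) * of_real (W\<^sub>f i k)) * w' k"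
        by (simp only: sum_distrib_right mult.assoc)
      also have "(\<Sum>i<?n. cnj (u i) * of_real (W\<^sub>f i k)) = cnj (w' k)"
        unfolding w'_def cnj_sum by (intro sum.cong refl) (simp only: complex_cnj_mult complex_cnj_complex_of_real mult.commute)
      finally have "(\<Sum>i<?n. cnj (u i) * (of_real (W\<^sub>f i k) * w' k)) = cnj (w' k) * w' k" .
      thus "(\<Sum>i<?n. cnj (u i) * (of_real (W\<^sub>f i k) * w' k)) = of_real ((cmod (w' k))\<^sup>2)"
        unfolding complex_norm_square by (simp only: mult.commute)
    qed
    finally have ipG: "?ip (\<lambda>i. G i u) = of_real (\<Sum>k<?m. (cmod (w' k))\<^sup>2)" by simp
    have "?ip (?Au u) = (\<Sum>i<?n. \<Sum>j<?n. cnj (u i) * ?A i j * u j)" by (simp add: sum_distrib_left mult.assoc)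
    also have "0 \<le> Re \<dots>" unfolding noise_quadratic_form by (rule bath_corr_nonneg[OF w])
    finally have "0 \<le> Re ((1 + y) * ?ip (\<lambda>i. G i u))" unfolding eq .
    hence "0 \<le> (1 + Re y) * (\<Sum>k<?m. (cmod (w' k))\<^sup>2)" unfolding ipG by simp
    hence "(\<Sum>k<?m. (cmod (w' k))\<^sup>2) \<le> 0" using y(2) by (simp add: zero_le_mult_iff)
    moreover have "0 \<le> (\<Sum>k<?m. (cmod (w' k))\<^sup>2)" by (rule sum_nonneg) simp
    ultimately have "(\<Sum>k<?m. (cmod (w' k))\<^sup>2) = 0" by simp
    hence w0: "w' k = 0" if "k < ?m" for k
      using that by (subst (asm) sum_nonneg_eq_0_iff) auto
    have G0: "G i u = 0" for i unfolding G_def w'_def[symmetric] by (simp add: w0)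
    have A0: "?Au u i = 0" for i
    proof -
      have "?Au u i = (\<Sum>j<?n. \<Sum>p<?m. \<Sum>q<?m. of_real (W\<^sub>f i p) * bath_corr K \<omega> p q * (of_real (W\<^sub>f j q) * u j))"
        unfolding noise_def sum_distrib_right by (simp only: mult_ac)
      also have "\<dots> = (\<Sum>p<?m. \<Sum>q<?m. \<Sum>j<?n. of_real (W\<^sub>f i p) * bath_corr K \<omega> p q * (of_real (W\<^sub>f j q) * u j))"
        by (simp only: sum.swap[of _ "{..<?m}" "{..<?n}"])
      also have "\<dots> = (\<Sum>p<?m. \<Sum>q<?m. of_real (W\<^sub>f i p) * bath_corr K \<omega> p q * w' q)"
        unfolding w'_def by (simp only: sum_distrib_left)
      finally show ?thesis by (simp add: w0)
    qed
    have "?Yu (?R u) i = y * ?R u i" if i: "i < ?n" for i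
      using key[OF i u] by (simp add: G0 A0)
    thus ?thesis using w0 unfolding w'_def by blast
  qed
  have pow: "\<forall>i<?n. ?Yu ((?R ^^ r) u) i = y * (?R ^^ r) u i" for r
  proof (induct r)
    case (Suc r)
    from step[of "(?R ^^ r) u"] Suc show ?case by simp
  qed (use u in simp)
  have "(\<Sum>i<?n. (?R ^^ r) (\<lambda>i. of_real (W\<^sub>f i k)) i * u i) = 0" if "k < ?m" for r k
    using skew_power_transpose[where n = ?n and R = R\<^sub>f and r = r and w = "\<lambda>i. of_real (W\<^sub>f i k)" and z = u, OF Ra]
      step[of "(?R ^^ r) u"] pow[of r] that by simp
  thus ?thesis using controllable i unfolding controllable_def krylov_def by blast
qed

lemma covariance_eigenvalue_le:
  assumes controllable: controllable and w: "bath_state (2 ^ K) \<omega>"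
    and \<rho>: "\<rho> \<in> carrier_mat d d" "mtrace \<rho> = 1" "generator (noise K W \<omega>) \<rho> = 0 \<cdot>\<^sub>m 1\<^sub>m d"
    and u: "\<And>i. i < 2*L \<Longrightarrow> (\<Sum>j<2*L. covariance \<rho> i j * u j) = y * u i" and y: "cnj y = y"
    and nz: "i < 2*L" "u i \<noteq> 0"
  shows "\<bar>Re y\<bar> \<le> 1"
proof -
  have "\<not> Re y < - 1" using noise_eigenspace_vanishes[OF controllable w \<rho> u y _ nz(1)] nz(2) by blast
  \<comment> \<open>\<open>Y\<close> has imaginary entries, so complex conjugation maps an
    eigenvector for \<open>y\<close> to one for \<open>- y\<close>, which gives the upper
    bound.\<close>
  moreover have "\<not> Re (- y) < - 1"
  proof
    assume lt: "Re (- y) < - 1"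
    have "(\<Sum>j<2*L. covariance \<rho> i j * cnj (u j)) = - y * cnj (u i)" if i: "i < 2*L" for i
    proof -
      have "(\<Sum>j<2*L. covariance \<rho> i j * cnj (u j)) = cnj (\<Sum>j<2*L. - covariance \<rho> i j * u j)"
        unfolding cnj_sum
        by (intro sum.cong refl) (simp add: covariance_cnj[OF controllable \<rho> noise_cnj[OF w] i])
      also have "\<dots> = cnj (- (y * u i))" unfolding u[OF i, symmetric] by (simp add: sum_negf)
      finally show ?thesis using y by simp
    qed
    from noise_eigenspace_vanishes[OF controllable w \<rho> this _ lt nz(1)] y nz(2) show False by simp
  qed
  ultimately show ?thesis by simp
qed

end

section \<open>Gaussian approximation\<close>

context majorana_algebra
begin

text \<open>The factor 1/4 normalizes \<open>Q\<close> so that its commutator acts on the Majorana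
  operators by the matrix \<open>h\<close> itself: antisymmetry and the anticommutation relations
  each contribute a factor 2.\<close>

lemma quadratic_commutator:
  assumes h: "\<And>i j. i < n \<Longrightarrow> j < n \<Longrightarrow> h j i = - h i j" and m: "m < n"
  defines "Q \<equiv> \<Sum>i<n. \<Sum>j<n. sc (h i j / 4) (g i * g j)"
  shows "Q * g m - g m * Q = (\<Sum>i<n. sc (h i m) (g i))"
proof -
  have c: "g i * g j * g m - g m * (g i * g j) = (if j = m then 2 * g i else 0) - (if i = m then 2 * g j else 0)"
    if ij: "i < n" "j < n" for i j
  proof -
    have "g i * g j * g m = (if j = m then 2 * g i else 0) - g i * g m * g j" by (rule CAR_right[OF ij(2) m])
    moreover have "g m * (g i * g j) = (if m = i then 2 * g j else 0) - g i * (g m * g j)" by (rule CAR_left[OF m ij(1)])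
    ultimately show ?thesis by (simp add: mult.assoc)
  qed
  have two: "sc (z / 4) (2 * x) = sc (z / 2) x" for z x
  proof -
    have "2 * x = sc 2 x" by (simp add: sc_two mult_2)
    thus ?thesis by simp
  qed
  have "Q * g m - g m * Q = (\<Sum>i<n. \<Sum>j<n. sc (h i j / 4) (g i * g j * g m - g m * (g i * g j)))"
    unfolding Q_def by (simp add: sum_distrib_left sum_distrib_right sum_subtractf sc_diff_right mult.assoc)
  also have "\<dots> = (\<Sum>i<n. \<Sum>j<n. (if j = m then sc (h i j / 2) (g i) else 0) - (if i = m then sc (h i j / 2) (g j) else 0))"
    by (intro sum.cong refl) (simp add: c sc_diff_right two)
  also have "\<dots> = (\<Sum>i<n. sc (h i m / 2) (g i)) - (\<Sum>j<n. sc (h m j / 2) (g j))"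
  proof -
    have "(\<Sum>i<n. \<Sum>j<n. if i = m then sc (h i j / 2) (g j) else 0) = (\<Sum>j<n. sc (h m j / 2) (g j))"
      by (subst sum.swap) (use m in simp)
    thus ?thesis using m by (simp add: sum_subtractf)
  qed
  also have "\<dots> = (\<Sum>i<n. sc (h i m) (g i))"
    unfolding sum_subtractf[symmetric]
  proof (rule sum.cong[OF refl])
    fix i assume "i \<in> {..<n}"
    hence i: "i < n" by simp
    have "sc (h i m / 2) (g i) - sc (h m i / 2) (g i) = sc (h i m / 2 - h m i / 2) (g i)" by (simp add: sc_diff_left)
    also have "h i m / 2 - h m i / 2 = h i m" unfolding h[OF i m] by simp
    finally show "sc (h i m / 2) (g i) - sc (h m i / 2) (g i) = sc (h i m) (g i)" .
  qed
  finally show ?thesis .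
qed

lemma P_quadratic:
  assumes "i < n" "j < n" shows "P * (g i * g j) = g i * g j * P"
proof -
  have "P * (g i * g j) = - (g i * P) * g j" unfolding mult.assoc[symmetric] Pg[OF assms(1)] ..
  also have "\<dots> = - (g i * (P * g j))" by (simp add: mult.assoc)
  also have "\<dots> = g i * g j * P" unfolding Pg[OF assms(2)] by (simp add: mult.assoc)
  finally show ?thesis .
qed

lemma gen_interpolate:
  "gen N (\<lambda>i j. (1 - e) * A i j + e * G i j) x = sc (1 - e) (gen N A x) + sc e (gen N G x)"
proof -
  let ?D = "\<Sum>i<n. \<Sum>j<n. sc (N i j) (b i (a j x))"
  have "x = p + q \<Longrightarrow> s = r + t \<Longrightarrow> x + s = (p + r) + (q + t)" for x p q s r t :: lop by simp
  moreover have "?D = sc (1 - e) ?D + sc e ?D" by (simp add: sc_diff_left)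
  moreover have "(\<Sum>i<n. \<Sum>j<n. sc (2 * ((1 - e) * A i j + e * G i j)) (b i (b j x)))
    = sc (1 - e) (\<Sum>i<n. \<Sum>j<n. sc (2 * A i j) (b i (b j x))) + sc e (\<Sum>i<n. \<Sum>j<n. sc (2 * G i j) (b i (b j x)))"
    unfolding sc_sum_right sum.distrib[symmetric] sc_sc sc_add_left[symmetric]
    by (intro sum.cong refl arg_cong2[of _ _ _ _ sc]) (simp add: algebra_simps)
  ultimately show ?thesis unfolding gen_def sc_add_right by blast
qed

end

lemma quadratic_hamiltonianI:
  assumes C: "C \<in> carrier_mat (2*n) (2*n)" "mat_adjoint C = C"
  shows "quadratic_hamiltonian n (msum (2^n) (2^n) (\<lambda>(i,j). C $$ (i,j) \<cdot>\<^sub>m (majorana n i * majorana n j)) ({..<2*n} \<times> {..<2*n}))"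
    (is "quadratic_hamiltonian n ?H")
  unfolding quadratic_hamiltonian_def
proof (intro conjI bexI[OF refl C(1)])
  let ?J = "{..<2*n} \<times> {..<2*n}"
  show "?H = mat_adjoint ?H"
  proof (rule eq_matI)
    fix p q assume "p < dim_row (mat_adjoint ?H)" "q < dim_col (mat_adjoint ?H)"
    hence pq: "p < 2^n" "q < 2^n" by auto
    have Cc: "cnj (C $$ (i,j)) = C $$ (j,i)" if "i < 2*n" "j < 2*n" for i j
      using arg_cong[OF C(2), of "\<lambda>X. X $$ (j,i)"] C(1) that by simp
    have mc: "cnj ((majorana n i * majorana n j) $$ (q,p)) = (majorana n j * majorana n i) $$ (p,q)" if ij: "i < 2*n" "j < 2*n" for i j
    proof -
      note m = majorana_carrier[OF ij(1)] majorana_carrier[OF ij(2)]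
      have "mat_adjoint (majorana n i * majorana n j) = majorana n j * majorana n i"
        unfolding mat_adjoint_mult[OF m] majorana_adjoint[OF ij(1)] majorana_adjoint[OF ij(2)] ..
      hence "(majorana n j * majorana n i) $$ (p,q) = mat_adjoint (majorana n i * majorana n j) $$ (p,q)" by simp
      also have "\<dots> = cnj ((majorana n i * majorana n j) $$ (q,p))"
        by (rule index_mat_adjoint) (use ij pq in simp_all)
      finally show ?thesis by simp
    qed
    have e: "?H $$ (p,q) = (\<Sum>i<2*n. \<Sum>j<2*n. C $$ (i,j) * (majorana n i * majorana n j) $$ (p,q))" if pq: "p < 2^n" "q < 2^n" for p q
      unfolding index_msum[OF pq] sum.cartesian_product
      by (intro sum.cong refl) (use pq in \<open>auto simp del: index_mult_mat(1)\<close>)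
    have "mat_adjoint ?H $$ (p,q) = cnj (?H $$ (q,p))" by (rule index_mat_adjoint) (use pq in simp_all)
    also have "\<dots> = (\<Sum>i<2*n. \<Sum>j<2*n. C $$ (j,i) * (majorana n j * majorana n i) $$ (p,q))"
      unfolding e[OF pq(2,1)] cnj_sum
      by (intro sum.cong refl) (simp only: complex_cnj_mult Cc mc lessThan_iff)
    also have "\<dots> = ?H $$ (p,q)" unfolding e[OF pq] by (rule sum.swap)
    finally show "?H $$ (p,q) = mat_adjoint ?H $$ (p,q)" ..
  qed simp_all
qed

context fermion_model
begin

text \<open>With \<open>Y = tanh (h / 2)\<close>, the state \<open>exp (\<Sum> h\<^sub>i\<^sub>j g\<^sub>i g\<^sub>j / 4)\<close> has covariance \<open>Y\<close>.
  Here \<open>h\<close> is built from the spectral projections of \<open>Y\<close>.\<close>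
lemma gaussian_state_with_covariance:
  assumes Ya: "\<And>i j. i < 2*L \<Longrightarrow> j < 2*L \<Longrightarrow> Y j i = - Y i j"
    and Yc: "\<And>i j. i < 2*L \<Longrightarrow> j < 2*L \<Longrightarrow> cnj (Y i j) = - Y i j"
    and Yev: "\<And>y u i. (\<And>i. i < 2*L \<Longrightarrow> (\<Sum>j<2*L. Y i j * u j) = y * u i) \<Longrightarrow> cnj y = y \<Longrightarrow> i < 2*L \<Longrightarrow> u i \<noteq> 0 \<Longrightarrow> \<bar>Re y\<bar> < 1"
  obtains \<sigma> where "gaussian_state L \<sigma>" "\<And>m. m < 2*L \<Longrightarrow> a m (emb \<sigma>) = - (\<Sum>l<2*L. sc (Y l m) (b l (emb \<sigma>)))"
proof -
  let ?n = "2 * L"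
  define Ym where "Ym = mat ?n ?n (\<lambda>(i,j). Y i j)"
  have Ym: "Ym \<in> carrier_mat ?n ?n" by (simp add: Ym_def)
  have Ymi: "Ym $$ (i,j) = Y i j" if "i < ?n" "j < ?n" for i j using that by (simp add: Ym_def)
  have Yh: "cnj (Y j i) = Y i j" if "i < ?n" "j < ?n" for i j
    using Yc[OF that(2,1)] Ya[OF that] by simp
  have Yma: "mat_adjoint Ym = Ym" by (rule eq_matI) (use Ym Yh in \<open>auto simp: Ym_def\<close>)
  obtain S E where SE: "finite S" "\<And>e. e \<in> S \<Longrightarrow> E e \<in> carrier_mat ?n ?n" "\<And>e. e \<in> S \<Longrightarrow> Ym * E e = e \<cdot>\<^sub>m E e"
    "msum ?n ?n E S = 1\<^sub>m ?n" "\<And>e. e \<in> S \<Longrightarrow> eigenvalue Ym e" "\<And>e. e \<in> S \<Longrightarrow> cnj e = e"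
    "\<And>e. e \<in> S \<Longrightarrow> mat_adjoint (E e) = E e"
    "\<And>e f. e \<in> S \<Longrightarrow> f \<in> S \<Longrightarrow> E e * E f = (if e = f then 1 else 0) \<cdot>\<^sub>m E e"
    by (rule hermitian_spectral_projections[OF Ym Yma]) (rule that)
  define Ee where "Ee e i j = E e $$ (i,j)" for e i j
  have E1: "(\<Sum>k<?n. Y i k * Ee e k j) = e * Ee e i j" if e: "e \<in> S" and ij: "i < ?n" "j < ?n" for e i j
  proof -
    have "(\<Sum>k<?n. Y i k * Ee e k j) = (Ym * E e) $$ (i,j)"
      unfolding index_mult_sum[OF Ym SE(2)[OF e] ij] by (intro sum.cong refl) (simp add: Ymi ij Ee_def)
    thus ?thesis unfolding SE(3)[OF e] using SE(2)[OF e] ij by (simp add: Ee_def)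
  qed
  have E4: "cnj (Ee e i j) = Ee e j i" if e: "e \<in> S" and ij: "i < ?n" "j < ?n" for e i j
    using arg_cong[OF SE(7)[OF e], of "\<lambda>X. X $$ (j,i)"] index_mat_adjoint[of j "E e" i] SE(2)[OF e] ij by (simp add: Ee_def)
  have E2: "(\<Sum>k<?n. Ee e i k * Y k j) = e * Ee e i j" if e: "e \<in> S" and ij: "i < ?n" "j < ?n" for e i j
  proof -
    have "(\<Sum>k<?n. Ee e i k * Y k j) = cnj (\<Sum>k<?n. Ee e k i * Y j k)"
      unfolding cnj_sum by (intro sum.cong refl) (simp add: E4[OF e] Yh ij)
    also have "\<dots> = cnj (\<Sum>k<?n. Y j k * Ee e k i)" by (simp only: mult.commute)
    finally have "(\<Sum>k<?n. Ee e i k * Y k j) = cnj (\<Sum>k<?n. Y j k * Ee e k i)" .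
    thus ?thesis unfolding E1[OF e ij(2,1)] using E4[OF e ij(2,1)] SE(6)[OF e] by simp
  qed
  have E3: "(\<Sum>e\<in>S. Ee e i j) = (if i = j then 1 else 0)" if ij: "i < ?n" "j < ?n" for i j
    using arg_cong[OF SE(4), of "\<lambda>X. X $$ (i,j)"] ij by (simp add: Ee_def)
  have E5: "(\<Sum>k<?n. Ee e i k * Ee e' k j) = (if e = e' then Ee e i j else 0)"
    if e: "e \<in> S" "e' \<in> S" and ij: "i < ?n" "j < ?n" for e e' i j
    using arg_cong[OF SE(8)[OF e], of "\<lambda>X. X $$ (i,j)"] SE(2)[OF e(1)] ij
    unfolding index_mult_sum[OF SE(2)[OF e(1)] SE(2)[OF e(2)] ij] by (simp add: Ee_def split: if_splits)
  have ev: "\<bar>Re e\<bar> < 1" if e: "e \<in> S" for e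
  proof -
    from SE(5)[OF e] obtain v where v: "v \<in> carrier_vec ?n" "v \<noteq> 0\<^sub>v ?n" "Ym *\<^sub>v v = e \<cdot>\<^sub>v v"
      using Ym by (auto simp: eigenvalue_def eigenvector_def)
    from v(1,2) obtain i where i: "i < ?n" "v $ i \<noteq> 0" by (auto simp: vec_eq_iff)
    have "(\<Sum>j<?n. Y i j * v $ j) = e * v $ i" if i: "i < ?n" for i
    proof -
      have "(\<Sum>j<?n. Y i j * v $ j) = (Ym *\<^sub>v v) $ i"
        unfolding index_mult_vec_sum[OF Ym v(1) i] by (intro sum.cong refl) (simp add: Ymi i)
      thus ?thesis unfolding v(3) using v(1) i by simp
    qed
    from Yev[OF this SE(6)[OF e] i] show ?thesis .
  qed
  \<comment> \<open>This is \<open>2 artanh e\<close>, the inverse of \<open>tanh (h / 2)\<close> on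
    the spectrum; it makes \<open>exp (f e) = (1 + e) / (1 - e)\<close>. The strict bound
    \<open>ev\<close> keeps both logarithms defined.\<close>
  define f :: "complex \<Rightarrow> complex" where "f e = of_real (ln (1 + Re e) - ln (1 - Re e))" for e
  have fexp: "(1 - e) * exp (f e) = 1 + e" if e: "e \<in> S" for e
  proof -
    have r: "e = of_real (Re e)" using SE(6)[OF e] by (simp add: complex_eq_iff)
    have "exp (ln (1 + Re e) - ln (1 - Re e)) = (1 + Re e) / (1 - Re e)" using ev[OF e] by (simp add: exp_diff)
    hence "exp (f e) = of_real ((1 + Re e) / (1 - Re e))" by (simp only: f_def exp_of_real)
    moreover have "(1 - Re e) * ((1 + Re e) / (1 - Re e)) = 1 + Re e" using ev[OF e] by simp
    ultimately have "complex_of_real (1 - Re e) * exp (f e) = of_real (1 + Re e)" by (simp only: of_real_mult[symmetric])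
    moreover have "complex_of_real (1 - Re e) = 1 - e" "complex_of_real (1 + Re e) = 1 + e"
      by (subst (2) r, simp)+
    ultimately show ?thesis by simp
  qed
  define h where "h i j = (\<Sum>e\<in>S. f e * Ee e i j)" for i j
  \<comment> \<open>\<open>F w e\<close> is an entry of \<open>E_w E_e^T\<close>. As
    \<open>Y\<close> is antisymmetric, transposition exchanges the eigenvalues \<open>e\<close> and
    \<open>- e\<close>, so the product vanishes unless \<open>w = - e\<close>. In that case
    \<open>f w + f e = 0\<close> because \<open>f\<close> is odd. Summing over \<open>w\<close> and
    \<open>e\<close> gives the claim by completeness.\<close>
  have ha: "h j i = - h i j" if ij: "i < ?n" "j < ?n" for i j
  proof -
    define F where "F w e = (\<Sum>k<?n. Ee w i k * Ee e j k)" for w e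
    have F0: "(f w + f e) * F w e = 0" if we: "w \<in> S" "e \<in> S" for w e
    proof (cases "w + e = 0")
      case True
      hence "Re (w + e) = 0" by simp
      hence "Re e = - Re w" by simp
      thus ?thesis by (simp add: f_def)
    next
      case False
      have "w * F w e = (\<Sum>k<?n. (\<Sum>l<?n. Ee w i l * Y l k) * Ee e j k)"
        unfolding F_def sum_distrib_left by (intro sum.cong refl) (simp add: E2[OF we(1) ij(1)] mult.assoc)
      also have "\<dots> = (\<Sum>k<?n. \<Sum>l<?n. Ee w i l * Y l k * Ee e j k)" by (simp only: sum_distrib_right)
      also have "\<dots> = (\<Sum>l<?n. \<Sum>k<?n. Ee w i l * Y l k * Ee e j k)" by (rule sum.swap)
      also have "\<dots> = (\<Sum>l<?n. Ee w i l * (- (e * Ee e j l)))"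
      proof (rule sum.cong[OF refl])
        fix l assume "l \<in> {..<?n}"
        hence l: "l < ?n" by simp
        have "(\<Sum>k<?n. Ee w i l * Y l k * Ee e j k) = (\<Sum>k<?n. Ee w i l * (- (Ee e j k * Y k l)))"
        proof (rule sum.cong[OF refl])
          fix k assume "k \<in> {..<?n}"
          hence k: "k < ?n" by simp
          show "Ee w i l * Y l k * Ee e j k = Ee w i l * (- (Ee e j k * Y k l))"
            unfolding Ya[OF k l] by simp
        qed
        also have "\<dots> = Ee w i l * (- (\<Sum>k<?n. Ee e j k * Y k l))" by (simp only: sum_distrib_left sum_negf mult_minus_right)
        finally show "(\<Sum>k<?n. Ee w i l * Y l k * Ee e j k) = Ee w i l * (- (e * Ee e j l))"
          unfolding E2[OF we(2) ij(2) l] .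
      qed
      also have "\<dots> = - (e * F w e)"
        unfolding F_def sum_distrib_left sum_negf[symmetric] by (intro sum.cong refl) simp
      finally have "(w + e) * F w e = 0" by (simp add: distrib_right)
      with False show ?thesis by simp
    qed
    have "0 = (\<Sum>w\<in>S. \<Sum>e\<in>S. (f w + f e) * F w e)" by (intro sum.neutral[symmetric] ballI) (simp add: F0)
    also have "\<dots> = (\<Sum>w\<in>S. \<Sum>e\<in>S. f w * F w e) + (\<Sum>w\<in>S. \<Sum>e\<in>S. f e * F w e)"
      by (simp only: distrib_right sum.distrib)
    also have "(\<Sum>w\<in>S. \<Sum>e\<in>S. f e * F w e) = (\<Sum>e\<in>S. \<Sum>w\<in>S. f e * F w e)" by (rule sum.swap)
    also have "\<dots> = (\<Sum>e\<in>S. f e * Ee e j i)"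
    proof (rule sum.cong[OF refl])
      fix e
      have "(\<Sum>w\<in>S. f e * F w e) = f e * (\<Sum>w\<in>S. \<Sum>k<?n. Ee w i k * Ee e j k)" by (simp only: F_def sum_distrib_left)
      also have "(\<Sum>w\<in>S. \<Sum>k<?n. Ee w i k * Ee e j k) = (\<Sum>k<?n. (\<Sum>w\<in>S. Ee w i k) * Ee e j k)"
        unfolding sum_distrib_right by (rule sum.swap)
      also have "\<dots> = (\<Sum>k<?n. if i = k then Ee e j k else 0)" by (intro sum.cong refl) (simp add: E3 ij)
      also have "\<dots> = Ee e j i" using ij by simp
      finally show "(\<Sum>w\<in>S. f e * F w e) = f e * Ee e j i" .
    qed
    also have "(\<Sum>w\<in>S. \<Sum>e\<in>S. f w * F w e) = (\<Sum>w\<in>S. f w * Ee w i j)"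
    proof (rule sum.cong[OF refl])
      fix w
      have "(\<Sum>e\<in>S. f w * F w e) = f w * (\<Sum>e\<in>S. \<Sum>k<?n. Ee w i k * Ee e j k)" by (simp only: F_def sum_distrib_left)
      also have "(\<Sum>e\<in>S. \<Sum>k<?n. Ee w i k * Ee e j k) = (\<Sum>k<?n. Ee w i k * (\<Sum>e\<in>S. Ee e j k))"
        unfolding sum_distrib_left by (rule sum.swap)
      also have "\<dots> = (\<Sum>k<?n. if j = k then Ee w i k else 0)" by (intro sum.cong refl) (simp add: E3 ij)
      also have "\<dots> = Ee w i j" using ij by simp
      finally show "(\<Sum>e\<in>S. f w * F w e) = f w * Ee w i j" .
    qed
    finally have "h i j + h j i = 0" unfolding h_def by simp
    thus ?thesis by (simp add: eq_neg_iff_add_eq_0 add.commute)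
  qed
  have hc: "cnj (h i j) = h j i" if ij: "i < ?n" "j < ?n" for i j
    unfolding h_def cnj_sum by (intro sum.cong refl) (simp add: E4 ij f_def)
  have hE: "(\<Sum>i<?n. h k i * Ee e i m) = f e * Ee e k m" if e: "e \<in> S" and km: "k < ?n" "m < ?n" for e k m
  proof -
    have "(\<Sum>i<?n. h k i * Ee e i m) = (\<Sum>i<?n. \<Sum>w\<in>S. f w * (Ee w k i * Ee e i m))"
      unfolding h_def sum_distrib_right by (simp only: mult.assoc)
    also have "\<dots> = (\<Sum>w\<in>S. \<Sum>i<?n. f w * (Ee w k i * Ee e i m))" by (rule sum.swap)
    also have "\<dots> = (\<Sum>w\<in>S. if w = e then f w * Ee w k m else 0)"
      unfolding sum_distrib_left[symmetric] by (intro sum.cong refl) (simp add: E5 e km)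
    also have "\<dots> = f e * Ee e k m" using e SE(1) by simp
    finally show ?thesis .
  qed
  have hE': "(\<Sum>i<?n. Ee e i m * h k i) = f e * Ee e k m" if "e \<in> S" "k < ?n" "m < ?n" for e k m
    using hE[OF that] by (simp only: mult.commute)
  \<comment> \<open>The minus sign compensates \<open>exp (- \<beta> H)\<close>, taken with inverse
    temperature 1, so that the exponent embeds as \<open>Q\<close>.\<close>
  define C where "C = mat ?n ?n (\<lambda>(i,j). - h i j / 4)"
  have C: "C \<in> carrier_mat ?n ?n" "mat_adjoint C = C"
    by (simp add: C_def) (rule eq_matI, use hc in \<open>auto simp: C_def\<close>)
  define H where "H = msum d d (\<lambda>(i,j). C $$ (i,j) \<cdot>\<^sub>m (majorana L i * majorana L j)) ({..<2*L} \<times> {..<2*L})"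
  have qH: "quadratic_hamiltonian L H" unfolding H_def by (rule quadratic_hamiltonianI[OF C])
  have H: "H \<in> carrier_mat d d" by (simp add: H_def)
  define X where "X = (- of_real 1) \<cdot>\<^sub>m H"
  have X: "X \<in> carrier_mat d d" using H by (simp add: X_def)
  define Q where "Q = (\<Sum>i<?n. \<Sum>j<?n. sc (h i j / 4) (g i * g j))"
  have XQ: "emb X = Q"
    unfolding X_def opm_smult[OF two_pow_pos H] unfolding H_def opm_quadratic Q_def sc_sum_right sc_sc
    by (intro sum.cong refl) (simp add: C_def)
  define M where "M = mat_exp X"
  have M: "M \<in> carrier_mat d d" using X by (simp add: M_def)
  define \<rho> where "\<rho> = emb M"
  have PQ: "emb (fock_parity L) * Q = Q * emb (fock_parity L)"
    unfolding Q_def sum_distrib_left sum_distrib_right by (intro sum.cong refl) (simp add: P_quadratic)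
  have "X * fock_parity L = fock_parity L * X"
    by (rule opm_inj[OF mult_sq_carrier[OF X fock_parity_carrier] mult_sq_carrier[OF fock_parity_carrier X]])
      (simp only: opm_mult[OF two_pow_pos X fock_parity_carrier] opm_mult[OF two_pow_pos fock_parity_carrier X] XQ PQ)
  from mat_exp_intertwine[OF X X fock_parity_carrier this]
  have "emb (M * fock_parity L) = emb (fock_parity L * M)" unfolding M_def by simp
  hence Pr: "\<rho> * emb (fock_parity L) = emb (fock_parity L) * \<rho>"
    unfolding \<rho>_def by (simp only: opm_mult[OF two_pow_pos M fock_parity_carrier] opm_mult[OF two_pow_pos fock_parity_carrier M])
  have tw: "tw \<rho> = \<rho>" unfolding tw_def Pr[symmetric] mult.assoc PP by simp
  define B where "B e m = msum d d (\<lambda>i. Ee e i m \<cdot>\<^sub>m majo esb L i) {..<?n}" for e m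
  define \<beta> where "\<beta> e m = (\<Sum>i<?n. sc (Ee e i m) (g i))" for e m
  have B: "B e m \<in> carrier_mat d d" for e m by (simp add: B_def)
  have Bb: "emb (B e m) = \<beta> e m" for e m
    unfolding B_def \<beta>_def by (subst opm_msum) (simp_all add: opm_smult)
  \<comment> \<open>The combination \<open>\<beta> e m\<close> of Majorana operators is a ladder
    operator of \<open>Q\<close> for the eigenvalue \<open>f e\<close>.\<close>
  have comm: "Q * \<beta> e m = \<beta> e m * (sc (f e) 1 + Q)" if e: "e \<in> S" and m: "m < ?n" for e m
  proof -
    have "Q * \<beta> e m - \<beta> e m * Q = (\<Sum>i<?n. sc (Ee e i m) (Q * g i - g i * Q))"
      unfolding \<beta>_def by (simp add: sum_distrib_left sum_distrib_right sum_subtractf sc_diff_right)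
    also have "\<dots> = (\<Sum>i<?n. \<Sum>k<?n. sc (Ee e i m * h k i) (g k))"
      by (intro sum.cong refl) (simp add: Q_def quadratic_commutator[OF ha] sc_sum_right)
    also have "\<dots> = (\<Sum>k<?n. \<Sum>i<?n. sc (Ee e i m * h k i) (g k))" by (rule sum.swap)
    also have "\<dots> = (\<Sum>k<?n. sc (f e * Ee e k m) (g k))"
      unfolding sc_sum_left[symmetric] by (intro sum.cong refl) (simp add: hE'[OF e] m)
    also have "\<dots> = sc (f e) (\<beta> e m)" unfolding \<beta>_def sc_sum_right by simp
    finally have "Q * \<beta> e m = sc (f e) (\<beta> e m) + \<beta> e m * Q" by (simp add: diff_eq_eq)
    thus ?thesis by (simp add: distrib_left)
  qed
  \<comment> \<open>Exponentiating the ladder relation gives the factor \<open>exp (f e)\<close>;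
    multiplication by \<open>1 - e\<close> clears its denominator.\<close>
  have rb: "\<rho> * \<beta> e m - sc e (\<rho> * \<beta> e m) = \<beta> e m * \<rho> + sc e (\<beta> e m * \<rho>)" if e: "e \<in> S" and m: "m < ?n" for e m
  proof -
    have Xf: "f e \<cdot>\<^sub>m 1\<^sub>m d + X \<in> carrier_mat d d" using X by simp
    have "X * B e m = B e m * (f e \<cdot>\<^sub>m 1\<^sub>m d + X)"
    proof (rule opm_inj[OF mult_sq_carrier[OF X B] mult_sq_carrier[OF B Xf]])
      have "emb (f e \<cdot>\<^sub>m 1\<^sub>m d + X) = sc (f e) 1 + Q" using X by (simp add: opm_add opm_smult opm_one XQ)
      thus "emb (X * B e m) = emb (B e m * (f e \<cdot>\<^sub>m 1\<^sub>m d + X))"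
        unfolding opm_mult[OF two_pow_pos X B] opm_mult[OF two_pow_pos B Xf] XQ Bb by (simp only: comm[OF e m])
    qed
    from mat_exp_intertwine[OF X Xf B this] have "M * B e m = B e m * (exp (f e) \<cdot>\<^sub>m M)"
      unfolding mat_exp_scalar_add[OF X] M_def .
    hence "emb (M * B e m) = emb (B e m * (exp (f e) \<cdot>\<^sub>m M))" by simp
    hence "\<rho> * \<beta> e m = sc (exp (f e)) (\<beta> e m * \<rho>)"
      unfolding opm_mult[OF two_pow_pos M B] opm_mult[OF two_pow_pos B smult_carrier_mat[OF M]] opm_smult[OF two_pow_pos M] Bb \<rho>_def
      by simp
    hence "sc (1 - e) (\<rho> * \<beta> e m) = sc ((1 - e) * exp (f e)) (\<beta> e m * \<rho>)" by simp
    thus ?thesis unfolding fexp[OF e] by (simp add: sc_diff_left sc_add_left)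
  qed
  \<comment> \<open>Summation over the spectrum turns the eigenvalues into column \<open>m\<close>
    of \<open>Y\<close>: the commutator of \<open>g m\<close> with \<rho> is minus the
    anticommutator of \<open>y\<close> with it. Since \<rho> is even, commutators are
    \<open>a\<close> and anticommutators are \<open>b\<close>, each up to a factor 1/2.\<close>
  have gauss: "a m \<rho> = - (\<Sum>l<?n. sc (Y l m) (b l \<rho>))" if m: "m < ?n" for m
  proof -
    define y where "y = (\<Sum>i<?n. sc (Y i m) (g i))"
    have s1: "(\<Sum>e\<in>S. \<beta> e m) = g m"
    proof -
      have "(\<Sum>e\<in>S. \<beta> e m) = (\<Sum>i<?n. sc (\<Sum>e\<in>S. Ee e i m) (g i))" unfolding \<beta>_def sc_sum_left by (rule sum.swap)
      also have "\<dots> = (\<Sum>i<?n. if i = m then g i else 0)" by (intro sum.cong refl) (simp add: E3 m)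
      finally show ?thesis using m by simp
    qed
    have s2: "(\<Sum>e\<in>S. sc e (\<beta> e m)) = y"
    proof -
      have "(\<Sum>e\<in>S. sc e (\<beta> e m)) = (\<Sum>e\<in>S. \<Sum>i<?n. sc (e * Ee e i m) (g i))" unfolding \<beta>_def sc_sum_right sc_sc ..
      also have "\<dots> = (\<Sum>i<?n. sc (\<Sum>e\<in>S. e * Ee e i m) (g i))" unfolding sc_sum_left by (rule sum.swap)
      also have "\<dots> = y" unfolding y_def
      proof (intro sum.cong refl arg_cong2[of _ _ _ _ sc])
        fix i assume "i \<in> {..<?n}"
        hence i: "i < ?n" by simp
        have "(\<Sum>e\<in>S. e * Ee e i m) = (\<Sum>e\<in>S. \<Sum>k<?n. Y i k * Ee e k m)"
          by (intro sum.cong refl) (simp add: E1 i m)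
        also have "\<dots> = (\<Sum>k<?n. Y i k * (\<Sum>e\<in>S. Ee e k m))" unfolding sum_distrib_left by (rule sum.swap)
        also have "\<dots> = (\<Sum>k<?n. if k = m then Y i k else 0)" by (intro sum.cong refl) (simp add: E3 m)
        finally show "(\<Sum>e\<in>S. e * Ee e i m) = Y i m" using m by simp
      qed
      finally show ?thesis .
    qed
    have "(\<Sum>e\<in>S. \<rho> * \<beta> e m - sc e (\<rho> * \<beta> e m)) = (\<Sum>e\<in>S. \<beta> e m * \<rho> + sc e (\<beta> e m * \<rho>))"
      by (intro sum.cong refl) (simp only: rb m)
    moreover have "(\<Sum>e\<in>S. \<rho> * \<beta> e m - sc e (\<rho> * \<beta> e m)) = \<rho> * (\<Sum>e\<in>S. \<beta> e m) - \<rho> * (\<Sum>e\<in>S. sc e (\<beta> e m))"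
      by (simp add: sum_subtractf sum_distrib_left)
    moreover have "(\<Sum>e\<in>S. \<beta> e m * \<rho> + sc e (\<beta> e m * \<rho>)) = (\<Sum>e\<in>S. \<beta> e m) * \<rho> + (\<Sum>e\<in>S. sc e (\<beta> e m)) * \<rho>"
      by (simp add: sum.distrib sum_distrib_right)
    ultimately have "\<rho> * g m - \<rho> * y = g m * \<rho> + y * \<rho>" unfolding s1 s2 by simp
    hence c: "g m * \<rho> - \<rho> * g m = - (y * \<rho> + \<rho> * y)" by (simp add: algebra_simps)
    have "a m \<rho> = - sc (1/2) (y * \<rho> + \<rho> * y)" unfolding a_def tw c by (rule sc_minus_right)
    also have "sc (1/2) (y * \<rho> + \<rho> * y) = (\<Sum>l<?n. sc (Y l m) (b l \<rho>))"
      unfolding b_def tw y_def sum_distrib_left sum_distrib_right sum.distrib[symmetric] sc_sum_right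
      by (intro sum.cong refl) (simp add: sc_add_right mult.commute)
    finally show ?thesis .
  qed
  define \<sigma> where "\<sigma> = (1 / mtrace M) \<cdot>\<^sub>m M"
  have "gaussian_state L \<sigma>"
    unfolding gaussian_state_def \<sigma>_def M_def X_def by (intro exI[of _ 1] exI[of _ H] conjI qH refl) simp
  moreover have "a m (emb \<sigma>) = - (\<Sum>l<2*L. sc (Y l m) (b l (emb \<sigma>)))" if "m < ?n" for m
    unfolding \<sigma>_def opm_smult[OF two_pow_pos M] \<rho>_def[symmetric] a_sc b_sc gauss[OF that]
    by (simp add: sc_minus_right sc_sum_right mult.commute)
  ultimately show ?thesis by (rule that)
qed

text \<open>The Gaussian state is exactly stationary for the interpolated noise. The generator is
  linear in the noise, so the residual for the original noise is a multiple of \<epsilon>.\<close>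

lemma gaussian_almost_stationary:
  assumes controllable: controllable and w: "bath_state (2 ^ K) \<omega>"
    and \<rho>: "\<rho> \<in> carrier_mat d d" "mtrace \<rho> = 1" "generator (noise K W \<omega>) \<rho> = 0 \<cdot>\<^sub>m 1\<^sub>m d"
    and \<epsilon>: "0 < \<epsilon>" "\<epsilon> < 1"
  defines "G \<equiv> \<lambda>i j. complex_of_real (\<Sum>k<2*K. W\<^sub>f i k * W\<^sub>f j k)"
  obtains \<sigma> where "gaussian_state L \<sigma>"
    "generator (noise K W \<omega>) \<sigma> = of_real \<epsilon> \<cdot>\<^sub>m (generator (noise K W \<omega>) \<sigma> + - 1 \<cdot>\<^sub>m generator G \<sigma>)"
proof -
  let ?A = "noise K W \<omega>" and ?n = "2 * L"
  let ?e = "complex_of_real \<epsilon>" let ?c = "1 - ?e"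
  have Gs: "G j i = G i j" for i j unfolding G_def by (simp only: mult.commute)
  have cr: "?c = of_real (1 - \<epsilon>)" by simp
  have cn: "cnj ?c = ?c" unfolding cr by (rule complex_cnj_complex_of_real)
  have c0: "?c \<noteq> 0" unfolding cr of_real_eq_0_iff using \<epsilon> by simp
  define Y where "Y i j = ?c * covariance \<rho> i j" for i j
  have Ya: "Y j i = - Y i j" if "i < ?n" "j < ?n" for i j
    unfolding Y_def covariance_antisymmetric[OF that] by simp
  have Yc: "cnj (Y i j) = - Y i j" if "i < ?n" "j < ?n" for i j
    unfolding Y_def complex_cnj_mult cn covariance_cnj[OF controllable \<rho> noise_cnj[OF w] that] by simp
  have Yev: "\<bar>Re y\<bar> < 1"
    if h: "\<And>i. i < ?n \<Longrightarrow> (\<Sum>j<?n. Y i j * u j) = y * u i" and y: "cnj y = y" and i: "i < ?n" "u i \<noteq> 0" for y u i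
  proof -
    have "(\<Sum>j<?n. covariance \<rho> i j * u j) = (y / ?c) * u i" if i: "i < ?n" for i
    proof -
      have "?c * (\<Sum>j<?n. covariance \<rho> i j * u j) = y * u i"
        unfolding h[OF i, symmetric] Y_def sum_distrib_left by (simp only: mult.assoc)
      thus ?thesis using c0 by (simp add: nonzero_eq_divide_eq mult.commute)
    qed
    moreover have "cnj (y / ?c) = y / ?c" unfolding complex_cnj_divide cn y ..
    ultimately have "\<bar>Re (y / ?c)\<bar> \<le> 1" using covariance_eigenvalue_le[where u = u and i = i, OF controllable w \<rho> _ _ i] by blast
    hence "\<bar>Re y / (1 - \<epsilon>)\<bar> \<le> 1" unfolding cr Re_divide_of_real .
    thus ?thesis using \<epsilon> by (simp add: abs_divide)
  qed
  obtain \<sigma> where \<sigma>: "gaussian_state L \<sigma>" "\<And>m. m < ?n \<Longrightarrow> a m (emb \<sigma>) = - (\<Sum>l<?n. sc (Y l m) (b l (emb \<sigma>)))"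
    by (rule gaussian_state_with_covariance[where Y = Y, OF Ya Yc Yev]) (assumption | rule that)+
  have \<sigma>c: "\<sigma> \<in> carrier_mat d d" using gaussian_is_state[OF \<sigma>(1)] by (simp add: is_state_def)
  let ?x = "emb \<sigma>"
  \<comment> \<open>Both sides scale by \<open>1 - \<epsilon>\<close>: the symmetric matrix
    \<open>G\<close> cancels in the antisymmetrized source, and \<open>N\<close> is the
    same.\<close>
  have lyap: "(\<Sum>k<?n. N i k * Y k j) + (\<Sum>k<?n. Y i k * N j k) = - 2 * ((?c * ?A i j + ?e * G i j) - (?c * ?A j i + ?e * G j i))"
    if ij: "i < ?n" "j < ?n" for i j
  proof -
    have "(\<Sum>k<?n. N i k * Y k j) + (\<Sum>k<?n. Y i k * N j k)
      = ?c * ((\<Sum>k<?n. N i k * covariance \<rho> k j) + (\<Sum>k<?n. covariance \<rho> i k * N j k))"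
      unfolding Y_def distrib_left sum_distrib_left by (simp only: mult_ac)
    also have "\<dots> = ?c * (- 2 * (?A i j - ?A j i))" by (simp only: covariance_lyapunov[OF \<rho> ij])
    finally show ?thesis unfolding Gs[of i j] by (simp only:) (simp add: algebra_simps)
  qed
  have "gen N (\<lambda>i j. ?c * ?A i j + ?e * G i j) ?x = 0"
    by (rule gen_gaussian_eq_0[where Y = Y, OF \<sigma>(2) Ya lyap])
  hence "sc ?c (gen N ?A ?x) + sc ?e (gen N G ?x) = 0" unfolding gen_interpolate .
  hence "gen N ?A ?x - (sc ?e (gen N ?A ?x) - sc ?e (gen N G ?x)) = 0" by (simp add: sc_diff_left algebra_simps)
  hence eq: "gen N ?A ?x = sc ?e (gen N ?A ?x - gen N G ?x)" by (simp add: sc_diff_right)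
  note gA = generator_carrier[OF \<sigma>c, of ?A] and gG = generator_carrier[OF \<sigma>c, of G]
  have "emb (?e \<cdot>\<^sub>m (generator ?A \<sigma> + - 1 \<cdot>\<^sub>m generator G \<sigma>)) = sc ?e (gen N ?A ?x - gen N G ?x)"
    using gA gG by (simp add: opm_smult opm_add emb_generator[OF \<sigma>c] sc_minus_left)
  hence "emb (generator ?A \<sigma>) = emb (?e \<cdot>\<^sub>m (generator ?A \<sigma> + - 1 \<cdot>\<^sub>m generator G \<sigma>))"
    using eq by (simp only: emb_generator[OF \<sigma>c])
  hence "generator ?A \<sigma> = ?e \<cdot>\<^sub>m (generator ?A \<sigma> + - 1 \<cdot>\<^sub>m generator G \<sigma>)"
    by (intro opm_inj[OF gA]) (use gA gG in simp_all)
  with \<sigma>(1) show ?thesis by (rule that)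
qed

text \<open>The difference of an approximant and \<rho> is traceless, so the inverse of the
  corrected generator recovers it from the residual. That residual is \<epsilon> times a quantity
  bounded uniformly over Gaussian states, whose entries have modulus at most 1.\<close>

lemma stationary_quasi_free:
  assumes controllable: controllable and w: "bath_state (2 ^ K) \<omega>"
    and \<rho>: "\<rho> \<in> carrier_mat d d" "mtrace \<rho> = 1" "generator (noise K W \<omega>) \<rho> = 0 \<cdot>\<^sub>m 1\<^sub>m d"
  shows "quasi_free L \<rho>"
proof -
  let ?A = "noise K W \<omega>" and ?n = "d * d"
  let ?G = "\<lambda>i j. complex_of_real (\<Sum>k<2*K. W\<^sub>f i k * W\<^sub>f j k)"
  let ?SA = "superop_mat d (generator ?A)" and ?SG = "superop_mat d (generator ?G)" and ?S' = "superop_mat d (generator' ?A)"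
  obtain B where B: "B \<in> carrier_mat ?n ?n" "B * ?S' = 1\<^sub>m ?n" using generator'_inverse[OF controllable, of ?A] by blast
  define c where "c a = (\<Sum>b<?n. cmod (B $$ (a,b)) * (\<Sum>e<?n. cmod (?SA $$ (b,e)) + cmod (?SG $$ (b,e))))" for a
  have bound: "cmod (\<sigma> $$ (i,j) - \<rho> $$ (i,j)) \<le> \<epsilon> * c (i * d + j)"
    if \<sigma>: "gaussian_state L \<sigma>" "generator ?A \<sigma> = of_real \<epsilon> \<cdot>\<^sub>m (generator ?A \<sigma> + - 1 \<cdot>\<^sub>m generator ?G \<sigma>)"
      and \<epsilon>: "0 < \<epsilon>" and ij: "i < d" "j < d" for \<sigma> \<epsilon> i j
  proof -
    from gaussian_is_state[OF \<sigma>(1)] have \<sigma>c: "\<sigma> \<in> carrier_mat d d" "mtrace \<sigma> = 1" by (simp_all add: is_state_def)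
    note gA = generator_carrier[OF \<sigma>c(1), of ?A] and gG = generator_carrier[OF \<sigma>c(1), of ?G]
    define \<tau> where "\<tau> = \<sigma> + - 1 \<cdot>\<^sub>m \<rho>"
    have \<tau>: "\<tau> \<in> carrier_mat d d" unfolding \<tau>_def using \<rho> \<sigma>c by simp
    have t0: "mtrace \<tau> = 0" unfolding \<tau>_def using \<rho> \<sigma>c by (simp add: mtrace_add[of _ d] mtrace_smult[of _ d])
    note lin = linear_generator[of ?A, unfolded linear_superop_def]
    have "generator ?A \<tau> = generator ?A \<sigma> + generator ?A (- 1 \<cdot>\<^sub>m \<rho>)" unfolding \<tau>_def using lin \<sigma>c(1) smult_carrier_mat[OF \<rho>(1)] by blast
    also have "generator ?A (- 1 \<cdot>\<^sub>m \<rho>) = - 1 \<cdot>\<^sub>m generator ?A \<rho>" using lin \<rho>(1) by blast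
    finally have g\<tau>: "generator ?A \<tau> = generator ?A \<sigma>" unfolding \<rho>(3) using gA by (intro eq_matI) auto
    have "vec_of d \<tau> = (B * ?S') *\<^sub>v vec_of d \<tau>" unfolding B(2) by simp
    also have "\<dots> = B *\<^sub>v (?S' *\<^sub>v vec_of d \<tau>)" by (rule assoc_mult_mat_vec[OF B(1) superop_mat_carrier vec_of_carrier])
    also have "?S' *\<^sub>v vec_of d \<tau> = vec_of d (generator ?A \<sigma>)"
      unfolding superop_mat_vec_of[OF linear_generator' \<tau>] generator'_traceless[OF \<tau> t0] g\<tau> ..
    finally have v: "vec_of d \<tau> = B *\<^sub>v vec_of d (generator ?A \<sigma>)" .
    have e1: "cmod (vec_of d \<sigma> $ e) \<le> 1" if "e < ?n" for e
      using gaussian_entry_le[OF \<sigma>(1)] that by (simp add: div_mod_less)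
    have S1: "cmod (vec_of d (generator A' \<sigma>) $ b) \<le> (\<Sum>e<?n. cmod (superop_mat d (generator A') $$ (b,e)))" if b: "b < ?n" for A' b
    proof -
      have "cmod (vec_of d (generator A' \<sigma>) $ b) = cmod (\<Sum>e<?n. superop_mat d (generator A') $$ (b,e) * vec_of d \<sigma> $ e)"
        unfolding superop_mat_vec_of[OF linear_generator \<sigma>c(1), symmetric] index_mult_vec_sum[OF superop_mat_carrier vec_of_carrier b] ..
      also have "\<dots> \<le> (\<Sum>e<?n. cmod (superop_mat d (generator A') $$ (b,e)))"
      proof (rule order_trans[OF norm_sum], rule sum_mono)
        fix e assume "e \<in> {..<?n}"
        hence "e < ?n" by simp
        from e1[OF this] show "cmod (superop_mat d (generator A') $$ (b,e) * vec_of d \<sigma> $ e) \<le> cmod (superop_mat d (generator A') $$ (b,e))"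
          unfolding norm_mult by (rule mult_left_le) simp
      qed
      finally show ?thesis .
    qed
    have g1: "cmod (vec_of d (generator ?A \<sigma>) $ b) \<le> \<epsilon> * (\<Sum>e<?n. cmod (?SA $$ (b,e)) + cmod (?SG $$ (b,e)))" if b: "b < ?n" for b
    proof -
      have "vec_of d (generator ?A \<sigma>) $ b = vec_of d (of_real \<epsilon> \<cdot>\<^sub>m (generator ?A \<sigma> + - 1 \<cdot>\<^sub>m generator ?G \<sigma>)) $ b" by (subst \<sigma>(2)) (rule refl)
      also have "\<dots> = of_real \<epsilon> * (vec_of d (generator ?A \<sigma>) $ b - vec_of d (generator ?G \<sigma>) $ b)"
        using b gA gG by (simp add: div_mod_less)
      finally have "cmod (vec_of d (generator ?A \<sigma>) $ b) = cmod (of_real \<epsilon> * (vec_of d (generator ?A \<sigma>) $ b - vec_of d (generator ?G \<sigma>) $ b))"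
        by (rule arg_cong)
      hence "cmod (vec_of d (generator ?A \<sigma>) $ b) = \<epsilon> * cmod (vec_of d (generator ?A \<sigma>) $ b - vec_of d (generator ?G \<sigma>) $ b)"
        by (simp only: norm_mult norm_of_real abs_of_pos[OF \<epsilon>])
      also have "\<dots> \<le> \<epsilon> * ((\<Sum>e<?n. cmod (?SA $$ (b,e))) + (\<Sum>e<?n. cmod (?SG $$ (b,e))))"
        by (intro mult_left_mono order_trans[OF norm_triangle_ineq4] add_mono S1 b) (use \<epsilon> in simp)
      finally show ?thesis unfolding sum.distrib .
    qed
    have a: "i * d + j < ?n" by (rule index_pair_less[OF ij])
    have "\<sigma> $$ (i,j) - \<rho> $$ (i,j) = vec_of d \<tau> $ (i * d + j)" using a ij \<rho>(1) \<sigma>c(1) by (simp add: \<tau>_def)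
    also have "\<dots> = (\<Sum>b<?n. B $$ (i * d + j, b) * vec_of d (generator ?A \<sigma>) $ b)"
      unfolding v by (rule index_mult_vec_sum[OF B(1) vec_of_carrier a])
    finally have "cmod (\<sigma> $$ (i,j) - \<rho> $$ (i,j)) = cmod (\<Sum>b<?n. B $$ (i * d + j, b) * vec_of d (generator ?A \<sigma>) $ b)"
      by (rule arg_cong)
    also have "\<dots> \<le> (\<Sum>b<?n. cmod (B $$ (i * d + j, b)) * (\<epsilon> * (\<Sum>e<?n. cmod (?SA $$ (b,e)) + cmod (?SG $$ (b,e)))))"
    proof (rule order_trans[OF norm_sum], rule sum_mono)
      fix b assume "b \<in> {..<?n}"
      hence "b < ?n" by simp
      from g1[OF this] show "cmod (B $$ (i * d + j, b) * vec_of d (generator ?A \<sigma>) $ b)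
        \<le> cmod (B $$ (i * d + j, b)) * (\<epsilon> * (\<Sum>e<?n. cmod (?SA $$ (b,e)) + cmod (?SG $$ (b,e))))"
        unfolding norm_mult by (rule mult_left_mono) simp
    qed
    also have "\<dots> = (\<Sum>b<?n. \<epsilon> * (cmod (B $$ (i * d + j, b)) * (\<Sum>e<?n. cmod (?SA $$ (b,e)) + cmod (?SG $$ (b,e)))))"
      by (intro sum.cong refl) (rule mult.left_commute)
    also have "\<dots> = \<epsilon> * c (i * d + j)" unfolding c_def by (rule sum_distrib_left[symmetric])
    finally show ?thesis .
  qed
  \<comment> \<open>The sequence is \<open>1 / (k + 2)\<close>, so that \<open>\<epsilon> 0\<close>
    is already below 1.\<close>
  define \<epsilon> where "\<epsilon> k = inverse (real (Suc (Suc k)))" for k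
  have \<epsilon>: "0 < \<epsilon> k" "\<epsilon> k < 1" for k by (simp_all add: \<epsilon>_def inverse_less_1_iff)
  have "\<forall>k. \<exists>\<sigma>. gaussian_state L \<sigma> \<and> generator ?A \<sigma> = of_real (\<epsilon> k) \<cdot>\<^sub>m (generator ?A \<sigma> + - 1 \<cdot>\<^sub>m generator ?G \<sigma>)"
  proof
    fix k
    show "\<exists>\<sigma>. gaussian_state L \<sigma> \<and> generator ?A \<sigma> = of_real (\<epsilon> k) \<cdot>\<^sub>m (generator ?A \<sigma> + - 1 \<cdot>\<^sub>m generator ?G \<sigma>)"
      by (rule gaussian_almost_stationary[OF controllable w \<rho> \<epsilon>, of k]) (intro exI conjI)
  qed
  then obtain s where s: "\<And>k. gaussian_state L (s k)"
    "\<And>k. generator ?A (s k) = of_real (\<epsilon> k) \<cdot>\<^sub>m (generator ?A (s k) + - 1 \<cdot>\<^sub>m generator ?G (s k))"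
    by (auto dest!: choice)
  have "mat_tendsto s \<rho> sequentially"
    unfolding mat_tendsto_def carrier_matD[OF \<rho>(1)]
  proof (intro conjI allI impI)
    show "\<forall>\<^sub>F k in sequentially. s k \<in> carrier_mat d d"
      using gaussian_is_state[OF s(1)] by (simp add: is_state_def)
    fix i j assume ij: "i < d" "j < d"
    have "\<epsilon> \<longlonglongrightarrow> 0" unfolding \<epsilon>_def by (rule LIMSEQ_Suc[OF LIMSEQ_inverse_real_of_nat])
    moreover have "\<forall>\<^sub>F k in sequentially. norm (s k $$ (i,j) - \<rho> $$ (i,j)) \<le> norm (\<epsilon> k) * c (i * d + j)"
    proof (rule always_eventually, rule allI)
      fix k
      from bound[OF s[of k] \<epsilon>(1) ij] show "norm (s k $$ (i,j) - \<rho> $$ (i,j)) \<le> norm (\<epsilon> k) * c (i * d + j)"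
        unfolding real_norm_def abs_of_pos[OF \<epsilon>(1)] .
    qed
    ultimately have "(\<lambda>k. s k $$ (i,j) - \<rho> $$ (i,j)) \<longlonglongrightarrow> 0" by (rule tendsto_0_le)
    thus "(\<lambda>k. s k $$ (i,j)) \<longlonglongrightarrow> \<rho> $$ (i,j)" by (rule LIM_zero_cancel)
  qed
  thus ?thesis unfolding quasi_free_def using \<rho>(1) s(1) by blast
qed

section \<open>Necessity: initial states with distinct first moments\<close>

lemma mtrace_majo: "i < 2*L \<Longrightarrow> mtrace (majo esb L i) = 0"
  using tr_g[of i] ltr_opm[OF majo_carrier, of i L esb] by simp

lemma mtrace_majo_majo:
  assumes "i < 2*L" "j < 2*L" shows "mtrace (majo esb L i * majo esb L j) = (if i = j then of_nat d else 0)"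
proof -
  note m = majo_carrier[OF assms(1), of esb] majo_carrier[OF assms(2), of esb]
  have "mtrace (majo esb L i * majo esb L j) = ltr d (g i * g j)"
    unfolding ltr_opm[OF mult_sq_carrier[OF m], symmetric] opm_mult[OF two_pow_pos m] ..
  also have "\<dots> = (if i = j then of_nat d else 0)"
    unfolding tr_g_g[OF assms] using ltr_opm[OF one_carrier_mat, of d] opm_one[OF two_pow_pos, of L] by (simp add: mtrace_one)
  finally show ?thesis .
qed

lemma maximally_mixed_state: "is_state d ((1 / of_nat d) \<cdot>\<^sub>m 1\<^sub>m d)"
  using hermitian_square_state(1)[of "1\<^sub>m d" d] by (simp add: mat_adjoint_one mtrace_one)

text \<open>\<open>(1 + g j) / 2\<close> is a projection, hence a hermitian square. Its odd part
  gives it a nonzero first moment, which even states do not have.\<close>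

lemma polarized_state:
  assumes j: "j < 2*L" shows "is_state d ((1 / of_nat d) \<cdot>\<^sub>m (1\<^sub>m d + majo esb L j))"
proof -
  note m = majo_carrier[OF j, of esb]
  define p where "p = (1/2) \<cdot>\<^sub>m (1\<^sub>m d + majo esb L j)"
  have s: "1\<^sub>m d + majo esb L j \<in> carrier_mat d d" using m by simp
  have p: "p \<in> carrier_mat d d" using s by (simp add: p_def)
  have pa: "mat_adjoint p = p"
    unfolding p_def mat_adjoint_smult mat_adjoint_add[OF one_carrier_mat m] mat_adjoint_one majo_adjoint[OF j] by simp
  have ep: "emb p = sc (1/2) (1 + g j)" unfolding p_def using m by (simp add: opm_smult opm_add opm_one)
  have "(1 + g j) * (1 + g j) = sc 2 (1 + g j)" by (simp add: distrib_left distrib_right g_sq[OF j] sc_two)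
  hence "emb p * emb p = emb p" unfolding ep by simp
  hence pp: "p * p = p" by (intro opm_inj[OF mult_sq_carrier[OF p p] p]) (simp only: opm_mult[OF two_pow_pos p p])
  have tp: "mtrace p = of_nat d / 2"
    unfolding p_def mtrace_smult[OF s] mtrace_add[OF one_carrier_mat m] mtrace_one mtrace_majo[OF j] by simp
  have "mtrace (p * p) \<noteq> 0" unfolding pp tp by simp
  from hermitian_square_state(1)[OF p pa this] have "is_state d ((1 / (of_nat d / 2)) \<cdot>\<^sub>m p)" unfolding pp tp .
  moreover have "(1 / (of_nat d / 2)) \<cdot>\<^sub>m p = (1 / of_nat d) \<cdot>\<^sub>m (1\<^sub>m d + majo esb L j)"
    unfolding p_def smult_smult_times by simp
  ultimately show ?thesis by simp
qed

text \<open>The functional \<open>l\<close> vanishes on the maximally mixed state, so its constant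
  modulus forces \<open>l \<rho> = 0\<close> at the common limit. The state polarized along
  \<open>g j\<close> gives \<open>l\<close> the value \<open>v $ j\<close>, which must then vanish
  for every \<open>j\<close>.\<close>

lemma no_common_eigenvector_if_relaxes:
  assumes w: "bath_state (2 ^ K) \<omega>" and \<rho>: "\<rho> \<in> carrier_mat d d"
    and lim: "\<And>\<sigma>. is_state d \<sigma> \<Longrightarrow> mat_tendsto (\<lambda>t. semigroup esb L K T \<Theta> \<omega> t \<sigma>) \<rho> at_top"
  shows no_common_eigenvector
  unfolding no_common_eigenvector_def
proof (intro notI, elim exE conjE)
  fix v \<mu> assume ev: "eigenvector T v \<mu>" and th: "mat_adjoint \<Theta> *\<^sub>v v = 0\<^sub>v (2*K)"
  let ?n = "2 * L"
  from ev have v: "v \<in> carrier_vec ?n" "v \<noteq> 0\<^sub>v ?n" "T *\<^sub>v v = \<mu> \<cdot>\<^sub>v v"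
    using T_carrier by (auto simp: eigenvector_def)
  have \<mu>: "cnj \<mu> = \<mu>" by (rule hermitian_eigenvalue_real[OF T_carrier T_adjoint v])
  have Wv: "(\<Sum>i<?n. of_real (W\<^sub>f i k) * v $ i) = 0" if "k < 2*K" for k
    using th that unfolding adjoint_\<Theta>_eq_0[OF v(1)] by blast
  have Rv: "(\<Sum>i<?n. of_real (R\<^sub>f j i) * v $ i) = - \<i> * \<mu> * v $ j" if j: "j < ?n" for j
  proof -
    have "\<i> * (\<Sum>i<?n. of_real (R\<^sub>f j i) * v $ i) = (T *\<^sub>v v) $ j"
      unfolding index_mult_vec_sum[OF T_carrier v(1) j] sum_distrib_left
      by (intro sum.cong refl) (use j Rc in \<open>simp add: T_def\<close>)
    also have "\<dots> = \<mu> * v $ j" unfolding v(3) using v(1) j by simp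
    finally have "- \<i> * (\<i> * (\<Sum>i<?n. of_real (R\<^sub>f j i) * v $ i)) = - \<i> * (\<mu> * v $ j)" by simp
    thus ?thesis by (simp add: mult.assoc[symmetric])
  qed
  \<comment> \<open>Since \<open>W^T v = 0\<close>, only \<open>R\<close> acts; antisymmetry turns
    its transpose into \<open>- R\<close>, and \<open>R v = - \<i> \<mu> v\<close> gives the purely
    imaginary eigenvalue \<open>2 \<i> \<mu>\<close>.\<close>
  have left: "(\<Sum>i<?n. v $ i * N i j) = (2 * \<i> * \<mu>) * v $ j" if j: "j < ?n" for j
  proof -
    have "(\<Sum>i<?n. v $ i * N i j) = (\<Sum>i<?n. - 2 * (of_real (R\<^sub>f j i) * v $ i) - 2 * (\<Sum>k<2*K. of_real (W\<^sub>f j k) * (of_real (W\<^sub>f i k) * v $ i)))"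
    proof (rule sum.cong[OF refl])
      fix i assume "i \<in> {..<?n}"
      hence i: "i < ?n" by simp
      have "N i j = - 2 * of_real (R\<^sub>f j i) - 2 * (\<Sum>k<2*K. of_real (W\<^sub>f j k) * of_real (W\<^sub>f i k))"
        unfolding drift_def Ra[OF i j] by (simp add: mult.commute)
      moreover have "(\<Sum>k<2*K. of_real (W\<^sub>f j k) * (of_real (W\<^sub>f i k) * v $ i)) = (\<Sum>k<2*K. of_real (W\<^sub>f j k) * of_real (W\<^sub>f i k)) * v $ i"
        by (simp only: sum_distrib_right mult.assoc)
      ultimately show "v $ i * N i j = - 2 * (of_real (R\<^sub>f j i) * v $ i) - 2 * (\<Sum>k<2*K. of_real (W\<^sub>f j k) * (of_real (W\<^sub>f i k) * v $ i))"
        by (simp only:) (simp add: algebra_simps)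
    qed
    also have "\<dots> = - 2 * (\<Sum>i<?n. of_real (R\<^sub>f j i) * v $ i) - 2 * (\<Sum>i<?n. \<Sum>k<2*K. of_real (W\<^sub>f j k) * (of_real (W\<^sub>f i k) * v $ i))"
      unfolding sum_subtractf by (simp only: sum_distrib_left)
    also have "(\<Sum>i<?n. \<Sum>k<2*K. of_real (W\<^sub>f j k) * (of_real (W\<^sub>f i k) * v $ i)) = (\<Sum>k<2*K. of_real (W\<^sub>f j k) * (\<Sum>i<?n. of_real (W\<^sub>f i k) * v $ i))"
      unfolding sum_distrib_left by (rule sum.swap)
    also have "\<dots> = 0" by (intro sum.neutral ballI) (simp add: Wv)
    finally show ?thesis unfolding Rv[OF j] by simp
  qed
  define l where "l \<sigma> = (\<Sum>i<?n. v $ i * mtrace (majo esb L i * \<sigma>))" for \<sigma>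
  have conv: "((\<lambda>t. cmod (l (flow (noise K W \<omega>) t \<sigma>))) \<longlongrightarrow> cmod (l \<rho>)) at_top" if \<sigma>: "is_state d \<sigma>" for \<sigma>
  proof -
    let ?f = "\<lambda>t. flow (noise K W \<omega>) t \<sigma>"
    have e: "((\<lambda>t. ?f t $$ (i,j)) \<longlongrightarrow> \<rho> $$ (i,j)) at_top" if "i < d" "j < d" for i j
      using lim[OF \<sigma>] that \<rho> unfolding mat_tendsto_def semigroup_flow[OF w] by simp
    have m: "((\<lambda>t. mtrace (majo esb L i * ?f t)) \<longlongrightarrow> mtrace (majo esb L i * \<rho>)) at_top" if i: "i < ?n" for i
      unfolding mtrace_mult_sum[OF majo_carrier[OF i] flow_carrier] mtrace_mult_sum[OF majo_carrier[OF i] \<rho>]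
      by (intro tendsto_sum tendsto_mult_left e) auto
    show ?thesis unfolding l_def by (intro tendsto_norm tendsto_sum tendsto_mult_left m) auto
  qed
  have const: "cmod (l \<sigma>) = cmod (l \<rho>)" if \<sigma>: "is_state d \<sigma>" for \<sigma>
  proof -
    have \<sigma>c: "\<sigma> \<in> carrier_mat d d" using \<sigma> by (simp add: is_state_def)
    have "Re (2 * \<i> * \<mu>) = 0" using arg_cong[OF \<mu>, of Im] by simp
    hence e1: "cmod (exp (2 * \<i> * \<mu> * of_real t)) = 1" for t by simp
    have f: "l (flow (noise K W \<omega>) t \<sigma>) = exp (2 * \<i> * \<mu> * of_real t) * l \<sigma>" for t
      unfolding l_def by (rule flow_eigenfunctional[where v = "\<lambda>i. v $ i", OF left \<sigma>c])
    have "cmod (l (flow (noise K W \<omega>) t \<sigma>)) = cmod (l \<sigma>)" for t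
      unfolding f norm_mult e1 by simp
    with conv[OF \<sigma>] have "((\<lambda>t::real. cmod (l \<sigma>)) \<longlongrightarrow> cmod (l \<rho>)) at_top" by simp
    from tendsto_unique[OF _ this tendsto_const] show ?thesis by simp
  qed
  have l1: "mtrace (majo esb L i * ((1 / of_nat d) \<cdot>\<^sub>m 1\<^sub>m d)) = 0" if i: "i < ?n" for i
  proof -
    note m = majo_carrier[OF i, of esb]
    have "majo esb L i * ((1 / of_nat d) \<cdot>\<^sub>m 1\<^sub>m d) = (1 / of_nat d) \<cdot>\<^sub>m majo esb L i"
      unfolding mult_smult_distrib[OF m one_carrier_mat] right_mult_one_mat[OF m] ..
    thus ?thesis by (simp only: mtrace_smult[OF m] mtrace_majo[OF i] mult_zero_right)
  qed
  have "l ((1 / of_nat d) \<cdot>\<^sub>m 1\<^sub>m d) = 0" unfolding l_def by (intro sum.neutral ballI) (simp only: l1 lessThan_iff mult_zero_right)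
  with const[OF maximally_mixed_state] have l0: "cmod (l \<rho>) = 0" by (simp only: norm_zero)
  have "v $ j = 0" if j: "j < ?n" for j
  proof -
    note mj = majo_carrier[OF j, of esb]
    let ?s = "(1 / of_nat d) \<cdot>\<^sub>m (1\<^sub>m d + majo esb L j)"
    have l2: "mtrace (majo esb L i * ?s) = (if i = j then 1 else 0)" if i: "i < ?n" for i
    proof -
      note m = majo_carrier[OF i, of esb]
      have "majo esb L i * ?s = (1 / of_nat d) \<cdot>\<^sub>m (majo esb L i + majo esb L i * majo esb L j)"
        unfolding mult_smult_distrib[OF m add_carrier_mat[OF mj]] mult_add_distrib_mat[OF m one_carrier_mat mj] right_mult_one_mat[OF m] ..
      hence "mtrace (majo esb L i * ?s) = (1 / of_nat d) * (0 + (if i = j then of_nat d else 0))"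
        by (simp only: mtrace_smult[OF add_carrier_mat[OF mult_sq_carrier[OF m mj]]] mtrace_add[OF m mult_sq_carrier[OF m mj]]
          mtrace_majo[OF i] mtrace_majo_majo[OF i j])
      thus ?thesis by simp
    qed
    have "l ?s = (\<Sum>i<?n. if i = j then v $ i else 0)" unfolding l_def
      by (intro sum.cong refl) (simp only: l2 lessThan_iff, simp)
    also have "\<dots> = v $ j" using j by simp
    finally show ?thesis using const[OF polarized_state[OF j]] l0 by simp
  qed
  hence "v = 0\<^sub>v ?n" using v(1) by (intro eq_vecI) auto
  with v(2) show False ..
qed

text \<open>A stationary state is a constant trajectory, so convergence to \<rho> also yields
  uniqueness. That \<rho> is a state comes from its being quasi-free.\<close>

lemma relaxes_if_no_common_eigenvector:
  assumes w: "bath_state (2 ^ K) \<omega>" and c: no_common_eigenvector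
  shows "\<exists>\<rho>. stationary esb L K T \<Theta> \<omega> \<rho> \<and> (\<forall>\<sigma>. stationary esb L K T \<Theta> \<omega> \<sigma> \<longrightarrow> \<sigma> = \<rho>)
    \<and> quasi_free L \<rho> \<and> (\<forall>\<sigma>. is_state d \<sigma> \<longrightarrow> mat_tendsto (\<lambda>t. semigroup esb L K T \<Theta> \<omega> t \<sigma>) \<rho> at_top)"
proof -
  have controllable: controllable by (rule controllable_if_no_common_eigenvector[OF c])
  obtain \<rho> where \<rho>: "\<rho> \<in> carrier_mat d d" "mtrace \<rho> = 1" "generator (noise K W \<omega>) \<rho> = 0 \<cdot>\<^sub>m 1\<^sub>m d"
    using stationary_exists[OF controllable] by blast
  have q: "quasi_free L \<rho>" by (rule stationary_quasi_free[OF controllable w \<rho>])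
  have st: "stationary esb L K T \<Theta> \<omega> \<rho>"
    unfolding stationary_def using quasi_free_is_state[OF q] by (simp add: semigroup_flow[OF w] flow_stationary[OF \<rho>(1,3)])
  have lim: "mat_tendsto (\<lambda>t. semigroup esb L K T \<Theta> \<omega> t \<sigma>) \<rho> at_top" if "is_state d \<sigma>" for \<sigma>
    unfolding semigroup_flow[OF w] by (rule flow_tendsto[OF controllable \<rho>]) (use that in \<open>simp_all add: is_state_def\<close>)
  have uniq: "\<sigma> = \<rho>" if s: "stationary esb L K T \<Theta> \<omega> \<sigma>" for \<sigma>
  proof (rule eq_matI)
    from s have \<sigma>: "is_state d \<sigma>" "\<And>t. 0 \<le> t \<Longrightarrow> semigroup esb L K T \<Theta> \<omega> t \<sigma> = \<sigma>" by (auto simp: stationary_def)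
    hence \<sigma>c: "\<sigma> \<in> carrier_mat d d" by (simp add: is_state_def)
    thus "dim_row \<sigma> = dim_row \<rho>" "dim_col \<sigma> = dim_col \<rho>" using \<rho>(1) by auto
    fix i j assume "i < dim_row \<rho>" "j < dim_col \<rho>"
    hence l: "((\<lambda>t. semigroup esb L K T \<Theta> \<omega> t \<sigma> $$ (i,j)) \<longlongrightarrow> \<rho> $$ (i,j)) at_top"
      using lim[OF \<sigma>(1)] by (simp add: mat_tendsto_def)
    have "\<forall>\<^sub>F t in at_top. semigroup esb L K T \<Theta> \<omega> t \<sigma> $$ (i,j) = \<sigma> $$ (i,j)"
      by (rule eventually_at_top_linorderI[of 0]) (simp add: \<sigma>(2))
    with l have "((\<lambda>t::real. \<sigma> $$ (i,j)) \<longlongrightarrow> \<rho> $$ (i,j)) at_top" by (rule Lim_transform_eventually)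
    from tendsto_unique[OF _ this tendsto_const] show "\<sigma> $$ (i,j) = \<rho> $$ (i,j)" by simp
  qed
  show ?thesis using st uniq q lim by blast
qed

end

theorem theorem3p7:
  fixes L K :: nat and esb :: bool and R W :: "real mat" and \<omega> :: "complex mat"
  assumes "L \<ge> 1" and "K \<ge> 1"
    and "R \<in> carrier_mat (2*L) (2*L)" and "\<forall>i < 2*L. \<forall>j < 2*L. R $$ (i,j) = - R $$ (j,i)"
    and "W \<in> carrier_mat (2*L) (2*K)"
    and "quasi_free K \<omega>"
  defines "T \<equiv> map_mat (\<lambda>x. \<i> * complex_of_real x) R"
    and "\<Theta> \<equiv> map_mat (\<lambda>x. \<i> * complex_of_real x) W"
  shows "((\<exists>\<rho>inf. stationary esb L K T \<Theta> \<omega> \<rho>inf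
              \<and> (\<forall>\<sigma>. stationary esb L K T \<Theta> \<omega> \<sigma> \<longrightarrow> \<sigma> = \<rho>inf)
              \<and> quasi_free L \<rho>inf
              \<and> (\<forall>\<rho>0. is_state (2^L) \<rho>0 \<longrightarrow>
                   mat_tendsto (\<lambda>t. semigroup esb L K T \<Theta> \<omega> t \<rho>0) \<rho>inf at_top))
          \<longleftrightarrow> \<not> (\<exists>v \<mu>. eigenvector T v \<mu> \<and> mat_adjoint \<Theta> *\<^sub>v v = 0\<^sub>v (2*K)))
       \<and> (\<not> (\<exists>v \<mu>. eigenvector T v \<mu> \<and> mat_adjoint \<Theta> *\<^sub>v v = 0\<^sub>v (2*K))
          \<longleftrightarrow> cspan (2*L) (\<Union>k \<in> {0..2*L}. Ran (T ^\<^sub>m k * \<Theta>)) = carrier_vec (2*L))"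
proof -
  interpret F: fermion_model L K esb R W
  proof (rule fermion_model.intro)
    show "0 < L" "0 < K" using assms(1,2) by simp_all
    show "R $$ (i,j) = - R $$ (j,i)" if "i < 2*L" "j < 2*L" for i j using assms(4) that by blast
  qed (rule assms(3,5))+
  have TT: "T = F.T" and Th: "\<Theta> = F.\<Theta>" unfolding T_def \<Theta>_def F.T_def F.\<Theta>_def by (rule refl)+
  have w: "bath_state (2 ^ K) \<omega>" by (rule is_state_bath_state[OF quasi_free_is_state[OF assms(6)]])
  show ?thesis
    unfolding TT Th F.no_common_eigenvector_def[symmetric]
  proof (rule conjI[OF iffI F.no_common_eigenvector_iff_span])
    assume "\<exists>\<rho>inf. stationary esb L K F.T F.\<Theta> \<omega> \<rho>inf \<and> (\<forall>\<sigma>. stationary esb L K F.T F.\<Theta> \<omega> \<sigma> \<longrightarrow> \<sigma> = \<rho>inf)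
      \<and> quasi_free L \<rho>inf \<and> (\<forall>\<rho>0. is_state (2^L) \<rho>0 \<longrightarrow> mat_tendsto (\<lambda>t. semigroup esb L K F.T F.\<Theta> \<omega> t \<rho>0) \<rho>inf at_top)"
    then obtain \<rho> where \<rho>: "quasi_free L \<rho>"
      "\<forall>\<rho>0. is_state (2^L) \<rho>0 \<longrightarrow> mat_tendsto (\<lambda>t. semigroup esb L K F.T F.\<Theta> \<omega> t \<rho>0) \<rho> at_top"
      by (elim exE conjE) (rule that)
    from \<rho>(1) have "\<rho> \<in> carrier_mat (2^L) (2^L)" by (simp add: quasi_free_def)
    from F.no_common_eigenvector_if_relaxes[OF w this \<rho>(2)[rule_format]] show F.no_common_eigenvector .
  qed (rule F.relaxes_if_no_common_eigenvector[OF w])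
qed

end
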